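(* Let $f(x)=\max\{x,0\}$ applied entrywise. Given $\mathbf{A}=\mathbf{U}^* f(\mathbf{V}^*\mathbf{X})$ and $\mathbf{X}$, where $\mathbf{U}^*\in\mathbb{R}^{m\times k}$ and $\mathbf{V}^*\in\mathbb{R}^{k\times d}$ are rank-$k$, $\mathbf{V}^*$ has orthonormal rows, and $\mathbf{X}\in\mathbb{R}^{d\times n}$ has i.i.d. $\mathcal{N}(0,1)$ entries with $n=\mathrm{poly}(d,k,m,\kappa(\mathbf{U}^* ),\kappa(\mathbf{V}^* ))$, there is a $\mathrm{poly}(n)$-time algorithm which recovers $\mathbf{U}^*,\mathbf{V}^*$ exactly (up to a simultaneous permutation of the columns of $\mathbf{U}^*$ and rows of $\mathbf{V}^*$) with probability $1-\frac{1}{\mathrm{poly}(d,m,k)}$.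
   Context: $\kappa(\mathbf{W})$ is the ratio of the largest to smallest nonzero singular value of $\mathbf{W}$. Computation is in the real RAM model. *)

theory Defs
  imports
    "HOL-Probability.Probability"
    "Jordan_Normal_Form.DL_Rank"
    "Jordan_Normal_Form.Char_Poly"
begin

section \<open>Matrices\<close>

definition relu :: "real \<Rightarrow> real" where
  "relu x = max x 0"

text \<open>\<^const>\<open>vec_space.rank\<close> takes the number of rows of the matrix as its dimension parameter.\<close>

definition mat_rank :: "real mat \<Rightarrow> nat" where
  "mat_rank W = vec_space.rank (dim_row W) W"

definition orthonormal_rows :: "real mat \<Rightarrow> bool" where
  "orthonormal_rows V \<longleftrightarrow>
     (\<forall>i<dim_row V. \<forall>j<dim_row V. scalar_prod (row V i) (row V j) = (if i = j then 1 else 0))"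

definition nonzero_singular_values :: "real mat \<Rightarrow> real set" where
  "nonzero_singular_values W =
     {sqrt e | e. eigenvalue (transpose_mat W * W) e \<and> e \<noteq> 0}"

definition cond_number :: "real mat \<Rightarrow> real" where
  "cond_number W = Max (nonzero_singular_values W) / Min (nonzero_singular_values W)"


section \<open>A randomised real RAM\<close>

text \<open>
  The machine has a memory of natural numbers (used for indices and counters), a memory of
  real numbers, both with indirect addressing, and a source of independent uniform samples
  from the unit interval. Reals admit the field operations, square root (needed to normalise
  vectors exactly) and comparison, each at unit cost. The usual devices that make unit-cost
  models unrealistically strong are absent: there is no rounding of reals to integers, no
  multiplication of indices, and all real constants in a program are rational.
\<close>

record state =
  imem :: "nat \<Rightarrow> nat"
  rmem :: "nat \<Rightarrow> real"
  coins :: "nat \<Rightarrow> real"  \<comment> \<open>the random samples not yet consumed\<close>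

datatype iexp =
    IConst nat
  | ILoad iexp
  | IAdd iexp iexp
  | ISub iexp iexp

datatype rexp =
    RConst rat
  | RLoad iexp
  | ROfNat iexp
  | RAdd rexp rexp
  | RSub rexp rexp
  | RMul rexp rexp
  | RDiv rexp rexp
  | RSqrt rexp

datatype bexp =
    ILeq iexp iexp
  | RLeq rexp rexp
  | BNot bexp
  | BAnd bexp bexp

datatype com =
    Skip
  | IStore iexp iexp  \<comment> \<open>address, value\<close>
  | RStore iexp rexp
  | RSample iexp      \<comment> \<open>store a fresh uniform sample at the address\<close>
  | Seq com com
  | Cond bexp com com
  | While bexp com

fun ival :: "iexp \<Rightarrow> state \<Rightarrow> nat" where
  "ival (IConst c) s = c"
| "ival (ILoad a) s = imem s (ival a s)"
| "ival (IAdd a b) s = ival a s + ival b s"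
| "ival (ISub a b) s = ival a s - ival b s"

fun rval :: "rexp \<Rightarrow> state \<Rightarrow> real" where
  "rval (RConst c) s = of_rat c"
| "rval (RLoad a) s = rmem s (ival a s)"
| "rval (ROfNat a) s = real (ival a s)"
| "rval (RAdd a b) s = rval a s + rval b s"
| "rval (RSub a b) s = rval a s - rval b s"
| "rval (RMul a b) s = rval a s * rval b s"
| "rval (RDiv a b) s = rval a s / rval b s"
| "rval (RSqrt a) s = sqrt (rval a s)"

fun bval :: "bexp \<Rightarrow> state \<Rightarrow> bool" where
  "bval (ILeq a b) s \<longleftrightarrow> ival a s \<le> ival b s"
| "bval (RLeq a b) s \<longleftrightarrow> rval a s \<le> rval b s"
| "bval (BNot b) s \<longleftrightarrow> \<not> bval b s"
| "bval (BAnd a b) s \<longleftrightarrow> bval a s \<and> bval b s"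

text \<open>The cost of evaluating an expression is its number of operations, loads and constants.\<close>

fun icost :: "iexp \<Rightarrow> nat" where
  "icost (IConst c) = 1"
| "icost (ILoad a) = 1 + icost a"
| "icost (IAdd a b) = 1 + icost a + icost b"
| "icost (ISub a b) = 1 + icost a + icost b"

fun rcost :: "rexp \<Rightarrow> nat" where
  "rcost (RConst c) = 1"
| "rcost (RLoad a) = 1 + icost a"
| "rcost (ROfNat a) = 1 + icost a"
| "rcost (RAdd a b) = 1 + rcost a + rcost b"
| "rcost (RSub a b) = 1 + rcost a + rcost b"
| "rcost (RMul a b) = 1 + rcost a + rcost b"
| "rcost (RDiv a b) = 1 + rcost a + rcost b"
| "rcost (RSqrt a) = 1 + rcost a"

fun bcost :: "bexp \<Rightarrow> nat" where
  "bcost (ILeq a b) = 1 + icost a + icost b"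
| "bcost (RLeq a b) = 1 + rcost a + rcost b"
| "bcost (BNot b) = 1 + bcost b"
| "bcost (BAnd a b) = 1 + bcost a + bcost b"

text \<open>\<open>exec c s t s'\<close>: started in \<open>s\<close>, the program \<open>c\<close> halts in \<open>s'\<close> after exactly \<open>t\<close> steps.\<close>

inductive exec :: "com \<Rightarrow> state \<Rightarrow> nat \<Rightarrow> state \<Rightarrow> bool" where
  Skip: "exec Skip s 1 s"
| IStore: "exec (IStore a e) s (1 + icost a + icost e)
             (s\<lparr>imem := (imem s)(ival a s := ival e s)\<rparr>)"
| RStore: "exec (RStore a e) s (1 + icost a + rcost e)
             (s\<lparr>rmem := (rmem s)(ival a s := rval e s)\<rparr>)"
| RSample: "exec (RSample a) s (1 + icost a)
             (s\<lparr>rmem := (rmem s)(ival a s := coins s 0), coins := (\<lambda>i. coins s (Suc i))\<rparr>)"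
| Seq: "exec c1 s t1 s1 \<Longrightarrow> exec c2 s1 t2 s2 \<Longrightarrow> exec (Seq c1 c2) s (t1 + t2) s2"
| CondTrue: "bval b s \<Longrightarrow> exec c1 s t s' \<Longrightarrow> exec (Cond b c1 c2) s (1 + bcost b + t) s'"
| CondFalse: "\<not> bval b s \<Longrightarrow> exec c2 s t s' \<Longrightarrow> exec (Cond b c1 c2) s (1 + bcost b + t) s'"
| WhileFalse: "\<not> bval b s \<Longrightarrow> exec (While b c) s (1 + bcost b) s"
| WhileTrue: "bval b s \<Longrightarrow> exec c s t1 s1 \<Longrightarrow> exec (While b c) s1 t2 s2 \<Longrightarrow>
             exec (While b c) s (1 + bcost b + t1 + t2) s2"


section \<open>Input, output and running time\<close>

text \<open>
  The input is an m x n matrix A and a d x n matrix X. The index memory initially holds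
  m, d, n, and the real memory holds A followed by X, both in row-major order. Neither k nor
  any condition number is part of the input.
\<close>

definition input_state :: "real mat \<Rightarrow> real mat \<Rightarrow> (nat \<Rightarrow> real) \<Rightarrow> state" where
  "input_state A X \<omega> =
     (let m = dim_row A; d = dim_row X; n = dim_col X in
      \<lparr>imem = (\<lambda>_. 0)(0 := m, 1 := d, 2 := n),
       rmem = (\<lambda>a. if a < m * n then A $$ (a div n, a mod n)
                   else if a < m * n + d * n
                   then X $$ ((a - m * n) div n, (a - m * n) mod n)
                   else 0),
       coins = \<omega>\<rparr>)"

text \<open>
  The output is an m x k matrix U and a k x d matrix V: index cell 0 holds k, and the real
  memory holds U followed by V, both in row-major order.
\<close>

definition outputs :: "state \<Rightarrow> real mat \<Rightarrow> real mat \<Rightarrow> bool" where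
  "outputs s U V \<longleftrightarrow>
     imem s 0 = dim_col U \<and>
     U = mat (dim_row U) (dim_col U) (\<lambda>(i, j). rmem s (i * dim_col U + j)) \<and>
     V = mat (dim_row V) (dim_col V)
           (\<lambda>(i, j). rmem s (dim_row U * dim_col U + i * dim_col V + j))"

text \<open>Worst-case time polynomial in n, over all inputs in the range of dimensions m, d at most n
  (which the sample-size requirement implies) and all outcomes of the random source.\<close>

definition poly_time :: "com \<Rightarrow> bool" where
  "poly_time c \<longleftrightarrow>
     (\<exists>p :: nat poly. \<forall>m d n A X \<omega>.
        m \<le> n \<longrightarrow> d \<le> n \<longrightarrow> A \<in> carrier_mat m n \<longrightarrow> X \<in> carrier_mat d n \<longrightarrow>
        (\<forall>i. \<omega> i \<in> {0..1}) \<longrightarrow>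
        (\<exists>t s. exec c (input_state A X \<omega>) t s \<and> t \<le> poly p n))"

text \<open>The program recovers both factors, up to one common permutation of hidden units.\<close>

definition recovers ::
  "com \<Rightarrow> real mat \<Rightarrow> real mat \<Rightarrow> (nat \<Rightarrow> real) \<Rightarrow> real mat \<Rightarrow> real mat \<Rightarrow> bool" where
  "recovers c A X \<omega> U V \<longleftrightarrow>
     (\<exists>t s \<pi>. exec c (input_state A X \<omega>) t s \<and> \<pi> permutes {..<dim_col U} \<and>
        outputs s
          (mat (dim_row U) (dim_col U) (\<lambda>(i, j). U $$ (i, \<pi> j)))
          (mat (dim_row V) (dim_col V) (\<lambda>(i, j). V $$ (\<pi> i, j))))"


section \<open>Randomness\<close>

definition std_gaussian :: "real measure" where
  "std_gaussian = density lborel (\<lambda>x. ennreal (std_normal_density x))"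

text \<open>Joint law of the i.i.d. entries of the d x n data matrix and of the independent random
  source of the machine.\<close>

definition sample_space :: "nat \<Rightarrow> nat \<Rightarrow> ((nat \<times> nat \<Rightarrow> real) \<times> (nat \<Rightarrow> real)) measure" where
  "sample_space d n =
     (\<Pi>\<^sub>M _\<in>{..<d} \<times> {..<n}. std_gaussian) \<Otimes>\<^sub>M
     (\<Pi>\<^sub>M _\<in>UNIV. uniform_measure lborel {0..1})"

end

theory Submission
  imports Defs
begin

text \<open>
  Let \<open>a i\<close>, \<open>x i\<close> be the columns of \<open>A\<close> and \<open>X\<close>, and let \<open>g\<close> consist of the first \<open>m\<close> entries of the first
  row of \<open>X\<close>. The matrix \<open>M\<close>, the average of \<open>(g \<bullet> a i) (x i x i\<^sup>T - I)\<close>, is close to a linear combination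
  of the \<open>v l v l\<^sup>T\<close> with coefficients proportional to \<open>s l = g \<bullet> u l\<close>, where \<open>v l\<close> are the rows of \<open>V\<close>
  and \<open>u l\<close> the columns of \<open>U\<close>. By small-ball estimates the \<open>s l\<close> are separated from each other and
  from zero, so an approximate eigenvector of \<open>M\<close> is nearly \<open>\<plusminus> v j\<close>. It is found without iteration: for
  every \<open>\<lambda>\<close> on a grid and every coordinate \<open>p\<close>, take the orthogonal projection of the unit vector \<open>e p\<close> on
  the null space of the rows of \<open>M - \<lambda> I\<close> other than the \<open>p\<close>-th, and test its residual.

  The approximation matters only through the signs of its inner products with the first \<open>N\<close> columns, which
  are exactly the activation pattern of the hidden unit \<open>j\<close>. Given this pattern, the solutions
  \<open>(\<alpha>, \<beta>)\<close> of the linear equations \<open>\<alpha> \<bullet> a i + 1[v j \<bullet> x i > 0] (\<beta> \<bullet> x i) = 0\<close>, \<open>i < N\<close>, all have \<open>\<beta>\<close>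
  proportional to \<open>v j\<close>, so \<open>v j\<close> is obtained without error; for the opposite pattern they have \<open>\<beta> = 0\<close>.
  This genericity holds because certain test matrices, averages over the first \<open>N\<close> columns, are close to
  their expectations and hence diagonally dominant. Once \<open>V\<close> is known, the rows of \<open>U\<close> solve linear
  systems. The number \<open>N\<close> is the integer part of the 42nd root of \<open>n\<close>, so that averages over all
  \<open>n\<close> columns are accurate beyond every power of \<open>N\<close> that occurs.
\<close>

section \<open>A language of bounded loops and its compilation\<close>

text \<open>Exactness is the obstacle: a spectral method only approximates the \<open>v j\<close>,
  and unknown reals cannot be rounded to their true values. Finitely many strict signs, however, are
  unchanged by small errors, and once the signs are known the problem is linear, so exact arithmetic
  finishes it.

  The program is deterministic and takes its random direction \<open>g\<close> from the data,
  although \<open>g\<close> is then correlated with the columns averaged in \<open>M\<close>. This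
  is harmless because \<open>M\<close> is linear in \<open>g\<close>: it combines, with coefficients
  \<open>s l\<close>, empirical tensors defined from the columns alone, and concentration is proved
  for these tensors only.

  The scale of \<open>U\<close>, its least singular value \<open>S\<close>, is unknown to the
  program. All thresholds are relative to the Frobenius norm \<open>F\<close> of \<open>M\<close>,
  which the analysis compares with \<open>S\<close> up to powers of \<open>N\<close>.

  Every probability estimate is a second-moment or small-ball bound, enough for an inverse
  polynomial failure probability. This shapes the exponent 42: at accuracy \<open>N\<close> to the
  power -20, Chebyshev's inequality needs about the 41st power of \<open>N\<close> for a failure
  probability of order \<open>1 / N\<close>.\<close>

text \<open>
  Programs act on natural variables \<open>iv\<close> and real arrays \<open>ar\<close>. As the machine cannot multiply indices,
  compiled programs keep \<open>n * iv x\<close> next to every \<open>iv x\<close>; this is the expression \<open>HS x\<close>, by which matrices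
  are stored with row length \<open>n\<close>. A loop runs at most \<open>n\<close> times, which makes every program polynomial.
\<close>

record hst =
  iv :: "nat \<Rightarrow> nat"
  ar :: "nat \<Rightarrow> nat \<Rightarrow> real"

abbreviation setv :: "hst \<Rightarrow> nat \<Rightarrow> nat \<Rightarrow> hst" where
  "setv h x i \<equiv> h\<lparr>iv := (iv h)(x := i)\<rparr>"

datatype (plugins only: size) hiexp = HV nat | HS nat | HC nat | HA hiexp hiexp | HM hiexp hiexp

datatype (plugins only: size) hrexp = KC rat | KL nat hiexp | KN hiexp | KA hrexp hrexp | KM hrexp hrexp
  | KT hrexp hrexp | KD hrexp hrexp | KQ hrexp

text \<open>Only non-strict comparisons and no connectives: a strict test is programmed by
  exchanging the branches, and equality by two nested tests.\<close>

datatype (plugins only: size) hbexp = BR hrexp hrexp | BI hiexp hiexp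

datatype (plugins only: size) hcom = HSkip | HSt nat hiexp hrexp | HZero nat | HInc nat | HSeq hcom hcom
  | HIf hbexp hcom hcom | HFor nat nat hcom

primrec vi :: "nat \<Rightarrow> hiexp \<Rightarrow> hst \<Rightarrow> nat" where
  "vi n (HV x) h = iv h x"
| "vi n (HS x) h = n * iv h x"
| "vi n (HC c) h = c"
| "vi n (HA a b) h = vi n a h + vi n b h"
| "vi n (HM a b) h = vi n a h - vi n b h"

primrec vr :: "nat \<Rightarrow> hrexp \<Rightarrow> hst \<Rightarrow> real" where
  "vr n (KC c) h = of_rat c"
| "vr n (KL r e) h = ar h r (vi n e h)"
| "vr n (KN e) h = real (vi n e h)"
| "vr n (KA a b) h = vr n a h + vr n b h"
| "vr n (KM a b) h = vr n a h - vr n b h"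
| "vr n (KT a b) h = vr n a h * vr n b h"
| "vr n (KD a b) h = vr n a h / vr n b h"
| "vr n (KQ a) h = sqrt (vr n a h)"

primrec vb :: "nat \<Rightarrow> hbexp \<Rightarrow> hst \<Rightarrow> bool" where
  "vb n (BR a b) h \<longleftrightarrow> vr n a h \<le> vr n b h"
| "vb n (BI a b) h \<longleftrightarrow> vi n a h \<le> vi n b h"

text \<open>The counter is set to \<open>i\<close> before each pass instead of being incremented,
  which gives a plain recursion. The compiled loop increments; the two agree because
  \<open>wf\<close> forbids the body to change the counter or the variable holding the
  bound.\<close>

primrec hloop :: "(hst \<Rightarrow> hst) \<Rightarrow> nat \<Rightarrow> nat \<Rightarrow> hst \<Rightarrow> hst" where
  "hloop f x 0 h = h"
| "hloop f x (Suc i) h = f (setv (hloop f x i h) x i)"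

primrec run :: "nat \<Rightarrow> hcom \<Rightarrow> hst \<Rightarrow> hst" where
  "run n HSkip h = h"
| "run n (HSt r e v) h = h\<lparr>ar := (ar h)(r := (ar h r)(vi n e h := vr n v h))\<rparr>"
| "run n (HZero x) h = setv h x 0"
| "run n (HInc x) h = setv h x (Suc (iv h x))"
| "run n (HSeq a b) h = run n b (run n a h)"
| "run n (HIf b c1 c2) h = (if vb n b h then run n c1 h else run n c2 h)"
| "run n (HFor x y c) h = setv (hloop (run n c) x (min n (iv h y)) h) x (min n (iv h y))"

primrec mods :: "hcom \<Rightarrow> nat set" where
  "mods HSkip = {}"
| "mods (HSt r e v) = {}"
| "mods (HZero x) = {x}"
| "mods (HInc x) = {x}"
| "mods (HSeq a b) = mods a \<union> mods b"
| "mods (HIf b c1 c2) = mods c1 \<union> mods c2"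
| "mods (HFor x y c) = insert x (mods c)"

primrec amods :: "hcom \<Rightarrow> nat set" where
  "amods HSkip = {}"
| "amods (HSt r e v) = {r}"
| "amods (HZero x) = {}"
| "amods (HInc x) = {}"
| "amods (HSeq a b) = amods a \<union> amods b"
| "amods (HIf b c1 c2) = amods c1 \<union> amods c2"
| "amods (HFor x y c) = amods c"

primrec wfr :: "hrexp \<Rightarrow> bool" where
  "wfr (KC c) = True"
| "wfr (KL r e) = (r < 32)"
| "wfr (KN e) = True"
| "wfr (KA a b) = (wfr a \<and> wfr b)"
| "wfr (KM a b) = (wfr a \<and> wfr b)"
| "wfr (KT a b) = (wfr a \<and> wfr b)"
| "wfr (KD a b) = (wfr a \<and> wfr b)"
| "wfr (KQ a) = wfr a"

primrec wfb :: "hbexp \<Rightarrow> bool" where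
  "wfb (BR a b) = (wfr a \<and> wfr b)"
| "wfb (BI a b) = True"

primrec wf :: "hcom \<Rightarrow> bool" where
  "wf HSkip = True"
| "wf (HSt r e v) = (r < 32 \<and> wfr v)"
| "wf (HZero x) = True"
| "wf (HInc x) = True"
| "wf (HSeq a b) = (wf a \<and> wf b)"
| "wf (HIf b c1 c2) = (wfb b \<and> wf c1 \<and> wf c2)"
| "wf (HFor x y c) = (wf c \<and> x \<noteq> y \<and> x \<notin> mods c \<and> y \<notin> mods c)"

lemma hloop_iv: "(\<And>h. iv (f h) y = iv h y) \<Longrightarrow> x \<noteq> y \<Longrightarrow> iv (hloop f x i h) y = iv h y"
  by (induction i) auto

lemma hloop_ar: "(\<And>h. ar (f h) r = ar h r) \<Longrightarrow> ar (hloop f x i h) r = ar h r"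
  by (induction i) auto

lemma run_iv [simp]: "x \<notin> mods c \<Longrightarrow> iv (run n c h) x = iv h x"
  by (induction c arbitrary: h) (auto simp: hloop_iv)

lemma run_ar [simp]: "r \<notin> amods c \<Longrightarrow> ar (run n c h) r = ar h r"
  by (induction c arbitrary: h) (auto simp: hloop_ar)

lemma hloop_inv:
  assumes "I 0 h" and "\<And>i h. i < b \<Longrightarrow> I i h \<Longrightarrow> I (Suc i) (f (setv h x i))"
  shows "I b (hloop f x b h)"
  using assms by (induction b) auto

subsection \<open>Compilation\<close>

definition dbl :: "iexp \<Rightarrow> iexp" where "dbl e = IAdd e e"

text \<open>The 32 arrays are interleaved above the base address in cell 3, so none of them needs a
  length bound; the factor 32 is five doublings. Hence the restriction \<open>r < 32\<close> in
  \<open>wf\<close>.\<close>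

definition adr :: "nat \<Rightarrow> iexp \<Rightarrow> iexp" where
  "adr r e = IAdd (ILoad (IConst 3)) (IAdd (dbl (dbl (dbl (dbl (dbl e))))) (IConst r))"

primrec ci :: "hiexp \<Rightarrow> iexp" where
  "ci (HV x) = ILoad (IConst (10 + 2 * x))"
| "ci (HS x) = ILoad (IConst (11 + 2 * x))"
| "ci (HC c) = IConst c"
| "ci (HA a b) = IAdd (ci a) (ci b)"
| "ci (HM a b) = ISub (ci a) (ci b)"

primrec cr :: "hrexp \<Rightarrow> rexp" where
  "cr (KC c) = RConst c"
| "cr (KL r e) = RLoad (adr r (ci e))"
| "cr (KN e) = ROfNat (ci e)"
| "cr (KA a b) = RAdd (cr a) (cr b)"
| "cr (KM a b) = RSub (cr a) (cr b)"
| "cr (KT a b) = RMul (cr a) (cr b)"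
| "cr (KD a b) = RDiv (cr a) (cr b)"
| "cr (KQ a) = RSqrt (cr a)"

primrec cb :: "hbexp \<Rightarrow> bexp" where
  "cb (BR a b) = RLeq (cr a) (cr b)"
| "cb (BI a b) = ILeq (ci a) (ci b)"

definition czero :: "nat \<Rightarrow> com" where
  "czero x = Seq (IStore (IConst (10 + 2 * x)) (IConst 0)) (IStore (IConst (11 + 2 * x)) (IConst 0))"

definition cinc :: "nat \<Rightarrow> com" where
  "cinc x = Seq (IStore (IConst (10 + 2 * x)) (IAdd (ILoad (IConst (10 + 2 * x))) (IConst 1)))
     (IStore (IConst (11 + 2 * x)) (IAdd (ILoad (IConst (11 + 2 * x))) (ILoad (IConst 2))))"

definition loopcond :: "nat \<Rightarrow> nat \<Rightarrow> bexp" where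
  "loopcond x y = BAnd (BNot (ILeq (ILoad (IConst 2)) (ILoad (IConst (10 + 2 * x)))))
     (BNot (ILeq (ILoad (IConst (10 + 2 * y))) (ILoad (IConst (10 + 2 * x)))))"

primrec cc :: "hcom \<Rightarrow> com" where
  "cc HSkip = Skip"
| "cc (HSt r e v) = RStore (adr r (ci e)) (cr v)"
| "cc (HZero x) = czero x"
| "cc (HInc x) = cinc x"
| "cc (HSeq a b) = Seq (cc a) (cc b)"
| "cc (HIf b c1 c2) = Cond (cb b) (cc c1) (cc c2)"
| "cc (HFor x y c) = Seq (czero x) (While (loopcond x y) (Seq (cc c) (cinc x)))"

text \<open>Real cells below \<open>B\<close> are unconstrained: the raw input lies there, and the
  output is later written over it.\<close>

definition rel :: "nat \<Rightarrow> nat \<Rightarrow> state \<Rightarrow> hst \<Rightarrow> bool" where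
  "rel n B s h \<longleftrightarrow> imem s 2 = n \<and> imem s 3 = B \<and>
     (\<forall>x. imem s (10 + 2 * x) = iv h x \<and> imem s (11 + 2 * x) = n * iv h x) \<and>
     (\<forall>r e. r < 32 \<longrightarrow> rmem s (B + 32 * e + r) = ar h r e)"

lemma ival_dbl [simp]: "ival (dbl e) s = 2 * ival e s"
  by (simp add: dbl_def)

lemma ival_adr [simp]: "ival (adr r e) s = imem s 3 + 32 * ival e s + r"
  by (simp add: adr_def)

lemma ival_ci: "rel n B s h \<Longrightarrow> ival (ci e) s = vi n e h"
  by (induction e) (auto simp: rel_def)

lemma rval_cr: "rel n B s h \<Longrightarrow> wfr e \<Longrightarrow> rval (cr e) s = vr n e h"
  by (induction e) (auto simp: ival_ci, auto simp: rel_def)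

lemma bval_cb: "rel n B s h \<Longrightarrow> wfb b \<Longrightarrow> bval (cb b) s = vb n b h"
  by (cases b) (auto simp: ival_ci rval_cr)


lemma cell_inj:
  assumes "r < 32" "r' < (32 :: nat)"
  shows "32 * e + r = 32 * e' + r' \<longleftrightarrow> e = e' \<and> r = r'"
proof
  assume eq: "32 * e + r = 32 * e' + r'"
  have "e = (32 * e + r) div 32" "e' = (32 * e' + r') div 32"
    using assms by simp_all
  then have "e = e'" using eq by simp
  then show "e = e' \<and> r = r'" using eq by simp
qed simp

lemma rel_upd_ar:
  assumes "rel n B s h" "r < 32"
  shows "rel n B (s\<lparr>rmem := (rmem s)(B + 32 * e + r := v)\<rparr>) (h\<lparr>ar := (ar h)(r := (ar h r)(e := v))\<rparr>)"
  using assms unfolding rel_def by (simp add: cell_inj add.assoc)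

lemma even_odd_cell [simp]:
  "(10 + 2 * x = 11 + 2 * (y :: nat)) = False" "(11 + 2 * x = 10 + 2 * (y :: nat)) = False"
  by presburger+

lemma exec_czero:
  assumes "rel n B s h"
  shows "\<exists>s'. exec (czero x) s 6 s' \<and> rel n B s' (setv h x 0)"
proof -
  let ?s1 = "s\<lparr>imem := (imem s)(10 + 2 * x := 0)\<rparr>"
  let ?s2 = "?s1\<lparr>imem := (imem ?s1)(11 + 2 * x := 0)\<rparr>"
  have "exec (czero x) s ((1 + 1 + 1) + (1 + 1 + 1)) ?s2"
    unfolding czero_def
    using exec.Seq[OF exec.IStore[of "IConst (10 + 2 * x)" "IConst 0" s]
        exec.IStore[of "IConst (11 + 2 * x)" "IConst 0"]] by simp
  moreover have "rel n B ?s2 (setv h x 0)"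
    using assms unfolding rel_def by simp
  ultimately show ?thesis by (intro exI[of _ ?s2]) (simp add: numeral_eq_Suc)
qed

lemma exec_cinc_raw:
  "exec (cinc x) s 13 (s\<lparr>imem := (imem s)(10 + 2 * x := imem s (10 + 2 * x) + 1,
      11 + 2 * x := imem s (11 + 2 * x) + imem s 2)\<rparr>)"
proof -
  let ?s1 = "s\<lparr>imem := (imem s)(10 + 2 * x := imem s (10 + 2 * x) + 1)\<rparr>"
  let ?s2 = "?s1\<lparr>imem := (imem ?s1)(11 + 2 * x := imem s (11 + 2 * x) + imem s 2)\<rparr>"
  have "exec (cinc x) s ((1 + 1 + 4) + (1 + 1 + 5)) ?s2"
    unfolding cinc_def
    using exec.Seq[OF exec.IStore[of "IConst (10 + 2 * x)" "IAdd (ILoad (IConst (10 + 2 * x))) (IConst 1)" s]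
        exec.IStore[of "IConst (11 + 2 * x)" "IAdd (ILoad (IConst (11 + 2 * x))) (ILoad (IConst 2))"]]
    by (simp add: numeral_eq_Suc)
  then show ?thesis by simp
qed

lemma exec_cinc:
  assumes "rel n B s h"
  shows "\<exists>s'. exec (cinc x) s 13 s' \<and> rel n B s' (setv h x (Suc (iv h x)))"
  by (rule exI, rule conjI[OF exec_cinc_raw]) (use assms in \<open>simp add: rel_def\<close>)

text \<open>Induction on the number of passes still to come: the index of the invariant decides the
  guard, and the last summand of the bound pays for its final, failing evaluation.\<close>

lemma exec_while_count:
  assumes "\<And>i s. i < b \<Longrightarrow> I i s \<Longrightarrow> bval c s"
    and "\<And>s. I b s \<Longrightarrow> \<not> bval c s"
    and "\<And>i s. i < b \<Longrightarrow> I i s \<Longrightarrow> \<exists>t s'. exec body s t s' \<and> I (Suc i) s' \<and> t \<le> T"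
    and "I 0 s"
  shows "\<exists>t s'. exec (While c body) s t s' \<and> I b s' \<and> t \<le> b * (1 + bcost c + T) + (1 + bcost c)"
proof -
  have "j \<le> b \<Longrightarrow> I (b - j) s \<Longrightarrow>
     \<exists>t s'. exec (While c body) s t s' \<and> I b s' \<and> t \<le> j * (1 + bcost c + T) + (1 + bcost c)" for j s
  proof (induction j arbitrary: s)
    case 0
    then show ?case using assms(2)[of s] exec.WhileFalse[of c s body] by auto
  next
    case (Suc j)
    then have lt: "b - Suc j < b" and eq: "Suc (b - Suc j) = b - j" by auto
    obtain t1 s1 where 1: "exec body s t1 s1" "I (b - j) s1" "t1 \<le> T"
      using assms(3)[OF lt Suc.prems(2)] eq by auto
    obtain t2 s2 where 2: "exec (While c body) s1 t2 s2" "I b s2" "t2 \<le> j * (1 + bcost c + T) + (1 + bcost c)"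
      using Suc.IH[OF _ 1(2)] Suc.prems(1) by auto
    have "exec (While c body) s (1 + bcost c + t1 + t2) s2"
      by (rule exec.WhileTrue[OF assms(1)[OF lt Suc.prems(2)] 1(1) 2(1)])
    then show ?case using 1 2 by (intro exI conjI) (auto simp: algebra_simps)
  qed
  from this[of b s] assms(4) show ?thesis by simp
qed

text \<open>One polynomial serves all states, because no cost bound depends on the data: expressions
  have constant cost and every loop is cut off at \<open>n\<close> passes.\<close>

lemma cc_correct:
  assumes "wf c"
  shows "\<exists>p :: nat poly. \<forall>n B s h. rel n B s h \<longrightarrow>
    (\<exists>t s'. exec (cc c) s t s' \<and> rel n B s' (run n c h) \<and> t \<le> poly p n)"
  using assms
proof (induction c)
  case HSkip
  show ?case using exec.Skip by (intro exI[of _ "[:1:]"] allI impI exI[of _ 1]) auto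
next
  case (HSt r e v)
  show ?case
  proof (intro exI[of _ "[:1 + icost (adr r (ci e)) + rcost (cr v):]"] allI impI)
    fix n B s h assume R: "rel n B s h"
    have "exec (cc (HSt r e v)) s (1 + icost (adr r (ci e)) + rcost (cr v))
      (s\<lparr>rmem := (rmem s)(ival (adr r (ci e)) s := rval (cr v) s)\<rparr>)"
      using exec.RStore[of "adr r (ci e)" "cr v" s] by simp
    moreover have "rel n B (s\<lparr>rmem := (rmem s)(ival (adr r (ci e)) s := rval (cr v) s)\<rparr>) (run n (HSt r e v) h)"
      using rel_upd_ar[OF R, of r "vi n e h" "vr n v h"] HSt R ival_ci[OF R] rval_cr[OF R, of v]
      by (simp add: rel_def)
    ultimately show "\<exists>t s'. exec (cc (HSt r e v)) s t s' \<and> rel n B s' (run n (HSt r e v) h) \<and>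
      t \<le> poly [:1 + icost (adr r (ci e)) + rcost (cr v):] n" by (intro exI conjI) auto
  qed
next
  case (HZero x)
  show ?case
  proof (intro exI[of _ "[:6:]"] allI impI)
    fix n B s h assume "rel n B s h"
    then show "\<exists>t s'. exec (cc (HZero x)) s t s' \<and> rel n B s' (run n (HZero x) h) \<and> t \<le> poly [:6:] n"
      using exec_czero[of n B s h x] by (intro exI[of _ 6]) simp
  qed
next
  case (HInc x)
  show ?case
  proof (intro exI[of _ "[:13:]"] allI impI)
    fix n B s h assume "rel n B s h"
    then show "\<exists>t s'. exec (cc (HInc x)) s t s' \<and> rel n B s' (run n (HInc x) h) \<and> t \<le> poly [:13:] n"
      using exec_cinc[of n B s h x] by (intro exI[of _ 13]) simp
  qed
next
  case (HSeq a b)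
  have w1: "wf a" and w2: "wf b" using HSeq.prems by simp_all
  obtain p where p0: "\<forall>n B s h. rel n B s h \<longrightarrow> (\<exists>t s'. exec (cc a) s t s' \<and> rel n B s' (run n a h) \<and> t \<le> poly p n)"
    using HSeq.IH(1)[OF w1] ..
  obtain q where q0: "\<forall>n B s h. rel n B s h \<longrightarrow> (\<exists>t s'. exec (cc b) s t s' \<and> rel n B s' (run n b h) \<and> t \<le> poly q n)"
    using HSeq.IH(2)[OF w2] ..
  note p = p0[rule_format] and q = q0[rule_format]
  show ?case
  proof (intro exI[of _ "p + q"] allI impI)
    fix n B s h assume "rel n B s h"
    then obtain t s' where 1: "exec (cc a) s t s'" "rel n B s' (run n a h)" "t \<le> poly p n" using p[of n B s h] by blast
    obtain t2 s2 where 2: "exec (cc b) s' t2 s2" "rel n B s2 (run n b (run n a h))" "t2 \<le> poly q n"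
      using q[OF 1(2)] by blast
    show "\<exists>t s'. exec (cc (HSeq a b)) s t s' \<and> rel n B s' (run n (HSeq a b) h) \<and> t \<le> poly (p + q) n"
      using exec.Seq[OF 1(1) 2(1)] 1 2 by (intro exI[of _ "t + t2"] exI[of _ s2]) auto
  qed
next
  case (HIf b c1 c2)
  have w1: "wf c1" and w2: "wf c2" using HIf.prems by simp_all
  obtain p where p0: "\<forall>n B s h. rel n B s h \<longrightarrow> (\<exists>t s'. exec (cc c1) s t s' \<and> rel n B s' (run n c1 h) \<and> t \<le> poly p n)"
    using HIf.IH(1)[OF w1] ..
  obtain q where q0: "\<forall>n B s h. rel n B s h \<longrightarrow> (\<exists>t s'. exec (cc c2) s t s' \<and> rel n B s' (run n c2 h) \<and> t \<le> poly q n)"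
    using HIf.IH(2)[OF w2] ..
  note p = p0[rule_format] and q = q0[rule_format]
  show ?case
  proof (intro exI[of _ "p + q + [:1 + bcost (cb b):]"] allI impI)
    fix n B s h assume R: "rel n B s h"
    have v: "bval (cb b) s = vb n b h" using bval_cb[OF R] HIf.prems by simp
    show "\<exists>t s'. exec (cc (HIf b c1 c2)) s t s' \<and> rel n B s' (run n (HIf b c1 c2) h) \<and>
        t \<le> poly (p + q + [:1 + bcost (cb b):]) n"
    proof (cases "vb n b h")
      case True
      obtain t s' where 1: "exec (cc c1) s t s'" "rel n B s' (run n c1 h)" "t \<le> poly p n" using p[OF R] by blast
      show ?thesis using exec.CondTrue[OF _ 1(1), of "cb b" "cc c2"] 1 True v
        by (intro exI[of _ "1 + bcost (cb b) + t"] exI[of _ s']) auto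
    next
      case False
      obtain t s' where 1: "exec (cc c2) s t s'" "rel n B s' (run n c2 h)" "t \<le> poly q n" using q[OF R] by blast
      show ?thesis using exec.CondFalse[OF _ 1(1), of "cb b" "cc c1"] 1 False v
        by (intro exI[of _ "1 + bcost (cb b) + t"] exI[of _ s']) auto
    qed
  qed
next
  case (HFor x y c)
  have w1: "wf c" using HFor.prems by simp_all
  obtain p where p0: "\<forall>n B s h. rel n B s h \<longrightarrow> (\<exists>t s'. exec (cc c) s t s' \<and> rel n B s' (run n c h) \<and> t \<le> poly p n)"
    using HFor.IH[OF w1] ..
  note p = p0[rule_format]
  have wf: "x \<noteq> y" "x \<notin> mods c" "y \<notin> mods c" using HFor.prems by auto
  define K where "K = 1 + bcost (loopcond x y)"
  show ?case
  \<comment> \<open>\<open>[:0, 1:]\<close> is the polynomial \<open>n\<close>, bounding the passes;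
    \<open>K + 13\<close> pays for guard and increment of one pass, and \<open>6 + K\<close> for
    zeroing the counter and for the last guard.\<close>
  proof (intro exI[of _ "[:6 + K:] + [:0, 1:] * ([:K + 13:] + p)"] allI impI)
    fix n B s h assume R: "rel n B s h"
    obtain s0 where s0: "exec (czero x) s 6 s0" "rel n B s0 (setv h x 0)" using exec_czero[OF R] by blast
    define b where "b = min n (iv h y)"
    define I where "I i s \<longleftrightarrow> rel n B s (setv (hloop (run n c) x i h) x i)" for i s
    have iy: "iv (hloop (run n c) x i h) y = iv h y" for i using wf by (simp add: hloop_iv)
    have cond: "bval (loopcond x y) s \<longleftrightarrow> i < b" if "I i s" for i s
    proof -
      from that have "rel n B s (setv (hloop (run n c) x i h) x i)" by (simp add: I_def)
      then have "imem s 2 = n" "imem s (10 + 2 * x) = i" "imem s (10 + 2 * y) = iv h y"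
        using wf iy unfolding rel_def by simp_all
      then show ?thesis unfolding loopcond_def b_def by (simp add: not_le)
    qed
    have step: "\<exists>t s'. exec (Seq (cc c) (cinc x)) s t s' \<and> I (Suc i) s' \<and> t \<le> poly p n + 13"
      if "I i s" for i s
    proof -
      from that have "rel n B s (setv (hloop (run n c) x i h) x i)" by (simp add: I_def)
      from p[OF this] obtain t s' where 1: "exec (cc c) s t s'"
        "rel n B s' (run n c (setv (hloop (run n c) x i h) x i))" "t \<le> poly p n" by blast
      obtain s2 where 2: "exec (cinc x) s' 13 s2"
        "rel n B s2 (setv (hloop (run n c) x (Suc i) h) x (Suc i))"
        using exec_cinc[OF 1(2), of x] wf by auto
      show ?thesis using exec.Seq[OF 1(1) 2(1)] 1(3) 2(2) unfolding I_def
        by (intro exI[of _ "t + 13"] exI[of _ s2]) simp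
    qed
    have I0: "I 0 s0" using s0 by (simp add: I_def)
    have "\<exists>t s'. exec (While (loopcond x y) (Seq (cc c) (cinc x))) s0 t s' \<and> I b s' \<and>
      t \<le> b * (1 + bcost (loopcond x y) + (poly p n + 13)) + (1 + bcost (loopcond x y))"
    proof (rule exec_while_count)
      show "bval (loopcond x y) s" if "i < b" "I i s" for i s using cond[OF that(2)] that(1) by simp
      show "\<not> bval (loopcond x y) s" if "I b s" for s using cond[OF that] by simp
    qed (rule step, assumption, rule I0)
    then obtain t s' where W: "exec (While (loopcond x y) (Seq (cc c) (cinc x))) s0 t s'" "I b s'"
      "t \<le> b * (1 + bcost (loopcond x y) + (poly p n + 13)) + (1 + bcost (loopcond x y))"
      by (elim exE conjE)
    have "t \<le> b * (K + (poly p n + 13)) + K" using W(3) by (simp add: K_def)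
    also have "\<dots> \<le> n * (K + (poly p n + 13)) + K" by (simp add: b_def)
    finally have "6 + t \<le> poly ([:6 + K:] + [:0, 1:] * ([:K + 13:] + p)) n" by (simp add: algebra_simps)
    then show "\<exists>t s'. exec (cc (HFor x y c)) s t s' \<and> rel n B s' (run n (HFor x y c) h) \<and>
        t \<le> poly ([:6 + K:] + [:0, 1:] * ([:K + 13:] + p)) n"
      using exec.Seq[OF s0(1) W(1)] W(2) unfolding I_def b_def
      by (intro exI[of _ "6 + t"] exI[of _ s']) simp
  qed
qed

text \<open>\<open>recovers\<close> asks for some halting run. By determinism the run constructed
  for a compiled program is the only one, so success becomes a property of the state in which it
  ends.\<close>

lemma exec_det: "exec c s t s' \<Longrightarrow> exec c s t2 s2 \<Longrightarrow> s2 = s' \<and> t2 = t"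
proof (induction arbitrary: t2 s2 rule: exec.induct)
  case (Skip s) from Skip.prems show ?case by cases auto
next
  case (IStore a e s) from IStore.prems show ?case by cases auto
next
  case (RStore a e s) from RStore.prems show ?case by cases auto
next
  case (RSample a s) from RSample.prems show ?case by cases auto
next
  case (Seq c1 s t1 s1 c2 t2 s2)
  note IH1 = Seq.IH(1) and IH2 = Seq.IH(2)
  from Seq.prems show ?case
  proof cases
    case (Seq u1 r1 u2)
    then show ?thesis using IH1[of u1 r1] IH2[of u2] by auto
  qed
next
  case (CondTrue b s c1 t s' c2)
  note IH = CondTrue.IH and b = CondTrue.hyps(1)
  from CondTrue.prems show ?case
  proof cases
    case (CondTrue u)
    then show ?thesis using IH[of u s2] by simp
  next
    case (CondFalse u)
    then show ?thesis using b by simp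
  qed
next
  case (CondFalse b s c2 t s' c1)
  note IH = CondFalse.IH and b = CondFalse.hyps(1)
  from CondFalse.prems show ?case
  proof cases
    case (CondTrue u)
    then show ?thesis using b by simp
  next
    case (CondFalse u)
    then show ?thesis using IH[of u s2] by simp
  qed
next
  case (WhileFalse b s c) from WhileFalse.prems show ?case by cases (use WhileFalse.hyps in auto)
next
  case (WhileTrue b s c t1 s1 t2 s2)
  note IH1 = WhileTrue.IH(1) and IH2 = WhileTrue.IH(2)
  note nb = WhileTrue.hyps(1)
  from WhileTrue.prems show ?case
  proof cases
    case WhileFalse
    then show ?thesis using nb by simp
  next
    case (WhileTrue u1 r1 u2)
    then show ?thesis using IH1[of u1 r1] IH2[of u2] by auto
  qed
qed

section \<open>Loading the input and storing the output\<close>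

definition csetv :: "nat \<Rightarrow> iexp \<Rightarrow> com" where
  "csetv x e = Seq (czero x) (While (BNot (ILeq e (ILoad (IConst (10 + 2 * x))))) (cinc x))"

text \<open>The state before a base address exists: the real memory is the untouched input, and
  cells 0, 1, 2 still hold the dimensions from which the variables are filled.\<close>

definition prel :: "nat \<Rightarrow> nat \<Rightarrow> nat \<Rightarrow> (nat \<Rightarrow> real) \<Rightarrow> state \<Rightarrow> (nat \<Rightarrow> nat) \<Rightarrow> bool" where
  "prel m d n rm s f \<longleftrightarrow> imem s 0 = m \<and> imem s 1 = d \<and> imem s 2 = n \<and> rmem s = rm \<and>
     (\<forall>x. imem s (10 + 2 * x) = f x \<and> imem s (11 + 2 * x) = n * f x)"

lemma exec_czero_p:
  assumes "prel m d n rm s f"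
  shows "\<exists>s'. exec (czero x) s 6 s' \<and> prel m d n rm s' (f(x := 0))"
proof -
  let ?s1 = "s\<lparr>imem := (imem s)(10 + 2 * x := 0)\<rparr>"
  let ?s2 = "?s1\<lparr>imem := (imem ?s1)(11 + 2 * x := 0)\<rparr>"
  have "exec (czero x) s ((1 + 1 + 1) + (1 + 1 + 1)) ?s2"
    unfolding czero_def
    using exec.Seq[OF exec.IStore[of "IConst (10 + 2 * x)" "IConst 0" s]
        exec.IStore[of "IConst (11 + 2 * x)" "IConst 0"]] by simp
  moreover have "prel m d n rm ?s2 (f(x := 0))"
    using assms unfolding prel_def by simp
  ultimately show ?thesis by (intro exI[of _ ?s2]) (simp add: numeral_eq_Suc)
qed

text \<open>Counting up with \<open>cinc\<close> is how \<open>n * b\<close> is obtained without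
  multiplication: every increment of the first cell of \<open>x\<close> adds \<open>n\<close> to the
  second.\<close>

lemma exec_csetv:
  assumes R: "prel m d n rm s f"
    and e: "\<And>s. imem s 0 = m \<Longrightarrow> imem s 1 = d \<Longrightarrow> imem s 2 = n \<Longrightarrow> ival e s = b"
  shows "\<exists>t s'. exec (csetv x e) s t s' \<and> prel m d n rm s' (f(x := b)) \<and> t \<le> 6 + (b + 1) * (20 + icost e)"
proof -
  obtain s0 where s0: "exec (czero x) s 6 s0" "prel m d n rm s0 (f(x := 0))"
    using exec_czero_p[OF R] by blast
  let ?c = "BNot (ILeq e (ILoad (IConst (10 + 2 * x))))"
  define I where "I i s \<longleftrightarrow> prel m d n rm s (f(x := i))" for i s
  have c: "bval ?c s \<longleftrightarrow> i < b" if "I i s" for i s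
  proof -
    have "ival e s = b" using that by (intro e) (simp_all add: I_def prel_def)
    moreover have "imem s (10 + 2 * x) = i" using that by (simp add: I_def prel_def)
    ultimately show ?thesis by (simp add: not_le)
  qed
  have "\<exists>t s'. exec (While ?c (cinc x)) s0 t s' \<and> I b s' \<and> t \<le> b * (1 + bcost ?c + 13) + (1 + bcost ?c)"
  proof (rule exec_while_count)
    show "bval ?c s" if "i < b" "I i s" for i s using c[OF that(2)] that(1) by simp
    show "\<not> bval ?c s" if "I b s" for s using c[OF that] by simp
    show "\<exists>t s'. exec (cinc x) s t s' \<and> I (Suc i) s' \<and> t \<le> 13" if "I i s" for i s
      by (intro exI conjI, rule exec_cinc_raw) (use that in \<open>simp_all add: I_def prel_def\<close>)
  qed (use s0 in \<open>simp add: I_def\<close>)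
  then obtain t s' where W: "exec (While ?c (cinc x)) s0 t s'" "I b s'"
    "t \<le> b * (1 + bcost ?c + 13) + (1 + bcost ?c)" by (elim exE conjE)
  have "t \<le> (b + 1) * (20 + icost e)" using W(3) by (simp add: algebra_simps)
  then show ?thesis
    using exec.Seq[OF s0(1) W(1)] W(2) unfolding csetv_def I_def
    by (intro exI[of _ "6 + t"] exI[of _ s']) simp
qed

definition inc4 :: com where
  "inc4 = IStore (IConst 4) (IAdd (ILoad (IConst 4)) (IConst 1))"

lemma exec_inc4: "exec inc4 s 6 (s\<lparr>imem := (imem s)(4 := Suc (imem s 4))\<rparr>)"
  using exec.IStore[of "IConst 4" "IAdd (ILoad (IConst 4)) (IConst 1)" s]
  by (simp add: inc4_def numeral_eq_Suc)

definition ccopy :: "iexp \<Rightarrow> iexp \<Rightarrow> com" where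
  "ccopy dst src = Seq (IStore (IConst 4) (IConst 0))
     (While (BNot (ILeq (ILoad (IConst 3)) (ILoad (IConst 4)))) (Seq (RStore dst (RLoad src)) inc4))"

lemma exec_ccopy:
  fixes J :: "nat \<Rightarrow> state \<Rightarrow> bool"
  assumes "imem s 3 = B"
    and "J 0 (s\<lparr>imem := (imem s)(4 := 0)\<rparr>)"
    and step: "\<And>i s. i < B \<Longrightarrow> J i s \<Longrightarrow> imem s 3 = B \<Longrightarrow> imem s 4 = i \<Longrightarrow>
      J (Suc i) (s\<lparr>rmem := (rmem s)(ival dst s := rmem s (ival src s)), imem := (imem s)(4 := Suc i)\<rparr>)"
  shows "\<exists>t s'. exec (ccopy dst src) s t s' \<and> J B s' \<and> imem s' 3 = B \<and> t \<le> 3 + (B + 1) * (16 + icost dst + icost src)"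
proof -
  let ?s0 = "s\<lparr>imem := (imem s)(4 := 0)\<rparr>"
  have 0: "exec (IStore (IConst 4) (IConst 0)) s 3 ?s0"
    using exec.IStore[of "IConst 4" "IConst 0" s] by (simp add: numeral_eq_Suc)
  let ?c = "BNot (ILeq (ILoad (IConst 3)) (ILoad (IConst 4)))"
  define I where "I i s \<longleftrightarrow> J i s \<and> imem s 3 = B \<and> imem s 4 = i" for i s
  have bc: "bcost ?c = 6" by simp
  have "\<exists>t s'. exec (While ?c (Seq (RStore dst (RLoad src)) inc4)) ?s0 t s' \<and> I B s' \<and>
    t \<le> B * (1 + bcost ?c + (8 + icost dst + icost src)) + (1 + bcost ?c)"
  proof (rule exec_while_count)
    show "bval ?c s" if "i < B" "I i s" for i s using that by (simp add: I_def)
    show "\<not> bval ?c s" if "I B s" for s using that by (simp add: I_def)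
    show "I 0 ?s0" using assms by (simp add: I_def)
    show "\<exists>t s'. exec (Seq (RStore dst (RLoad src)) inc4) s t s' \<and> I (Suc i) s' \<and> t \<le> 8 + icost dst + icost src"
      if "i < B" "I i s" for i s
    proof (intro exI conjI)
      show "exec (Seq (RStore dst (RLoad src)) inc4) s ((1 + icost dst + (1 + icost src)) + 6)
        (s\<lparr>rmem := (rmem s)(ival dst s := rmem s (ival src s)), imem := (imem s)(4 := Suc i)\<rparr>)"
        using exec.Seq[OF exec.RStore[of dst "RLoad src" s] exec_inc4] that by (simp add: I_def)
      show "I (Suc i) (s\<lparr>rmem := (rmem s)(ival dst s := rmem s (ival src s)), imem := (imem s)(4 := Suc i)\<rparr>)"
        using that step[of i s] by (simp add: I_def)
    qed simp
  qed
  then obtain t s' where W: "exec (While ?c (Seq (RStore dst (RLoad src)) inc4)) ?s0 t s'" "I B s'"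
    "t \<le> B * (1 + bcost ?c + (8 + icost dst + icost src)) + (1 + bcost ?c)" by (elim exE conjE)
  have "t \<le> (B + 1) * (16 + icost dst + icost src)" using W(3) by (simp add: bc algebra_simps)
  then show ?thesis
    using exec.Seq[OF 0 W(1)] W(2) unfolding ccopy_def I_def
    by (intro exI[of _ "3 + t"] exI[of _ s']) simp
qed

text \<open>Variable 2 receives the value \<open>m + d\<close>, so its second cell, number 15,
  contains \<open>(m + d) * n\<close>. This is the length of the input, obtained without
  multiplication, and it becomes the base address in cell 3.\<close>

definition cpro :: com where
  "cpro = Seq (csetv 0 (ILoad (IConst 0))) (Seq (csetv 1 (ILoad (IConst 1)))
    (Seq (csetv 2 (IAdd (ILoad (IConst 0)) (ILoad (IConst 1)))) (Seq (csetv 3 (ILoad (IConst 2)))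
    (Seq (csetv 4 (IConst 2)) (Seq (IStore (IConst 3) (ILoad (IConst 15)))
    (ccopy (adr 0 (ILoad (IConst 4))) (ILoad (IConst 4))))))))"

text \<open>Cell 22 is the first cell of variable 6, the number of recovered hidden units. A stretch
  of \<open>(m + d) * n\<close> cells is copied; the output fits into it, since
  \<open>m * k + k * d\<close> is at most that when \<open>k \<le> n\<close>.\<close>

definition cepi :: com where
  "cepi = Seq (ccopy (ILoad (IConst 4)) (adr 1 (ILoad (IConst 4)))) (IStore (IConst 0) (ILoad (IConst 22)))"

definition hinit :: "nat \<Rightarrow> nat \<Rightarrow> nat \<Rightarrow> (nat \<Rightarrow> real) \<Rightarrow> hst" where
  "hinit m d n rm = \<lparr>iv = (\<lambda>_. 0)(0 := m, 1 := d, 2 := m + d, 3 := n, 4 := 2), ar = (\<lambda>_ _. 0)(0 := rm)\<rparr>"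

lemma exec_cpro:
  assumes im: "imem s = (\<lambda>_. 0)(0 := m, 1 := d, 2 := n)"
    and rm0: "\<And>a. (m + d) * n \<le> a \<Longrightarrow> rmem s a = 0"
    and le: "m \<le> n" "d \<le> n"
  shows "\<exists>t s'. exec cpro s t s' \<and> rel n ((m + d) * n) s' (hinit m d n (rmem s)) \<and>
     t \<le> 1000 * (n + 1) * (n + 1)"
proof -
  define rm where "rm = rmem s"
  have p0: "prel m d n rm s (\<lambda>_. 0)" by (simp add: prel_def im rm_def)
  obtain t1 s1 where 1: "exec (csetv 0 (ILoad (IConst 0))) s t1 s1" "prel m d n rm s1 ((\<lambda>_. 0)(0 := m))"
    "t1 \<le> 6 + (m + 1) * 22"
    using exec_csetv[OF p0, of "ILoad (IConst 0)" m 0] by auto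
  obtain t2 s2 where 2: "exec (csetv 1 (ILoad (IConst 1))) s1 t2 s2" "prel m d n rm s2 ((\<lambda>_. 0)(0 := m, 1 := d))"
    "t2 \<le> 6 + (d + 1) * 22"
    using exec_csetv[OF 1(2), of "ILoad (IConst 1)" d 1] by auto
  obtain t3 s3 where 3: "exec (csetv 2 (IAdd (ILoad (IConst 0)) (ILoad (IConst 1)))) s2 t3 s3"
    "prel m d n rm s3 ((\<lambda>_. 0)(0 := m, 1 := d, 2 := m + d))" "t3 \<le> 6 + (m + d + 1) * 25"
    using exec_csetv[OF 2(2), of "IAdd (ILoad (IConst 0)) (ILoad (IConst 1))" "m + d" 2] by auto
  obtain t4 s4 where 4: "exec (csetv 3 (ILoad (IConst 2))) s3 t4 s4"
    "prel m d n rm s4 ((\<lambda>_. 0)(0 := m, 1 := d, 2 := m + d, 3 := n))" "t4 \<le> 6 + (n + 1) * 22"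
    using exec_csetv[OF 3(2), of "ILoad (IConst 2)" n 3] by auto
  obtain t5 s5 where 5: "exec (csetv 4 (IConst 2)) s4 t5 s5"
    "prel m d n rm s5 ((\<lambda>_. 0)(0 := m, 1 := d, 2 := m + d, 3 := n, 4 := 2))" "t5 \<le> 6 + 3 * 21"
    using exec_csetv[OF 4(2), of "IConst 2" 2 4] by auto
  let ?f = "(\<lambda>_. 0)(0 := m, 1 := d, 2 := m + d, 3 := n, 4 := 2 :: nat)"
  define B where "B = (m + d) * n"
  define s6 where "s6 = s5\<lparr>imem := (imem s5)(3 := B)\<rparr>"
  have cells: "imem s5 (10 + 2 * x) = ?f x \<and> imem s5 (11 + 2 * x) = n * ?f x" for x
    using 5(2) unfolding prel_def by (elim conjE) (rule spec)
  have "imem s5 15 = B" using cells[of 2] by (simp add: B_def)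
  then have 6: "exec (IStore (IConst 3) (ILoad (IConst 15))) s5 4 s6"
    using exec.IStore[of "IConst 3" "ILoad (IConst 15)" s5] by (simp add: s6_def numeral_eq_Suc)
  have s6: "imem s6 2 = n" "imem s6 3 = B" "rmem s6 = rm"
    "\<And>x. imem s6 (10 + 2 * x) = ?f x \<and> imem s6 (11 + 2 * x) = n * ?f x"
    using 5(2) cells by (simp_all add: s6_def prel_def)
  define J where "J i s \<longleftrightarrow> imem s 2 = n \<and> (\<forall>x. imem s (10 + 2 * x) = ?f x \<and> imem s (11 + 2 * x) = n * ?f x) \<and>
     (\<forall>a<B. rmem s a = rm a) \<and> (\<forall>r e. r < 32 \<longrightarrow> rmem s (B + 32 * e + r) = (if r = 0 \<and> e < i then rm e else 0))" for i and s :: state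
  have "\<exists>t s'. exec (ccopy (adr 0 (ILoad (IConst 4))) (ILoad (IConst 4))) s6 t s' \<and> J B s' \<and> imem s' 3 = B \<and>
    t \<le> 3 + (B + 1) * (16 + icost (adr 0 (ILoad (IConst 4))) + icost (ILoad (IConst 4)))"
  proof (rule exec_ccopy)
    show "J 0 (s6\<lparr>imem := (imem s6)(4 := 0)\<rparr>)"
      unfolding J_def using s6 rm0 by (simp add: B_def rm_def)
  next
    fix i s assume i: "i < B" "J i s" "imem s 3 = B" "imem s 4 = i"
    have r: "rmem s i = rm i" using i by (simp add: J_def)
    have "B + 32 * e + r = B + 32 * i \<longleftrightarrow> e = i \<and> r = 0" if "r < 32" for r e
      using cell_inj[of r 0 e i] that by (simp add: add.assoc)
    then show "J (Suc i) (s\<lparr>rmem := (rmem s)(ival (adr 0 (ILoad (IConst 4))) s := rmem s (ival (ILoad (IConst 4)) s)),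
        imem := (imem s)(4 := Suc i)\<rparr>)"
      using i r unfolding J_def by (auto simp: less_Suc_eq)
  qed (rule s6)
  then obtain t7 s7 where 7: "exec (ccopy (adr 0 (ILoad (IConst 4))) (ILoad (IConst 4))) s6 t7 s7" "J B s7" "imem s7 3 = B"
    "t7 \<le> 3 + (B + 1) * (16 + icost (adr 0 (ILoad (IConst 4))) + icost (ILoad (IConst 4)))" by (elim exE conjE)
  have ic: "icost (adr 0 (ILoad (IConst 4))) = 100" by (simp add: adr_def dbl_def)
  have t7: "t7 \<le> 3 + (B + 1) * 118" using 7(4) unfolding ic by simp
  have "rel n B s7 (hinit m d n rm)"
  proof -
    have z: "rm (B + 32 * e) = 0" "B \<le> e \<Longrightarrow> rm e = 0" for e using rm0 by (simp_all add: B_def rm_def)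
    then show ?thesis using 7(2,3) unfolding rel_def J_def hinit_def by (auto simp: not_less)
  qed
  moreover have "exec cpro s (t1 + (t2 + (t3 + (t4 + (t5 + (4 + t7)))))) s7"
    unfolding cpro_def 
    by (rule exec.Seq[OF 1(1) exec.Seq[OF 2(1) exec.Seq[OF 3(1) exec.Seq[OF 4(1) exec.Seq[OF 5(1) exec.Seq[OF 6 7(1)]]]]]])
  moreover have "t1 + (t2 + (t3 + (t4 + (t5 + (4 + t7))))) \<le> 1000 * (n + 1) * (n + 1)"
  proof -
    have "B \<le> 2 * n * n" using le by (simp add: B_def)
    moreover have "t7 \<le> 121 + 118 * B" using t7 by simp
    ultimately have "t7 \<le> 121 + 118 * (2 * n * n)" by linarith
    moreover have "t1 + t2 + t3 + t4 + t5 \<le> 500 + 200 * n" using 1(3) 2(3) 3(3) 4(3) 5(3) le unfolding distrib_right by linarith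
    ultimately show ?thesis by (simp add: algebra_simps)
  qed
  ultimately show ?thesis unfolding rm_def B_def by (intro exI conjI)
qed

lemma exec_cepi:
  assumes R: "rel n B s h"
  shows "\<exists>t s'. exec cepi s t s' \<and> imem s' 0 = iv h 6 \<and> (\<forall>e<B. rmem s' e = ar h 1 e) \<and> t \<le> 200 * (B + 1)"
proof -
  define J where "J i s \<longleftrightarrow> rel n B s h \<and> (\<forall>a<i. rmem s a = ar h 1 a)" for i and s :: state
  have R4: "rel n B (s\<lparr>imem := (imem s)(4 := i)\<rparr>) h" if "rel n B s h" for s i
    using that unfolding rel_def by simp
  have "\<exists>t s'. exec (ccopy (ILoad (IConst 4)) (adr 1 (ILoad (IConst 4)))) s t s' \<and> J B s' \<and> imem s' 3 = B \<and>
    t \<le> 3 + (B + 1) * (16 + icost (ILoad (IConst 4)) + icost (adr 1 (ILoad (IConst 4))))"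
  proof (rule exec_ccopy)
    show "imem s 3 = B" using R by (simp add: rel_def)
    show "J 0 (s\<lparr>imem := (imem s)(4 := 0)\<rparr>)" using R4[OF R] by (simp add: J_def)
  next
    fix i s assume i: "i < B" "J i s" "imem s 3 = B" "imem s 4 = i"
    have v: "rmem s (B + 32 * i + 1) = ar h 1 i"
    proof -
      have "\<forall>r e. r < 32 \<longrightarrow> rmem s (B + 32 * e + r) = ar h r e"
        using i(2) unfolding J_def rel_def by (elim conjE)
      from this[rule_format, of 1 i] show ?thesis by simp
    qed
    have "rel n B (s\<lparr>rmem := (rmem s)(i := ar h 1 i)\<rparr>) h" using i unfolding J_def rel_def by simp
    from R4[OF this] show "J (Suc i) (s\<lparr>rmem := (rmem s)(ival (ILoad (IConst 4)) s := rmem s (ival (adr 1 (ILoad (IConst 4))) s)),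
        imem := (imem s)(4 := Suc i)\<rparr>)"
      using i v unfolding J_def by (auto simp: less_Suc_eq)
  qed
  then obtain t s' where 1: "exec (ccopy (ILoad (IConst 4)) (adr 1 (ILoad (IConst 4)))) s t s'" "J B s'" "imem s' 3 = B"
    "t \<le> 3 + (B + 1) * (16 + icost (ILoad (IConst 4)) + icost (adr 1 (ILoad (IConst 4))))" by (elim exE conjE)
  have ic: "icost (adr 1 (ILoad (IConst 4))) = 100" by (simp add: adr_def dbl_def)
  have t: "t \<le> 3 + (B + 1) * 118" using 1(4) unfolding ic by simp
  have "\<forall>x. imem s' (10 + 2 * x) = iv h x \<and> imem s' (11 + 2 * x) = n * iv h x"
    using 1(2) unfolding J_def rel_def by (elim conjE)
  from spec[OF this, of 6] have c: "imem s' 22 = iv h 6" by simp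
  have "exec (IStore (IConst 0) (ILoad (IConst 22))) s' (1 + 1 + 2) (s'\<lparr>imem := (imem s')(0 := iv h 6)\<rparr>)"
    using exec.IStore[of "IConst 0" "ILoad (IConst 22)" s'] c by simp
  from exec.Seq[OF 1(1) this] show ?thesis
    using 1(2) t unfolding cepi_def J_def
    by (intro exI[of _ "t + (1 + 1 + 2)"] exI[of _ "s'\<lparr>imem := (imem s')(0 := iv h 6)\<rparr>"]) simp
qed

definition calg :: "hcom \<Rightarrow> com" where
  "calg c = Seq cpro (Seq (cc c) cepi)"

lemma exec_calg:
  assumes "wf c"
  shows "\<exists>p :: nat poly. \<forall>m d n A X \<omega>. m \<le> n \<longrightarrow> d \<le> n \<longrightarrow> A \<in> carrier_mat m n \<longrightarrow> X \<in> carrier_mat d n \<longrightarrow>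
    (\<exists>t s. exec (calg c) (input_state A X \<omega>) t s \<and> t \<le> poly p n \<and>
      imem s 0 = iv (run n c (hinit m d n (rmem (input_state A X \<omega>)))) 6 \<and>
      (\<forall>e<(m + d) * n. rmem s e = ar (run n c (hinit m d n (rmem (input_state A X \<omega>)))) 1 e))"
proof -
  obtain p where p: "\<forall>n B s h. rel n B s h \<longrightarrow>
    (\<exists>t s'. exec (cc c) s t s' \<and> rel n B s' (run n c h) \<and> t \<le> poly p n)"
    using cc_correct[OF assms] ..
  show ?thesis
  proof (intro exI[of _ "[:1000:] * [:1, 1:] * [:1, 1:] + p + [:200:] * ([:2:] * [:0, 1:] * [:0, 1:] + 1)"] allI impI)
    fix m d n and A X :: "real mat" and \<omega> assume le: "m \<le> n" "d \<le> n" and A: "A \<in> carrier_mat m n" and X: "X \<in> carrier_mat d n"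
    let ?s = "input_state A X \<omega>"
    have im: "imem ?s = (\<lambda>_. 0)(0 := m, 1 := d, 2 := n)" using A X by (simp add: input_state_def Let_def)
    have rm0: "rmem ?s a = 0" if "(m + d) * n \<le> a" for a
      using A X that by (simp add: input_state_def Let_def algebra_simps)
    obtain t1 s1 where 1: "exec cpro ?s t1 s1" "rel n ((m + d) * n) s1 (hinit m d n (rmem ?s))"
      "t1 \<le> 1000 * (n + 1) * (n + 1)"
      using exec_cpro[OF im rm0 le] by blast
    obtain t2 s2 where 2: "exec (cc c) s1 t2 s2" "rel n ((m + d) * n) s2 (run n c (hinit m d n (rmem ?s)))"
      "t2 \<le> poly p n" using p[rule_format, OF 1(2)] by blast
    obtain t3 s3 where 3: "exec cepi s2 t3 s3" "imem s3 0 = iv (run n c (hinit m d n (rmem ?s))) 6"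
      "\<forall>e<(m + d) * n. rmem s3 e = ar (run n c (hinit m d n (rmem ?s))) 1 e" "t3 \<le> 200 * ((m + d) * n + 1)"
      using exec_cepi[OF 2(2)] by blast
    have "(m + d) * n \<le> 2 * n * n" using le by simp
    then have t: "t1 + (t2 + t3) \<le> poly ([:1000:] * [:1, 1:] * [:1, 1:] + p + [:200:] * ([:2:] * [:0, 1:] * [:0, 1:] + 1)) n"
      using 1(3) 2(3) 3(4) by (simp add: algebra_simps)
    show "\<exists>t s. exec (calg c) ?s t s \<and> t \<le> poly ([:1000:] * [:1, 1:] * [:1, 1:] + p + [:200:] * ([:2:] * [:0, 1:] * [:0, 1:] + 1)) n \<and>
      imem s 0 = iv (run n c (hinit m d n (rmem (input_state A X \<omega>)))) 6 \<and>
      (\<forall>e<(m + d) * n. rmem s e = ar (run n c (hinit m d n (rmem (input_state A X \<omega>)))) 1 e)"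
      unfolding calg_def
      by (intro exI conjI, rule exec.Seq[OF 1(1) exec.Seq[OF 2(1) 3(1)]]) (use t 3(2,3) in simp_all)
  qed
qed

lemma poly_time_calg:
  assumes "wf c"
  shows "poly_time (calg c)"
proof -
  obtain p where p: "\<forall>m d n A X \<omega>. m \<le> n \<longrightarrow> d \<le> n \<longrightarrow> A \<in> carrier_mat m n \<longrightarrow> X \<in> carrier_mat d n \<longrightarrow>
    (\<exists>t s. exec (calg c) (input_state A X \<omega>) t s \<and> t \<le> poly p n \<and>
      imem s 0 = iv (run n c (hinit m d n (rmem (input_state A X \<omega>)))) 6 \<and>
      (\<forall>e<(m + d) * n. rmem s e = ar (run n c (hinit m d n (rmem (input_state A X \<omega>)))) 1 e))"
    using exec_calg[OF assms] ..
  show ?thesis unfolding poly_time_def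
  proof (intro exI[of _ p] allI impI)
    fix m d n and A X :: "real mat" and \<omega> :: "nat \<Rightarrow> real"
    assume "m \<le> n" "d \<le> n" "A \<in> carrier_mat m n" "X \<in> carrier_mat d n"
    from p[rule_format, OF this, of \<omega>] show "\<exists>t s. exec (calg c) (input_state A X \<omega>) t s \<and> t \<le> poly p n"
      by (elim exE conjE) (intro exI conjI)
  qed
qed

subsection \<open>Measurability\<close>

text \<open>\<open>measure\<close> is zero on non-measurable sets, so a lower bound for the success
  probability needs a measurable success event. It is obtained by following the whole program state
  as a function of the sample.\<close>

definition mh :: "'w measure \<Rightarrow> ('w \<Rightarrow> hst) \<Rightarrow> bool" where
  "mh M H \<longleftrightarrow> (\<forall>x. (\<lambda>w. iv (H w) x) \<in> measurable M (count_space UNIV)) \<and>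
     (\<forall>r e. (\<lambda>w. ar (H w) r e) \<in> borel_measurable M)"

lemma measurable_count2:
  fixes f :: "'w \<Rightarrow> 'a :: countable" and g :: "'w \<Rightarrow> 'b :: countable"
  assumes "f \<in> measurable M (count_space UNIV)" "g \<in> measurable M (count_space UNIV)"
  shows "(\<lambda>w. F (f w) (g w)) \<in> measurable M (count_space UNIV)"
proof -
  have "(\<lambda>w. F i (g w)) \<in> measurable M (count_space UNIV)" for i
    using measurable_compose_countable[of "\<lambda>j w. F i j" M "count_space UNIV" g] assms(2) by simp
  from measurable_compose_countable[of "\<lambda>i w. F i (g w)", OF this assms(1)] show ?thesis .
qed

lemma measurable_vi: "mh M H \<Longrightarrow> (\<lambda>w. vi n e (H w)) \<in> measurable M (count_space UNIV)"
proof (induction e)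
  case (HV x)
  then show ?case by (simp add: mh_def)
next
  case (HS x)
  then have "(\<lambda>w. iv (H w) x) \<in> measurable M (count_space UNIV)" by (simp add: mh_def)
  from measurable_count2[where F="\<lambda>a b. n * a", OF this this] show ?case by simp
next
  case (HA a b)
  from measurable_count2[where F="(+)", OF HA.IH[OF HA.prems]] show ?case by simp
next
  case (HM a b)
  from measurable_count2[where F="(-)", OF HM.IH[OF HM.prems]] show ?case by simp
qed simp

lemma measurable_vr: "mh M H \<Longrightarrow> (\<lambda>w. vr n e (H w)) \<in> borel_measurable M"
proof (induction e)
  case (KL r e)
  have "(\<lambda>w. ar (H w) r i) \<in> borel_measurable M" for i using KL by (simp add: mh_def)
  from measurable_compose_countable[of "\<lambda>i w. ar (H w) r i", OF this measurable_vi[OF KL]] show ?case by simp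
next
  case (KN e)
  have "(\<lambda>w. real i) \<in> borel_measurable M" for i by simp
  from measurable_compose_countable[of "\<lambda>i w. real i", OF this measurable_vi[OF KN]] show ?case by simp
next
  case (KC c)
  show ?case by simp
next
  case (KQ a)
  from measurable_compose[OF KQ.IH[OF KQ.prems] borel_measurable_sqrt] show ?case by simp
next
  case (KA a b)
  from borel_measurable_add[OF KA.IH[OF KA.prems]] show ?case by simp
next
  case (KM a b)
  from borel_measurable_diff[OF KM.IH[OF KM.prems]] show ?case by simp
next
  case (KT a b)
  from borel_measurable_times[OF KT.IH[OF KT.prems]] show ?case by simp
next
  case (KD a b)
  from borel_measurable_divide[OF KD.IH[OF KD.prems]] show ?case by simp
qed

lemma measurable_vb: "mh M H \<Longrightarrow> (\<lambda>w. vb n b (H w)) \<in> measurable M (count_space UNIV)"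
proof (cases b)
  case (BR e1 e2)
  assume "mh M H"
  then have [measurable]: "(\<lambda>w. vr n e1 (H w)) \<in> borel_measurable M" "(\<lambda>w. vr n e2 (H w)) \<in> borel_measurable M"
    by (rule measurable_vr)+
  show ?thesis unfolding BR vb.simps by measurable
next
  case (BI e1 e2)
  assume "mh M H"
  then show ?thesis unfolding BI vb.simps by (intro measurable_count2[where F="(\<le>)"] measurable_vi)
qed

text \<open>Addresses, branches and loop bounds depend on the sample but take countably many values;
  on each of the countably many pieces the operation is a fixed one.\<close>

lemma mh_compose:
  fixes g :: "'w \<Rightarrow> 'i :: countable"
  assumes "\<And>i. mh M (F i)" "g \<in> measurable M (count_space UNIV)"
  shows "mh M (\<lambda>w. F (g w) w)"
proof -
  have "(\<lambda>w. iv (F i w) x) \<in> measurable M (count_space UNIV)" for i x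
    using assms(1)[of i] by (simp add: mh_def)
  then have 1: "(\<lambda>w. iv (F (g w) w) x) \<in> measurable M (count_space UNIV)" for x
    using measurable_compose_countable[of "\<lambda>i w. iv (F i w) x" M "count_space UNIV" g] assms(2) by simp
  have "(\<lambda>w. ar (F i w) r e) \<in> borel_measurable M" for i r e
    using assms(1)[of i] by (simp add: mh_def)
  then have "(\<lambda>w. ar (F (g w) w) r e) \<in> borel_measurable M" for r e
    using measurable_compose_countable[of "\<lambda>i w. ar (F i w) r e" M borel g] assms(2) by simp
  with 1 show ?thesis unfolding mh_def by simp
qed

lemma mh_setv:
  assumes "mh M H" "v \<in> measurable M (count_space UNIV)"
  shows "mh M (\<lambda>w. setv (H w) x (v w))"
proof -
  have "(\<lambda>w. if y = x then v w else iv (H w) y) \<in> measurable M (count_space UNIV)" for y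
    using assms by (cases "y = x") (simp_all add: mh_def)
  then show ?thesis using assms unfolding mh_def by simp
qed

lemma mh_run: "mh M H \<Longrightarrow> mh M (\<lambda>w. run n c (H w))"
proof (induction c arbitrary: H)
  case (HSt r e v)
  have "mh M (\<lambda>w. (H w)\<lparr>ar := (ar (H w))(r := (ar (H w) r)(i := vr n v (H w)))\<rparr>)" for i
  proof -
    have "(\<lambda>w. if r' = r \<and> e' = i then vr n v (H w) else ar (H w) r' e') \<in> borel_measurable M" for r' e'
      using HSt measurable_vr[OF HSt, of n v] by (cases "r' = r"; cases "e' = i") (simp_all add: mh_def)
    moreover have "((ar (H w))(r := (ar (H w) r)(i := vr n v (H w)))) r' e' =
      (if r' = r \<and> e' = i then vr n v (H w) else ar (H w) r' e')" for w r' e' by simp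
    ultimately show ?thesis using HSt unfolding mh_def by simp
  qed
  from mh_compose[of M "\<lambda>i w. (H w)\<lparr>ar := (ar (H w))(r := (ar (H w) r)(i := vr n v (H w)))\<rparr>", OF this measurable_vi[OF HSt]]
  show ?case by simp
next
  case (HZero x)
  from mh_setv[OF HZero, of "\<lambda>_. 0" x] show ?case by simp
next
  case (HInc x)
  have "(\<lambda>w. Suc (iv (H w) x)) \<in> measurable M (count_space UNIV)"
    using HInc measurable_count2[where F="\<lambda>a b. Suc a", of "\<lambda>w. iv (H w) x" M "\<lambda>_. 0 :: nat"] unfolding mh_def by simp
  from mh_setv[OF HInc this, of x] show ?case by simp
next
  case (HIf b c1 c2)
  have "mh M (\<lambda>w. if i then run n c1 (H w) else run n c2 (H w))" for i
    using HIf.IH[OF HIf.prems] by (cases i) auto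
  from mh_compose[of M "\<lambda>i w. if i then run n c1 (H w) else run n c2 (H w)", OF this measurable_vb[OF HIf.prems]]
  show ?case by simp
next
  case (HFor x y c)
  have b: "(\<lambda>w. min n (iv (H w) y)) \<in> measurable M (count_space UNIV)"
    using HFor.prems measurable_count2[where F="\<lambda>a b. min n a", of "\<lambda>w. iv (H w) y" M "\<lambda>_. 0 :: nat"] unfolding mh_def by simp
  have "mh M (\<lambda>w. hloop (run n c) x i (H w))" for i
  proof (induction i)
    case 0
    then show ?case using HFor.prems by simp
  next
    case (Suc i)
    have "(\<lambda>w. i) \<in> measurable M (count_space UNIV)" by simp
    from HFor.IH[OF mh_setv[OF Suc this]] show ?case by simp
  qed
  then have "mh M (\<lambda>w. setv (hloop (run n c) x i (H w)) x i)" for i by (rule mh_setv) simp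
  from mh_compose[of M "\<lambda>i w. setv (hloop (run n c) x i (H w)) x i", OF this b]
  show ?case by simp
next
  case HSkip
  then show ?case by simp
next
  case (HSeq a b)
  from HSeq.IH(2)[OF HSeq.IH(1)[OF HSeq.prems]] show ?case by simp
qed

section \<open>Rotation invariance of the Gaussian measure\<close>

lemma sets_std_gaussian [measurable_cong, simp]: "sets std_gaussian = sets borel"
  by (simp add: std_gaussian_def)

lemma space_std_gaussian [simp]: "space std_gaussian = UNIV"
  by (simp add: std_gaussian_def)

lemma prob_space_std_gaussian: "prob_space std_gaussian"
  unfolding std_gaussian_def using prob_space_normal_density[of 1 0] by simp

interpretation sg: prob_space std_gaussian
  by (rule prob_space_std_gaussian)

interpretation sgp: product_sigma_finite "\<lambda>_. std_gaussian"
  by (simp add: product_sigma_finite_def sg.sigma_finite_measure_axioms)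

abbreviation gam :: "nat \<Rightarrow> (nat \<Rightarrow> real) measure" where
  "gam d \<equiv> \<Pi>\<^sub>M _\<in>{..<d}. std_gaussian"

lemma nn_integral_std_gaussian:
  assumes "f \<in> borel_measurable borel"
  shows "(\<integral>\<^sup>+x. f x \<partial>std_gaussian) = (\<integral>\<^sup>+x. ennreal (std_normal_density x) * f x \<partial>lborel)"
  unfolding std_gaussian_def using assms by (subst nn_integral_density) auto

lemma std_normal_density_prod:
  "ennreal (std_normal_density x) * ennreal (std_normal_density y) =
   ennreal ((1 / (2 * pi)) * exp (- (x\<^sup>2 + y\<^sup>2) / 2))"
proof -
  have "std_normal_density x * std_normal_density y = (1 / (2 * pi)) * exp (- (x\<^sup>2 + y\<^sup>2) / 2)"
    by (simp add: std_normal_density_def exp_add[symmetric] add_divide_distrib)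
  then show ?thesis by (simp add: ennreal_mult[symmetric])
qed

text \<open>For \<open>a \<noteq> 0\<close> two one-dimensional substitutions suffice: with
  \<open>y\<close> fixed put \<open>u = a * x + b * y\<close>, then, after exchanging the integrals,
  with \<open>u\<close> fixed put \<open>w = (y - b * u) / a\<close>. The Jacobians cancel. For
  \<open>a = 0\<close> the map exchanges the coordinates up to signs.\<close>

lemma lborel_rotate:
  fixes g :: "real \<times> real \<Rightarrow> ennreal"
  assumes g [measurable]: "g \<in> borel_measurable (borel \<Otimes>\<^sub>M borel)" and ab: "a\<^sup>2 + b\<^sup>2 = 1"
  shows "(\<integral>\<^sup>+y. \<integral>\<^sup>+x. g (a * x + b * y, a * y - b * x) \<partial>lborel \<partial>lborel) =
    (\<integral>\<^sup>+y. \<integral>\<^sup>+x. g (x, y) \<partial>lborel \<partial>lborel)"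
proof (cases "a = 0")
  case True
  then have b: "b\<^sup>2 = 1" using ab by simp
  then have b1: "\<bar>b\<bar> = 1" and b0: "b \<noteq> 0" by (auto simp: power2_eq_1_iff)
  have "(\<integral>\<^sup>+y. \<integral>\<^sup>+x. g (a * x + b * y, a * y - b * x) \<partial>lborel \<partial>lborel) =
    (\<integral>\<^sup>+y. \<integral>\<^sup>+x. g (b * y, - b * x) \<partial>lborel \<partial>lborel)" using True by simp
  also have "\<dots> = (\<integral>\<^sup>+y. \<integral>\<^sup>+x. g (b * y, x) \<partial>lborel \<partial>lborel)"
  proof (rule nn_integral_cong)
    fix y
    have "(\<integral>\<^sup>+x. g (b * y, x) \<partial>lborel) = ennreal \<bar>- b\<bar> * (\<integral>\<^sup>+x. g (b * y, 0 + - b * x) \<partial>lborel)"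
      by (rule nn_integral_real_affine) (use b0 in auto)
    then show "(\<integral>\<^sup>+x. g (b * y, - b * x) \<partial>lborel) = (\<integral>\<^sup>+x. g (b * y, x) \<partial>lborel)" using b1 by simp
  qed
  also have "\<dots> = (\<integral>\<^sup>+y. \<integral>\<^sup>+x. g (y, x) \<partial>lborel \<partial>lborel)"
    by (subst (2) nn_integral_real_affine[where c = b and t = 0]) (use b1 b0 in auto)
  also have "\<dots> = (\<integral>\<^sup>+y. \<integral>\<^sup>+x. g (x, y) \<partial>lborel \<partial>lborel)"
    by (rule lborel_pair.Fubini') simp
  finally show ?thesis .
next
  case False
  have sq: "a * a = 1 - b * b" using ab by (simp add: power2_eq_square algebra_simps)
  have "(\<integral>\<^sup>+y. \<integral>\<^sup>+x. g (a * x + b * y, a * y - b * x) \<partial>lborel \<partial>lborel) =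
     (\<integral>\<^sup>+y. \<integral>\<^sup>+x. g (b * y + a * x, (y - b * (b * y + a * x)) / a) \<partial>lborel \<partial>lborel)"
  proof (intro nn_integral_cong arg_cong[where f = g])
    fix x y :: real
    have "a * (a * y - b * x) = (a * a + b * b) * y - b * (b * y + a * x)" by (simp add: algebra_simps)
    then have "a * (a * y - b * x) = y - b * (b * y + a * x)" using sq by simp
    then show "(a * x + b * y, a * y - b * x) = (b * y + a * x, (y - b * (b * y + a * x)) / a)"
      using False by (simp add: field_simps)
  qed
  also have "\<dots> = (\<integral>\<^sup>+y. (\<integral>\<^sup>+u. g (u, (y - b * u) / a) \<partial>lborel) / ennreal \<bar>a\<bar> \<partial>lborel)"
  proof (intro nn_integral_cong)
    fix y
    have "(\<integral>\<^sup>+u. g (u, (y - b * u) / a) \<partial>lborel) =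
      ennreal \<bar>a\<bar> * (\<integral>\<^sup>+x. g (b * y + a * x, (y - b * (b * y + a * x)) / a) \<partial>lborel)"
      by (subst nn_integral_real_affine[where c = a and t = "b * y"]) (use False in auto)
    then show "(\<integral>\<^sup>+x. g (b * y + a * x, (y - b * (b * y + a * x)) / a) \<partial>lborel) =
      (\<integral>\<^sup>+u. g (u, (y - b * u) / a) \<partial>lborel) / ennreal \<bar>a\<bar>"
      using False by (simp add: ennreal_mult_divide_eq mult.commute[of "ennreal \<bar>a\<bar>"])
  qed
  also have "\<dots> = (\<integral>\<^sup>+y. (\<integral>\<^sup>+u. g (u, (y - b * u) / a) \<partial>lborel) \<partial>lborel) / ennreal \<bar>a\<bar>"
    by (rule nn_integral_divide) measurable
  also have "(\<integral>\<^sup>+y. (\<integral>\<^sup>+u. g (u, (y - b * u) / a) \<partial>lborel) \<partial>lborel) =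
    (\<integral>\<^sup>+u. (\<integral>\<^sup>+y. g (u, (y - b * u) / a) \<partial>lborel) \<partial>lborel)"
    by (rule lborel_pair.Fubini') measurable
  also have "\<dots> = (\<integral>\<^sup>+u. ennreal \<bar>a\<bar> * (\<integral>\<^sup>+w. g (u, w) \<partial>lborel) \<partial>lborel)"
  proof (intro nn_integral_cong)
    fix u
    have "(\<integral>\<^sup>+w. g (u, w) \<partial>lborel) = ennreal \<bar>1 / a\<bar> * (\<integral>\<^sup>+y. g (u, - b * u / a + 1 / a * y) \<partial>lborel)"
      by (subst nn_integral_real_affine[where c = "1 / a" and t = "- b * u / a"]) (use False in auto)
    also have "(\<lambda>y. g (u, - b * u / a + 1 / a * y)) = (\<lambda>y. g (u, (y - b * u) / a))"
      using False by (auto simp: field_simps)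
    finally have "ennreal \<bar>a\<bar> * (\<integral>\<^sup>+w. g (u, w) \<partial>lborel) =
      ennreal \<bar>a\<bar> * ennreal \<bar>1 / a\<bar> * (\<integral>\<^sup>+y. g (u, (y - b * u) / a) \<partial>lborel)"
      by (simp add: mult.assoc)
    moreover have "ennreal \<bar>a\<bar> * ennreal \<bar>1 / a\<bar> = 1"
      using False by (simp add: ennreal_mult[symmetric] abs_mult[symmetric])
    ultimately show "(\<integral>\<^sup>+y. g (u, (y - b * u) / a) \<partial>lborel) = ennreal \<bar>a\<bar> * (\<integral>\<^sup>+w. g (u, w) \<partial>lborel)"
      by simp
  qed
  also have "\<dots> = ennreal \<bar>a\<bar> * (\<integral>\<^sup>+u. (\<integral>\<^sup>+w. g (u, w) \<partial>lborel) \<partial>lborel)"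
    by (rule nn_integral_cmult) measurable
  also have "\<dots> / ennreal \<bar>a\<bar> = (\<integral>\<^sup>+u. (\<integral>\<^sup>+w. g (u, w) \<partial>lborel) \<partial>lborel)"
    using False by (simp add: ennreal_mult_divide_eq mult.commute[of "ennreal \<bar>a\<bar>"])
  also have "\<dots> = (\<integral>\<^sup>+y. \<integral>\<^sup>+x. g (x, y) \<partial>lborel \<partial>lborel)"
    by (rule lborel_pair.Fubini') simp
  finally show ?thesis .
qed

lemma std_gaussian_rotate:
  fixes f :: "real \<times> real \<Rightarrow> ennreal"
  assumes f [measurable]: "f \<in> borel_measurable (borel \<Otimes>\<^sub>M borel)" and ab: "a\<^sup>2 + b\<^sup>2 = 1"
  shows "(\<integral>\<^sup>+y. \<integral>\<^sup>+x. f (a * x + b * y, a * y - b * x) \<partial>std_gaussian \<partial>std_gaussian) =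
    (\<integral>\<^sup>+y. \<integral>\<^sup>+x. f (x, y) \<partial>std_gaussian \<partial>std_gaussian)"
proof -
  define g where "g = (\<lambda>(x, y). ennreal ((1 / (2 * pi)) * exp (- (x\<^sup>2 + y\<^sup>2) / 2)) * f (x, y))"
  have [measurable]: "g \<in> borel_measurable (borel \<Otimes>\<^sub>M borel)" unfolding g_def by measurable
  have conv: "(\<integral>\<^sup>+y. \<integral>\<^sup>+x. h (x, y) \<partial>std_gaussian \<partial>std_gaussian) =
     (\<integral>\<^sup>+y. \<integral>\<^sup>+x. ennreal ((1 / (2 * pi)) * exp (- (x\<^sup>2 + y\<^sup>2) / 2)) * h (x, y) \<partial>lborel \<partial>lborel)"
    if [measurable]: "h \<in> borel_measurable (borel \<Otimes>\<^sub>M borel)" for h :: "real \<times> real \<Rightarrow> ennreal"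
  proof -
    have "(\<integral>\<^sup>+y. \<integral>\<^sup>+x. h (x, y) \<partial>std_gaussian \<partial>std_gaussian) =
      (\<integral>\<^sup>+y. ennreal (std_normal_density y) * (\<integral>\<^sup>+x. ennreal (std_normal_density x) * h (x, y) \<partial>lborel) \<partial>lborel)"
      by (subst nn_integral_std_gaussian, measurable) (simp add: nn_integral_std_gaussian)
    also have "\<dots> = (\<integral>\<^sup>+y. \<integral>\<^sup>+x. ennreal (std_normal_density y) * (ennreal (std_normal_density x) * h (x, y)) \<partial>lborel \<partial>lborel)"
      by (intro nn_integral_cong nn_integral_cmult[symmetric]) measurable
    finally show ?thesis
      by (simp only: mult.assoc[symmetric] std_normal_density_prod mult.commute[of "ennreal (std_normal_density _)" "ennreal (std_normal_density _)"])
        (simp add: add.commute)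
  qed
  have rot: "(a * x + b * y)\<^sup>2 + (a * y - b * x)\<^sup>2 = x\<^sup>2 + y\<^sup>2" for x y
  proof -
    have "(a * x + b * y)\<^sup>2 + (a * y - b * x)\<^sup>2 = (a\<^sup>2 + b\<^sup>2) * (x\<^sup>2 + y\<^sup>2)"
      by (simp add: power2_eq_square algebra_simps)
    then show ?thesis using ab by simp
  qed
  have "(\<integral>\<^sup>+y. \<integral>\<^sup>+x. f (a * x + b * y, a * y - b * x) \<partial>std_gaussian \<partial>std_gaussian) =
     (\<integral>\<^sup>+y. \<integral>\<^sup>+x. g (a * x + b * y, a * y - b * x) \<partial>lborel \<partial>lborel)"
    using conv[of "\<lambda>(x, y). f (a * x + b * y, a * y - b * x)"] unfolding g_def split_conv rot by simp
  also have "\<dots> = (\<integral>\<^sup>+y. \<integral>\<^sup>+x. g (x, y) \<partial>lborel \<partial>lborel)" by (rule lborel_rotate) (use ab in auto)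
  also have "\<dots> = (\<integral>\<^sup>+y. \<integral>\<^sup>+x. f (x, y) \<partial>std_gaussian \<partial>std_gaussian)"
    using conv[of f] by (simp add: g_def)
  finally show ?thesis .
qed

lemma std_gaussian_flip:
  assumes [measurable]: "f \<in> borel_measurable borel"
  shows "(\<integral>\<^sup>+x. f (- x) \<partial>std_gaussian) = (\<integral>\<^sup>+x. f x \<partial>std_gaussian)"
proof -
  have "(\<integral>\<^sup>+x. ennreal (std_normal_density x) * f x \<partial>lborel) =
    ennreal \<bar>- 1\<bar> * (\<integral>\<^sup>+x. ennreal (std_normal_density (0 + - 1 * x)) * f (0 + - 1 * x) \<partial>lborel)"
    by (rule nn_integral_real_affine) auto
  then show ?thesis
    by (subst (1 2) nn_integral_std_gaussian) (auto simp: std_normal_density_def)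
qed

subsection \<open>Linear maps preserving the product measure\<close>

definition lin :: "nat \<Rightarrow> (nat \<Rightarrow> nat \<Rightarrow> real) \<Rightarrow> (nat \<Rightarrow> real) \<Rightarrow> (nat \<Rightarrow> real)" where
  "lin d T x = (\<lambda>p\<in>{..<d}. \<Sum>r<d. T p r * x r)"

lemma lin_measurable [measurable]: "lin d T \<in> measurable (gam d) (gam d)"
  unfolding lin_def by measurable

definition roworth :: "nat \<Rightarrow> (nat \<Rightarrow> nat \<Rightarrow> real) \<Rightarrow> bool" where
  "roworth d T \<longleftrightarrow> (\<forall>p<d. \<forall>q<d. (\<Sum>r<d. T p r * T q r) = (if p = q then 1 else 0))"

text \<open>Invariance of the measure is bundled with orthogonality and established only for
  products of plane rotations and sign changes. These reach every orthonormal family, and each needs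
  integration in at most two variables instead of a change of variables in dimension
  \<open>d\<close>.\<close>

definition good :: "nat \<Rightarrow> (nat \<Rightarrow> nat \<Rightarrow> real) \<Rightarrow> bool" where
  "good d T \<longleftrightarrow> roworth d T \<and>
    (\<forall>f \<in> borel_measurable (gam d). (\<integral>\<^sup>+x. f (lin d T x) \<partial>gam d) = (\<integral>\<^sup>+x. (f x :: ennreal) \<partial>gam d))"

lemma gam_rotate:
  assumes f [measurable]: "f \<in> borel_measurable (gam d)" and ij: "i < d" "j < d" "i \<noteq> j" and ab: "a\<^sup>2 + b\<^sup>2 = 1"
  shows "(\<integral>\<^sup>+x. f (x(i := a * x i + b * x j, j := a * x j - b * x i)) \<partial>gam d) = (\<integral>\<^sup>+x. (f x :: ennreal) \<partial>gam d)"
proof -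
  define J where "J = {..<d} - {i, j}"
  have ins: "{..<d} = insert i (insert j J)" using ij by (auto simp: J_def)
  have J: "finite J" "i \<notin> insert j J" "j \<notin> J" "finite (insert j J)" using ij by (auto simp: J_def)
  have split: "(\<integral>\<^sup>+x. h x \<partial>gam d) =
    (\<integral>\<^sup>+x. \<integral>\<^sup>+y. \<integral>\<^sup>+t. h (x(j := y, i := t)) \<partial>std_gaussian \<partial>std_gaussian \<partial>PiM J (\<lambda>_. std_gaussian))"
    if h: "h \<in> borel_measurable (gam d)" for h :: "(nat \<Rightarrow> real) \<Rightarrow> ennreal"
  proof -
    have h' [measurable]: "h \<in> borel_measurable (PiM (insert i (insert j J)) (\<lambda>_. std_gaussian))" using h ins by simp
    have "(\<integral>\<^sup>+x. h x \<partial>gam d) = (\<integral>\<^sup>+x. \<integral>\<^sup>+t. h (x(i := t)) \<partial>std_gaussian \<partial>PiM (insert j J) (\<lambda>_. std_gaussian))"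
      unfolding ins by (rule sgp.product_nn_integral_insert[OF J(4,2) h'])
    also have "\<dots> = (\<integral>\<^sup>+x. \<integral>\<^sup>+y. \<integral>\<^sup>+t. h (x(j := y, i := t)) \<partial>std_gaussian \<partial>std_gaussian \<partial>PiM J (\<lambda>_. std_gaussian))"
      by (rule sgp.product_nn_integral_insert[OF J(1,3)]) measurable
    finally show ?thesis .
  qed
  have [measurable]: "(\<lambda>x. x(i := a * x i + b * x j, j := a * x j - b * x i)) \<in> measurable (gam d) (gam d)"
  proof (rule measurable_PiM_single')
    show "(\<lambda>x. (x(i := a * x i + b * x j, j := a * x j - b * x i)) k) \<in> measurable (gam d) std_gaussian"
      if "k \<in> {..<d}" for k using that ij by (cases "k = i"; cases "k = j") auto
    show "(\<lambda>x. x(i := a * x i + b * x j, j := a * x j - b * x i)) \<in> space (gam d) \<rightarrow> {..<d} \<rightarrow>\<^sub>E space std_gaussian"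
      using ij by (auto simp: space_PiM PiE_def extensional_def)
  qed
  have "(\<integral>\<^sup>+x. f (x(i := a * x i + b * x j, j := a * x j - b * x i)) \<partial>gam d) =
    (\<integral>\<^sup>+x. \<integral>\<^sup>+y. \<integral>\<^sup>+t. f (x(j := a * y - b * t, i := a * t + b * y)) \<partial>std_gaussian \<partial>std_gaussian \<partial>PiM J (\<lambda>_. std_gaussian))"
    by (subst split) (use ij in \<open>auto intro!: nn_integral_cong arg_cong[where f = f] simp: fun_eq_iff\<close>)
  also have "\<dots> = (\<integral>\<^sup>+x. \<integral>\<^sup>+y. \<integral>\<^sup>+t. f (x(j := y, i := t)) \<partial>std_gaussian \<partial>std_gaussian \<partial>PiM J (\<lambda>_. std_gaussian))"
  proof (rule nn_integral_cong)
    fix x assume x: "x \<in> space (PiM J (\<lambda>_. std_gaussian))"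
    have m: "(\<lambda>(t, y). x(j := y, i := t)) \<in> measurable (borel \<Otimes>\<^sub>M borel) (gam d)"
    proof (rule measurable_PiM_single')
      show "(\<lambda>w. (case w of (t, y) \<Rightarrow> x(j := y, i := t)) k) \<in> measurable (borel \<Otimes>\<^sub>M borel) std_gaussian"
        if "k \<in> {..<d}" for k using that by (cases "k = i"; cases "k = j") (auto simp: case_prod_beta')
      show "(\<lambda>(t, y). x(j := y, i := t)) \<in> space (borel \<Otimes>\<^sub>M borel) \<rightarrow> {..<d} \<rightarrow>\<^sub>E space std_gaussian"
        using x ins by (auto simp: space_PiM PiE_def extensional_def)
    qed
    have "(\<lambda>(t, y). f (x(j := y, i := t))) \<in> borel_measurable (borel \<Otimes>\<^sub>M borel)"
      using measurable_compose[OF m f] by (simp add: case_prod_beta')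
    from std_gaussian_rotate[OF this ab]
    show "(\<integral>\<^sup>+y. \<integral>\<^sup>+t. f (x(j := a * y - b * t, i := a * t + b * y)) \<partial>std_gaussian \<partial>std_gaussian) =
      (\<integral>\<^sup>+y. \<integral>\<^sup>+t. f (x(j := y, i := t)) \<partial>std_gaussian \<partial>std_gaussian)" by simp
  qed
  also have "\<dots> = (\<integral>\<^sup>+x. f x \<partial>gam d)" by (rule split[symmetric]) fact
  finally show ?thesis .
qed

lemma gam_flip:
  assumes f [measurable]: "f \<in> borel_measurable (gam d)" and i: "i < d"
  shows "(\<integral>\<^sup>+x. f (x(i := - x i)) \<partial>gam d) = (\<integral>\<^sup>+x. (f x :: ennreal) \<partial>gam d)"
proof -
  define J where "J = {..<d} - {i}"
  have ins: "{..<d} = insert i J" using i by (auto simp: J_def)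
  have J: "finite J" "i \<notin> J" using i by (auto simp: J_def)
  have split: "(\<integral>\<^sup>+x. h x \<partial>gam d) =
    (\<integral>\<^sup>+x. \<integral>\<^sup>+t. h (x(i := t)) \<partial>std_gaussian \<partial>PiM J (\<lambda>_. std_gaussian))"
    if h: "h \<in> borel_measurable (gam d)" for h :: "(nat \<Rightarrow> real) \<Rightarrow> ennreal"
    unfolding ins by (rule sgp.product_nn_integral_insert[OF J]) (use h ins in simp)
  have [measurable]: "(\<lambda>x. x(i := - x i)) \<in> measurable (gam d) (gam d)"
  proof (rule measurable_PiM_single')
    show "(\<lambda>x. (x(i := - x i)) k) \<in> measurable (gam d) std_gaussian"
      if "k \<in> {..<d}" for k using that i by (cases "k = i") auto
    show "(\<lambda>x. x(i := - x i)) \<in> space (gam d) \<rightarrow> {..<d} \<rightarrow>\<^sub>E space std_gaussian"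
      using i by (auto simp: space_PiM PiE_def extensional_def)
  qed
  have "(\<integral>\<^sup>+x. f (x(i := - x i)) \<partial>gam d) =
    (\<integral>\<^sup>+x. \<integral>\<^sup>+t. f (x(i := - t)) \<partial>std_gaussian \<partial>PiM J (\<lambda>_. std_gaussian))"
    by (subst split) simp_all
  also have "\<dots> = (\<integral>\<^sup>+x. \<integral>\<^sup>+t. f (x(i := t)) \<partial>std_gaussian \<partial>PiM J (\<lambda>_. std_gaussian))"
  proof (rule nn_integral_cong)
    fix x assume x: "x \<in> space (PiM J (\<lambda>_. std_gaussian))"
    have m: "(\<lambda>t. x(i := t)) \<in> measurable borel (gam d)"
    proof (rule measurable_PiM_single')
      show "(\<lambda>t. (x(i := t)) k) \<in> measurable borel std_gaussian"
        if "k \<in> {..<d}" for k using that by (cases "k = i") auto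
      show "(\<lambda>t. x(i := t)) \<in> space borel \<rightarrow> {..<d} \<rightarrow>\<^sub>E space std_gaussian"
        using x ins by (auto simp: space_PiM PiE_def extensional_def)
    qed
    show "(\<integral>\<^sup>+t. f (x(i := - t)) \<partial>std_gaussian) = (\<integral>\<^sup>+t. f (x(i := t)) \<partial>std_gaussian)"
      by (rule std_gaussian_flip[where f = "\<lambda>t. f (x(i := t))"]) (rule measurable_compose[OF m f])
  qed
  also have "\<dots> = (\<integral>\<^sup>+x. f x \<partial>gam d)" by (rule split[symmetric]) fact
  finally show ?thesis .
qed

section \<open>Orthogonal matrices as products of plane rotations\<close>

lemma good_id: "good d (\<lambda>p r. if p = r then 1 else 0)"
proof -
  have "lin d (\<lambda>p r. if p = r then 1 else 0) x = x" if "x \<in> space (gam d)" for x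
    using that by (auto simp: lin_def space_PiM PiE_def extensional_def fun_eq_iff if_distrib[of "\<lambda>c. c * _"] cong: if_cong)
  then have "(\<integral>\<^sup>+x. f (lin d (\<lambda>p r. if p = r then 1 else 0) x) \<partial>gam d) = (\<integral>\<^sup>+x. f x \<partial>gam d)" for f :: "_ \<Rightarrow> ennreal"
    by (intro nn_integral_cong) simp
  then show ?thesis
    by (auto simp: good_def roworth_def if_distrib[of "\<lambda>c. c * _"] cong: if_cong)
qed

text \<open>The rotation of the plane \<open>(i, j)\<close> is applied to the argument before
  \<open>T\<close>, hence it acts on the columns of \<open>T\<close>.\<close>

definition rotcols :: "nat \<Rightarrow> nat \<Rightarrow> real \<Rightarrow> real \<Rightarrow> (nat \<Rightarrow> nat \<Rightarrow> real) \<Rightarrow> nat \<Rightarrow> nat \<Rightarrow> real" where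
  "rotcols i j a b T p = (T p)(i := a * T p i - b * T p j, j := b * T p i + a * T p j)"

definition flipcol :: "nat \<Rightarrow> (nat \<Rightarrow> nat \<Rightarrow> real) \<Rightarrow> nat \<Rightarrow> nat \<Rightarrow> real" where
  "flipcol i T p = (T p)(i := - T p i)"

lemma sum_two:
  fixes f :: "nat \<Rightarrow> real"
  assumes "i < d" "j < d" "i \<noteq> j"
  shows "(\<Sum>r<d. f r) = f i + f j + (\<Sum>r\<in>{..<d} - {i, j}. f r)"
proof -
  have "{..<d} - {i} - {j} = {..<d} - {i, j}" by auto
  then show ?thesis using assms sum.remove[of "{..<d}" i f] sum.remove[of "{..<d} - {i}" j f] by simp
qed

lemma good_rot:
  assumes T: "good d T" and ij: "i < d" "j < d" "i \<noteq> j" and ab: "a\<^sup>2 + b\<^sup>2 = 1"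
  shows "good d (rotcols i j a b T)"
proof -
  let ?S = "rotcols i j a b T"
  have lin: "lin d ?S x = lin d T (x(i := a * x i + b * x j, j := a * x j - b * x i))" for x
  proof -
    have "(\<Sum>r<d. ?S p r * x r) = (\<Sum>r<d. T p r * (x(i := a * x i + b * x j, j := a * x j - b * x i)) r)" for p
      unfolding sum_two[OF ij] using ij by (simp add: rotcols_def algebra_simps)
    then show ?thesis by (simp add: lin_def)
  qed
  have "roworth d ?S"
    unfolding roworth_def
  proof (intro allI impI)
    fix p q assume pq: "p < d" "q < d"
    have "?S p i * ?S q i + ?S p j * ?S q j = (a\<^sup>2 + b\<^sup>2) * (T p i * T q i + T p j * T q j)"
      using ij by (simp add: rotcols_def power2_eq_square algebra_simps)
    then have "(\<Sum>r<d. ?S p r * ?S q r) = (\<Sum>r<d. T p r * T q r)"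
      unfolding sum_two[OF ij] using ab by (simp add: rotcols_def)
    then show "(\<Sum>r<d. ?S p r * ?S q r) = (if p = q then 1 else 0)"
      using T pq by (simp add: good_def roworth_def)
  qed
  moreover have "(\<integral>\<^sup>+x. f (lin d ?S x) \<partial>gam d) = (\<integral>\<^sup>+x. f x \<partial>gam d)"
    if [measurable]: "f \<in> borel_measurable (gam d)" for f :: "_ \<Rightarrow> ennreal"
    unfolding lin using gam_rotate[of "\<lambda>x. f (lin d T x)" d i j a b] T that ij ab by (simp add: good_def)
  ultimately show ?thesis by (simp add: good_def)
qed

lemma good_flip:
  assumes T: "good d T" and i: "i < d"
  shows "good d (flipcol i T)"
proof -
  have e: "(\<Sum>r<d. flipcol i T p r * x r) = (\<Sum>r<d. T p r * (x(i := - x i)) r)" for p x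
    by (intro sum.cong) (auto simp: flipcol_def)
  then have lin: "lin d (flipcol i T) x = lin d T (x(i := - x i))" for x
    by (simp add: lin_def)
  have "(\<Sum>r<d. flipcol i T p r * flipcol i T q r) = (\<Sum>r<d. T p r * T q r)" for p q
    by (intro sum.cong) (auto simp: flipcol_def)
  then have "roworth d (flipcol i T)" using T by (simp add: good_def roworth_def)
  moreover have "(\<integral>\<^sup>+x. f (lin d (flipcol i T) x) \<partial>gam d) = (\<integral>\<^sup>+x. f x \<partial>gam d)"
    if [measurable]: "f \<in> borel_measurable (gam d)" for f :: "_ \<Rightarrow> ennreal"
    unfolding lin using gam_flip[of "\<lambda>x. f (lin d T x)" d i] T that i by (simp add: good_def)
  ultimately show ?thesis by (simp add: good_def)
qed

text \<open>The transpose of \<open>T\<close> applied to \<open>u\<close>: the inner products of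
  \<open>u\<close> with the columns of \<open>T\<close>.\<close>

definition vt :: "nat \<Rightarrow> (nat \<Rightarrow> nat \<Rightarrow> real) \<Rightarrow> (nat \<Rightarrow> real) \<Rightarrow> nat \<Rightarrow> real" where
  "vt d T u r = (\<Sum>p<d. u p * T p r)"

lemma vt_rot:
  "i \<noteq> j \<Longrightarrow> vt d (rotcols i j a b T) u = (vt d T u)(i := a * vt d T u i - b * vt d T u j, j := b * vt d T u i + a * vt d T u j)"
  by (auto simp: fun_eq_iff vt_def rotcols_def sum_distrib_left sum_subtractf sum.distrib algebra_simps)

lemma vt_flip: "vt d (flipcol i T) u = (vt d T u)(i := - vt d T u i)"
  by (auto simp: fun_eq_iff vt_def flipcol_def sum_negf)

lemma vt_inner:
  assumes "roworth d T"
  shows "(\<Sum>r<d. vt d T u r * vt d T w r) = (\<Sum>p<d. u p * w p)"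
proof -
  have "(\<Sum>r<d. vt d T u r * vt d T w r) = (\<Sum>r<d. \<Sum>p<d. \<Sum>q<d. u p * w q * (T p r * T q r))"
    unfolding vt_def sum_product by (intro sum.cong refl) (simp add: algebra_simps)
  also have "\<dots> = (\<Sum>p<d. \<Sum>q<d. u p * w q * (\<Sum>r<d. T p r * T q r))"
  proof -
    have "(\<Sum>r<d. \<Sum>p<d. \<Sum>q<d. u p * w q * (T p r * T q r)) = (\<Sum>p<d. \<Sum>r<d. \<Sum>q<d. u p * w q * (T p r * T q r))"
      by (rule sum.swap)
    also have "\<dots> = (\<Sum>p<d. \<Sum>q<d. \<Sum>r<d. u p * w q * (T p r * T q r))"
      by (intro sum.cong refl sum.swap)
    finally show ?thesis by (simp add: sum_distrib_left)
  qed
  also have "\<dots> = (\<Sum>p<d. \<Sum>q<d. u p * w q * (if p = q then 1 else 0))"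
    using assms by (intro sum.cong refl) (simp add: roworth_def)
  also have "\<dots> = (\<Sum>p<d. u p * w p)"
    by (simp add: if_distrib[of "\<lambda>c. _ * c"] cong: if_cong)
  finally show ?thesis .
qed

text \<open>Givens elimination: one rotation in each plane \<open>(l, j)\<close> with
  \<open>j \<in> J\<close> moves coordinate \<open>j\<close> of the transformed \<open>u\<close>
  into coordinate \<open>l\<close>. Vectors that vanish on all coordinates involved are untouched,
  which protects the directions aligned before.\<close>

lemma good_eliminate:
  assumes "finite J" "J \<subseteq> {l<..<d}" "good d T" "l < d"
  shows "\<exists>T'. good d T' \<and> (\<forall>w. (\<forall>i\<in>insert l J. vt d T w i = 0) \<longrightarrow> vt d T' w = vt d T w) \<and>
    (\<forall>j\<in>J. vt d T' u j = 0) \<and> (\<forall>j. j \<notin> insert l J \<longrightarrow> vt d T' u j = vt d T u j)"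
  using assms
proof (induction J arbitrary: rule: finite_induct)
  case empty
  then show ?case by (intro exI[of _ T]) auto
next
  case (insert j J)
  then obtain S where S: "good d S" "\<And>w. (\<forall>i\<in>insert l J. vt d T w i = 0) \<Longrightarrow> vt d S w = vt d T w"
    "\<And>i. i \<in> J \<Longrightarrow> vt d S u i = 0" "\<And>i. i \<notin> insert l J \<Longrightarrow> vt d S u i = vt d T u i" by auto
  have lj: "l < d" "j < d" "l \<noteq> j" using insert.prems by auto
  let ?y = "vt d S u"
  show ?case
  proof (cases "?y l = 0 \<and> ?y j = 0")
    case True
    have "vt d S u i = 0" if "i \<in> insert j J" for i using that True S(3) by auto
    moreover have "vt d S w = vt d T w" if "\<forall>i\<in>insert l (insert j J). vt d T w i = 0" for w using that by (intro S(2)) auto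
    moreover have "vt d S u i = vt d T u i" if "i \<notin> insert l (insert j J)" for i using that by (intro S(4)) auto
    ultimately show ?thesis using S(1) by blast
  next
    case False
    define \<rho> where "\<rho> = sqrt ((?y l)\<^sup>2 + (?y j)\<^sup>2)"
    have \<rho>: "\<rho> > 0" "\<rho>\<^sup>2 = (?y l)\<^sup>2 + (?y j)\<^sup>2"
      using False by (auto simp: \<rho>_def sum_power2_gt_zero_iff)
    define a where "a = ?y l / \<rho>"
    define b where "b = - ?y j / \<rho>"
    have ab: "a\<^sup>2 + b\<^sup>2 = 1" using \<rho> False by (simp add: a_def b_def power_divide add_divide_distrib[symmetric])
    let ?T = "rotcols l j a b S"
    have "good d ?T" by (rule good_rot[OF S(1) lj ab])
    moreover have "vt d ?T u i = 0" if "i \<in> insert j J" for i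
    proof (cases "i = j")
      case True
      then show ?thesis using lj by (simp add: vt_rot a_def b_def)
    next
      case False
      then have "i \<noteq> l" using that insert.prems by auto
      then show ?thesis using False that lj S(3) by (simp add: vt_rot)
    qed
    moreover have "vt d ?T w = vt d T w" if w: "\<forall>i\<in>insert l (insert j J). vt d T w i = 0" for w
    proof -
      have "vt d S w = vt d T w" using w by (intro S(2)) auto
      then show ?thesis using w lj by (simp add: vt_rot fun_eq_iff)
    qed
    moreover have "vt d ?T u i = vt d T u i" if "i \<notin> insert l (insert j J)" for i
      using that lj S(4)[of i] by (simp add: vt_rot)
    ultimately show ?thesis by blast
  qed
qed

definition orthn :: "nat \<Rightarrow> nat \<Rightarrow> (nat \<Rightarrow> nat \<Rightarrow> real) \<Rightarrow> bool" where
  "orthn d k v \<longleftrightarrow> (\<forall>i<k. \<forall>j<k. (\<Sum>p<d. v i p * v j p) = (if i = j then 1 else 0))"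

text \<open>QR factorisation by Givens rotations, one vector after the other. Orthogonality to the
  earlier vectors kills the first \<open>l\<close> coordinates of \<open>v l\<close>, elimination
  kills the later ones, and the remaining coordinate is 1 or -1, made positive by a
  reflection.\<close>

theorem rotation_exists:
  assumes v: "orthn d k v"
  shows "\<exists>T. good d T \<and> (\<forall>l<k. l < d \<and> (\<forall>r<d. vt d T (v l) r = (if r = l then 1 else 0)))"
  using v
proof (induction k)
  case 0
  then show ?case using good_id by auto
next
  case (Suc l)
  then have "orthn d l v" by (simp add: orthn_def)
  then obtain T where T: "good d T" "\<And>i. i < l \<Longrightarrow> i < d \<and> (\<forall>r<d. vt d T (v i) r = (if r = i then 1 else 0))"
    using Suc.IH by blast
  have inn: "(\<Sum>r<d. vt d T (v i) r * vt d T (v j) r) = (if i = j then 1 else 0)" if "i < Suc l" "j < Suc l" for i j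
    using vt_inner[of d T "v i" "v j"] T(1) Suc.prems that by (simp add: good_def orthn_def)
  have z: "vt d T (v l) i = 0" if "i < l" for i
  proof -
    have i: "i < d" using T(2)[OF that] by simp
    have "(\<Sum>r<d. vt d T (v i) r * vt d T (v l) r) = (\<Sum>r<d. (if r = i then vt d T (v l) r else 0))"
      using T(2)[OF that] by (intro sum.cong) auto
    also have "\<dots> = vt d T (v l) i" using i by simp
    finally show ?thesis using inn[of i l] that by simp
  qed
  have "l < d"
  proof (rule ccontr)
    assume "\<not> l < d"
    then have "(\<Sum>r<d. vt d T (v l) r * vt d T (v l) r) = 0" using z by (intro sum.neutral) auto
    then show False using inn[of l l] by simp
  qed
  define J where "J = {l<..<d}"
  obtain S where S: "good d S" "\<And>w. (\<forall>i\<in>insert l J. vt d T w i = 0) \<Longrightarrow> vt d S w = vt d T w"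
    "\<And>i. i \<in> J \<Longrightarrow> vt d S (v l) i = 0" "\<And>i. i \<notin> insert l J \<Longrightarrow> vt d S (v l) i = vt d T (v l) i"
    using good_eliminate[of J l d T "v l"] T(1) \<open>l < d\<close> by (auto simp: J_def)
  have Sv: "vt d S (v i) r = (if r = i then 1 else 0)" if "i < l" "r < d" for i r
    using S(2)[of "v i"] T(2)[OF that(1)] that \<open>l < d\<close> by (auto simp: J_def)
  have Sl: "vt d S (v l) r = 0" if "r \<noteq> l" "r < d" for r
    using S(3)[of r] S(4)[of r] z[of r] that by (cases "r < l") (auto simp: J_def)
  have "(\<Sum>r<d. vt d S (v l) r * vt d S (v l) r) = 1"
    using vt_inner[of d S "v l" "v l"] S(1) Suc.prems by (simp add: good_def orthn_def)
  moreover have "(\<Sum>r<d. vt d S (v l) r * vt d S (v l) r) = (\<Sum>r<d. if r = l then vt d S (v l) l * vt d S (v l) l else 0)"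
    using Sl by (intro sum.cong) auto
  ultimately have "vt d S (v l) l * vt d S (v l) l = 1" using \<open>l < d\<close> by simp
  then have pm: "vt d S (v l) l = 1 \<or> vt d S (v l) l = - 1" by (simp add: square_eq_1_iff)
  show ?case
  proof (cases "vt d S (v l) l = 1")
    case True
    have "i < d \<and> (\<forall>r<d. vt d S (v i) r = (if r = i then 1 else 0))" if "i < Suc l" for i
      using that True Sl Sv \<open>l < d\<close> T(2)[of i] by (cases "i = l") auto
    then show ?thesis using S(1) by blast
  next
    case False
    then have m: "vt d S (v l) l = - 1" using pm by simp
    have "i < d \<and> (\<forall>r<d. vt d (flipcol l S) (v i) r = (if r = i then 1 else 0))" if "i < Suc l" for i
      using that m Sl Sv \<open>l < d\<close> T(2)[of i] by (cases "i = l") (auto simp: vt_flip)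
    then show ?thesis using good_flip[OF S(1) \<open>l < d\<close>] by blast
  qed
qed

text \<open>As \<open>T\<close> has orthonormal rows, applying it to its own transpose applied to
  \<open>u\<close> returns \<open>u\<close>; here that transpose sends \<open>u\<close> to a
  coordinate vector.\<close>

lemma good_columns:
  assumes "roworth d T" "p < d" and vt: "\<And>r. r < d \<Longrightarrow> vt d T u r = (if r = l then 1 else 0)" and l: "l < d"
  shows "T p l = u p"
proof -
  have "T p l = (\<Sum>r<d. T p r * vt d T u r)"
    using vt l by (simp add: if_distrib[of "\<lambda>c. _ * c"] cong: if_cong)
  also have "\<dots> = (\<Sum>r<d. \<Sum>q<d. u q * (T p r * T q r))"
    by (simp add: vt_def sum_distrib_left algebra_simps)
  also have "\<dots> = (\<Sum>q<d. u q * (\<Sum>r<d. T p r * T q r))"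
    by (subst sum.swap) (simp add: sum_distrib_left)
  also have "\<dots> = (\<Sum>q<d. u q * (if p = q then 1 else 0))"
    using assms(1,2) by (intro sum.cong refl) (simp add: roworth_def)
  also have "\<dots> = u p" using assms(2) by (simp add: if_distrib[of "\<lambda>c. _ * c"] cong: if_cong)
  finally show ?thesis .
qed

lemma good_distr:
  assumes "good d T"
  shows "distr (gam d) (gam d) (lin d T) = gam d"
proof (rule measure_eqI)
  fix A assume "A \<in> sets (distr (gam d) (gam d) (lin d T))"
  then have A [measurable]: "A \<in> sets (gam d)" by simp
  have "emeasure (distr (gam d) (gam d) (lin d T)) A = (\<integral>\<^sup>+x. indicator A x \<partial>distr (gam d) (gam d) (lin d T))" by simp
  also have "\<dots> = (\<integral>\<^sup>+x. indicator A (lin d T x) \<partial>gam d)" by (rule nn_integral_distr) auto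
  also have "\<dots> = emeasure (gam d) A" using assms A by (simp add: good_def)
  finally show "emeasure (distr (gam d) (gam d) (lin d T)) A = emeasure (gam d) A" .
qed simp

lemma good_integral:
  fixes h :: "(nat \<Rightarrow> real) \<Rightarrow> real"
  assumes "good d T" and [measurable]: "h \<in> borel_measurable (gam d)"
  shows "(\<integral>x. h x \<partial>gam d) = (\<integral>x. h (lin d T x) \<partial>gam d)"
  using integral_distr[of "lin d T" "gam d" "gam d" h] assms by (simp add: good_distr)

subsection \<open>Expectations of test functions\<close>

lemma sg_prob_UNIV [simp]: "sg.prob UNIV = 1"
  using sg.prob_space by simp

lemma std_gaussian_distribution: "std_gaussian = std_normal_distribution"
  by (simp add: std_gaussian_def)

text \<open>The mean of \<open>relu\<close> under the standard normal law, equal to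
  \<open>1 / sqrt (2 * pi)\<close>.\<close>

definition c0 :: real where "c0 = sqrt (2 / pi) / 2"

lemma c0_bounds: "1 / 3 \<le> c0" "c0 \<le> 1 / 2" "c0 > 0"
proof -
  have "(2 / 3)\<^sup>2 \<le> 2 / pi" using pi_less_4 pi_gt_zero by (simp add: divide_simps power2_eq_square)
  then have "2 / 3 \<le> sqrt (2 / pi)" by (rule real_le_rsqrt)
  then show "1 / 3 \<le> c0" by (simp add: c0_def)
  then show "c0 > 0" by simp
  have "2 / pi \<le> 1" using pi_ge_two by simp
  then have "sqrt (2 / pi) \<le> 1" by simp
  then show "c0 \<le> 1 / 2" by (simp add: c0_def)
qed

lemma sg_moment_integrable [simp]: "integrable std_gaussian (\<lambda>t. t ^ k)"
  unfolding std_gaussian_distribution by (rule integrable_std_normal_distribution_moment)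

lemma sg_moment_abs_integrable [simp]: "integrable std_gaussian (\<lambda>t. \<bar>t\<bar> ^ k)"
proof -
  have "integrable std_gaussian (\<lambda>t. norm (t ^ k))" by (intro integrable_norm sg_moment_integrable)
  then show ?thesis by (simp add: power_abs)
qed

lemma sg_id_integrable [simp]: "integrable std_gaussian (\<lambda>t. t)" "integrable std_gaussian (\<lambda>t. \<bar>t\<bar>)"
  using sg_moment_integrable[of 1] sg_moment_abs_integrable[of 1] by simp_all

lemma sg_moments:
  "(\<integral>t. t \<partial>std_gaussian) = 0" "(\<integral>t. t\<^sup>2 \<partial>std_gaussian) = 1" "(\<integral>t. t ^ 3 \<partial>std_gaussian) = 0"
  "(\<integral>t. \<bar>t\<bar> \<partial>std_gaussian) = 2 * c0" "(\<integral>t. \<bar>t\<bar> ^ 3 \<partial>std_gaussian) = 4 * c0"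
  "(\<integral>t. t ^ 8 \<partial>std_gaussian) = 105"
  unfolding std_gaussian_distribution
  using integral_std_normal_distribution_moment_odd[of 1] integral_std_normal_distribution_moment_odd[of 3]
    std_normal_distribution_even_moments(1)[of 1] std_normal_distribution_odd_moments_abs[of 0]
    std_normal_distribution_odd_moments_abs[of 1] std_normal_distribution_even_moments(1)[of 4]
  by (simp_all add: c0_def fact_numeral)

lemma sg_distr_flip: "distr std_gaussian std_gaussian uminus = std_gaussian"
proof (rule measure_eqI)
  fix A assume "A \<in> sets (distr std_gaussian std_gaussian uminus)"
  then have A [measurable]: "A \<in> sets borel" by simp
  have "emeasure (distr std_gaussian std_gaussian uminus) A = (\<integral>\<^sup>+x. indicator A x \<partial>distr std_gaussian std_gaussian uminus)"
    using A by simp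
  also have "\<dots> = (\<integral>\<^sup>+x. indicator A (- x) \<partial>std_gaussian)" by (rule nn_integral_distr) auto
  also have "\<dots> = emeasure std_gaussian A" using std_gaussian_flip[of "indicator A"] A by simp
  finally show "emeasure (distr std_gaussian std_gaussian uminus) A = emeasure std_gaussian A" .
qed simp

lemma sg_flip_integral:
  fixes f :: "real \<Rightarrow> real"
  assumes [measurable]: "f \<in> borel_measurable borel"
  shows "(\<integral>t. f (- t) \<partial>std_gaussian) = (\<integral>t. f t \<partial>std_gaussian)"
  using integral_distr[of uminus std_gaussian std_gaussian f] by (simp add: sg_distr_flip)

definition pos :: "real \<Rightarrow> real" where "pos t = (if t > 0 then 1 else 0)"
definition neg :: "real \<Rightarrow> real" where "neg t = (if t < 0 then 1 else 0)"

lemma pos_neg_measurable [measurable]: "pos \<in> borel_measurable borel" "neg \<in> borel_measurable borel"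
  "relu \<in> borel_measurable borel"
  unfolding pos_def[abs_def] neg_def[abs_def] relu_def[abs_def] by measurable

lemma sg_bounded_integrable:
  fixes f :: "real \<Rightarrow> real"
  assumes "integrable std_gaussian g" "f \<in> borel_measurable borel" "\<And>t. \<bar>f t\<bar> \<le> \<bar>g t\<bar>"
  shows "integrable std_gaussian f"
  by (rule Bochner_Integration.integrable_bound[OF assms(1)]) (use assms(2,3) in auto)

lemma [simp]: "integrable std_gaussian pos"
  by (rule sg_bounded_integrable[of "\<lambda>t. 1"], simp, measurable, simp add: pos_def neg_def)

lemma [simp]: "integrable std_gaussian neg"
  by (rule sg_bounded_integrable[of "\<lambda>t. 1"], simp, measurable, simp add: pos_def neg_def)

lemma [simp]: "integrable std_gaussian relu"
  by (rule sg_bounded_integrable[of "\<lambda>t. t"], simp, measurable, simp add: pos_def neg_def relu_def max_def)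

lemma [simp]: "integrable std_gaussian (\<lambda>t. pos t * t)"
  by (rule sg_bounded_integrable[of "\<lambda>t. t"], simp, measurable, simp add: pos_def neg_def relu_def max_def)

lemma [simp]: "integrable std_gaussian (\<lambda>t. neg t * t)"
  by (rule sg_bounded_integrable[of "\<lambda>t. t"], simp, measurable, simp add: pos_def neg_def relu_def max_def)

lemma [simp]: "integrable std_gaussian (\<lambda>t. pos t * t\<^sup>2)"
  by (rule sg_bounded_integrable[of "\<lambda>t. t\<^sup>2"], simp, measurable, simp add: pos_def neg_def relu_def power2_eq_square abs_mult max_def)

lemma [simp]: "integrable std_gaussian (\<lambda>t. neg t * t\<^sup>2)"
  by (rule sg_bounded_integrable[of "\<lambda>t. t\<^sup>2"], simp, measurable, simp add: pos_def neg_def relu_def power2_eq_square abs_mult max_def)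

lemma [simp]: "integrable std_gaussian (\<lambda>t. relu t * t)"
  by (rule sg_bounded_integrable[of "\<lambda>t. t\<^sup>2"], simp, measurable, simp add: pos_def neg_def relu_def power2_eq_square abs_mult max_def)

lemma [simp]: "integrable std_gaussian (\<lambda>t. relu t * t\<^sup>2)"
proof (rule sg_bounded_integrable[of "\<lambda>t. t ^ 3"])
  fix t :: real
  have "\<bar>relu t\<bar> * t\<^sup>2 \<le> \<bar>t\<bar> * t\<^sup>2" by (intro mult_right_mono) (auto simp: relu_def)
  also have "\<dots> = \<bar>t ^ 3\<bar>" by (simp add: power2_eq_square power3_eq_cube abs_mult)
  finally show "\<bar>relu t * t\<^sup>2\<bar> \<le> \<bar>t ^ 3\<bar>" by (simp add: abs_mult)
qed simp_all

lemma relu_abs: "relu t = (t + \<bar>t\<bar>) / 2"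
  by (simp add: relu_def)

lemma sg_relu: "(\<integral>t. relu t \<partial>std_gaussian) = c0"
  by (simp add: relu_abs sg_moments)

text \<open>Half of the second moment: \<open>relu\<close> is the mean of the identity and the
  absolute value, and \<open>t * \<bar>t\<bar>\<close> is odd.\<close>

lemma sg_relu_t: "(\<integral>t. relu t * t \<partial>std_gaussian) = 1 / 2"
proof -
  have "(\<integral>t. t * \<bar>t\<bar> \<partial>std_gaussian) = (\<integral>t. (- t) * \<bar>- t\<bar> \<partial>std_gaussian)"
    by (rule sg_flip_integral[symmetric]) measurable
  then have z: "(\<integral>t. t * \<bar>t\<bar> \<partial>std_gaussian) = 0" by simp
  have i: "integrable std_gaussian (\<lambda>t. t * \<bar>t\<bar>)"
    by (rule sg_bounded_integrable[of "\<lambda>t. t\<^sup>2"], simp, measurable, simp add: power2_eq_square abs_mult)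
  have "(\<integral>t. relu t * t \<partial>std_gaussian) = (\<integral>t. (t\<^sup>2 + t * \<bar>t\<bar>) / 2 \<partial>std_gaussian)"
    by (intro Bochner_Integration.integral_cong) (auto simp: relu_abs power2_eq_square algebra_simps)
  also have "\<dots> = ((\<integral>t. t\<^sup>2 \<partial>std_gaussian) + (\<integral>t. t * \<bar>t\<bar> \<partial>std_gaussian)) / 2"
    using i by simp
  finally show ?thesis by (simp add: sg_moments z)
qed

lemma sg_relu_t2: "(\<integral>t. relu t * t\<^sup>2 \<partial>std_gaussian) = 2 * c0"
proof -
  have "(\<integral>t. relu t * t\<^sup>2 \<partial>std_gaussian) = (\<integral>t. (t ^ 3 + \<bar>t\<bar> ^ 3) / 2 \<partial>std_gaussian)"
    by (intro Bochner_Integration.integral_cong)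
      (auto simp: relu_abs power3_eq_cube power2_eq_square algebra_simps abs_if)
  then show ?thesis by (simp add: sg_moments)
qed

lemma sg_pos_t2: "(\<integral>t. pos t * t\<^sup>2 \<partial>std_gaussian) = 1 / 2"
  unfolding sg_relu_t[symmetric]
  by (intro Bochner_Integration.integral_cong) (auto simp: pos_def relu_def power2_eq_square)

lemma sg_neg_t2: "(\<integral>t. neg t * t\<^sup>2 \<partial>std_gaussian) = 1 / 2"
proof -
  have "(\<integral>t. neg t * t\<^sup>2 \<partial>std_gaussian) = (\<integral>t. pos (- t) * (- t)\<^sup>2 \<partial>std_gaussian)"
    by (simp add: pos_def neg_def)
  also have "\<dots> = (\<integral>t. pos t * t\<^sup>2 \<partial>std_gaussian)" by (rule sg_flip_integral) measurable
  finally show ?thesis by (simp add: sg_pos_t2)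
qed

lemma sg_pos_eq_neg: "(\<integral>t. pos t \<partial>std_gaussian) = (\<integral>t. neg t \<partial>std_gaussian)"
proof -
  have "(\<integral>t. pos (- t) \<partial>std_gaussian) = (\<integral>t. pos t \<partial>std_gaussian)" by (rule sg_flip_integral) measurable
  then show ?thesis by (simp add: pos_def neg_def)
qed

lemma sg_pos: "(\<integral>t. pos t \<partial>std_gaussian) = 1 / 2" and sg_neg: "(\<integral>t. neg t \<partial>std_gaussian) = 1 / 2"
proof -
  have "AE t in lborel. t \<noteq> (0 :: real)" by (rule AE_lborel_singleton)
  then have "AE t in std_gaussian. t \<noteq> 0" unfolding std_gaussian_def by (subst AE_density) auto
  then have "AE t in std_gaussian. pos t + neg t = 1" by (rule AE_mp) (auto simp: pos_def neg_def)
  then have "(\<integral>t. pos t + neg t \<partial>std_gaussian) = (\<integral>t. 1 \<partial>std_gaussian)"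
    by (intro integral_cong_AE) auto
  then have "(\<integral>t. pos t \<partial>std_gaussian) + (\<integral>t. neg t \<partial>std_gaussian) = 1" by simp
  then show "(\<integral>t. pos t \<partial>std_gaussian) = 1 / 2" "(\<integral>t. neg t \<partial>std_gaussian) = 1 / 2"
    using sg_pos_eq_neg by auto
qed

lemma gam_const_integrable [simp]: "integrable (gam d) (\<lambda>x. c :: real)"
  by (intro finite_measure.integrable_const prob_space.finite_measure prob_space_PiM prob_space_std_gaussian)

lemma gam_prod:
  fixes F :: "nat \<Rightarrow> real \<Rightarrow> real"
  assumes I: "I \<subseteq> {..<d}" and F: "\<And>i. i \<in> I \<Longrightarrow> integrable std_gaussian (F i)"
  shows "(\<integral>z. (\<Prod>i\<in>I. F i (z i)) \<partial>gam d) = (\<Prod>i\<in>I. (\<integral>t. F i t \<partial>std_gaussian))"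
    and "integrable (gam d) (\<lambda>z. \<Prod>i\<in>I. F i (z i))"
proof -
  define G where "G i = (if i \<in> I then F i else (\<lambda>_. 1))" for i
  have G: "integrable std_gaussian (G i)" for i using F by (simp add: G_def)
  have 1: "(\<Prod>i<d. G i (z i)) = (\<Prod>i\<in>I. F i (z i))" for z :: "nat \<Rightarrow> real"
    using I by (intro prod.mono_neutral_cong_right) (auto simp: G_def)
  have 2: "(\<Prod>i<d. (\<integral>t. G i t \<partial>std_gaussian)) = (\<Prod>i\<in>I. (\<integral>t. F i t \<partial>std_gaussian))"
    using I by (intro prod.mono_neutral_cong_right) (auto simp: G_def)
  show "(\<integral>z. (\<Prod>i\<in>I. F i (z i)) \<partial>gam d) = (\<Prod>i\<in>I. (\<integral>t. F i t \<partial>std_gaussian))"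
    using sgp.product_integral_prod[of "{..<d}" G] G unfolding 1 2 by simp
  show "integrable (gam d) (\<lambda>z. \<Prod>i\<in>I. F i (z i))"
    using sgp.product_integrable_prod[of "{..<d}" G] G unfolding 1 by simp
qed

lemma gam_E1:
  assumes "a < d" "integrable std_gaussian A"
  shows "(\<integral>z. A (z a) \<partial>gam d) = (\<integral>t. A t \<partial>std_gaussian :: real)" "integrable (gam d) (\<lambda>z. A (z a) :: real)"
  using gam_prod[of "{a}" d "\<lambda>_. A"] assms by simp_all

lemma gam_E2:
  assumes "a < d" "b < d" "a \<noteq> b" "integrable std_gaussian A" "integrable std_gaussian B"
  shows "(\<integral>z. A (z a) * B (z b) \<partial>gam d) = (\<integral>t. A t \<partial>std_gaussian) * (\<integral>t. B t \<partial>std_gaussian :: real)"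
    "integrable (gam d) (\<lambda>z. A (z a) * B (z b) :: real)"
  using gam_prod[of "{a, b}" d "(\<lambda>_. B)(a := A)"] assms by auto

lemma gam_E3:
  assumes "a < d" "b < d" "c < d" "a \<noteq> b" "b \<noteq> c" "a \<noteq> c"
    "integrable std_gaussian A" "integrable std_gaussian B" "integrable std_gaussian C"
  shows "(\<integral>z. A (z a) * B (z b) * C (z c) \<partial>gam d) =
      (\<integral>t. A t \<partial>std_gaussian) * (\<integral>t. B t \<partial>std_gaussian) * (\<integral>t. C t \<partial>std_gaussian :: real)"
    "integrable (gam d) (\<lambda>z. A (z a) * B (z b) * C (z c) :: real)"
  using gam_prod[of "{a, b, c}" d "(\<lambda>_. C)(a := A, b := B)"] assms by (auto simp: mult.assoc)

section \<open>Test expectations in coordinates adapted to the hidden weights\<close>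

lemma test1:
  assumes "j < d" "l < d" "r < d" "l \<noteq> j" "r \<noteq> j"
  shows "(\<integral>z. neg (z j) * relu (z l) * z r \<partial>gam d) = (if l = r then 1 / 4 else 0)"
proof (cases "l = r")
  case True
  have "(\<integral>z. neg (z j) * relu (z l) * z r \<partial>gam d) = (\<integral>z. neg (z j) * (relu (z l) * z l) \<partial>gam d)"
    using True by (simp add: mult.assoc)
  also have "\<dots> = 1 / 4"
    by (subst gam_E2(1)[where A = neg and B = "\<lambda>t. relu t * t"]) (use assms in \<open>auto simp: sg_neg sg_relu_t\<close>)
  finally show ?thesis using True by simp
next
  case False
  then show ?thesis
    by (subst gam_E3(1)[where C = "\<lambda>t. t"]) (use assms in \<open>auto simp: sg_moments\<close>)
qed

lemma test2:
  assumes "j < d" "l < d" "r < d" "r \<noteq> j"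
  shows "(\<integral>z. pos (z j) * relu (z l) * z r \<partial>gam d) = (if l = r then 1 / 4 else 0)"
proof -
  consider "l = r" | "l = j" "l \<noteq> r" | "l \<noteq> j" "l \<noteq> r" by blast
  then show ?thesis
  proof cases
    case 1
    then have "(\<integral>z. pos (z j) * relu (z l) * z r \<partial>gam d) = (\<integral>z. pos (z j) * (relu (z l) * z l) \<partial>gam d)"
      by (simp add: mult.assoc)
    also have "\<dots> = 1 / 4"
      by (subst gam_E2(1)[where A = pos and B = "\<lambda>t. relu t * t"]) (use assms 1 in \<open>auto simp: sg_pos sg_relu_t\<close>)
    finally show ?thesis using 1 by simp
  next
    case 2
    have "pos t * relu t = relu t" for t by (simp add: pos_def relu_def)
    then have "(\<integral>z. pos (z j) * relu (z l) * z r \<partial>gam d) = (\<integral>z. relu (z j) * z r \<partial>gam d)"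
      unfolding 2(1) by presburger
    also have "\<dots> = 0" by (subst gam_E2(1)[where A = relu and B = "\<lambda>t. t"]) (use assms in \<open>auto simp: sg_moments\<close>)
    finally show ?thesis using 2 by simp
  next
    case 3
    then show ?thesis
      by (subst gam_E3(1)[where C = "\<lambda>t. t"]) (use assms in \<open>auto simp: sg_moments\<close>)
  qed
qed

text \<open>The weight \<open>z j\<close> itself would not do as the test for unit \<open>j\<close>:
  its mean over the half space is not zero, so it would correlate with every
  \<open>relu (z l)\<close>. The second Hermite polynomial has mean zero over the half space and
  still sees \<open>relu (z j)\<close>.\<close>

lemma test3:
  assumes "j < d" "l < d"
  shows "(\<integral>z. pos (z j) * relu (z l) * ((z j)\<^sup>2 - 1) \<partial>gam d) = (if l = j then c0 else 0)"
proof (cases "l = j")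
  case True
  have "pos t * relu t * (t\<^sup>2 - 1) = relu t * t\<^sup>2 - relu t" for t by (simp add: pos_def relu_def algebra_simps)
  then show ?thesis using True
    by (simp, subst gam_E1(1)[where A = "\<lambda>t. relu t * t\<^sup>2 - relu t"]) (use assms in \<open>auto simp: sg_relu sg_relu_t2\<close>)
next
  case False
  have "(\<integral>z. pos (z j) * relu (z l) * ((z j)\<^sup>2 - 1) \<partial>gam d) = (\<integral>z. (pos (z j) * (z j)\<^sup>2 - pos (z j)) * relu (z l) \<partial>gam d)"
    by (intro Bochner_Integration.integral_cong) (auto simp: algebra_simps)
  also have "\<dots> = 0"
    by (subst gam_E2(1)[where A = "\<lambda>t. pos t * t\<^sup>2 - pos t"]) (use assms False in \<open>auto simp: sg_pos sg_pos_t2\<close>)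
  finally show ?thesis using False by simp
qed

text \<open>By the symmetry of the Gaussian under negation, a half space through the origin carries
  exactly half of all second moments.\<close>

lemma test4:
  assumes "j < d" "r < d" "s < d" and w: "w = pos \<or> w = neg"
  shows "(\<integral>z. w (z j) * z r * z s \<partial>gam d) = (if r = s then 1 / 2 else 0)"
    "integrable (gam d) (\<lambda>z. w (z j) * z r * z s)"
proof -
  have wi: "integrable std_gaussian w" "integrable std_gaussian (\<lambda>t. w t * t\<^sup>2)" "integrable std_gaussian (\<lambda>t. w t * t)"
    "(\<integral>t. w t \<partial>std_gaussian) = 1 / 2" "(\<integral>t. w t * t\<^sup>2 \<partial>std_gaussian) = 1 / 2"
    using w by (auto simp: sg_pos sg_neg sg_pos_t2 sg_neg_t2)
  consider "r = s" "r = j" | "r = s" "r \<noteq> j" | "r \<noteq> s" "r = j" | "r \<noteq> s" "s = j" | "r \<noteq> s" "r \<noteq> j" "s \<noteq> j"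
    by (cases "r = s"; cases "r = j"; cases "s = j") simp_all
  then have "(\<integral>z. w (z j) * z r * z s \<partial>gam d) = (if r = s then 1 / 2 else 0) \<and> integrable (gam d) (\<lambda>z. w (z j) * z r * z s)"
  proof cases
    case 1
    have e: "(\<lambda>z. w (z j) * z r * z s) = (\<lambda>z. w (z j) * (z j)\<^sup>2)" using 1 by (auto simp: fun_eq_iff power2_eq_square ac_simps)
    show ?thesis unfolding e using 1 gam_E1[of j d "\<lambda>t. w t * t\<^sup>2"] assms(1-3) sg_moments wi by simp
  next
      case 2
    have e: "(\<lambda>z. w (z j) * z r * z s) = (\<lambda>z. w (z j) * (z r)\<^sup>2)" using 2 by (auto simp: fun_eq_iff power2_eq_square ac_simps)
    show ?thesis unfolding e using 2 gam_E2[of j d r w "\<lambda>t. t\<^sup>2"] assms(1-3) sg_moments wi by simp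
  next
      case 3
    have e: "(\<lambda>z. w (z j) * z r * z s) = (\<lambda>z. (w (z j) * z j) * z s)" using 3 by (auto simp: fun_eq_iff power2_eq_square ac_simps)
    show ?thesis unfolding e using 3 gam_E2[of j d s "\<lambda>t. w t * t" "\<lambda>t. t"] assms(1-3) sg_moments wi by simp
  next
      case 4
    have e: "(\<lambda>z. w (z j) * z r * z s) = (\<lambda>z. (w (z j) * z j) * z r)" using 4 by (auto simp: fun_eq_iff power2_eq_square ac_simps)
    show ?thesis unfolding e using 4 gam_E2[of j d r "\<lambda>t. w t * t" "\<lambda>t. t"] assms(1-3) sg_moments wi by simp
  next
      case 5
    then show ?thesis using 5 gam_E3[of j d r s w "\<lambda>t. t" "\<lambda>t. t"] assms(1-3) sg_moments wi by simp
  qed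
  then show "(\<integral>z. w (z j) * z r * z s \<partial>gam d) = (if r = s then 1 / 2 else 0)"
    "integrable (gam d) (\<lambda>z. w (z j) * z r * z s)" by auto
qed

text \<open>The second-moment matrix weighted by \<open>relu (z l)\<close> is \<open>c0\<close>
  times the identity plus \<open>c0\<close> at the diagonal place \<open>l\<close>. This is why the
  identity is subtracted in \<open>M\<close>: what remains points in the direction
  \<open>l\<close>.\<close>

lemma test5:
  assumes "l < d" "r < d" "s < d"
  shows "(\<integral>z. relu (z l) * z r * z s \<partial>gam d) = (if r = s then c0 + (if r = l then c0 else 0) else 0)"
    "integrable (gam d) (\<lambda>z. relu (z l) * z r * z s)"
proof -
  consider "r = s" "r = l" | "r = s" "r \<noteq> l" | "r \<noteq> s" "r = l" | "r \<noteq> s" "s = l" | "r \<noteq> s" "r \<noteq> l" "s \<noteq> l"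
    by (cases "r = s"; cases "r = l"; cases "s = l") simp_all
  then have "(\<integral>z. relu (z l) * z r * z s \<partial>gam d) = (if r = s then c0 + (if r = l then c0 else 0) else 0) \<and>
    integrable (gam d) (\<lambda>z. relu (z l) * z r * z s)"
  proof cases
    case 1
    have e: "(\<lambda>z. relu (z l) * z r * z s) = (\<lambda>z. relu (z l) * (z l)\<^sup>2)" using 1 by (auto simp: fun_eq_iff power2_eq_square ac_simps)
    show ?thesis unfolding e using 1 gam_E1[of l d "\<lambda>t. relu t * t\<^sup>2"] assms(1-3) sg_moments sg_relu sg_relu_t2 by simp
  next
      case 2
    have e: "(\<lambda>z. relu (z l) * z r * z s) = (\<lambda>z. relu (z l) * (z r)\<^sup>2)" using 2 by (auto simp: fun_eq_iff power2_eq_square ac_simps)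
    show ?thesis unfolding e using 2 gam_E2[of l d r relu "\<lambda>t. t\<^sup>2"] assms(1-3) sg_moments sg_relu sg_relu_t2 by simp
  next
      case 3
    have e: "(\<lambda>z. relu (z l) * z r * z s) = (\<lambda>z. (relu (z l) * z l) * z s)" using 3 by (auto simp: fun_eq_iff power2_eq_square ac_simps)
    show ?thesis unfolding e using 3 gam_E2[of l d s "\<lambda>t. relu t * t" "\<lambda>t. t"] assms(1-3) sg_moments sg_relu sg_relu_t2 by simp
  next
      case 4
    have e: "(\<lambda>z. relu (z l) * z r * z s) = (\<lambda>z. (relu (z l) * z l) * z r)" using 4 by (auto simp: fun_eq_iff power2_eq_square ac_simps)
    show ?thesis unfolding e using 4 gam_E2[of l d r "\<lambda>t. relu t * t" "\<lambda>t. t"] assms(1-3) sg_moments sg_relu sg_relu_t2 by simp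
  next
      case 5
    then show ?thesis using 5 gam_E3[of l d r s relu "\<lambda>t. t" "\<lambda>t. t"] assms(1-3) sg_moments sg_relu sg_relu_t2 by simp
  qed
  then show "(\<integral>z. relu (z l) * z r * z s \<partial>gam d) = (if r = s then c0 + (if r = l then c0 else 0) else 0)"
    "integrable (gam d) (\<lambda>z. relu (z l) * z r * z s)" by auto
qed

definition dotp :: "nat \<Rightarrow> (nat \<Rightarrow> real) \<Rightarrow> (nat \<Rightarrow> real) \<Rightarrow> real" where
  "dotp d u x = (\<Sum>p<d. u p * x p)"

lemma dotp_measurable [measurable]: "(\<lambda>x. dotp d u x) \<in> borel_measurable (gam d)"
  unfolding dotp_def by measurable

lemma dotp_lin: "dotp d u (lin d T z) = (\<Sum>r<d. vt d T u r * z r)"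
proof -
  have "dotp d u (lin d T z) = (\<Sum>p<d. \<Sum>r<d. u p * T p r * z r)"
    by (simp add: dotp_def lin_def sum_distrib_left mult.assoc)
  also have "\<dots> = (\<Sum>r<d. \<Sum>p<d. u p * T p r * z r)" by (rule sum.swap)
  finally show ?thesis by (simp add: vt_def sum_distrib_right)
qed

locale orthonormal =
  fixes d k :: nat and v :: "nat \<Rightarrow> nat \<Rightarrow> real"
  assumes orth: "orthn d k v"
begin

lemma rotation: "\<exists>T. good d T \<and> (\<forall>l<k. l < d) \<and> (\<forall>l<k. \<forall>z. dotp d (v l) (lin d T z) = z l) \<and>
    (\<forall>l<k. \<forall>p<d. T p l = v l p)"
proof -
  obtain T where T: "good d T" "\<And>l. l < k \<Longrightarrow> l < d \<and> (\<forall>r<d. vt d T (v l) r = (if r = l then 1 else 0))"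
    using rotation_exists[OF orth] by blast
  have "dotp d (v l) (lin d T z) = z l" if "l < k" for l z
  proof -
    have "dotp d (v l) (lin d T z) = (\<Sum>r<d. (if r = l then z r else 0))"
      unfolding dotp_lin using T(2)[OF that] by (intro sum.cong) auto
    then show ?thesis using T(2)[OF that] by simp
  qed
  moreover have "T p l = v l p" if "l < k" "p < d" for l p
    using good_columns[of d T p "v l" l] T that by (simp add: good_def)
  ultimately show ?thesis using T by (intro exI[of _ T]) simp
qed

lemma kd: "l < k \<Longrightarrow> l < d"
proof -
  assume "l < k"
  obtain T where "good d T \<and> (\<forall>l<k. l < d) \<and> (\<forall>l<k. \<forall>z. dotp d (v l) (lin d T z) = z l) \<and>
    (\<forall>l<k. \<forall>p<d. T p l = v l p)" using rotation ..
  with \<open>l < k\<close> show "l < d" by simp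
qed

lemma E1:
  assumes "j < k" "l < k" "r < k" "l \<noteq> j" "r \<noteq> j"
  shows "(\<integral>x. neg (dotp d (v j) x) * relu (dotp d (v l) x) * dotp d (v r) x \<partial>gam d) = (if l = r then 1 / 4 else 0)"
proof -
  obtain T where T0: "good d T \<and> (\<forall>l<k. l < d) \<and> (\<forall>l<k. \<forall>z. dotp d (v l) (lin d T z) = z l) \<and>
    (\<forall>l<k. \<forall>p<d. T p l = v l p)" using rotation ..
  then have T: "good d T" "\<And>l z. l < k \<Longrightarrow> dotp d (v l) (lin d T z) = z l"
    "\<And>l p. l < k \<Longrightarrow> p < d \<Longrightarrow> T p l = v l p" by simp_all
  show ?thesis by (subst good_integral[OF T(1)]) (use assms T(2) kd test1[of j d l r] in auto)
qed

lemma E2: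
  assumes "j < k" "l < k" "r < k" "r \<noteq> j"
  shows "(\<integral>x. pos (dotp d (v j) x) * relu (dotp d (v l) x) * dotp d (v r) x \<partial>gam d) = (if l = r then 1 / 4 else 0)"
proof -
  obtain T where T0: "good d T \<and> (\<forall>l<k. l < d) \<and> (\<forall>l<k. \<forall>z. dotp d (v l) (lin d T z) = z l) \<and>
    (\<forall>l<k. \<forall>p<d. T p l = v l p)" using rotation ..
  then have T: "good d T" "\<And>l z. l < k \<Longrightarrow> dotp d (v l) (lin d T z) = z l"
    "\<And>l p. l < k \<Longrightarrow> p < d \<Longrightarrow> T p l = v l p" by simp_all
  show ?thesis by (subst good_integral[OF T(1)]) (use assms T(2) kd test2[of j d l r] in auto)
qed

lemma E3:
  assumes "j < k" "l < k"
  shows "(\<integral>x. pos (dotp d (v j) x) * relu (dotp d (v l) x) * ((dotp d (v j) x)\<^sup>2 - 1) \<partial>gam d) = (if l = j then c0 else 0)"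
proof -
  obtain T where T0: "good d T \<and> (\<forall>l<k. l < d) \<and> (\<forall>l<k. \<forall>z. dotp d (v l) (lin d T z) = z l) \<and>
    (\<forall>l<k. \<forall>p<d. T p l = v l p)" using rotation ..
  then have T: "good d T" "\<And>l z. l < k \<Longrightarrow> dotp d (v l) (lin d T z) = z l"
    "\<And>l p. l < k \<Longrightarrow> p < d \<Longrightarrow> T p l = v l p" by simp_all
  show ?thesis by (subst good_integral[OF T(1)]) (use assms T(2) kd test3[of j d l] in auto)
qed

text \<open>If the weighted second moments are \<open>a\<close> times the identity plus
  \<open>b\<close> at the diagonal place \<open>l\<close>, conjugation by the orthogonal
  \<open>T\<close> keeps the first part and turns the second into \<open>b\<close> times the outer
  square of column \<open>l\<close>.\<close>

lemma quad_expand: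
  assumes T: "roworth d T" and p: "p < d" and q: "q < d"
    and i: "\<And>r s. r < d \<Longrightarrow> s < d \<Longrightarrow> integrable (gam d) (\<lambda>z. f z * z r * z s)"
    and E: "\<And>r s. r < d \<Longrightarrow> s < d \<Longrightarrow> (\<integral>z. f z * z r * z s \<partial>gam d) = (if r = s then a + (if r = l then b else 0) else 0)"
    and l: "l < d"
  shows "(\<integral>z. f z * lin d T z p * lin d T z q \<partial>gam d) = (if p = q then a else 0) + b * T p l * T q l"
proof -
  have "(\<integral>z. f z * lin d T z p * lin d T z q \<partial>gam d) = (\<integral>z. (\<Sum>r<d. \<Sum>s<d. T p r * T q s * (f z * z r * z s)) \<partial>gam d)"
  proof (rule Bochner_Integration.integral_cong)
    fix z
    have "lin d T z p * lin d T z q = (\<Sum>r<d. \<Sum>s<d. (T p r * z r) * (T q s * z s))"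
      using p q by (simp add: lin_def sum_product)
    then show "f z * lin d T z p * lin d T z q = (\<Sum>r<d. \<Sum>s<d. T p r * T q s * (f z * z r * z s))"
      by (simp add: mult.assoc sum_distrib_left) (simp add: ac_simps)
  qed simp
  also have "\<dots> = (\<Sum>r<d. \<Sum>s<d. T p r * T q s * (\<integral>z. f z * z r * z s \<partial>gam d))"
  proof -
    have ii: "integrable (gam d) (\<lambda>z. T p r * T q s * (f z * z r * z s))" if "r < d" "s < d" for r s
      using i[OF that] by (rule integrable_mult_right)
    have "(\<integral>z. (\<Sum>r<d. \<Sum>s<d. T p r * T q s * (f z * z r * z s)) \<partial>gam d) =
      (\<Sum>r<d. (\<integral>z. (\<Sum>s<d. T p r * T q s * (f z * z r * z s)) \<partial>gam d))"
      by (intro Bochner_Integration.integral_sum Bochner_Integration.integrable_sum ii) auto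
    also have "\<dots> = (\<Sum>r<d. \<Sum>s<d. (\<integral>z. T p r * T q s * (f z * z r * z s) \<partial>gam d))"
      by (intro sum.cong refl Bochner_Integration.integral_sum ii) auto
    finally show ?thesis by simp
  qed
  also have "\<dots> = (\<Sum>r<d. \<Sum>s<d. (if r = s then T p r * T q s * (a + (if r = l then b else 0)) else 0))"
    using E by (intro sum.cong refl) auto
  also have "\<dots> = (\<Sum>r<d. a * (T p r * T q r) + (if r = l then b * T p r * T q r else 0))"
    by (intro sum.cong refl) (auto simp: algebra_simps)
  also have "\<dots> = a * (\<Sum>r<d. T p r * T q r) + b * T p l * T q l"
    using l by (simp add: sum.distrib sum_distrib_left)
  finally show ?thesis using T p q by (simp add: roworth_def)
qed

lemma E4:
  assumes "j < k" "p < d" "q < d" and w: "w = pos \<or> w = neg"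
  shows "(\<integral>x. w (dotp d (v j) x) * x p * x q \<partial>gam d) = (if p = q then 1 / 2 else 0)"
proof -
  obtain T where T0: "good d T \<and> (\<forall>l<k. l < d) \<and> (\<forall>l<k. \<forall>z. dotp d (v l) (lin d T z) = z l) \<and>
    (\<forall>l<k. \<forall>p<d. T p l = v l p)" using rotation ..
  then have T: "good d T" "\<And>l z. l < k \<Longrightarrow> dotp d (v l) (lin d T z) = z l"
    "\<And>l p. l < k \<Longrightarrow> p < d \<Longrightarrow> T p l = v l p" by simp_all
  have [measurable]: "w \<in> borel_measurable borel" using w by auto
  have "(\<integral>x. w (dotp d (v j) x) * x p * x q \<partial>gam d) = (\<integral>z. w (z j) * lin d T z p * lin d T z q \<partial>gam d)"
    by (subst good_integral[OF T(1)]) (use assms T(2) in auto)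
  also have "\<dots> = (if p = q then 1 / 2 else 0) + 0 * T p j * T q j"
    by (rule quad_expand) (use T(1) test4[OF kd[OF assms(1)] _ _ w] assms kd in \<open>auto simp: good_def\<close>)
  finally show ?thesis by simp
qed

lemma E5:
  assumes "l < k" "p < d" "q < d"
  shows "(\<integral>x. relu (dotp d (v l) x) * (x p * x q - (if p = q then 1 else 0)) \<partial>gam d) = c0 * v l p * v l q"
proof -
  obtain T where T0: "good d T \<and> (\<forall>l<k. l < d) \<and> (\<forall>l<k. \<forall>z. dotp d (v l) (lin d T z) = z l) \<and>
    (\<forall>l<k. \<forall>p<d. T p l = v l p)" using rotation ..
  then have T: "good d T" "\<And>l z. l < k \<Longrightarrow> dotp d (v l) (lin d T z) = z l"
    "\<And>l p. l < k \<Longrightarrow> p < d \<Longrightarrow> T p l = v l p" by simp_all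
  let ?a = "\<lambda>z. relu (z l) * lin d T z p * lin d T z q"
  let ?b = "\<lambda>z. relu (z l) * (if p = q then 1 else 0)"
  have l: "l < d" using kd assms by simp
  have q: "(\<integral>z. ?a z \<partial>gam d) = (if p = q then c0 else 0) + c0 * T p l * T q l"
    by (rule quad_expand) (use T(1) test5[OF l] assms l in \<open>auto simp: good_def\<close>)
  have ia: "integrable (gam d) ?a"
  proof -
    have "integrable (gam d) (\<lambda>z. \<Sum>r<d. \<Sum>s<d. T p r * T q s * (relu (z l) * z r * z s))"
      using test5(2)[OF l] by (intro Bochner_Integration.integrable_sum integrable_mult_right) auto
    moreover have "?a z = (\<Sum>r<d. \<Sum>s<d. T p r * T q s * (relu (z l) * z r * z s))" for z
    proof -
      have "lin d T z p * lin d T z q = (\<Sum>r<d. \<Sum>s<d. (T p r * z r) * (T q s * z s))"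
        using assms by (simp add: lin_def sum_product)
      then show ?thesis by (simp add: mult.assoc sum_distrib_left) (simp add: ac_simps)
    qed
    ultimately show ?thesis by simp
  qed
  have ib: "integrable (gam d) ?b" "(\<integral>z. ?b z \<partial>gam d) = (if p = q then c0 else 0)"
    using gam_E1[of l d relu] l sg_relu by auto
  have "(\<integral>x. relu (dotp d (v l) x) * (x p * x q - (if p = q then 1 else 0)) \<partial>gam d) = (\<integral>z. ?a z - ?b z \<partial>gam d)"
    by (subst good_integral[OF T(1)])
      (use assms T(2) in \<open>auto intro!: Bochner_Integration.integral_cong simp: algebra_simps\<close>)
  also have "\<dots> = c0 * T p l * T q l" using ia ib q by simp
  finally show ?thesis using T(3) assms by simp
qed

end

subsection \<open>Growth\<close>

text \<open>A common majorant of all averaged functions: up to a gate, each is a product of two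
  factors bounded by one plus the squared norm. Its square has degree eight, hence the constant 105,
  the eighth moment of a standard normal variable.\<close>

definition grow :: "nat \<Rightarrow> (nat \<Rightarrow> real) \<Rightarrow> real" where
  "grow d x = (1 + (\<Sum>p<d. (x p)\<^sup>2))\<^sup>2"

lemma sum_sq_le:
  fixes a :: "nat \<Rightarrow> real"
  shows "(1 + (\<Sum>p<d. a p))\<^sup>2 \<le> (real d + 1) * (1 + (\<Sum>p<d. (a p)\<^sup>2))"
proof -
  let ?b = "\<lambda>p. if p < d then a p else 1"
  have "(\<Sum>p\<in>{..d}. 1 * ?b p)\<^sup>2 \<le> (\<Sum>p\<in>{..d}. 1\<^sup>2) * (\<Sum>p\<in>{..d}. (?b p)\<^sup>2)" by (rule Cauchy_Schwarz_ineq_sum)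
  moreover have "{..d} = insert d {..<d}" by auto
  ultimately show ?thesis by (simp add: add.commute)
qed

lemma grow_sq_le: "(grow d x)\<^sup>2 \<le> (real d + 1) ^ 3 * (1 + (\<Sum>p<d. x p ^ 8))"
proof -
  have "grow d x \<le> (real d + 1) * (1 + (\<Sum>p<d. ((x p)\<^sup>2)\<^sup>2))" unfolding grow_def by (rule sum_sq_le)
  moreover have "0 \<le> grow d x" by (simp add: grow_def)
  ultimately have "(grow d x)\<^sup>2 \<le> ((real d + 1) * (1 + (\<Sum>p<d. ((x p)\<^sup>2)\<^sup>2)))\<^sup>2" by (intro power_mono)
  also have "\<dots> = (real d + 1)\<^sup>2 * (1 + (\<Sum>p<d. ((x p)\<^sup>2)\<^sup>2))\<^sup>2" by (simp add: power_mult_distrib)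
  also have "\<dots> \<le> (real d + 1)\<^sup>2 * ((real d + 1) * (1 + (\<Sum>p<d. (((x p)\<^sup>2)\<^sup>2)\<^sup>2)))"
    by (intro mult_left_mono sum_sq_le) auto
  also have "\<dots> = (real d + 1) ^ 3 * (1 + (\<Sum>p<d. x p ^ 8))"
  proof -
    have "((y\<^sup>2)\<^sup>2)\<^sup>2 = y ^ 8" for y :: real by (simp add: power_mult[symmetric])
    moreover have "(real d + 1)\<^sup>2 * ((real d + 1) * S) = (real d + 1) ^ 3 * S" for S
      by (simp add: power3_eq_cube power2_eq_square)
    ultimately show ?thesis by simp
  qed
  finally show ?thesis .
qed

lemma grow_measurable [measurable]: "grow d \<in> borel_measurable (gam d)"
  unfolding grow_def[abs_def] by measurable

lemma grow_ge_1: "1 \<le> grow d x"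
  unfolding grow_def by (intro one_le_power) (simp add: sum_nonneg)

lemma grow_sq_integral:
  "integrable (gam d) (\<lambda>x. (grow d x)\<^sup>2)" "(\<integral>x. (grow d x)\<^sup>2 \<partial>gam d) \<le> 105 * (real d + 1) ^ 4"
proof -
  have pr: "measure (gam d) (space (gam d)) = 1"
    by (rule prob_space.prob_space) (intro prob_space_PiM prob_space_std_gaussian)
  let ?R = "\<lambda>x. (real d + 1) ^ 3 * (1 + (\<Sum>p<d. x p ^ 8))"
  have i: "integrable (gam d) ?R"
    by (intro integrable_mult_right Bochner_Integration.integrable_add Bochner_Integration.integrable_sum)
      (auto intro!: gam_E1(2)[where A = "\<lambda>t. t ^ 8"])
  show gi: "integrable (gam d) (\<lambda>x. (grow d x)\<^sup>2)"
  proof (rule Bochner_Integration.integrable_bound[OF i])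
    show "AE x in gam d. norm ((grow d x)\<^sup>2) \<le> norm (?R x)"
      using grow_sq_le by (auto intro!: AE_I2 order_trans[OF grow_sq_le] simp: abs_mult)
  qed measurable
  have "(\<integral>x. (grow d x)\<^sup>2 \<partial>gam d) \<le> (\<integral>x. ?R x \<partial>gam d)"
    by (rule integral_mono[OF gi i]) (rule grow_sq_le)
  also have "(\<integral>x. ?R x \<partial>gam d) = (real d + 1) ^ 3 * (1 + (\<Sum>p<d. (\<integral>x. x p ^ 8 \<partial>gam d)))"
  proof -
    have "(\<integral>x. 1 + (\<Sum>p<d. x p ^ 8) \<partial>gam d) = 1 + (\<integral>x. (\<Sum>p<d. x p ^ 8) \<partial>gam d)"
      by (subst Bochner_Integration.integral_add)
        (auto simp: pr intro!: Bochner_Integration.integrable_sum gam_E1(2)[where A = "\<lambda>t. t ^ 8"])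
    also have "(\<integral>x. (\<Sum>p<d. x p ^ 8) \<partial>gam d) = (\<Sum>p<d. (\<integral>x. x p ^ 8 \<partial>gam d))"
      by (rule Bochner_Integration.integral_sum) (auto intro!: gam_E1(2)[where A = "\<lambda>t. t ^ 8"])
    finally show ?thesis by simp
  qed
  also have "\<dots> = (real d + 1) ^ 3 * (1 + 105 * real d)"
    using gam_E1(1)[where A = "\<lambda>t. t ^ 8"] by (simp add: sg_moments)
  also have "\<dots> \<le> (real d + 1) ^ 3 * (105 * (real d + 1))" by (intro mult_left_mono) auto
  also have "\<dots> = 105 * (real d + 1) ^ 4" using power_add[of "real d + 1" 3 1] by simp
  finally show "(\<integral>x. (grow d x)\<^sup>2 \<partial>gam d) \<le> 105 * (real d + 1) ^ 4" .
qed

subsection \<open>Concentration and small-ball estimates\<close>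

abbreviation SG :: "nat \<Rightarrow> nat \<Rightarrow> (nat \<times> nat \<Rightarrow> real) measure" where
  "SG d n \<equiv> \<Pi>\<^sub>M _\<in>{..<d} \<times> {..<n}. std_gaussian"

definition col :: "nat \<Rightarrow> nat \<Rightarrow> (nat \<times> nat \<Rightarrow> real) \<Rightarrow> nat \<Rightarrow> real" where
  "col d i \<xi> = (\<lambda>p\<in>{..<d}. \<xi> (p, i))"

lemma col_measurable [measurable]: "i < n \<Longrightarrow> col d i \<in> measurable (SG d n) (gam d)"
  unfolding col_def[abs_def] by measurable

lemma prob_space_SG: "prob_space (PiM I (\<lambda>_. std_gaussian))"
  by (intro prob_space_PiM prob_space_std_gaussian)

lemma distr_col: "i < n \<Longrightarrow> distr (SG d n) (gam d) (col d i) = gam d"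
  unfolding col_def[abs_def]
  using distr_PiM_reindex[of "{..<d} \<times> {..<n}" "\<lambda>_. std_gaussian" "\<lambda>p. (p, i)" "{..<d}"]
  by (auto simp: inj_on_def prob_space_std_gaussian)

lemma indep_coordinates:
  assumes "I \<noteq> {}"
  shows "prob_space.indep_vars (PiM I (\<lambda>_. std_gaussian)) (\<lambda>_. std_gaussian) (\<lambda>i \<xi>. \<xi> i) I"
proof -
  interpret P: prob_space "PiM I (\<lambda>_. std_gaussian)" by (rule prob_space_SG)
  have "distr (PiM I (\<lambda>_. std_gaussian)) (PiM I (\<lambda>_. std_gaussian)) (\<lambda>x. \<lambda>i\<in>I. x i) =
    distr (PiM I (\<lambda>_. std_gaussian)) (PiM I (\<lambda>_. std_gaussian)) (\<lambda>x. x)"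
    by (rule distr_cong) (auto simp: space_PiM)
  moreover have "(\<Pi>\<^sub>M i\<in>I. distr (PiM I (\<lambda>_. std_gaussian)) std_gaussian (\<lambda>\<xi>. \<xi> i)) = PiM I (\<lambda>_. std_gaussian)"
    by (rule PiM_cong) (auto intro!: distr_PiM_component prob_space_std_gaussian)
  ultimately show ?thesis
    by (subst P.indep_vars_iff_distr_eq_PiM') (auto simp: assms)
qed

lemma indep_cols:
  assumes "d > 0" "n > 0"
  shows "prob_space.indep_vars (SG d n) (\<lambda>_. gam d) (\<lambda>i \<xi>. col d i \<xi>) {..<n}"
proof -
  interpret P: prob_space "SG d n" by (rule prob_space_SG)
  have ne: "{..<d} \<times> {..<n} \<noteq> {}" using assms by (auto simp: lessThan_empty_iff)
  have "P.indep_vars (\<lambda>i. PiM ({..<d} \<times> {i}) (\<lambda>_. std_gaussian)) (\<lambda>i \<xi>. restrict (\<lambda>j. \<xi> j) ({..<d} \<times> {i})) {..<n}"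
    by (rule P.indep_vars_restrict[OF indep_coordinates[OF ne]]) (auto simp: disjoint_family_on_def)
  then have "P.indep_vars (\<lambda>_. gam d)
     (\<lambda>i \<xi>. (\<lambda>\<eta>. \<lambda>p\<in>{..<d}. \<eta> (p, i)) (restrict (\<lambda>j. \<xi> j) ({..<d} \<times> {i}))) {..<n}"
    by (rule P.indep_vars_compose2) measurable
  moreover have "(\<lambda>\<eta>. \<lambda>p\<in>{..<d}. \<eta> (p, i)) (restrict (\<lambda>j. \<xi> j) ({..<d} \<times> {i})) = col d i \<xi>" for i \<xi>
    by (auto simp: col_def)
  ultimately show ?thesis by simp
qed

lemma concentration:
  assumes d: "d > 0" and N: "N > 0" "N \<le> n" and h [measurable]: "h \<in> borel_measurable (gam d)"
    and hg: "\<And>x. \<bar>h x\<bar> \<le> grow d x" and \<epsilon>: "\<epsilon> > 0"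
  shows "measure (SG d n) {\<xi> \<in> space (SG d n). \<epsilon> \<le> \<bar>(\<Sum>i<N. h (col d i \<xi>)) / N - (\<integral>x. h x \<partial>gam d)\<bar>}
    \<le> 105 * (real d + 1) ^ 4 / (N * \<epsilon>\<^sup>2)"
proof -
  interpret P: prob_space "SG d n" by (rule prob_space_SG)
  interpret g: prob_space "gam d" by (rule prob_space_SG)
  define \<mu> where "\<mu> = (\<integral>x. h x \<partial>gam d)"
  define B where "B = 105 * (real d + 1) ^ 4"
  define Y where "Y i \<xi> = h (col d i \<xi>) - \<mu>" for i \<xi>
  have hsq: "(h x)\<^sup>2 \<le> (grow d x)\<^sup>2" for x
    using hg[of x] grow_ge_1[of d x] abs_le_square_iff[of "h x" "grow d x"] by simp
  have h2: "integrable (gam d) (\<lambda>x. (h x)\<^sup>2)"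
  proof (rule Bochner_Integration.integrable_bound[OF grow_sq_integral(1)[of d]])
    show "AE x in gam d. norm ((h x)\<^sup>2) \<le> norm ((grow d x)\<^sup>2)" using hsq by (intro AE_I2) simp
  qed measurable
  have h1: "integrable (gam d) h"
    by (rule g.square_integrable_imp_integrable[OF h h2])
  have "(\<integral>x. (h x)\<^sup>2 \<partial>gam d) \<le> (\<integral>x. (grow d x)\<^sup>2 \<partial>gam d)"
    by (rule integral_mono[OF h2 grow_sq_integral(1)]) (rule hsq)
  then have hB: "(\<integral>x. (h x)\<^sup>2 \<partial>gam d) \<le> B" using grow_sq_integral(2)[of d] by (simp add: B_def)
  have hm: "(\<lambda>x. h x - \<mu>) \<in> borel_measurable (gam d)" by measurable
  have Ym [measurable]: "i < n \<Longrightarrow> Y i \<in> borel_measurable (SG d n)" for i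
    unfolding Y_def[abs_def] by measurable
  have tr: "(\<integral>\<xi>. f (col d i \<xi>) \<partial>SG d n) = (\<integral>x. f x \<partial>gam d)" "integrable (gam d) f \<Longrightarrow> integrable (SG d n) (\<lambda>\<xi>. f (col d i \<xi>))"
    if "i < n" "f \<in> borel_measurable (gam d)" for i and f :: "_ \<Rightarrow> real"
    using integral_distr[OF col_measurable[OF that(1)] that(2)] integrable_distr_eq[OF col_measurable[OF that(1)] that(2)]
      distr_col[OF that(1)] by simp_all
  have Y1: "integrable (SG d n) (Y i)" "(\<integral>\<xi>. Y i \<xi> \<partial>SG d n) = 0" if "i < n" for i
    using tr[OF that hm] h1 unfolding Y_def by (simp_all add: \<mu>_def g.prob_space)
  have sq: "(h x - \<mu>)\<^sup>2 = (h x)\<^sup>2 - 2 * \<mu> * h x + \<mu>\<^sup>2" for x by (simp add: power2_eq_square algebra_simps)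
  have Y2: "integrable (SG d n) (\<lambda>\<xi>. (Y i \<xi>)\<^sup>2)" "(\<integral>\<xi>. (Y i \<xi>)\<^sup>2 \<partial>SG d n) \<le> B" if "i < n" for i
  proof -
    have m: "(\<lambda>x. (h x - \<mu>)\<^sup>2) \<in> borel_measurable (gam d)" by measurable
    have i: "integrable (gam d) (\<lambda>x. (h x - \<mu>)\<^sup>2)" unfolding sq using h1 h2 by simp
    show "integrable (SG d n) (\<lambda>\<xi>. (Y i \<xi>)\<^sup>2)" using tr(2)[OF that m i] by (simp add: Y_def)
    have "(\<integral>x. (h x - \<mu>)\<^sup>2 \<partial>gam d) = (\<integral>x. (h x)\<^sup>2 \<partial>gam d) - \<mu>\<^sup>2"
      unfolding sq using h1 h2 by (simp add: g.prob_space \<mu>_def[symmetric] power2_eq_square)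
    then show "(\<integral>\<xi>. (Y i \<xi>)\<^sup>2 \<partial>SG d n) \<le> B" using tr(1)[OF that m] hB
      by (simp add: Y_def order_trans[OF _ hB])
  qed
  have indep: "P.indep_vars (\<lambda>_. borel) Y {..<n}"
    unfolding Y_def[abs_def] using N d
    by (intro P.indep_vars_compose2[OF indep_cols, where Y = "\<lambda>_ x. h x - \<mu>"]) auto
  have YY: "integrable (SG d n) (\<lambda>\<xi>. Y i \<xi> * Y j \<xi>)" "(\<integral>\<xi>. Y i \<xi> * Y j \<xi> \<partial>SG d n) \<le> (if i = j then B else 0)"
    if "i < n" "j < n" for i j
  proof -
    have "integrable (SG d n) (\<lambda>\<xi>. Y i \<xi> * Y j \<xi>) \<and> (\<integral>\<xi>. Y i \<xi> * Y j \<xi> \<partial>SG d n) \<le> (if i = j then B else 0)"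
    proof (cases "i = j")
      case True
      then show ?thesis using Y2[OF that(1)] by (simp add: power2_eq_square)
    next
      case False
      have "P.indep_vars (\<lambda>_. borel) Y {i, j}" by (rule P.indep_vars_subset[OF indep]) (use that in auto)
      have Yi: "integrable (SG d n) (Y l)" "(\<integral>\<xi>. Y l \<xi> \<partial>SG d n) = 0" if "l \<in> {i, j}" for l
        using that \<open>i < n\<close> \<open>j < n\<close> Y1[of i] Y1[of j] by auto
      have "(\<integral>\<xi>. (\<Prod>l\<in>{i, j}. Y l \<xi>) \<partial>SG d n) = (\<Prod>l\<in>{i, j}. (\<integral>\<xi>. Y l \<xi> \<partial>SG d n))"
        by (rule P.indep_vars_lebesgue_integral) (simp, fact, rule Yi(1))
      moreover have "integrable (SG d n) (\<lambda>\<xi>. \<Prod>l\<in>{i, j}. Y l \<xi>)"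
        by (rule P.indep_vars_integrable) (simp, fact, rule Yi(1))
      ultimately show ?thesis using False Yi(2)[of i] by simp
    qed
    then show "integrable (SG d n) (\<lambda>\<xi>. Y i \<xi> * Y j \<xi>)" "(\<integral>\<xi>. Y i \<xi> * Y j \<xi> \<partial>SG d n) \<le> (if i = j then B else 0)" by auto
  qed
  define S where "S \<xi> = (\<Sum>i<N. Y i \<xi>)" for \<xi>
  have Ssq: "(S \<xi>)\<^sup>2 = (\<Sum>i<N. \<Sum>j<N. Y i \<xi> * Y j \<xi>)" for \<xi>
    by (simp add: S_def power2_eq_square sum_product)
  have Si: "integrable (SG d n) (\<lambda>\<xi>. (S \<xi>)\<^sup>2)"
    unfolding Ssq using N by (intro Bochner_Integration.integrable_sum YY(1)) auto
  have "(\<integral>\<xi>. (S \<xi>)\<^sup>2 \<partial>SG d n) = (\<Sum>i<N. (\<integral>\<xi>. (\<Sum>j<N. Y i \<xi> * Y j \<xi>) \<partial>SG d n))"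
    unfolding Ssq using N by (intro Bochner_Integration.integral_sum Bochner_Integration.integrable_sum YY(1)) auto
  also have "\<dots> = (\<Sum>i<N. \<Sum>j<N. (\<integral>\<xi>. Y i \<xi> * Y j \<xi> \<partial>SG d n))"
    using N by (intro sum.cong refl Bochner_Integration.integral_sum YY(1)) auto
  also have "\<dots> \<le> (\<Sum>i<N. \<Sum>j<N. if i = j then B else 0)"
    using N by (intro sum_mono YY(2)) auto
  also have "\<dots> = N * B" by simp
  finally have SB: "(\<integral>\<xi>. (S \<xi>)\<^sup>2 \<partial>SG d n) \<le> N * B" .
  have eq: "(\<Sum>i<N. h (col d i \<xi>)) / N - \<mu> = S \<xi> / N" for \<xi>
    using N by (simp add: S_def Y_def sum_subtractf field_simps)
  have "{\<xi> \<in> space (SG d n). \<epsilon> \<le> \<bar>(\<Sum>i<N. h (col d i \<xi>)) / N - \<mu>\<bar>} =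
      {\<xi> \<in> space (SG d n). (N * \<epsilon>)\<^sup>2 \<le> (S \<xi>)\<^sup>2}"
  proof -
    have "\<epsilon> \<le> \<bar>S \<xi> / N\<bar> \<longleftrightarrow> (N * \<epsilon>)\<^sup>2 \<le> (S \<xi>)\<^sup>2" for \<xi>
      using abs_le_square_iff[of "N * \<epsilon>" "S \<xi>"] N \<epsilon> by (simp add: field_simps abs_mult)
    then show ?thesis unfolding eq by simp
  qed
  also have "measure (SG d n) \<dots> \<le> (\<integral>\<xi>. (S \<xi>)\<^sup>2 \<partial>SG d n) / (N * \<epsilon>)\<^sup>2"
    by (rule integral_Markov_inequality_measure[OF Si sets.top]) (use N \<epsilon> in auto)
  also have "\<dots> \<le> (N * B) / (N * \<epsilon>)\<^sup>2" using SB by (rule divide_right_mono) simp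
  also have "\<dots> = B / (N * \<epsilon>\<^sup>2)" using N by (simp add: power2_eq_square)
  finally show ?thesis by (simp add: \<mu>_def B_def)
qed

text \<open>The normal density is at most \<open>1 / 2\<close>, and the interval has length
  \<open>2 * \<delta> / \<bar>c\<bar>\<close>.\<close>

lemma std_gaussian_small_interval:
  assumes c: "c \<noteq> 0" and \<delta>: "\<delta> \<ge> 0"
  shows "emeasure std_gaussian {t. \<bar>c * t + R\<bar> \<le> \<delta>} \<le> ennreal (\<delta> / \<bar>c\<bar>)"
proof -
  define a where "a = - R / c"
  define r where "r = \<delta> / \<bar>c\<bar>"
  have r: "r \<ge> 0" using \<delta> by (simp add: r_def)
  have abs_eq: "\<bar>c * t + R\<bar> = \<bar>c\<bar> * \<bar>t - a\<bar>" for t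
    using c by (simp add: a_def abs_mult[symmetric] algebra_simps)
  have eq: "{t. \<bar>c * t + R\<bar> \<le> \<delta>} = {a - r .. a + r}"
  proof -
    have "\<bar>c * t + R\<bar> \<le> \<delta> \<longleftrightarrow> \<bar>t - a\<bar> \<le> r" for t
      unfolding abs_eq r_def using c pos_le_divide_eq[of "\<bar>c\<bar>" "\<bar>t - a\<bar>" \<delta>] by (simp only: mult.commute)
    then have "{t. \<bar>c * t + R\<bar> \<le> \<delta>} = {t. \<bar>t - a\<bar> \<le> r}" by (intro Collect_cong)
    also have "\<dots> = {a - r .. a + r}" unfolding set_eq_iff mem_Collect_eq atLeastAtMost_iff abs_le_iff by (intro allI) linarith
    finally show ?thesis .
  qed
  have dens: "std_normal_density t \<le> 1 / 2" for t
  proof -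
    have "2 \<le> sqrt (2 * pi)" using pi_ge_two by (intro real_le_rsqrt) simp
    then have "1 / sqrt (2 * pi) \<le> 1 / 2" by (simp add: frac_le)
    moreover have "exp (- t\<^sup>2 / 2) \<le> 1" by simp
    ultimately have "(1 / sqrt (2 * pi)) * exp (- t\<^sup>2 / 2) \<le> (1 / 2) * 1"
      by (intro mult_mono) auto
    then show ?thesis by (simp add: std_normal_density_def)
  qed
  have "emeasure std_gaussian {a - r .. a + r} = (\<integral>\<^sup>+t. ennreal (std_normal_density t) * indicator {a - r .. a + r} t \<partial>lborel)"
    unfolding std_gaussian_def by (subst emeasure_density) auto
  also have "\<dots> \<le> (\<integral>\<^sup>+t. ennreal (1 / 2) * indicator {a - r .. a + r} t \<partial>lborel)"
    using dens by (intro nn_integral_mono mult_right_mono ennreal_leI) auto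
  also have "\<dots> = ennreal (1 / 2) * emeasure lborel {a - r .. a + r}"
    by (rule nn_integral_cmult_indicator) simp
  also have "emeasure lborel {a - r .. a + r} = ennreal (2 * r)" using r by simp
  also have "ennreal (1 / 2) * ennreal (2 * r) = ennreal r" using ennreal_mult[of "1 / 2" "2 * r"] r by simp
  finally show ?thesis unfolding eq by (simp add: r_def)
qed

text \<open>Integrate coordinate \<open>i0\<close> first: with all others fixed the form is affine
  in it with slope \<open>c i0\<close>, so one large coefficient controls the probability whatever
  the rest of the form is.\<close>

lemma small_ball:
  assumes I: "finite I" "i0 \<in> I" and c: "c i0 \<noteq> 0" and \<delta>: "\<delta> \<ge> 0"
  shows "measure (PiM I (\<lambda>_. std_gaussian)) {\<xi> \<in> space (PiM I (\<lambda>_. std_gaussian)). \<bar>\<Sum>i\<in>I. c i * \<xi> i\<bar> \<le> \<delta>} \<le> \<delta> / \<bar>c i0\<bar>"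
proof -
  interpret P: prob_space "PiM I (\<lambda>_. std_gaussian)" by (rule prob_space_SG)
  define J where "J = I - {i0}"
  have J: "finite J" "i0 \<notin> J" and ins: "I = insert i0 J" using I by (auto simp: J_def)
  interpret Q: prob_space "PiM J (\<lambda>_. std_gaussian)" by (rule prob_space_SG)
  let ?A = "{\<xi> \<in> space (PiM I (\<lambda>_. std_gaussian)). \<bar>\<Sum>i\<in>I. c i * \<xi> i\<bar> \<le> \<delta>}"
  have A [measurable]: "?A \<in> sets (PiM I (\<lambda>_. std_gaussian))" by measurable
  have "emeasure (PiM I (\<lambda>_. std_gaussian)) ?A = (\<integral>\<^sup>+\<xi>. indicator ?A \<xi> \<partial>PiM I (\<lambda>_. std_gaussian))" by simp
  also have "\<dots> = (\<integral>\<^sup>+x. \<integral>\<^sup>+t. indicator ?A (x(i0 := t)) \<partial>std_gaussian \<partial>PiM J (\<lambda>_. std_gaussian))"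
    using A unfolding ins by (intro sgp.product_nn_integral_insert J borel_measurable_indicator)
  also have "\<dots> \<le> (\<integral>\<^sup>+x. ennreal (\<delta> / \<bar>c i0\<bar>) \<partial>PiM J (\<lambda>_. std_gaussian))"
  proof (rule nn_integral_mono)
    fix x assume x: "x \<in> space (PiM J (\<lambda>_. std_gaussian))"
    define R where "R = (\<Sum>i\<in>J. c i * x i)"
    have "(\<Sum>i\<in>I. c i * (x(i0 := t)) i) = c i0 * t + R" for t
    proof -
      have "(\<Sum>i\<in>J. c i * (x(i0 := t)) i) = R" unfolding R_def using J by (intro sum.cong) auto
      then show ?thesis unfolding ins using J by simp
    qed
    then have "(\<integral>\<^sup>+t. indicator ?A (x(i0 := t)) \<partial>std_gaussian) \<le> (\<integral>\<^sup>+t. indicator {t. \<bar>c i0 * t + R\<bar> \<le> \<delta>} t \<partial>std_gaussian)"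
      by (intro nn_integral_mono) (auto simp: indicator_def)
    also have "\<dots> = emeasure std_gaussian {t. \<bar>c i0 * t + R\<bar> \<le> \<delta>}"
      by (rule nn_integral_indicator) simp
    also have "\<dots> \<le> ennreal (\<delta> / \<bar>c i0\<bar>)" by (rule std_gaussian_small_interval[OF c \<delta>])
    finally show "(\<integral>\<^sup>+t. indicator ?A (x(i0 := t)) \<partial>std_gaussian) \<le> ennreal (\<delta> / \<bar>c i0\<bar>)" .
  qed
  also have "\<dots> = ennreal (\<delta> / \<bar>c i0\<bar>)" by (simp add: Q.emeasure_space_1)
  finally show ?thesis using \<delta> by (simp add: P.emeasure_eq_measure)
qed

lemma gaussian_tail:
  assumes "i \<in> I" "R > 0"
  shows "measure (PiM I (\<lambda>_. std_gaussian)) {\<xi> \<in> space (PiM I (\<lambda>_. std_gaussian)). R \<le> \<bar>\<xi> i\<bar>} \<le> 1 / R\<^sup>2"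
proof -
  have d: "distr (PiM I (\<lambda>_. std_gaussian)) std_gaussian (\<lambda>\<xi>. \<xi> i) = std_gaussian"
    using assms by (intro distr_PiM_component prob_space_std_gaussian)
  have m: "(\<lambda>\<xi>. \<xi> i) \<in> measurable (PiM I (\<lambda>_. std_gaussian)) std_gaussian" using assms by measurable
  have i: "integrable (PiM I (\<lambda>_. std_gaussian)) (\<lambda>\<xi>. (\<xi> i)\<^sup>2)" "(\<integral>\<xi>. (\<xi> i)\<^sup>2 \<partial>PiM I (\<lambda>_. std_gaussian)) = 1"
    using integrable_distr_eq[OF m, of "\<lambda>t. t\<^sup>2"] integral_distr[OF m, of "\<lambda>t. t\<^sup>2"] d sg_moments(2) by simp_all
  have "{\<xi> \<in> space (PiM I (\<lambda>_. std_gaussian)). R \<le> \<bar>\<xi> i\<bar>} = {\<xi> \<in> space (PiM I (\<lambda>_. std_gaussian)). R\<^sup>2 \<le> (\<xi> i)\<^sup>2}"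
    using abs_le_square_iff[of R] assms by auto
  also have "measure (PiM I (\<lambda>_. std_gaussian)) \<dots> \<le> (\<integral>\<xi>. (\<xi> i)\<^sup>2 \<partial>PiM I (\<lambda>_. std_gaussian)) / R\<^sup>2"
    by (rule integral_Markov_inequality_measure[OF i(1) sets.top]) (use assms in auto)
  finally show ?thesis using i by simp
qed

section \<open>Linear algebra\<close>

lemma dotp_commute: "dotp d x y = dotp d y x"
  by (simp add: dotp_def mult.commute)

lemma dotp_cong: "(\<And>i. i < d \<Longrightarrow> x i = x' i) \<Longrightarrow> (\<And>i. i < d \<Longrightarrow> y i = y' i) \<Longrightarrow> dotp d x y = dotp d x' y'"
  by (simp add: dotp_def)

lemma dotp_add: "dotp d x (\<lambda>i. y i + z i) = dotp d x y + dotp d x z"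
  by (simp add: dotp_def distrib_left sum.distrib)

lemma dotp_diff: "dotp d x (\<lambda>i. y i - z i) = dotp d x y - dotp d x z"
  by (simp add: dotp_def right_diff_distrib sum_subtractf)

lemma dotp_scale: "dotp d x (\<lambda>i. c * y i) = c * dotp d x y"
  by (simp add: dotp_def sum_distrib_left algebra_simps)

lemma dotp_sum: "dotp d x (\<lambda>i. \<Sum>l\<in>S. f l i) = (\<Sum>l\<in>S. dotp d x (f l))"
  unfolding dotp_def sum_distrib_left by (rule sum.swap)

lemma dotp_self_nonneg: "0 \<le> dotp d x x"
  by (simp add: dotp_def sum_nonneg)

lemma dotp_self_zero: "dotp d x x = 0 \<Longrightarrow> i < d \<Longrightarrow> x i = 0"
  by (simp add: dotp_def sum_nonneg_eq_0_iff)

lemma dotp_self_pos: "i < d \<Longrightarrow> x i \<noteq> 0 \<Longrightarrow> 0 < dotp d x x"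
  using dotp_self_nonneg[of d x] dotp_self_zero[of d x i] by linarith

lemma dotp_CS: "(dotp d x y)\<^sup>2 \<le> dotp d x x * dotp d y y"
  using Cauchy_Schwarz_ineq_sum[of x y "{..<d}"] by (simp add: dotp_def power2_eq_square)

lemma dotp_unit: "i < d \<Longrightarrow> dotp d x (\<lambda>j. if j = i then 1 else 0) = x i"
  by (simp add: dotp_def if_distrib[of "\<lambda>c. _ * c"] cong: if_cong)

subsection \<open>Projection onto the orthogonal complement of a list of vectors\<close>

text \<open>Gram-Schmidt carried out on the projection matrix: \<open>h\<close> is the residual of
  the new vector, \<open>s\<close> its squared norm, and \<open>s \<le> 0\<close> means that the
  vector depends on the earlier ones, a test that exact arithmetic makes reliable. Only field
  operations and comparisons occur, so the machine runs the very same recursion.\<close>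

primrec npj :: "nat \<Rightarrow> (nat \<Rightarrow> nat \<Rightarrow> real) \<Rightarrow> nat \<Rightarrow> nat \<Rightarrow> nat \<Rightarrow> real" where
  "npj D a 0 = (\<lambda>i j. if i = j then 1 else 0)"
| "npj D a (Suc t) = (let P = npj D a t; h = (\<lambda>i. dotp D (P i) (a t)); s = dotp D (a t) h in
     (\<lambda>i j. if s \<le> 0 then P i j else P i j - h i * h j / s))"

text \<open>Everything is stated for indices below \<open>D\<close>, as vectors are total functions.
  The last clause, that the identity minus the projection maps into the span of the given vectors,
  is the one that yields dual vectors.\<close>

definition proj_inv :: "nat \<Rightarrow> (nat \<Rightarrow> nat \<Rightarrow> real) \<Rightarrow> nat \<Rightarrow> (nat \<Rightarrow> nat \<Rightarrow> real) \<Rightarrow> bool" where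
  "proj_inv D a t P \<longleftrightarrow>
    (\<forall>i<D. \<forall>j<D. P i j = P j i) \<and>
    (\<forall>u<t. \<forall>i<D. dotp D (P i) (a u) = 0) \<and>
    (\<forall>x. (\<forall>u<t. dotp D (a u) x = 0) \<longrightarrow> (\<forall>i<D. dotp D (P i) x = x i)) \<and>
    (\<forall>x. \<exists>c. \<forall>i<D. x i - dotp D (P i) x = (\<Sum>u<t. c u * a u i))"

lemma proj_sym_dot:
  assumes "\<forall>i<D. \<forall>j<D. P i j = P j i"
  shows "dotp D (\<lambda>i. dotp D (P i) x) y = dotp D x (\<lambda>i. dotp D (P i) y)"
proof -
  have "dotp D (\<lambda>i. dotp D (P i) x) y = (\<Sum>i<D. \<Sum>j<D. P i j * x j * y i)"
    by (simp add: dotp_def sum_distrib_right)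
  also have "\<dots> = (\<Sum>j<D. \<Sum>i<D. P i j * x j * y i)" by (rule sum.swap)
  also have "\<dots> = (\<Sum>j<D. \<Sum>i<D. x j * (P j i * y i))" using assms by (intro sum.cong) auto
  finally show ?thesis by (simp add: dotp_def sum_distrib_left)
qed

lemma npj_inv: "proj_inv D a t (npj D a t)"
proof (induction t)
  case 0
  have "dotp D (\<lambda>j. if i = j then 1 else 0) x = x i" if "i < D" for i x
    using that by (simp add: dotp_def if_distrib[of "\<lambda>c. c * _"] cong: if_cong)
  then show ?case by (simp add: proj_inv_def)
next
  case (Suc t)
  define P where "P = npj D a t"
  define h where "h = (\<lambda>i. dotp D (P i) (a t))"
  define s where "s = dotp D (a t) h"
  define P' where "P' = npj D a (Suc t)"
  have P': "P' i j = (if s \<le> 0 then P i j else P i j - h i * h j / s)" for i j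
    by (simp add: P'_def P_def h_def s_def Let_def)
  have sym: "\<forall>i<D. \<forall>j<D. P i j = P j i"
    and kill: "\<And>u i. u < t \<Longrightarrow> i < D \<Longrightarrow> dotp D (P i) (a u) = 0"
    and fx: "\<And>x i. (\<And>u. u < t \<Longrightarrow> dotp D (a u) x = 0) \<Longrightarrow> i < D \<Longrightarrow> dotp D (P i) x = x i"
    and span: "\<And>x. \<exists>c. \<forall>i<D. x i - dotp D (P i) x = (\<Sum>u<t. c u * a u i)"
  proof -
    have A: "(\<forall>i<D. \<forall>j<D. P i j = P j i) \<and> (\<forall>u<t. \<forall>i<D. dotp D (P i) (a u) = 0) \<and>
      (\<forall>x. (\<forall>u<t. dotp D (a u) x = 0) \<longrightarrow> (\<forall>i<D. dotp D (P i) x = x i)) \<and>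
      (\<forall>x. \<exists>c. \<forall>i<D. x i - dotp D (P i) x = (\<Sum>u<t. c u * a u i))"
      using Suc unfolding proj_inv_def P_def .
    show "\<forall>i<D. \<forall>j<D. P i j = P j i" by (rule conjunct1[OF A])
    show "dotp D (P i) (a u) = 0" if "u < t" "i < D" for u i using A that by simp
    show "dotp D (P i) x = x i" if "\<And>u. u < t \<Longrightarrow> dotp D (a u) x = 0" "i < D" for x i
      using conjunct1[OF conjunct2[OF conjunct2[OF A]]] that by simp
    show "\<exists>c. \<forall>i<D. x i - dotp D (P i) x = (\<Sum>u<t. c u * a u i)" for x
      by (rule spec[OF conjunct2[OF conjunct2[OF conjunct2[OF A]]]])
  qed
  have hu: "dotp D (a u) h = 0" if "u < t" for u
  proof -
    have "dotp D h (a u) = dotp D (a t) (\<lambda>i. dotp D (P i) (a u))"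
      unfolding h_def by (rule proj_sym_dot[OF sym])
    also have "\<dots> = 0" using kill[OF that] by (simp add: dotp_def)
    finally show ?thesis by (simp add: dotp_commute)
  qed
  have Ph: "dotp D (P i) h = h i" if "i < D" for i using fx[OF hu that] .
  have hh: "dotp D h h = s"
  proof -
    have "dotp D h h = dotp D (a t) (\<lambda>i. dotp D (P i) h)"
      using proj_sym_dot[OF sym, of "a t" h] by (simp add: h_def)
    also have "\<dots> = s" unfolding s_def using Ph by (intro dotp_cong) auto
    finally show ?thesis .
  qed
  have s0: "0 \<le> s" using dotp_self_nonneg[of D h] hh by simp
  have P'x: "dotp D (P' i) x = dotp D (P i) x - (if s \<le> 0 then 0 else h i * dotp D h x / s)" for i x
    by (simp add: P' dotp_def left_diff_distrib sum_subtractf sum_distrib_left sum_divide_distrib mult.assoc)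
  have hx: "dotp D h x = dotp D (a t) (\<lambda>i. dotp D (P i) x)" for x
    unfolding h_def by (rule proj_sym_dot[OF sym])
  obtain ch where ch: "\<And>i. i < D \<Longrightarrow> a t i - h i = (\<Sum>u<t. ch u * a u i)"
  proof -
    obtain ch where "\<forall>i<D. a t i - dotp D (P i) (a t) = (\<Sum>u<t. ch u * a u i)" using span[of "a t"] ..
    then show ?thesis using that[of ch] by (simp add: h_def)
  qed
  show ?case unfolding P'_def[symmetric] proj_inv_def
  proof (intro conjI allI impI)
    show "P' i j = P' j i" if "i < D" "j < D" for i j using that sym by (simp add: P' mult.commute)
    show "dotp D (P' i) (a u) = 0" if "u < Suc t" "i < D" for u i
    proof (cases "u = t")
      case True
      show ?thesis
      proof (cases "s \<le> 0")
        case True2: True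
        then have "dotp D h h = 0" using hh s0 by simp
        then have "h i = 0" using dotp_self_zero[of D h i] that by simp
        then show ?thesis using True True2 by (simp add: P'x h_def)
      next
        case False
        have "dotp D (P i) (a t) = h i" by (simp add: h_def)
        with False show ?thesis using True by (simp add: P'x dotp_commute[of D h] s_def[symmetric])
      qed
    next
      case False
      then have "u < t" using that by simp
      then show ?thesis using kill[OF _ that(2)] hu by (simp add: P'x dotp_commute[of D h])
    qed
    show "dotp D (P' i) x = x i" if x: "\<forall>u<Suc t. dotp D (a u) x = 0" and i: "i < D" for x i
    proof -
      have Px: "dotp D (P i) x = x i" if "i < D" for i using fx[OF _ that] x by simp
      have "dotp D h x = dotp D (a t) x" unfolding hx using Px by (intro dotp_cong) auto
      then show ?thesis using x Px[OF i] by (simp add: P'x)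
    qed
    show "\<exists>c. \<forall>i<D. x i - dotp D (P' i) x = (\<Sum>u<Suc t. c u * a u i)" for x
    proof -
      obtain c where c: "\<And>i. i < D \<Longrightarrow> x i - dotp D (P i) x = (\<Sum>u<t. c u * a u i)"
      proof -
        obtain c where "\<forall>i<D. x i - dotp D (P i) x = (\<Sum>u<t. c u * a u i)" using span[of x] ..
        then show ?thesis using that[of c] by simp
      qed
      define \<beta> where "\<beta> = (if s \<le> 0 then 0 else dotp D h x / s)"
      have "x i - dotp D (P' i) x = (\<Sum>u<Suc t. (if u < t then c u - \<beta> * ch u else \<beta>) * a u i)" if "i < D" for i
      proof -
        have "x i - dotp D (P' i) x = (\<Sum>u<t. c u * a u i) + \<beta> * h i"
          using c[OF that] by (simp add: P'x \<beta>_def algebra_simps)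
        also have "h i = a t i - (\<Sum>u<t. ch u * a u i)" using ch[OF that] by simp
        finally have "x i - dotp D (P' i) x = (\<Sum>u<t. c u * a u i) - \<beta> * (\<Sum>u<t. ch u * a u i) + \<beta> * a t i"
          by (simp add: right_diff_distrib)
        also have "\<dots> = (\<Sum>u<t. (c u - \<beta> * ch u) * a u i) + \<beta> * a t i"
          by (simp add: left_diff_distrib sum_subtractf sum_distrib_left mult.assoc)
        finally show ?thesis by simp
      qed
      then show ?thesis by (intro exI[of _ "\<lambda>u. if u < t then c u - \<beta> * ch u else \<beta>"]) simp
    qed
  qed
qed

lemma npj_sym: "i < D \<Longrightarrow> j < D \<Longrightarrow> npj D a t i j = npj D a t j i"
  using npj_inv[of D a t] by (simp add: proj_inv_def)

lemma npj_kill: "u < t \<Longrightarrow> i < D \<Longrightarrow> dotp D (npj D a t i) (a u) = 0"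
  using npj_inv[of D a t] by (simp add: proj_inv_def)

lemma npj_fix: "(\<And>u. u < t \<Longrightarrow> dotp D (a u) x = 0) \<Longrightarrow> i < D \<Longrightarrow> dotp D (npj D a t i) x = x i"
  using npj_inv[of D a t] by (simp add: proj_inv_def)

lemma npj_span: "\<exists>c. \<forall>i<D. x i - dotp D (npj D a t i) x = (\<Sum>u<t. c u * a u i)"
  using npj_inv[of D a t] by (simp add: proj_inv_def)

lemma npj_null:
  assumes "u < t"
  shows "dotp D (a u) (\<lambda>i. dotp D (npj D a t i) x) = 0"
proof -
  have "dotp D (\<lambda>i. dotp D (npj D a t i) (a u)) x = dotp D (a u) (\<lambda>i. dotp D (npj D a t i) x)"
    by (rule proj_sym_dot) (simp add: npj_sym)
  moreover have "dotp D (\<lambda>i. dotp D (npj D a t i) (a u)) x = 0"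
    using npj_kill[OF assms] by (simp add: dotp_def)
  ultimately show ?thesis by simp
qed

lemma npj_pair:
  assumes "\<And>u. u < t \<Longrightarrow> dotp D (a u) y = 0"
  shows "dotp D (\<lambda>i. dotp D (npj D a t i) x) y = dotp D x y"
proof -
  have "dotp D (\<lambda>i. dotp D (npj D a t i) x) y = dotp D x (\<lambda>i. dotp D (npj D a t i) y)"
    by (rule proj_sym_dot) (simp add: npj_sym)
  also have "\<dots> = dotp D x y" using npj_fix[of t D a y] assms by (intro dotp_cong) auto
  finally show ?thesis .
qed

lemma npj_pair_self: "dotp D x (\<lambda>i. dotp D (npj D a t i) x) =
    dotp D (\<lambda>i. dotp D (npj D a t i) x) (\<lambda>i. dotp D (npj D a t i) x)"
  using npj_pair[of t D a "\<lambda>i. dotp D (npj D a t i) x" x] npj_null[of _ t D a x] by simp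

text \<open>Project \<open>u j\<close> onto the orthogonal complement of the other vectors. The
  result is nonzero, for otherwise \<open>u j\<close> would be a combination of them; divided by its
  squared norm it is the dual vector.\<close>

lemma dual_vector:
  fixes u :: "nat \<Rightarrow> nat \<Rightarrow> real"
  assumes inj: "\<And>c. (\<And>i. i < m \<Longrightarrow> (\<Sum>l<k. c l * u l i) = 0) \<Longrightarrow> (\<And>l. l < k \<Longrightarrow> c l = 0)" and j: "j < k"
  shows "\<exists>w. \<forall>l<k. dotp m w (u l) = (if l = j then 1 else 0)"
proof -
  define a where "a l = (if l = j then (\<lambda>_. 0) else u l)" for l
  define w where "w i = dotp m (npj m a k i) (u j)" for i
  have 0: "dotp m w (u l) = 0" if "l < k" "l \<noteq> j" for l
    using npj_null[OF that(1), of m a "u j"] that by (simp add: a_def w_def[abs_def] dotp_commute)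
  have ww: "dotp m w (u j) = dotp m w w"
    using npj_pair_self[of m "u j" a k] by (simp add: w_def[abs_def] dotp_commute)
  have "dotp m w w \<noteq> 0"
  proof
    assume "dotp m w w = 0"
    then have w0: "w i = 0" if "i < m" for i using dotp_self_zero that by blast
    obtain c where c: "\<And>i. i < m \<Longrightarrow> u j i - w i = (\<Sum>l<k. c l * a l i)"
      using npj_span[of m "u j" a k] unfolding w_def by blast
    define c' where "c' l = (if l = j then -1 else c l)" for l
    have "(\<Sum>l<k. c' l * u l i) = 0" if i: "i < m" for i
    proof -
      have "(\<Sum>l<k. c' l * u l i) = (\<Sum>l<k. c l * a l i + (if l = j then - u j i else 0))"
        by (intro sum.cong) (auto simp: c'_def a_def)
      also have "\<dots> = (\<Sum>l<k. c l * a l i) - u j i" using j by (simp add: sum.distrib)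
      finally show ?thesis using c[OF i] w0[OF i] by simp
    qed
    then have "c' j = 0" using inj j by blast
    then show False by (simp add: c'_def)
  qed
  then have "\<forall>l<k. dotp m (\<lambda>i. w i / dotp m w w) (u l) = (if l = j then 1 else 0)"
    using 0 ww by (auto simp: dotp_def sum_divide_distrib[symmetric])
  then show ?thesis by blast
qed

subsection \<open>Perturbation of a symmetric matrix with orthonormal eigenvectors\<close>

locale spectral = orthonormal +
  fixes \<mu> :: "nat \<Rightarrow> real"
begin

definition Mx :: "(nat \<Rightarrow> real) \<Rightarrow> nat \<Rightarrow> real" where
  "Mx x p = (\<Sum>l<k. \<mu> l * dotp d (v l) x * v l p)"

lemma v_dot: "l < k \<Longrightarrow> l' < k \<Longrightarrow> dotp d (v l) (v l') = (if l = l' then 1 else 0)"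
  using orth by (simp add: orthn_def dotp_def)

lemma v_dot_comb: "l < k \<Longrightarrow> dotp d (v l) (\<lambda>p. \<Sum>l'<k. \<beta> l' * v l' p) = \<beta> l"
  by (simp add: dotp_sum dotp_scale v_dot if_distrib[of "\<lambda>c. _ * c"] cong: if_cong)

lemma pythagoras:
  assumes z: "\<And>l. l < k \<Longrightarrow> dotp d (v l) z = 0"
  shows "dotp d (\<lambda>p. (\<Sum>l<k. \<beta> l * v l p) + z p) (\<lambda>p. (\<Sum>l<k. \<beta> l * v l p) + z p) = (\<Sum>l<k. (\<beta> l)\<^sup>2) + dotp d z z"
proof -
  let ?b = "\<lambda>p. \<Sum>l<k. \<beta> l * v l p"
  have bz: "dotp d z ?b = 0" using z by (simp add: dotp_sum dotp_scale dotp_commute[of d z])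
  have "dotp d ?b ?b = (\<Sum>l<k. \<beta> l * dotp d ?b (v l))" by (simp only: dotp_sum dotp_scale)
  also have "\<dots> = (\<Sum>l<k. (\<beta> l)\<^sup>2)"
    by (intro sum.cong refl) (simp add: dotp_commute[of d ?b] v_dot_comb power2_eq_square)
  finally have bb: "dotp d ?b ?b = (\<Sum>l<k. (\<beta> l)\<^sup>2)" .
  have "dotp d (\<lambda>p. ?b p + z p) (\<lambda>p. ?b p + z p) = dotp d (\<lambda>p. ?b p + z p) ?b + dotp d (\<lambda>p. ?b p + z p) z"
    by (rule dotp_add)
  also have "\<dots> = dotp d ?b ?b + dotp d z z + 2 * dotp d z ?b"
    by (simp add: dotp_commute[of d "\<lambda>p. ?b p + z p"] dotp_add) (simp add: dotp_commute)
  finally show ?thesis using bb bz by simp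
qed

definition perp :: "(nat \<Rightarrow> real) \<Rightarrow> nat \<Rightarrow> real" where
  "perp x p = x p - (\<Sum>l<k. dotp d (v l) x * v l p)"

lemma perp_orth: "l < k \<Longrightarrow> dotp d (v l) (perp x) = 0"
  unfolding perp_def[abs_def] by (simp add: dotp_diff v_dot_comb)

lemma norm_split: "dotp d x x = (\<Sum>l<k. (dotp d (v l) x)\<^sup>2) + dotp d (perp x) (perp x)"
  using pythagoras[of "perp x" "\<lambda>l. dotp d (v l) x", OF perp_orth] by (simp add: perp_def)

lemma resid_split:
  "dotp d (\<lambda>p. Mx x p - L * x p) (\<lambda>p. Mx x p - L * x p) =
    (\<Sum>l<k. ((\<mu> l - L) * dotp d (v l) x)\<^sup>2) + L\<^sup>2 * dotp d (perp x) (perp x)"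
proof -
  let ?z = "\<lambda>p. - L * perp x p"
  have "dotp d (v l) ?z = 0" if "l < k" for l using perp_orth[OF that] by (simp only: dotp_scale mult_zero_right)
  from pythagoras[of ?z "\<lambda>l. (\<mu> l - L) * dotp d (v l) x", OF this]
  have "dotp d (\<lambda>p. (\<Sum>l<k. (\<mu> l - L) * dotp d (v l) x * v l p) + ?z p) (\<lambda>p. (\<Sum>l<k. (\<mu> l - L) * dotp d (v l) x * v l p) + ?z p) =
    (\<Sum>l<k. ((\<mu> l - L) * dotp d (v l) x)\<^sup>2) + dotp d ?z ?z" .
  moreover have "(\<Sum>l<k. (\<mu> l - L) * dotp d (v l) x * v l p) + ?z p = Mx x p - L * x p" for p
    by (simp add: Mx_def perp_def left_diff_distrib sum_subtractf sum_distrib_left sum_negf algebra_simps)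
  moreover have "dotp d ?z ?z = L\<^sup>2 * dotp d (perp x) (perp x)"
    by (simp add: dotp_def sum_distrib_left power2_eq_square algebra_simps)
  ultimately show ?thesis by simp
qed

text \<open>The residual multiplies the component along \<open>v l\<close> by
  \<open>\<mu> l - L\<close>, and the component orthogonal to all of them, where the operator
  vanishes, by \<open>L\<close>. The hypothesis \<open>\<rho> < \<bar>L\<bar>\<close> excludes this
  kernel, so one of the \<open>\<mu> l\<close> must be close.\<close>

lemma near_eigenvalue:
  assumes res: "dotp d (\<lambda>p. Mx x p - L * x p) (\<lambda>p. Mx x p - L * x p) \<le> \<rho>\<^sup>2 * dotp d x x"
    and x: "dotp d x x > 0" and \<rho>: "0 \<le> \<rho>" "\<rho> < \<bar>L\<bar>"
  shows "\<exists>j<k. \<bar>\<mu> j - L\<bar> \<le> \<rho>"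
proof (rule ccontr)
  assume "\<not> ?thesis"
  then have far: "\<rho>\<^sup>2 < (\<mu> l - L)\<^sup>2" if "l < k" for l
    using that power_strict_mono[of \<rho> "\<bar>\<mu> l - L\<bar>" 2] \<rho> by (auto simp: not_le)
  have far': "\<rho>\<^sup>2 * y\<^sup>2 \<le> ((\<mu> l - L) * y)\<^sup>2" if "l < k" for l y
    by (simp add: power_mult_distrib mult_right_mono less_imp_le[OF far[OF that]])
  have lam: "\<rho>\<^sup>2 < L\<^sup>2" using \<rho> power_strict_mono[of \<rho> "\<bar>L\<bar>" 2] by simp
  have "\<rho>\<^sup>2 * dotp d x x < dotp d (\<lambda>p. Mx x p - L * x p) (\<lambda>p. Mx x p - L * x p)"
  proof -
    have le: "(\<Sum>l<k. \<rho>\<^sup>2 * (dotp d (v l) x)\<^sup>2) \<le> (\<Sum>l<k. ((\<mu> l - L) * dotp d (v l) x)\<^sup>2)"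
      using far' by (intro sum_mono) simp
    show ?thesis
    proof (cases "dotp d (perp x) (perp x) = 0")
      case False
      then have "0 < dotp d (perp x) (perp x)" using dotp_self_nonneg[of d "perp x"] by linarith
      then have "\<rho>\<^sup>2 * dotp d (perp x) (perp x) < L\<^sup>2 * dotp d (perp x) (perp x)" using lam by simp
      then show ?thesis unfolding resid_split norm_split[of x] using le by (simp add: distrib_left sum_distrib_left)
    next
      case True
      then have "0 < (\<Sum>l<k. (dotp d (v l) x)\<^sup>2)" using x norm_split[of x] by simp
      then obtain l where l: "l < k" "(dotp d (v l) x)\<^sup>2 \<noteq> 0"
        by (metis (mono_tags, lifting) lessThan_iff less_irrefl sum.neutral)
      have "(\<Sum>l<k. \<rho>\<^sup>2 * (dotp d (v l) x)\<^sup>2) < (\<Sum>l<k. ((\<mu> l - L) * dotp d (v l) x)\<^sup>2)"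
      proof (rule sum_strict_mono_ex1)
        show "\<forall>l\<in>{..<k}. \<rho>\<^sup>2 * (dotp d (v l) x)\<^sup>2 \<le> ((\<mu> l - L) * dotp d (v l) x)\<^sup>2"
          using far' by simp
        show "\<exists>l\<in>{..<k}. \<rho>\<^sup>2 * (dotp d (v l) x)\<^sup>2 < ((\<mu> l - L) * dotp d (v l) x)\<^sup>2"
          using l far[OF l(1)] by (intro bexI[of _ l]) (auto simp: power_mult_distrib)
      qed simp
      then show ?thesis unfolding resid_split norm_split[of x] using True by (simp add: distrib_left sum_distrib_left)
    qed
  qed
  then show False using res by simp
qed

text \<open>An elementary form of the sine theorem for eigenvectors: the whole spectrum except
  \<open>\<mu> j\<close>, the zero eigenvalue of the complement included, has distance at least
  \<open>g\<close> from \<open>L\<close>, so the part of \<open>x\<close> outside \<open>v j\<close>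
  is seen in the residual with a factor of at least \<open>g\<close>.\<close>

lemma off_component:
  assumes j: "j < k" and far: "\<And>l. l < k \<Longrightarrow> l \<noteq> j \<Longrightarrow> g \<le> \<bar>\<mu> l - L\<bar>" and lam: "g \<le> \<bar>L\<bar>" and g: "0 \<le> g"
  shows "g\<^sup>2 * (dotp d x x - (dotp d (v j) x)\<^sup>2) \<le> dotp d (\<lambda>p. Mx x p - L * x p) (\<lambda>p. Mx x p - L * x p)"
proof -
  have sq: "g\<^sup>2 \<le> t\<^sup>2" if "g \<le> \<bar>t\<bar>" for t using abs_le_square_iff[of g t] that g by simp
  have "g\<^sup>2 * (dotp d x x - (dotp d (v j) x)\<^sup>2) =
    (\<Sum>l\<in>{..<k} - {j}. g\<^sup>2 * (dotp d (v l) x)\<^sup>2) + g\<^sup>2 * dotp d (perp x) (perp x)"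
    unfolding norm_split[of x] using j by (simp add: sum.remove[of "{..<k}" j] sum_distrib_left algebra_simps)
  also have "\<dots> \<le> (\<Sum>l\<in>{..<k} - {j}. ((\<mu> l - L) * dotp d (v l) x)\<^sup>2) + L\<^sup>2 * dotp d (perp x) (perp x)"
    using far lam by (intro add_mono sum_mono mult_right_mono)
      (auto simp: power_mult_distrib dotp_self_nonneg intro!: mult_right_mono sq)
  also have "\<dots> \<le> (\<Sum>l<k. ((\<mu> l - L) * dotp d (v l) x)\<^sup>2) + L\<^sup>2 * dotp d (perp x) (perp x)"
    by (intro add_right_mono sum_mono2) auto
  finally show ?thesis unfolding resid_split .
qed

lemma Mx_eigen: "j < k \<Longrightarrow> Mx (v j) p = \<mu> j * v j p"
proof -
  assume j: "j < k"
  have "Mx (v j) p = (\<Sum>l<k. if l = j then \<mu> l * v l p else 0)"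
    unfolding Mx_def using j by (intro sum.cong) (auto simp: v_dot)
  then show ?thesis using j by simp
qed

lemma component_diff:
  assumes "j < k"
  shows "dotp d (\<lambda>p. x p - dotp d (v j) x * v j p) (\<lambda>p. x p - dotp d (v j) x * v j p) = dotp d x x - (dotp d (v j) x)\<^sup>2"
proof -
  let ?a = "dotp d (v j) x"
  let ?y = "\<lambda>p. x p - ?a * v j p"
  have xv: "dotp d x (v j) = ?a" by (rule dotp_commute)
  have vv: "dotp d (v j) (v j) = 1" using v_dot assms by simp
  have 1: "dotp d x ?y = dotp d x x - ?a * ?a" by (simp add: dotp_diff dotp_scale xv)
  have 2: "dotp d (v j) ?y = 0" by (simp add: dotp_diff dotp_scale vv)
  have "dotp d ?y ?y = dotp d ?y x - ?a * dotp d ?y (v j)" by (simp only: dotp_diff dotp_scale)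
  also have "\<dots> = dotp d x x - ?a * ?a" using 1 2 by (simp add: dotp_commute[of d ?y])
  finally show ?thesis by (simp add: power2_eq_square)
qed

end

subsection \<open>Singular value bounds from the condition number\<close>

definition quad :: "nat \<Rightarrow> (nat \<Rightarrow> nat \<Rightarrow> real) \<Rightarrow> (nat \<Rightarrow> real) \<Rightarrow> real" where
  "quad k G x = (\<Sum>i<k. \<Sum>j<k. G i j * x i * x j)"

text \<open>Vectors of length \<open>k\<close> are functions vanishing from \<open>k\<close> on, so
  Tychonoff's theorem makes the box compact; the unit sphere in \<open>rayleigh_min\<close> is a
  closed part of it.\<close>

lemma compact_box: "compact {x :: nat \<Rightarrow> real. \<forall>i. (i < k \<longrightarrow> \<bar>x i\<bar> \<le> 1) \<and> (\<not> i < k \<longrightarrow> x i = 0)}"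
proof -
  let ?B = "\<lambda>i. if i < k then {- 1 .. 1 :: real} else {0}"
  have "compactin (product_topology (\<lambda>_ :: nat. euclidean) UNIV) (PiE UNIV ?B)"
    by (subst compactin_PiE) auto
  then have "compact (PiE UNIV ?B)" by (simp add: euclidean_product_topology)
  moreover have "PiE UNIV ?B = {x. \<forall>i. (i < k \<longrightarrow> \<bar>x i\<bar> \<le> 1) \<and> (\<not> i < k \<longrightarrow> x i = 0)}"
    by (auto simp: PiE_def Pi_def abs_le_iff split: if_splits)
  ultimately show ?thesis by simp
qed

lemma quad_perturb:
  assumes sym: "\<And>i j. i < k \<Longrightarrow> j < k \<Longrightarrow> G i j = G j i" and i: "i < k"
  shows "quad k G (\<lambda>a. c a + (if a = i then t else 0)) = quad k G c + 2 * t * (\<Sum>j<k. G i j * c j) + t\<^sup>2 * G i i"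
proof -
  have 1: "(\<Sum>b<k. G a b * (c a + (if a = i then t else 0)) * (c b + (if b = i then t else 0))) =
     (\<Sum>b<k. G a b * c a * c b) + t * (G a i * c a) + (if a = i then t * (\<Sum>b<k. G i b * c b) + t\<^sup>2 * G i i else 0)" if "a < k" for a
  proof -
    have "(\<Sum>b<k. G a b * (c a + (if a = i then t else 0)) * (c b + (if b = i then t else 0))) =
      (\<Sum>b<k. (c a + (if a = i then t else 0)) * (G a b * c b) + (if b = i then G a i * (c a + (if a = i then t else 0)) * t else 0))"
      by (intro sum.cong) (auto simp: algebra_simps)
    also have "\<dots> = (c a + (if a = i then t else 0)) * (\<Sum>b<k. G a b * c b) + G a i * (c a + (if a = i then t else 0)) * t"
      using i by (simp add: sum.distrib sum_distrib_left)
    also have "\<dots> = c a * (\<Sum>b<k. G a b * c b) + t * (G a i * c a) + (if a = i then t * (\<Sum>b<k. G i b * c b) + t\<^sup>2 * G i i else 0)"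
      by (simp add: algebra_simps power2_eq_square)
    finally show ?thesis by (simp add: sum_distrib_left algebra_simps)
  qed
  have "quad k G (\<lambda>a. c a + (if a = i then t else 0)) = (\<Sum>a<k. (\<Sum>b<k. G a b * c a * c b) + t * (G a i * c a) +
      (if a = i then t * (\<Sum>b<k. G i b * c b) + t\<^sup>2 * G i i else 0))"
    unfolding quad_def using 1 by (intro sum.cong refl) simp
  also have "\<dots> = quad k G c + t * (\<Sum>a<k. G a i * c a) + (t * (\<Sum>b<k. G i b * c b) + t\<^sup>2 * G i i)"
    using i by (simp add: sum.distrib quad_def sum_distrib_left)
  also have "(\<Sum>a<k. G a i * c a) = (\<Sum>j<k. G i j * c j)" using sym i by (intro sum.cong refl) simp
  finally show ?thesis by simp
qed

text \<open>A minimiser of the form on the unit sphere is an eigenvector: perturbing one coordinate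
  by \<open>t\<close> gives \<open>0 \<le> 2 * t * B + t^2 * C\<close> for all \<open>t\<close>,
  which forces the linear coefficient \<open>B\<close>, the defect in the \<open>i\<close>-th
  eigenvector equation, to vanish.\<close>

lemma rayleigh_min:
  assumes k: "1 \<le> k" and sym: "\<And>i j. i < k \<Longrightarrow> j < k \<Longrightarrow> G i j = G j i"
  shows "\<exists>e c. (\<Sum>i<k. (c i)\<^sup>2) = 1 \<and> (\<forall>i<k. (\<Sum>j<k. G i j * c j) = e * c i) \<and> (\<forall>x. e * (\<Sum>i<k. (x i)\<^sup>2) \<le> quad k G x)"
proof -
  let ?B = "{x :: nat \<Rightarrow> real. \<forall>i. (i < k \<longrightarrow> \<bar>x i\<bar> \<le> 1) \<and> (\<not> i < k \<longrightarrow> x i = 0)}"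
  let ?S = "?B \<inter> {x. (\<Sum>i<k. (x i)\<^sup>2) = 1}"
  have co: "continuous_on UNIV (\<lambda>x :: nat \<Rightarrow> real. x i)" for i by simp
  have "closed {x :: nat \<Rightarrow> real. (\<Sum>i<k. (x i)\<^sup>2) = 1}"
    by (intro closed_Collect_eq continuous_on_sum continuous_on_power continuous_on_const co)
  then have comp: "compact ?S" by (intro compact_Int_closed compact_box)
  have "(\<lambda>i. if i = 0 then 1 else 0) \<in> ?S" 
  proof -
    have "(\<Sum>i<k. (if i = 0 then 1 else 0 :: real)\<^sup>2) = (\<Sum>i<k. if i = 0 then 1 else 0)" by (intro sum.cong) auto
    also have "\<dots> = 1" using k by simp
    finally show ?thesis using k by simp
  qed
  then have ne: "?S \<noteq> {}" by (metis empty_iff)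
  have "continuous_on UNIV (quad k G)" unfolding quad_def[abs_def]
    by (intro continuous_on_sum continuous_on_mult continuous_on_const co)
  then have "continuous_on ?S (quad k G)" by (rule continuous_on_subset) simp
  from continuous_attains_inf[OF comp ne this] obtain c where c: "c \<in> ?S" "\<forall>y\<in>?S. quad k G c \<le> quad k G y" ..
  define e where "e = quad k G c"
  have norm: "(\<Sum>i<k. (c i)\<^sup>2) = 1" using c(1) by simp
  have lower: "e * (\<Sum>i<k. (x i)\<^sup>2) \<le> quad k G x" for x
  proof (cases "(\<Sum>i<k. (x i)\<^sup>2) = 0")
    case True
    then have "x i = 0" if "i < k" for i using that by (simp add: sum_nonneg_eq_0_iff)
    then have "quad k G x = 0" by (simp add: quad_def)
    then show ?thesis using True by simp
  next
    case False
    define s where "s = (\<Sum>i<k. (x i)\<^sup>2)"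
    have s: "s > 0" proof -
      have "0 \<le> s" unfolding s_def by (intro sum_nonneg) simp
      then show ?thesis using False unfolding s_def by simp
    qed
    define y where "y i = (if i < k then x i / sqrt s else 0)" for i
    have y2: "(\<Sum>i<k. (y i)\<^sup>2) = 1"
      using s by (simp add: y_def power_divide sum_divide_distrib[symmetric] s_def[symmetric])
    have "\<bar>y i\<bar> \<le> 1" if "i < k" for i
    proof -
      have "(y i)\<^sup>2 \<le> (\<Sum>i<k. (y i)\<^sup>2)" using that by (intro member_le_sum) auto
      then show ?thesis using y2 by (simp add: abs_square_le_1)
    qed
    then have "y \<in> ?S" using y2 by (simp add: y_def)
    then have "e \<le> quad k G y" using c(2) unfolding e_def by blast
    also have "quad k G y = quad k G x / s"
    proof -
      have "G i j * y i * y j = G i j * x i * x j / s" if "i < k" "j < k" for i j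
        using that s by (simp add: y_def)
      then show ?thesis by (simp add: quad_def sum_divide_distrib)
    qed
    finally show ?thesis using s by (simp add: s_def[symmetric] pos_le_divide_eq)
  qed
  have stat: "(\<Sum>j<k. G i j * c j) = e * c i" if i: "i < k" for i
  proof -
    define B where "B = (\<Sum>j<k. G i j * c j) - e * c i"
    define C where "C = G i i - e"
    have *: "0 \<le> 2 * t * B + t\<^sup>2 * C" for t
    proof -
      have n: "(\<Sum>a<k. (c a + (if a = i then t else 0))\<^sup>2) = 1 + 2 * t * c i + t\<^sup>2"
      proof -
        have "(\<Sum>a<k. (c a + (if a = i then t else 0))\<^sup>2) = (\<Sum>a<k. (c a)\<^sup>2 + (if a = i then 2 * t * c i + t\<^sup>2 else 0))"
          by (intro sum.cong) (auto simp: power2_eq_square algebra_simps)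
        then show ?thesis using norm i by (simp add: sum.distrib)
      qed
      have "e * (1 + 2 * t * c i + t\<^sup>2) \<le> e + 2 * t * (\<Sum>j<k. G i j * c j) + t\<^sup>2 * G i i"
      proof -
        have "quad k G (\<lambda>a. c a + (if a = i then t else 0)) = quad k G c + 2 * t * (\<Sum>j<k. G i j * c j) + t\<^sup>2 * G i i"
          by (rule quad_perturb[OF sym i])
        then show ?thesis using lower[of "\<lambda>a. c a + (if a = i then t else 0)"] unfolding n by (simp add: e_def)
      qed
      then show ?thesis by (simp add: B_def C_def algebra_simps)
    qed
    have "B = 0"
    proof (rule ccontr)
      assume B: "B \<noteq> 0"
      \<comment> \<open>Any positive \<open>K\<close> with \<open>C \<le> K\<close> makes the step
        \<open>- B / K\<close> short enough for the linear term to win over the quadratic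
        one.\<close>
      define K where "K = \<bar>C\<bar> + 1"
      have K: "0 < K" "C \<le> K" by (auto simp: K_def)
      define t where "t = - B / K"
      have "2 * t * B + t\<^sup>2 * C = (B\<^sup>2 / K) * (- 2 + C / K)"
        using K(1) by (simp add: t_def power2_eq_square field_simps)
      moreover have "0 < B\<^sup>2 / K" using B K(1) by (intro divide_pos_pos) auto
      moreover have "- 2 + C / K < 0"
      proof -
        have "C / K \<le> 1" using K by simp
        then show ?thesis by linarith
      qed
      ultimately have "2 * t * B + t\<^sup>2 * C < 0" by (simp only: mult_pos_neg)
      then show False using *[of t] by simp
    qed
    then show ?thesis by (simp add: B_def)
  qed
  show ?thesis using norm stat lower by (intro exI[of _ e] exI[of _ c]) simp
qed

text \<open>Rank is the size of a maximal independent part of the set of columns. A repeated column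
  would make this set too small for rank \<open>k\<close>, so the columns are distinct, and then
  they are independent.\<close>

lemma full_rank_injective:
  fixes U :: "real mat"
  assumes U: "U \<in> carrier_mat m k" and r: "mat_rank U = k" and v: "v \<in> carrier_vec k" "U *\<^sub>v v = 0\<^sub>v m"
  shows "v = 0\<^sub>v k"
proof -
  interpret vec_space "TYPE(real)" m .
  have rk: "rank U = k" using r U by (simp add: mat_rank_def)
  have dist: "distinct (cols U)"
  proof (rule ccontr)
    assume nd: "\<not> distinct (cols U)"
    obtain S where S: "maximal S (\<lambda>T. T \<subseteq> set (cols U) \<and> lin_indpt T)"
      using maximal_exists[of "(\<lambda>T. T \<subseteq> set (cols U) \<and> lin_indpt T)" "card (set (cols U))" "{}"]
      by (meson List.finite_set card_mono empty_iff empty_subsetI finite_lin_indpt2 rev_finite_subset)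
    have "card S \<le> card (set (cols U))" using S by (simp add: card_mono maximal_def)
    also have "\<dots> < length (cols U)" using nd card_distinct[of "cols U"] card_length[of "cols U"] by linarith
    finally show False using rank_card_indpt[OF U S] rk U by simp
  qed
  show ?thesis
  proof (rule ccontr)
    assume "v \<noteq> 0\<^sub>v k"
    then show False using lin_depI[OF U v(1) _ v(2) dist] full_rank_lin_indpt[OF U rk dist] by blast
  qed
qed

section \<open>The Gram matrix, its eigenvalues and the condition number\<close>

lemma gram_entry:
  assumes "U \<in> carrier_mat m k" "i < k" "j < k"
  shows "(transpose_mat U * U) $$ (i, j) = (\<Sum>r<m. U $$ (r, i) * U $$ (r, j))"
  using assms by (simp add: scalar_prod_def atLeast0LessThan)

lemma gram_quad:
  "quad k (\<lambda>i j. \<Sum>r<m. u i r * u j r) x = (\<Sum>r<m. (\<Sum>j<k. x j * u j r)\<^sup>2)"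
proof -
  have "quad k (\<lambda>i j. \<Sum>r<m. u i r * u j r) x = (\<Sum>i<k. \<Sum>j<k. \<Sum>r<m. (x i * u i r) * (x j * u j r))"
    by (simp add: quad_def sum_distrib_left sum_distrib_right algebra_simps)
  also have "\<dots> = (\<Sum>i<k. \<Sum>r<m. \<Sum>j<k. (x i * u i r) * (x j * u j r))"
    by (intro sum.cong refl sum.swap)
  also have "\<dots> = (\<Sum>r<m. \<Sum>i<k. \<Sum>j<k. (x i * u i r) * (x j * u j r))" by (rule sum.swap)
  finally show ?thesis by (simp add: power2_eq_square sum_product)
qed

lemma gram_eigenvalueI:
  fixes U :: "real mat"
  assumes U: "U \<in> carrier_mat m k" and c: "\<And>i. i < k \<Longrightarrow> (\<Sum>j<k. (\<Sum>r<m. U $$ (r, i) * U $$ (r, j)) * c j) = e * c i"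
    and i: "i < k" "c i \<noteq> 0"
  shows "eigenvalue (transpose_mat U * U) e"
proof -
  let ?G = "transpose_mat U * U"
  have G: "?G \<in> carrier_mat k k" using U by simp
  have "?G *\<^sub>v vec k c = e \<cdot>\<^sub>v vec k c"
  proof (rule eq_vecI)
    fix i assume "i < dim_vec (e \<cdot>\<^sub>v vec k c)"
    then have i: "i < k" by simp
    have "(?G *\<^sub>v vec k c) $ i = row ?G i \<bullet> vec k c"
      by (rule index_mult_mat_vec) (use i carrier_matD(1)[OF G] in simp)
    also have "\<dots> = (\<Sum>j\<in>{0..<k}. row ?G i $ j * vec k c $ j)" by (simp only: scalar_prod_def dim_vec)
    also have "\<dots> = (\<Sum>j<k. (\<Sum>r<m. U $$ (r, i) * U $$ (r, j)) * c j)"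
    proof (intro sum.cong)
      fix j assume "j \<in> {..<k}"
      then have j: "j < k" by simp
      have "row ?G i $ j = ?G $$ (i, j)" using i j G by (intro index_row(1)) auto
      then show "row ?G i $ j * vec k c $ j = (\<Sum>r<m. U $$ (r, i) * U $$ (r, j)) * c j"
        using gram_entry[OF U i j] j by simp
    qed auto
    finally show "(?G *\<^sub>v vec k c) $ i = (e \<cdot>\<^sub>v vec k c) $ i" using c[OF i] i by simp
  qed (use U in simp)
  moreover have "vec k c \<noteq> 0\<^sub>v k" using i by (metis index_vec index_zero_vec(1))
  ultimately have "eigenvector ?G (vec k c) e" using U by (simp add: eigenvector_def)
  then show ?thesis unfolding eigenvalue_def by blast
qed

lemma gram_eigenvalueD:
  fixes U :: "real mat"
  assumes U: "U \<in> carrier_mat m k" and e: "eigenvalue (transpose_mat U * U) e"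
  shows "0 \<le> e"
proof -
  let ?G = "transpose_mat U * U"
  have G: "?G \<in> carrier_mat k k" using U by simp
  obtain v where v: "v \<in> carrier_vec k" "v \<noteq> 0\<^sub>v k" "?G *\<^sub>v v = e \<cdot>\<^sub>v v"
    using e G unfolding eigenvalue_def eigenvector_def by auto
  have "v \<bullet> (?G *\<^sub>v v) = (U *\<^sub>v v) \<bullet> (U *\<^sub>v v)"
  proof -
    have "?G *\<^sub>v v = transpose_mat U *\<^sub>v (U *\<^sub>v v)" using U v by (intro assoc_mult_mat_vec) auto
    then show ?thesis using transpose_vec_mult_scalar[OF U v(1), of "U *\<^sub>v v"] U v
      by (simp add: comm_scalar_prod[of _ k])
  qed
  also have "v \<bullet> (?G *\<^sub>v v) = e * (v \<bullet> v)" using v by simp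
  finally have "0 \<le> e * (v \<bullet> v)" by (simp add: scalar_prod_def sum_nonneg)
  moreover have "0 < v \<bullet> v"
  proof -
    obtain i where i: "i < k" "v $ i \<noteq> 0" using v(1,2) by (metis carrier_vecD eq_vecI index_zero_vec)
    have "0 < v $ i * v $ i" using i(2) by (metis mult_eq_0_iff not_real_square_gt_zero)
    also have "\<dots> \<le> (\<Sum>j<k. v $ j * v $ j)" using i(1) by (intro member_le_sum) auto
    finally show ?thesis using v(1) by (simp add: scalar_prod_def atLeast0LessThan)
  qed
  ultimately show ?thesis by (simp add: zero_le_mult_iff)
qed

lemma finite_singular_values: "U \<in> carrier_mat m k \<Longrightarrow> finite (nonzero_singular_values U)"
proof -
  assume U: "U \<in> carrier_mat m k"
  let ?G = "transpose_mat U * U"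
  have G: "?G \<in> carrier_mat k k" using U by simp
  have "finite {e. poly (char_poly ?G) e = 0}"
    using degree_monic_char_poly[OF G] by (intro poly_roots_finite) auto
  then have "finite {e. eigenvalue ?G e}" by (simp add: eigenvalue_root_char_poly[OF G])
  moreover have "nonzero_singular_values U \<subseteq> sqrt ` {e. eigenvalue ?G e}"
    by (auto simp: nonzero_singular_values_def)
  ultimately show ?thesis by (meson finite_imageI finite_subset)
qed

lemma singular_values_pos: "U \<in> carrier_mat m k \<Longrightarrow> s \<in> nonzero_singular_values U \<Longrightarrow> 0 < s"
  using gram_eigenvalueD[of U m k] by (auto simp: nonzero_singular_values_def less_le)

lemma cond_number_nonneg:
  assumes "U \<in> carrier_mat m k" "nonzero_singular_values U \<noteq> {}"
  shows "0 \<le> cond_number U"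
  using assms singular_values_pos[OF assms(1)] finite_singular_values[OF assms(1)]
  unfolding cond_number_def by (intro divide_nonneg_nonneg less_imp_le) (metis Max_in, metis Min_in)

text \<open>The extreme values of the Gram form on the sphere are attained at eigenvectors, so their
  roots are singular values in the sense of the definition. Full rank makes the form positive
  definite; hence its minimum is a nonzero eigenvalue, and \<open>s\<close>, the least nonzero
  singular value, bounds the form from below.\<close>

theorem singular_value_bounds:
  fixes U :: "real mat"
  assumes U: "U \<in> carrier_mat m k" and r: "mat_rank U = k" and k: "1 \<le> k"
  shows "\<exists>s>0. 0 \<le> cond_number U \<and> (\<forall>x. s\<^sup>2 * (\<Sum>j<k. (x j)\<^sup>2) \<le> (\<Sum>r<m. (\<Sum>j<k. x j * U $$ (r, j))\<^sup>2) \<and>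
    (\<Sum>r<m. (\<Sum>j<k. x j * U $$ (r, j))\<^sup>2) \<le> (cond_number U * s)\<^sup>2 * (\<Sum>j<k. (x j)\<^sup>2))"
proof -
  define u where "u j r = U $$ (r, j)" for j r
  define G where "G i j = (\<Sum>r<m. u i r * u j r)" for i j
  have sym: "G i j = G j i" for i j by (simp add: G_def mult.commute)
  have Q: "quad k G x = (\<Sum>r<m. (\<Sum>j<k. x j * u j r)\<^sup>2)" for x unfolding G_def by (rule gram_quad)
  have Qpos: "0 < quad k G c" if "(\<Sum>i<k. (c i)\<^sup>2) = 1" for c
  proof -
    have "quad k G c \<noteq> 0"
    proof
      assume "quad k G c = 0"
      then have z: "(\<Sum>j<k. c j * u j r) = 0" if "r < m" for r using that by (simp add: Q sum_nonneg_eq_0_iff)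
      have "U *\<^sub>v vec k c = 0\<^sub>v m"
        using U z by (intro eq_vecI) (auto simp: scalar_prod_def atLeast0LessThan u_def mult.commute)
      from full_rank_injective[OF U r _ this] have "vec k c = 0\<^sub>v k" by simp
      then have "c i = 0" if "i < k" for i using that by (metis index_vec index_zero_vec(1))
      then show False using that by simp
    qed
    moreover have "0 \<le> quad k G c" by (simp add: Q sum_nonneg)
    ultimately show ?thesis by simp
  qed
  have ev: "quad k G c = e" if n: "(\<Sum>i<k. (c i)\<^sup>2) = 1" and e: "\<forall>i<k. (\<Sum>j<k. G i j * c j) = e * c i" for c e
  proof -
    have "quad k G c = (\<Sum>i<k. c i * (\<Sum>j<k. G i j * c j))"
      by (simp add: quad_def sum_distrib_left algebra_simps)
    also have "\<dots> = (\<Sum>i<k. e * (c i)\<^sup>2)" using e by (intro sum.cong) (auto simp: power2_eq_square)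
    finally show ?thesis using n by (simp add: sum_distrib_left[symmetric])
  qed
  have mem: "sqrt e \<in> nonzero_singular_values U" "0 < e"
    if n: "(\<Sum>i<k. (c i)\<^sup>2) = 1" and e: "\<forall>i<k. (\<Sum>j<k. G i j * c j) = e * c i" for c e
  proof -
    show "0 < e" using Qpos[OF n] ev[OF n e] by simp
    obtain i where i: "i < k" "c i \<noteq> 0" using n by (metis (mono_tags, lifting) lessThan_iff power_zero_numeral sum.neutral zero_neq_one)
    have "eigenvalue (transpose_mat U * U) e"
      by (rule gram_eigenvalueI[where c = c and i = i, OF U]) (use e i in \<open>simp_all add: G_def u_def\<close>)
    then show "sqrt e \<in> nonzero_singular_values U" using \<open>0 < e\<close> by (auto simp: nonzero_singular_values_def)
  qed
  have "\<exists>e c. (\<Sum>i<k. (c i)\<^sup>2) = 1 \<and> (\<forall>i<k. (\<Sum>j<k. G i j * c j) = e * c i) \<and>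
      (\<forall>x. e * (\<Sum>i<k. (x i)\<^sup>2) \<le> quad k G x)"
    by (rule rayleigh_min[OF k]) (metis sym)
  then obtain e1 c1 where 1: "(\<Sum>i<k. (c1 i)\<^sup>2) = 1" "\<forall>i<k. (\<Sum>j<k. G i j * c1 j) = e1 * c1 i"
    "\<forall>x. e1 * (\<Sum>i<k. (x i)\<^sup>2) \<le> quad k G x"
    by (elim exE conjE)
  \<comment> \<open>The largest eigenvalue is found as minus the least one of the negated
    form.\<close>
  have "\<exists>e c. (\<Sum>i<k. (c i)\<^sup>2) = 1 \<and> (\<forall>i<k. (\<Sum>j<k. - G i j * c j) = e * c i) \<and>
      (\<forall>x. e * (\<Sum>i<k. (x i)\<^sup>2) \<le> quad k (\<lambda>i j. - G i j) x)"
    by (rule rayleigh_min[OF k]) (metis sym)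
  then obtain e2 c2 where 2: "(\<Sum>i<k. (c2 i)\<^sup>2) = 1" "\<forall>i<k. (\<Sum>j<k. - G i j * c2 j) = e2 * c2 i"
    "\<forall>x. e2 * (\<Sum>i<k. (x i)\<^sup>2) \<le> quad k (\<lambda>i j. - G i j) x"
    by (elim exE conjE)
  have neg: "quad k (\<lambda>i j. - G i j) x = - quad k G x" for x by (simp add: quad_def sum_negf)
  have two': "\<forall>i<k. (\<Sum>j<k. G i j * c2 j) = - e2 * c2 i"
  proof (intro allI impI)
    fix i assume "i < k"
    then have "(\<Sum>j<k. - G i j * c2 j) = e2 * c2 i" using 2(2) by blast
    then show "(\<Sum>j<k. G i j * c2 j) = - e2 * c2 i" by (simp add: sum_negf)
  qed
  define S where "S = nonzero_singular_values U"
  have fin: "finite S" unfolding S_def by (rule finite_singular_values[OF U])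
  have m1: "sqrt e1 \<in> S" "0 < e1" and m2: "sqrt (- e2) \<in> S" "0 < - e2"
    using mem[OF 1(1,2)] mem[OF 2(1) two'] by (simp_all add: S_def)
  define s where "s = Min S"
  have s0: "0 < s" unfolding s_def S_def
    by (rule singular_values_pos[OF U]) (use Min_in[OF fin] m1 in \<open>auto simp: S_def\<close>)
  have kap: "cond_number U * s = Max S" using s0 by (simp add: cond_number_def s_def S_def)
  have "s \<le> sqrt e1" unfolding s_def using fin m1 by simp
  then have s1: "s\<^sup>2 \<le> e1" using s0 m1(2) power_mono[of s "sqrt e1" 2] by simp
  have "sqrt (- e2) \<le> Max S" using fin m2 by simp
  then have s2: "- e2 \<le> (Max S)\<^sup>2" using m2(2) power_mono[of "sqrt (- e2)" "Max S" 2] by simp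
  have nn: "0 \<le> (\<Sum>i<k. (x i)\<^sup>2)" for x :: "nat \<Rightarrow> real" by (simp add: sum_nonneg)
  have lo: "s\<^sup>2 * (\<Sum>i<k. (x i)\<^sup>2) \<le> quad k G x" for x
    using mult_right_mono[OF s1 nn[of x]] 1(3) by (meson order_trans)
  have hi: "quad k G x \<le> (cond_number U * s)\<^sup>2 * (\<Sum>i<k. (x i)\<^sup>2)" for x
  proof -
    have "quad k G x \<le> - e2 * (\<Sum>i<k. (x i)\<^sup>2)" using 2(3)[rule_format, of x] unfolding neg by simp
    also have "\<dots> \<le> (Max S)\<^sup>2 * (\<Sum>i<k. (x i)\<^sup>2)" by (rule mult_right_mono[OF s2 nn])
    finally show ?thesis unfolding kap .
  qed
  have "0 \<le> cond_number U" by (rule cond_number_nonneg[OF U]) (use m1 in \<open>auto simp: S_def\<close>)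
  then show ?thesis using s0 lo hi unfolding Q u_def by blast
qed

text \<open>The first row of \<open>V\<close> is an eigenvector of the Gram matrix with eigenvalue
  1, so there is a nonzero singular value and the quotient is one of positive numbers. Nonnegativity
  lets the sum in the sample-size hypothesis dominate its other terms.\<close>

lemma cond_number_orthonormal_nonneg:
  assumes V: "V \<in> carrier_mat k d" and k: "1 \<le> k" and o: "orthonormal_rows V"
  shows "0 \<le> cond_number V"
proof (rule cond_number_nonneg[OF V])
  have oo: "(\<Sum>p<d. V $$ (i, p) * V $$ (j, p)) = (if i = j then 1 else 0)" if "i < k" "j < k" for i j
    using o V that unfolding orthonormal_rows_def by (simp add: scalar_prod_def atLeast0LessThan)
  have "(\<Sum>q<d. (\<Sum>r<k. V $$ (r, p) * V $$ (r, q)) * V $$ (0, q)) = 1 * V $$ (0, p)" for p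
  proof -
    have "(\<Sum>q<d. (\<Sum>r<k. V $$ (r, p) * V $$ (r, q)) * V $$ (0, q)) = (\<Sum>q<d. \<Sum>r<k. V $$ (r, p) * (V $$ (r, q) * V $$ (0, q)))"
      by (simp add: sum_distrib_right mult.assoc)
    also have "\<dots> = (\<Sum>r<k. \<Sum>q<d. V $$ (r, p) * (V $$ (r, q) * V $$ (0, q)))" by (rule sum.swap)
    also have "\<dots> = (\<Sum>r<k. V $$ (r, p) * (if r = 0 then 1 else 0))"
      using oo k by (intro sum.cong refl) (simp add: sum_distrib_left[symmetric])
    also have "\<dots> = V $$ (0, p)" using k by (simp add: if_distrib[of "\<lambda>c. _ * c"] cong: if_cong)
    finally show ?thesis by simp
  qed
  note eq = this
  have "\<exists>p<d. V $$ (0, p) \<noteq> 0"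
  proof (rule ccontr)
    assume "\<not> ?thesis"
    then have "(\<Sum>p<d. V $$ (0, p) * V $$ (0, p)) = 0" by (intro sum.neutral) auto
    then show False using oo[of 0 0] k by simp
  qed
  then obtain p where p: "p < d" "V $$ (0, p) \<noteq> 0" by blast
  from gram_eigenvalueI[OF V, of "\<lambda>p. V $$ (0, p)" 1 p, OF eq p] have "eigenvalue (transpose_mat V * V) 1" .
  then show "nonzero_singular_values V \<noteq> {}" by (auto simp: nonzero_singular_values_def)
qed

section \<open>Reasoning about programs\<close>

lemmas run_HFor = run.simps(7)

declare run_HFor [simp del]

text \<open>The frame condition used throughout: \<open>S\<close> and \<open>W\<close> bound the
  arrays and variables that may have changed. A command stays within its \<open>amods\<close> and
  \<open>mods\<close>, so facts about everything else survive it.\<close>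

definition agr :: "nat set \<Rightarrow> nat set \<Rightarrow> hst \<Rightarrow> hst \<Rightarrow> bool" where
  "agr S W h h' \<longleftrightarrow> (\<forall>r. r \<notin> S \<longrightarrow> ar h' r = ar h r) \<and> (\<forall>z. z \<notin> W \<longrightarrow> iv h' z = iv h z)"

lemma agr_ar: "agr S W h h' \<Longrightarrow> r \<notin> S \<Longrightarrow> ar h' r = ar h r"
  by (simp add: agr_def)

lemma agr_iv: "agr S W h h' \<Longrightarrow> z \<notin> W \<Longrightarrow> iv h' z = iv h z"
  by (simp add: agr_def)

lemma agr_refl: "agr S W h h"
  by (simp add: agr_def)

lemma agr_trans: "agr S W h h' \<Longrightarrow> agr S W h' h'' \<Longrightarrow> agr S W h h''"
  by (simp add: agr_def)

lemma agr_mono: "agr S W h h' \<Longrightarrow> S \<subseteq> S' \<Longrightarrow> W \<subseteq> W' \<Longrightarrow> agr S' W' h h'"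
  unfolding agr_def by (meson subsetD)

lemma agr_run: "agr (amods c) (mods c) h (run n c h)"
  by (simp add: agr_def)

lemma agr_setv: "x \<in> W \<Longrightarrow> agr S W h (setv h x i)"
  by (auto simp: agr_def)

text \<open>The step may use that everything outside the footprint of the loop is as it was at the
  start, so an invariant has to speak only of what the body changes.\<close>

lemma For_inv:
  assumes b: "b = min n (iv h y)" and 0: "I 0 h"
    and ins: "\<And>i h' z. I i h' \<Longrightarrow> I i (setv h' x z)"
    and step: "\<And>i h'. i < b \<Longrightarrow> I i h' \<Longrightarrow> agr (amods c) (insert x (mods c)) h h' \<Longrightarrow> iv h' x = i \<Longrightarrow> I (Suc i) (run n c h')"
  shows "I b (run n (HFor x y c) h)"
proof -
  define J where "J i h' \<longleftrightarrow> I i h' \<and> agr (amods c) (insert x (mods c)) h h'" for i h'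
  have "J b (hloop (run n c) x b h)"
  proof (rule hloop_inv)
    show "J 0 h" using 0 by (simp add: J_def agr_refl)
    fix i h' assume i: "i < b" and J: "J i h'"
    let ?h = "setv h' x i"
    have a: "agr (amods c) (insert x (mods c)) h ?h"
      using J unfolding J_def by (intro agr_trans[OF _ agr_setv]) auto
    have "agr (amods c) (insert x (mods c)) ?h (run n c ?h)"
      by (rule agr_mono[OF agr_run]) auto
    then have "agr (amods c) (insert x (mods c)) h (run n c ?h)" by (rule agr_trans[OF a])
    moreover have "I (Suc i) (run n c ?h)" using i J ins a unfolding J_def by (intro step) auto
    ultimately show "J (Suc i) (run n c ?h)" by (simp add: J_def)
  qed
  then show ?thesis using ins by (simp add: b J_def run_HFor)
qed

lemma For_ar:
  assumes b: "b = min n (iv h y)" and 0: "I 0 (ar h)"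
    and step: "\<And>i h'. i < b \<Longrightarrow> I i (ar h') \<Longrightarrow> agr (amods c) (insert x (mods c)) h h' \<Longrightarrow> iv h' x = i \<Longrightarrow> I (Suc i) (ar (run n c h'))"
  shows "I b (ar (run n (HFor x y c) h))"
  by (rule For_inv[where I = "\<lambda>i h. I i (ar h)", OF b]) (use 0 step in auto)

primrec rda :: "hrexp \<Rightarrow> nat set" where
  "rda (KC c) = {}"
| "rda (KL r e) = {r}"
| "rda (KN e) = {}"
| "rda (KA a b) = rda a \<union> rda b"
| "rda (KM a b) = rda a \<union> rda b"
| "rda (KT a b) = rda a \<union> rda b"
| "rda (KD a b) = rda a \<union> rda b"
| "rda (KQ a) = rda a"

lemma vi_cong: "iv h = iv h' \<Longrightarrow> vi n e h = vi n e h'"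
  by (induction e) auto

lemma vr_cong: "iv h = iv h' \<Longrightarrow> (\<And>r. r \<in> rda e \<Longrightarrow> ar h r = ar h' r) \<Longrightarrow> vr n e h = vr n e h'"
  by (induction e) (auto simp: vi_cong[of h h'])

definition HSum :: "nat \<Rightarrow> nat \<Rightarrow> nat \<Rightarrow> hrexp \<Rightarrow> hcom" where
  "HSum a x y e = HSeq (HSt a (HC 0) (KC 0)) (HFor x y (HSt a (HC 0) (KA (KL a (HC 0)) e)))"

lemma HSum_simps [simp]: "amods (HSum a x y e) = {a}" "mods (HSum a x y e) = {x}"
  "wf (HSum a x y e) \<longleftrightarrow> a < 32 \<and> wfr e \<and> x \<noteq> y"
  by (auto simp: HSum_def)

lemma run_HSum:
  assumes a: "a \<notin> rda e" and xy: "x \<noteq> y"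
  shows "ar (run n (HSum a x y e) h) a 0 = (\<Sum>i<min n (iv h y). vr n e (setv h x i))"
proof -
  let ?h = "h\<lparr>ar := (ar h)(a := (ar h a)(0 := 0))\<rparr>"
  let ?c = "HSt a (HC 0) (KA (KL a (HC 0)) e)"
  have "(\<lambda>i A. A a 0 = (\<Sum>j<i. vr n e (setv h x j))) (min n (iv h y)) (ar (run n (HFor x y ?c) ?h))"
  proof (rule For_ar)
    fix i h' assume "ar h' a 0 = (\<Sum>j<i. vr n e (setv h x j))"
      and ag: "agr (amods ?c) (insert x (mods ?c)) ?h h'" and ix: "iv h' x = i"
    moreover have "vr n e h' = vr n e (setv h x i)"
    proof (rule vr_cong)
      show "iv h' = iv (setv h x i)"
      proof
        fix z show "iv h' z = iv (setv h x i) z" using agr_iv[OF ag, of z] ix by (cases "z = x") auto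
      qed
      show "ar h' r = ar (setv h x i) r" if "r \<in> rda e" for r
      proof -
        have "r \<noteq> a" using that a by auto
        then show ?thesis using agr_ar[OF ag, of r] by simp
      qed
    qed
    ultimately show "ar (run n ?c h') a 0 = (\<Sum>j<Suc i. vr n e (setv h x j))" by simp
  qed simp_all
  then show ?thesis by (simp add: HSum_def)
qed

text \<open>Injectivity of \<open>idx\<close> means that each entry is written once; before its turn
  it still has its old value, which the step may read. This covers in-place updates.\<close>

lemma fill:
  assumes b: "b = min n (iv h y)" and inj: "inj_on idx {..<b}"
    and step: "\<And>i h'. i < b \<Longrightarrow> agr (amods c) (insert x (mods c)) h h' \<Longrightarrow> iv h' x = i \<Longrightarrow>
      (\<And>e. (\<forall>i'<i. e \<noteq> idx i') \<Longrightarrow> ar h' r e = ar h r e) \<Longrightarrow>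
      ar (run n c h') r = (ar h' r)(idx i := val i)"
  shows "i < b \<Longrightarrow> ar (run n (HFor x y c) h) r (idx i) = val i"
    and "(\<forall>i<b. e \<noteq> idx i) \<Longrightarrow> ar (run n (HFor x y c) h) r e = ar h r e"
proof -
  define I where "I i A \<longleftrightarrow> (\<forall>i'<i. A r (idx i') = val i') \<and> (\<forall>e. (\<forall>i'<i. e \<noteq> idx i') \<longrightarrow> A r e = ar h r e)" for i and A :: "nat \<Rightarrow> nat \<Rightarrow> real"
  have "I b (ar (run n (HFor x y c) h))"
  proof (rule For_ar[OF b])
    show "I 0 (ar h)" by (simp add: I_def)
    fix i h' assume i: "i < b" and I: "I i (ar h')" and ag: "agr (amods c) (insert x (mods c)) h h'" and ix: "iv h' x = i"
    have s: "ar (run n c h') r = (ar h' r)(idx i := val i)"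
      using I by (intro step[OF i ag ix]) (simp add: I_def)
    have "idx i' \<noteq> idx i" if "i' < i" for i' using inj that i by (auto simp: inj_on_def)
    then show "I (Suc i) (ar (run n c h'))" using I unfolding I_def s by (auto simp: less_Suc_eq)
  qed
  then show "i < b \<Longrightarrow> ar (run n (HFor x y c) h) r (idx i) = val i"
    "(\<forall>i<b. e \<noteq> idx i) \<Longrightarrow> ar (run n (HFor x y c) h) r e = ar h r e" by (simp_all add: I_def)
qed

lemma vfill:
  assumes b: "b = min n (iv h y)"
    and step: "\<And>i h'. i < b \<Longrightarrow> agr (amods c) (insert x (mods c)) h h' \<Longrightarrow> iv h' x = i \<Longrightarrow>
      (\<And>e. i \<le> e \<Longrightarrow> ar h' r e = ar h r e) \<Longrightarrow> ar (run n c h') r = (ar h' r)(i := val i)"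
  shows "i < b \<Longrightarrow> ar (run n (HFor x y c) h) r i = val i"
    and "b \<le> e \<Longrightarrow> ar (run n (HFor x y c) h) r e = ar h r e"
proof -
  have s: "ar (run n c h') r = (ar h' r)(i := val i)"
    if "i < b" "agr (amods c) (insert x (mods c)) h h'" "iv h' x = i" "\<And>e. (\<forall>i'<i. e \<noteq> i') \<Longrightarrow> ar h' r e = ar h r e" for i h'
    using that(4) by (intro step[OF that(1-3)]) auto
  note f = fill[where idx = "\<lambda>i. i" and r = r and val = val, OF b _ s]
  show "i < b \<Longrightarrow> ar (run n (HFor x y c) h) r i = val i" by (rule f(1)) simp_all
  show "b \<le> e \<Longrightarrow> ar (run n (HFor x y c) h) r e = ar h r e" by (rule f(2)) simp_all
qed

lemma cell2_inj:
  fixes n :: nat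
  assumes "j < n" "j' < n"
  shows "n * i + j = n * i' + j' \<longleftrightarrow> i = i' \<and> j = j'"
proof
  assume eq: "n * i + j = n * i' + j'"
  have "i = (n * i + j) div n" "i' = (n * i' + j') div n" using assms by simp_all
  then have "i = i'" using eq by simp
  then show "i = i' \<and> j = j'" using eq by simp
qed simp

text \<open>Addresses \<open>n * i + j\<close> with \<open>j < n\<close> are distinct, so again each
  entry is written once and its old value is available at that moment.\<close>

lemma matfill:
  assumes bi: "bi = min n (iv h yi)" and bj: "bj = min n (iv h yj)"
    and ne: "yj \<noteq> xi" "yj \<noteq> xj" "yj \<notin> mods c" "xi \<noteq> xj" "xi \<notin> mods c"
    and step: "\<And>i j h'. i < bi \<Longrightarrow> j < bj \<Longrightarrow> agr (amods c) (insert xi (insert xj (mods c))) h h' \<Longrightarrow>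
      iv h' xi = i \<Longrightarrow> iv h' xj = j \<Longrightarrow> ar h' r (n * i + j) = ar h r (n * i + j) \<Longrightarrow>
      ar (run n c h') r = (ar h' r)(n * i + j := val i j)"
    and ij: "i < bi" "j < bj"
  shows "ar (run n (HFor xi yi (HFor xj yj c)) h) r (n * i + j) = val i j"
proof -
  define W where "W = insert xi (insert xj (mods c))"
  define I where "I i A \<longleftrightarrow> (\<forall>i'<i. \<forall>j<bj. A r (n * i' + j) = val i' j) \<and> (\<forall>i'\<ge>i. \<forall>j<bj. A r (n * i' + j) = ar h r (n * i' + j))" for i and A :: "nat \<Rightarrow> nat \<Rightarrow> real"
  have "I bi (ar (run n (HFor xi yi (HFor xj yj c)) h))"
  proof (rule For_ar[OF bi])
    show "I 0 (ar h)" by (simp add: I_def)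
    fix i h' assume i: "i < bi" and I: "I i (ar h')"
      and ag0: "agr (amods (HFor xj yj c)) (insert xi (mods (HFor xj yj c))) h h'" and ix: "iv h' xi = i"
    have ag: "agr (amods c) W h h'" using ag0 by (simp add: W_def)
    have bj': "bj = min n (iv h' yj)" using agr_iv[OF ag, of yj] ne bj by (simp add: W_def)
    have jn: "j < n" if "j < bj" for j using that bj by simp
    have inj: "inj_on (\<lambda>j. n * i + j) {..<bj}" by (simp add: inj_on_def)
    have s: "ar (run n c h'') r = (ar h'' r)(n * i + j := val i j)"
      if j: "j < bj" and a: "agr (amods c) (insert xj (mods c)) h' h''" and jx: "iv h'' xj = j"
        and old: "\<And>e. (\<forall>j'<j. e \<noteq> n * i + j') \<Longrightarrow> ar h'' r e = ar h' r e" for j h''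
    proof (rule step[OF i j])
      have "agr (amods c) W h' h''" using a by (rule agr_mono) (auto simp: W_def)
      then show "agr (amods c) (insert xi (insert xj (mods c))) h h''" using agr_trans[OF ag] by (simp add: W_def)
      show "iv h'' xi = i" using agr_iv[OF a, of xi] ne ix by simp
      have "ar h'' r (n * i + j) = ar h' r (n * i + j)" by (rule old) simp
      also have "\<dots> = ar h r (n * i + j)" using I j unfolding I_def by simp
      finally show "ar h'' r (n * i + j) = ar h r (n * i + j)" .
    qed fact
    note f = fill[where idx = "\<lambda>j. n * i + j" and r = r and val = "val i", OF bj' inj s]
    have new: "ar (run n (HFor xj yj c) h') r (n * i + j) = val i j" if "j < bj" for j
      by (rule f(1)) (use that in auto)
    have old: "ar (run n (HFor xj yj c) h') r (n * i' + j) = ar h' r (n * i' + j)" if "i' \<noteq> i" "j < bj" for i' j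
      by (rule f(2)) (use that cell2_inj[OF jn jn] in auto)
    show "I (Suc i) (ar (run n (HFor xj yj c) h'))"
      unfolding I_def
    proof (intro conjI allI impI)
      fix i' j assume "i' < Suc i" "j < bj"
      then show "ar (run n (HFor xj yj c) h') r (n * i' + j) = val i' j"
        using new old[of i' j] I by (cases "i' = i") (auto simp: I_def)
    next
      fix i' j assume "Suc i \<le> i'" "j < bj"
      then show "ar (run n (HFor xj yj c) h') r (n * i' + j) = ar h r (n * i' + j)"
        using old[of i' j] I by (simp add: I_def)
    qed
  qed
  then show ?thesis using ij by (simp add: I_def)
qed

subsection \<open>The projection subroutine\<close>

abbreviation cell :: "nat \<Rightarrow> nat \<Rightarrow> nat \<Rightarrow> hrexp" where
  "cell r x y \<equiv> KL r (HA (HS x) (HV y))"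

abbreviation sca :: "nat \<Rightarrow> hrexp" where
  "sca r \<equiv> KL r (HC 0)"

abbreviation vec1 :: "nat \<Rightarrow> nat \<Rightarrow> hrexp" where
  "vec1 r x \<equiv> KL r (HV x)"

definition HNinit :: "nat \<Rightarrow> hcom" where
  "HNinit yD = HSeq (HFor 14 yD (HFor 15 yD (HSt 4 (HA (HS 14) (HV 15)) (KC 0))))
     (HFor 14 yD (HSt 4 (HA (HS 14) (HV 14)) (KC 1)))"

definition HNstep :: "nat \<Rightarrow> hcom" where
  "HNstep yD = HSeq (HFor 14 yD (HSeq (HSum 10 15 yD (KT (cell 4 14 15) (vec1 5 15))) (HSt 6 (HV 14) (sca 10))))
    (HSeq (HSum 17 15 yD (KT (vec1 5 15) (vec1 6 15)))
    (HIf (BR (sca 17) (KC 0)) HSkip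
       (HFor 14 yD (HFor 15 yD (HSt 4 (HA (HS 14) (HV 15))
          (KM (cell 4 14 15) (KD (KT (vec1 6 14) (vec1 6 15)) (sca 17))))))))"

text \<open>\<open>gen\<close> produces the rows one at a time in array 5, so the same routine
  serves three linear systems of different shapes without storing them.\<close>

definition HNPJ :: "nat \<Rightarrow> nat \<Rightarrow> hcom \<Rightarrow> hcom" where
  "HNPJ yD yc gen = HSeq (HNinit yD) (HFor 13 yc (HSeq gen (HNstep yD)))"

lemma HN_simps [simp]:
  "amods (HNinit yD) = {4}" "mods (HNinit yD) = {14, 15}"
  "amods (HNstep yD) = {4, 6, 10, 17}" "mods (HNstep yD) = {14, 15}"
  "amods (HNPJ yD yc gen) = {4, 6, 10, 17} \<union> amods gen" "mods (HNPJ yD yc gen) = {13, 14, 15} \<union> mods gen"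
  "wf (HNinit yD) \<longleftrightarrow> yD \<noteq> 14 \<and> yD \<noteq> 15" "wf (HNstep yD) \<longleftrightarrow> yD \<noteq> 14 \<and> yD \<noteq> 15"
  by (auto simp: HNinit_def HNstep_def HNPJ_def)

lemma wf_HNPJ [simp]:
  "wf (HNPJ yD yc gen) \<longleftrightarrow> yD \<noteq> 14 \<and> yD \<noteq> 15 \<and> wf gen \<and> yc \<notin> {13, 14, 15} \<and> 13 \<notin> mods gen \<and> yc \<notin> mods gen"
  by (auto simp: HNPJ_def)

lemma run_HNinit:
  assumes D: "D = min n (iv h yD)" and y: "yD \<noteq> 14" "yD \<noteq> 15" and ij: "i < D" "j < D"
  shows "ar (run n (HNinit yD) h) 4 (n * i + j) = (if i = j then 1 else 0)"
proof -
  let ?c1 = "HFor 14 yD (HFor 15 yD (HSt 4 (HA (HS 14) (HV 15)) (KC 0)))"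
  let ?c = "HSt 4 (HA (HS 14) (HV 14)) (KC 1)"
  let ?h1 = "run n ?c1 h"
  have 1: "ar ?h1 4 (n * i + j) = 0" if "i < D" "j < D" for i j
    by (rule matfill[where bi = D and bj = D and val = "\<lambda>_ _. 0"]) (use D y that in simp_all)
  have jn: "j < n" if "j < D" for j using that D by simp
  have D1: "D = min n (iv ?h1 yD)" using D y by simp
  have inj: "inj_on (\<lambda>i. n * i + i) {..<D}"
  proof (rule inj_onI)
    fix a b assume ab: "a \<in> {..<D}" "b \<in> {..<D}" and eq: "n * a + a = n * b + b"
    have "a < n" "b < n" using ab jn by auto
    from cell2_inj[OF this, of a b] show "a = b" using eq by simp
  qed
  note f = fill[where idx = "\<lambda>i. n * i + i" and r = 4 and val = "\<lambda>_. 1" and c = ?c and x = 14, OF D1 inj]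
  show ?thesis
  proof (cases "i = j")
    case True
    have "ar (run n (HFor 14 yD ?c) ?h1) 4 (n * i + i) = 1" by (rule f(1)) (use ij in simp_all)
    then show ?thesis using True by (simp add: HNinit_def)
  next
    case False
    have "ar (run n (HFor 14 yD ?c) ?h1) 4 (n * i + j) = ar ?h1 4 (n * i + j)"
    proof (rule f(2))
      show "\<forall>a<D. n * i + j \<noteq> n * a + a"
      proof (intro allI impI)
        fix a assume "a < D"
        then have "a < n" using jn by simp
        from cell2_inj[OF jn[OF ij(2)] this, of i a] show "n * i + j \<noteq> n * a + a" using False by simp
      qed
    qed simp
    then show ?thesis using False 1[OF ij] by (simp add: HNinit_def)
  qed
qed

lemma run_HNstep:
  assumes D: "D = min n (iv h yD)" and y: "yD \<noteq> 14" "yD \<noteq> 15"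
    and P: "\<And>i j. i < D \<Longrightarrow> j < D \<Longrightarrow> ar h 4 (n * i + j) = npj D a t i j"
    and row: "\<And>j. j < D \<Longrightarrow> ar h 5 j = a t j" and ij: "i < D" "j < D"
  shows "ar (run n (HNstep yD) h) 4 (n * i + j) = npj D a (Suc t) i j"
proof -
  let ?A = "HFor 14 yD (HSeq (HSum 10 15 yD (KT (cell 4 14 15) (vec1 5 15))) (HSt 6 (HV 14) (sca 10)))"
  let ?B = "HSum 17 15 yD (KT (vec1 5 15) (vec1 6 15))"
  let ?C = "HFor 14 yD (HFor 15 yD (HSt 4 (HA (HS 14) (HV 15))
          (KM (cell 4 14 15) (KD (KT (vec1 6 14) (vec1 6 15)) (sca 17)))))"
  define hv where "hv i = dotp D (npj D a t i) (a t)" for i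
  define s where "s = dotp D (a t) hv"
  let ?h1 = "run n ?A h"
  let ?h2 = "run n ?B ?h1"
  have 6: "ar ?h1 6 i = hv i" if i: "i < D" for i
  proof (rule vfill(1)[OF D])
    fix i h' assume i: "i < D" and ag: "agr (amods (HSeq (HSum 10 15 yD (KT (cell 4 14 15) (vec1 5 15))) (HSt 6 (HV 14) (sca 10))))
       (insert 14 (mods (HSeq (HSum 10 15 yD (KT (cell 4 14 15) (vec1 5 15))) (HSt 6 (HV 14) (sca 10))))) h h'" and ix: "iv h' 14 = i"
    have D': "min n (iv h' yD) = D" using agr_iv[OF ag, of yD] y D by simp
    have "ar (run n (HSum 10 15 yD (KT (cell 4 14 15) (vec1 5 15))) h') 10 0 = hv i"
      using y agr_ar[OF ag, of 4] agr_ar[OF ag, of 5] P row i ix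
      by (subst run_HSum) (simp_all add: D' hv_def dotp_def)
    then show "ar (run n (HSeq (HSum 10 15 yD (KT (cell 4 14 15) (vec1 5 15))) (HSt 6 (HV 14) (sca 10))) h') 6 = (ar h' 6)(i := hv i)"
      using ix by simp
  qed fact
  have D1: "min n (iv ?h1 yD) = D" using y D by simp
  have s2: "ar ?h2 17 0 = s"
    using y row 6 by (subst run_HSum) (simp_all add: D[symmetric] s_def dotp_def)
  have P2: "ar ?h2 4 (n * i + j) = npj D a t i j" if "i < D" "j < D" for i j using P[OF that] by simp
  have h2: "ar ?h2 6 i = hv i" if "i < D" for i using 6[OF that] by simp
  have npj: "npj D a (Suc t) i j = (if s \<le> 0 then npj D a t i j else npj D a t i j - hv i * hv j / s)" for i j
    by (simp add: Let_def hv_def[symmetric] s_def hv_def[abs_def, symmetric])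
  show ?thesis
  proof (cases "s \<le> 0")
    case True
    then have "run n (HNstep yD) h = ?h2" using s2 by (simp add: HNstep_def)
    then show ?thesis using P2[OF ij] npj True by simp
  next
    case False
    then have e: "run n (HNstep yD) h = run n ?C ?h2" using s2 by (simp add: HNstep_def)
    have D2: "D = min n (iv ?h2 yD)" using y D by simp
    have "ar (run n ?C ?h2) 4 (n * i + j) = npj D a t i j - hv i * hv j / s"
    proof (rule matfill[where bi = D and bj = D])
      fix i j h' assume i: "i < D" and j: "j < D" and ix: "iv h' 14 = i" "iv h' 15 = j" and
        ag: "agr (amods (HSt 4 (HA (HS 14) (HV 15)) (KM (cell 4 14 15) (KD (KT (vec1 6 14) (vec1 6 15)) (sca 17)))))
           (insert 14 (insert 15 (mods (HSt 4 (HA (HS 14) (HV 15)) (KM (cell 4 14 15) (KD (KT (vec1 6 14) (vec1 6 15)) (sca 17))))))) ?h2 h'"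
        and old: "ar h' 4 (n * i + j) = ar ?h2 4 (n * i + j)"
      show "ar (run n (HSt 4 (HA (HS 14) (HV 15)) (KM (cell 4 14 15) (KD (KT (vec1 6 14) (vec1 6 15)) (sca 17)))) h') 4 =
        (ar h' 4)(n * i + j := npj D a t i j - hv i * hv j / s)"
        using ix old P2[OF i j] h2[OF i] h2[OF j] s2 agr_ar[OF ag, of 6] agr_ar[OF ag, of 17] by simp
    qed (use D2 y ij in simp_all)
    then show ?thesis using e npj False by simp
  qed
qed

theorem run_HNPJ:
  assumes D: "D = min n (iv h yD)" and T: "T = min n (iv h yc)"
    and y: "yD \<notin> {13, 14, 15} \<union> mods gen" "yc \<noteq> 13" "yc \<notin> {14, 15} \<union> mods gen" and g4: "4 \<notin> amods gen" "13 \<notin> mods gen"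
    and gen: "\<And>t h'. t < T \<Longrightarrow> agr ({4, 6, 10, 17} \<union> amods gen) ({13, 14, 15} \<union> mods gen) h h' \<Longrightarrow> iv h' 13 = t \<Longrightarrow>
       (\<And>j. j < D \<Longrightarrow> ar (run n gen h') 5 j = a t j)"
    and ij: "i < D" "j < D"
  shows "ar (run n (HNPJ yD yc gen) h) 4 (n * i + j) = npj D a T i j"
proof -
  let ?h = "run n (HNinit yD) h"
  let ?c = "HSeq gen (HNstep yD)"
  have T1: "T = min n (iv ?h yc)" using T y by simp
  define I where "I t A \<longleftrightarrow> (\<forall>i<D. \<forall>j<D. A 4 (n * i + j) = npj D a t i j)" for t and A :: "nat \<Rightarrow> nat \<Rightarrow> real"
  have "I T (ar (run n (HFor 13 yc ?c) ?h))"
  proof (rule For_ar[OF T1])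
    show "I 0 (ar ?h)" using run_HNinit[OF D] y by (simp add: I_def)
    fix t h' assume t: "t < T" and I: "I t (ar h')" and ag: "agr (amods ?c) (insert 13 (mods ?c)) ?h h'" and it: "iv h' 13 = t"
    have "agr ({4, 6, 10, 17} \<union> amods gen) ({13, 14, 15} \<union> mods gen) h ?h"
      by (rule agr_mono[OF agr_run]) auto
    moreover have "agr ({4, 6, 10, 17} \<union> amods gen) ({13, 14, 15} \<union> mods gen) ?h h'"
      by (rule agr_mono[OF ag]) auto
    ultimately have ag': "agr ({4, 6, 10, 17} \<union> amods gen) ({13, 14, 15} \<union> mods gen) h h'" by (rule agr_trans)
    have D': "D = min n (iv (run n gen h') yD)" using agr_iv[OF ag', of yD] D y by simp
    have row: "ar (run n gen h') 5 j = a t j" if "j < D" for j by (rule gen[OF t ag' it that])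
    have P: "ar (run n gen h') 4 (n * i + j) = npj D a t i j" if "i < D" "j < D" for i j
      using I that g4 by (simp add: I_def)
    show "I (Suc t) (ar (run n ?c h'))"
      unfolding I_def using run_HNstep[OF D' _ _ P row] y by simp
  qed
  then show ?thesis using ij by (simp add: I_def HNPJ_def)
qed

section \<open>The program\<close>

text \<open>
  Variables: 0 to 5 hold \<open>m\<close>, \<open>d\<close>, \<open>m + d\<close>, \<open>n\<close>, 2 and \<open>N\<close>; 6 counts the recovered rows of \<open>V\<close>, 7 is the
  output position, 8 holds \<open>k + 1\<close>; the others are loop counters. Arrays: 0 input, 1 output, 2 \<open>yv\<close>, 3 \<open>M\<close>,
  4 the current projection, 5 the row to be projected out, 7 the current candidate, 8 the recovered rows, 9 the
  hidden layer; 11 and 12 hold \<open>F\<close> and \<open>lam\<close>; the others are temporaries.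
\<close>

primrec pw :: "hrexp \<Rightarrow> nat \<Rightarrow> hrexp" where
  "pw e 0 = KC 1"
| "pw e (Suc p) = KT e (pw e p)"

lemma pw_simps [simp]: "vr n (pw e p) h = vr n e h ^ p" "wfr e \<Longrightarrow> wfr (pw e p)" "rda (pw e p) \<subseteq> rda e"
  by (induction p) auto

text \<open>The input array holds the \<open>m\<close> rows of \<open>A\<close> followed by those of
  \<open>X\<close>; \<open>HS 0\<close> is \<open>n * m\<close>, the offset of
  \<open>X\<close>.\<close>

abbreviation Xc :: "nat \<Rightarrow> nat \<Rightarrow> hrexp" where
  "Xc p i \<equiv> KL 0 (HA (HA (HS 0) (HS p)) (HV i))"

definition PN :: "nat \<Rightarrow> hcom" where
  "PN P = HFor 10 3 (HIf (BR (pw (KA (KN (HV 5)) (KC 1)) P) (KN (HV 3))) (HInc 5) HSkip)"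

definition Py :: hcom where
  "Py = HFor 10 3 (HSeq (HSum 10 17 0 (KT (KL 0 (HA (HS 0) (HV 17))) (cell 0 17 10))) (HSt 2 (HV 10) (sca 10)))"

definition PM :: hcom where
  "PM = HSeq (HFor 10 1 (HFor 11 1 (HSeq (HSum 10 17 3 (KT (vec1 2 17) (KT (Xc 10 17) (Xc 11 17))))
        (HSt 3 (HA (HS 10) (HV 11)) (KD (sca 10) (KN (HV 3)))))))
    (HSeq (HSum 12 17 3 (vec1 2 17))
      (HFor 10 1 (HSt 3 (HA (HS 10) (HV 10)) (KM (cell 3 10 10) (KD (sca 12) (KN (HV 3)))))))"

definition PF :: hcom where
  "PF = HSeq (HSt 11 (HC 0) (KC 0)) (HSeq
    (HFor 10 1 (HSeq (HSum 10 17 1 (KT (cell 3 10 17) (cell 3 10 17))) (HSt 11 (HC 0) (KA (sca 11) (sca 10)))))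
    (HSt 11 (HC 0) (KQ (sca 11))))"

text \<open>Row \<open>p0\<close> is replaced by zero instead of being skipped, so that the routine
  always receives \<open>d\<close> rows; a zero row has zero residual and leaves the projection as
  it is.\<close>

definition gen1 :: hcom where
  "gen1 = HSeq (HFor 16 1 (HSt 5 (HV 16) (cell 3 13 16))) (HSeq (HSt 5 (HV 13) (KM (vec1 5 13) (sca 12)))
    (HIf (BI (HV 13) (HV 11)) (HIf (BI (HV 11) (HV 13)) (HFor 16 1 (HSt 5 (HV 16) (KC 0))) HSkip) HSkip))"

text \<open>The grid starts at \<open>- 2 * F\<close> and has \<open>n\<close> points in steps of
  \<open>4 * F / n\<close>, which covers the eigenvalues sought. The candidate satisfies all rows
  but \<open>p0\<close> exactly, so its residual is the single number kept in array 13.\<close>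

definition Pcand :: hcom where
  "Pcand = HSeq (HSt 12 (HC 0) (KT (sca 11) (KM (KD (KT (KC 4) (KN (HV 10))) (KN (HV 3))) (KC 2))))
    (HSeq (HNPJ 1 1 gen1)
    (HSeq (HFor 16 1 (HSt 7 (HV 16) (cell 4 16 11)))
    (HSeq (HSum 13 16 1 (KT (cell 3 11 16) (vec1 7 16)))
    (HSeq (HSt 13 (HC 0) (KM (sca 13) (KT (sca 12) (vec1 7 11))))
    (HSum 14 16 1 (KT (vec1 7 16) (vec1 7 16)))))))"

definition gen2 :: hcom where
  "gen2 = HSeq (HSum 18 16 1 (KT (vec1 7 16) (Xc 16 13))) (HSeq (HFor 16 0 (HSt 5 (HV 16) (cell 0 16 13)))
    (HIf (BR (sca 18) (KC 0)) (HFor 16 1 (HSt 5 (HA (HV 0) (HV 16)) (KC 0)))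
      (HFor 16 1 (HSt 5 (HA (HV 0) (HV 16)) (Xc 16 13)))))"

text \<open>Projects the vector with first part zero and second part \<open>w\<close> onto the
  solutions \<open>(\<alpha>, \<beta>)\<close> and keeps the second part of the result. Array 16
  receives its squared norm, zero for the wrong sign.\<close>

definition Prefine :: hcom where
  "Prefine = HSeq (HNPJ 2 5 gen2) (HSeq
    (HFor 16 1 (HSeq (HSum 10 17 1 (KT (KL 4 (HA (HA (HS 0) (HS 16)) (HA (HV 0) (HV 17)))) (vec1 7 17))) (HSt 20 (HV 16) (sca 10))))
    (HSum 16 17 1 (KT (vec1 20 17) (vec1 20 17))))"

text \<open>The recovered rows are orthonormal, so the sum of their inner products with the
  normalised new vector is 1 if that vector is among them and 0 otherwise; comparison with
  \<open>1 / 2\<close> decides whether it is new.\<close>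

definition Ptot :: hcom where
  "Ptot = HSeq (HFor 16 1 (HSt 22 (HV 16) (KD (vec1 20 16) (KQ (sca 16))))) (HSeq (HSt 15 (HC 0) (KC 0))
    (HFor 18 6 (HSeq (HSum 10 17 1 (KT (cell 8 18 17) (vec1 22 17))) (HSt 15 (HC 0) (KA (sca 15) (sca 10))))))"

definition Pappend :: hcom where
  "Pappend = HSeq (HFor 16 1 (HSt 8 (HA (HS 6) (HV 16)) (vec1 22 16))) (HInc 6)"

text \<open>An eigenvector has no preferred sign. As each call starts by negating the candidate, two
  calls try both signs; for the wrong one the refined vector is zero and nothing is
  appended.\<close>

definition Ptry :: hcom where
  "Ptry = HSeq (HFor 16 1 (HSt 7 (HV 16) (KM (KC 0) (vec1 7 16)))) (HSeq Prefine (HIf (BR (sca 16) (KC 0)) HSkip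
    (HSeq Ptot (HIf (BR (sca 15) (KC (1 / 2))) Pappend HSkip))))"

definition Pbody :: hcom where
  "Pbody = HSeq Pcand (HIf (BR (KT (KT (sca 11) (sca 11)) (sca 14)) (KT (pw (KN (HV 5)) 24) (KT (sca 13) (sca 13)))) HSkip
    (HIf (BR (KT (pw (KN (HV 5)) 10) (KT (sca 12) (sca 12))) (KT (sca 11) (sca 11))) HSkip (HFor 12 4 Ptry)))"

definition Pmain :: hcom where
  "Pmain = HFor 10 3 (HFor 11 1 Pbody)"

definition Pb :: hcom where
  "Pb = HFor 10 6 (HFor 11 5 (HSeq (HSum 10 17 1 (KT (cell 8 10 17) (Xc 17 11)))
    (HIf (BR (sca 10) (KC 0)) (HSt 9 (HA (HS 10) (HV 11)) (KC 0)) (HSt 9 (HA (HS 10) (HV 11)) (sca 10)))))"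

definition gen3 :: hcom where
  "gen3 = HSeq (HFor 16 6 (HSt 5 (HV 16) (cell 9 16 13))) (HSt 5 (HV 6) (cell 0 10 13))"

text \<open>For a row of \<open>U\<close>, the null vectors of the system formed by the hidden
  outputs and the corresponding row of \<open>A\<close> are the multiples of
  \<open>(- u, 1)\<close>, so a ratio of projection entries gives \<open>u\<close>. The output
  address is a running position in variable 7, since \<open>r * k + l\<close> would require a
  multiplication of indices.\<close>

definition PU :: hcom where
  "PU = HFor 10 0 (HSeq (HNPJ 8 5 gen3)
    (HFor 11 6 (HSeq (HSt 1 (HV 7) (KD (KM (KC 0) (cell 4 11 6)) (KL 4 (HA (HS 6) (HV 6))))) (HInc 7))))"

definition PV :: hcom where
  "PV = HFor 10 6 (HFor 11 1 (HSeq (HSt 1 (HV 7) (cell 8 10 11)) (HInc 7)))"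

definition Prog :: "nat \<Rightarrow> hcom" where
  "Prog P = HSeq (PN P) (HSeq Py (HSeq PM (HSeq PF (HSeq Pmain
    (HSeq (HSeq (HFor 10 6 (HInc 8)) (HInc 8)) (HSeq Pb (HSeq PU PV)))))))"

lemmas prog_defs = PN_def Py_def PM_def PF_def gen1_def Pcand_def gen2_def Prefine_def Ptot_def Pappend_def
  Ptry_def Pbody_def Pmain_def Pb_def gen3_def PU_def PV_def Prog_def

lemma mods_prog [simp]:
  "mods (PN P) = {5, 10}" "amods (PN P) = {}"
  "mods Py = {10, 17}" "amods Py = {2, 10}"
  "mods PM = {10, 11, 17}" "amods PM = {3, 10, 12}"
  "mods PF = {10, 17}" "amods PF = {10, 11}"
  "mods gen1 = {16}" "amods gen1 = {5}"
  "mods Pcand = {13, 14, 15, 16}" "amods Pcand = {4, 5, 6, 7, 10, 12, 13, 14, 17}"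
  "mods gen2 = {16}" "amods gen2 = {5, 18}"
  "mods Prefine = {13, 14, 15, 16, 17}" "amods Prefine = {4, 5, 6, 10, 16, 17, 18, 20}"
  "mods Ptot = {16, 17, 18}" "amods Ptot = {10, 15, 22}"
  "mods Pappend = {6, 16}" "amods Pappend = {8}"
  "mods Ptry = {6, 13, 14, 15, 16, 17, 18}" "amods Ptry = {4, 5, 6, 7, 8, 10, 15, 16, 17, 18, 20, 22}"
  "mods Pbody = {6, 12, 13, 14, 15, 16, 17, 18}" "amods Pbody = {4, 5, 6, 7, 8, 10, 12, 13, 14, 15, 16, 17, 18, 20, 22}"
  "mods Pb = {10, 11, 17}" "amods Pb = {9, 10}"
  "mods gen3 = {16}" "amods gen3 = {5}"
  by (auto simp: prog_defs)

lemma wf_Prog: "wf (Prog P)"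
  by (simp add: prog_defs)

text \<open>After \<open>n\<close> passes the counter has either stopped or reached
  \<open>n\<close>, and in the second case \<open>n < (n + 1) ^ P\<close> holds anyway.\<close>

lemma run_PN:
  assumes P: "1 \<le> P" and h: "iv h 3 = n" "iv h 5 = 0" and n: "1 \<le> n"
  shows "\<exists>N\<le>n. iv (run n (PN P) h) 5 = N \<and> real N ^ P \<le> real n \<and> real n < (real N + 1) ^ P"
proof -
  let ?c = "HIf (BR (pw (KA (KN (HV 5)) (KC 1)) P) (KN (HV 3))) (HInc 5) HSkip"
  define I where "I i h' \<longleftrightarrow> iv h' 5 \<le> i \<and> real (iv h' 5) ^ P \<le> real n \<and> (iv h' 5 = i \<or> real n < (real (iv h' 5) + 1) ^ P)" for i and h' :: hst
  have "I n (run n (HFor 10 3 ?c) h)"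
  proof (rule For_inv)
    show "n = min n (iv h 3)" using h by simp
    show "I 0 h" using h P by (simp add: I_def power_0_left)
    show "I i (setv h' 10 z)" if "I i h'" for i h' z using that by (simp add: I_def)
    fix i h' assume I: "I i h'" and ag: "agr (amods ?c) (insert 10 (mods ?c)) h h'"
    have 3: "iv h' 3 = n" using agr_iv[OF ag, of 3] h by simp
    show "I (Suc i) (run n ?c h')"
      using I 3 by (cases "(real (iv h' 5) + 1) ^ P \<le> real n") (auto simp: I_def add.commute)
  qed
  then obtain "iv (run n (PN P) h) 5 \<le> n" "real (iv (run n (PN P) h) 5) ^ P \<le> real n"
    "iv (run n (PN P) h) 5 = n \<or> real n < (real (iv (run n (PN P) h) 5) + 1) ^ P"
    by (simp add: I_def PN_def)
  moreover have "real n < (real n + 1) ^ P"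
  proof -
    have "real n < (real n + 1) ^ 1" by simp
    also have "\<dots> \<le> (real n + 1) ^ P" using P by (intro power_increasing) auto
    finally show ?thesis .
  qed
  ultimately show ?thesis by auto
qed

locale run_data =
  fixes m d n N :: nat and A x :: "nat \<Rightarrow> nat \<Rightarrow> real"
  assumes sz: "m + d + 1 \<le> n" "2 \<le> n" "N \<le> n" and d0: "0 < d"
begin

lemma mins [simp]: "min n m = m" "min n d = d" "min n (m + d) = m + d" "min n N = N" "min n 2 = 2"
  using sz by auto

definition yv :: "nat \<Rightarrow> real" where "yv i = (\<Sum>r<m. x r 0 * A r i)"

definition M :: "nat \<Rightarrow> nat \<Rightarrow> real" where
  "M p q = (\<Sum>i<n. yv i * (x i p * x i q)) / n - (if p = q then (\<Sum>i<n. yv i) / n else 0)"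

definition F :: real where "F = sqrt (\<Sum>p<d. \<Sum>q<d. M p q * M p q)"

definition lam :: "nat \<Rightarrow> real" where "lam li = F * (4 * real li / real n - 2)"

definition rowsE :: "nat \<Rightarrow> nat \<Rightarrow> nat \<Rightarrow> nat \<Rightarrow> real" where
  "rowsE li p0 t q = (if t = p0 then 0 else M t q - (if t = q then lam li else 0))"

definition xc :: "nat \<Rightarrow> nat \<Rightarrow> nat \<Rightarrow> real" where "xc li p0 q = npj d (rowsE li p0) d q p0"

definition tt :: "nat \<Rightarrow> nat \<Rightarrow> real" where "tt li p0 = dotp d (M p0) (xc li p0) - lam li * xc li p0 p0"

text \<open>The residual must be below \<open>N\<close> to the power -12 and the shift above \<open>N\<close> to the power -5, relative to \<open>F\<close>;
  the second test discards the kernel of \<open>M\<close>.\<close>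

definition check :: "nat \<Rightarrow> nat \<Rightarrow> bool" where
  "check li p0 \<longleftrightarrow> real N ^ 24 * (tt li p0 * tt li p0) < F * F * dotp d (xc li p0) (xc li p0) \<and>
     F * F < real N ^ 10 * (lam li * lam li)"

text \<open>The coefficients of equation \<open>i\<close>, with the gate taken from \<open>w\<close>
  in place of the unknown \<open>v j\<close>; coordinates below \<open>m\<close> belong to
  \<open>\<alpha>\<close>, the others to \<open>\<beta>\<close>.\<close>

definition rowsR :: "(nat \<Rightarrow> real) \<Rightarrow> nat \<Rightarrow> nat \<Rightarrow> real" where
  "rowsR w i j = (if j < m then A j i else if dotp d w (x i) \<le> 0 then 0 else x i (j - m))"

definition vv :: "(nat \<Rightarrow> real) \<Rightarrow> nat \<Rightarrow> real" where
  "vv w p = (\<Sum>q<d. npj (m + d) (rowsR w) N (m + p) (m + q) * w q)"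

definition base0 :: "hst \<Rightarrow> bool" where
  "base0 h \<longleftrightarrow> iv h 0 = m \<and> iv h 1 = d \<and> iv h 2 = m + d \<and> iv h 3 = n \<and> iv h 4 = 2 \<and> iv h 5 = N \<and>
    (\<forall>r<m. \<forall>i<n. ar h 0 (n * r + i) = A r i) \<and> (\<forall>p<d. \<forall>i<n. ar h 0 (n * m + n * p + i) = x i p)"

definition base :: "hst \<Rightarrow> bool" where
  "base h \<longleftrightarrow> base0 h \<and> (\<forall>p<d. \<forall>q<d. ar h 3 (n * p + q) = M p q) \<and> ar h 11 0 = F"

lemma base0D: "base0 h \<Longrightarrow> iv h 0 = m" "base0 h \<Longrightarrow> iv h 1 = d" "base0 h \<Longrightarrow> iv h 2 = m + d" "base0 h \<Longrightarrow> iv h 3 = n"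
  "base0 h \<Longrightarrow> iv h 4 = 2" "base0 h \<Longrightarrow> iv h 5 = N" "base0 h \<Longrightarrow> r < m \<Longrightarrow> i < n \<Longrightarrow> ar h 0 (n * r + i) = A r i"
  "base0 h \<Longrightarrow> p < d \<Longrightarrow> i < n \<Longrightarrow> ar h 0 (n * m + n * p + i) = x i p"
  by (simp_all add: base0_def)

lemma baseD: "base h \<Longrightarrow> base0 h" "base h \<Longrightarrow> p < d \<Longrightarrow> q < d \<Longrightarrow> ar h 3 (n * p + q) = M p q" "base h \<Longrightarrow> ar h 11 0 = F"
  by (simp_all add: base_def)

lemma base0_agr: "base0 h \<Longrightarrow> agr S W h h' \<Longrightarrow> 0 \<notin> S \<Longrightarrow> W \<inter> {0, 1, 2, 3, 4, 5} = {} \<Longrightarrow> base0 h'"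
  by (simp add: base0_def agr_def)

lemma base_agr: "base h \<Longrightarrow> agr S W h h' \<Longrightarrow> S \<inter> {0, 3, 11} = {} \<Longrightarrow> W \<inter> {0, 1, 2, 3, 4, 5} = {} \<Longrightarrow> base h'"
  by (simp add: base_def base0_def agr_def)

lemma base_setv: "base h \<Longrightarrow> z \<notin> {0, 1, 2, 3, 4, 5} \<Longrightarrow> base (setv h z i)"
  by (rule base_agr[OF _ agr_setv[of z "{z}"]]) auto

section \<open>Correctness of the individual blocks of the program\<close>

lemma run_Py:
  assumes b: "base0 h" and i: "i < n"
  shows "ar (run n Py h) 2 i = yv i"
  unfolding Py_def
proof (rule vfill(1)[where b = n])
  show "n = min n (iv h 3)" using base0D[OF b] by simp
  fix i h' assume i: "i < n" and ix: "iv h' 10 = i" and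
    ag: "agr (amods (HSeq (HSum 10 17 0 (KT (KL 0 (HA (HS 0) (HV 17))) (cell 0 17 10))) (HSt 2 (HV 10) (sca 10))))
       (insert 10 (mods (HSeq (HSum 10 17 0 (KT (KL 0 (HA (HS 0) (HV 17))) (cell 0 17 10))) (HSt 2 (HV 10) (sca 10))))) h h'"
  have b': "base0 h'" by (rule base0_agr[OF b ag]) auto
  have z: "ar h' 0 (n * m + r) = x r 0" if "r < m" "0 < d" for r
    using base0D(8)[OF b', of 0 r] that sz by simp
  show "ar (run n (HSeq (HSum 10 17 0 (KT (KL 0 (HA (HS 0) (HV 17))) (cell 0 17 10))) (HSt 2 (HV 10) (sca 10))) h') 2 =
    (ar h' 2)(i := yv i)"
  proof -
    have "ar (run n (HSum 10 17 0 (KT (KL 0 (HA (HS 0) (HV 17))) (cell 0 17 10))) h') 10 0 = yv i" if "0 < d"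
      using base0D[OF b'] z that i ix by (subst run_HSum) (simp_all add: yv_def)
    then show ?thesis using ix d0 by simp
  qed
qed fact

lemma run_PM:
  assumes b: "base0 h" and y: "\<And>i. i < n \<Longrightarrow> ar h 2 i = yv i" and pq: "p < d" "q < d"
  shows "ar (run n PM h) 3 (n * p + q) = M p q"
proof -
  let ?c = "HSeq (HSum 10 17 3 (KT (vec1 2 17) (KT (Xc 10 17) (Xc 11 17)))) (HSt 3 (HA (HS 10) (HV 11)) (KD (sca 10) (KN (HV 3))))"
  let ?s = "HSum 12 17 3 (vec1 2 17)"
  let ?c2 = "HSt 3 (HA (HS 10) (HV 10)) (KM (cell 3 10 10) (KD (sca 12) (KN (HV 3))))"
  define G where "G p q = (\<Sum>i<n. yv i * (x i p * x i q)) / n" for p q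
  let ?h1 = "run n (HFor 10 1 (HFor 11 1 ?c)) h"
  let ?h2 = "run n ?s ?h1"
  have 1: "ar ?h1 3 (n * p + q) = G p q" if "p < d" "q < d" for p q
  proof (rule matfill[where bi = d and bj = d])
    fix p q h' assume p: "p < d" and q: "q < d" and ix: "iv h' 10 = p" "iv h' 11 = q" and
      ag: "agr (amods ?c) (insert 10 (insert 11 (mods ?c))) h h'"
    have b': "base0 h'" by (rule base0_agr[OF b ag]) auto
    have y': "ar h' 2 i = yv i" if "i < n" for i using agr_ar[OF ag, of 2] y[OF that] by simp
    have "ar (run n (HSum 10 17 3 (KT (vec1 2 17) (KT (Xc 10 17) (Xc 11 17)))) h') 10 0 = (\<Sum>i<n. yv i * (x i p * x i q))"
      using base0D[OF b'] y' ix p q by (subst run_HSum) simp_all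
    then show "ar (run n ?c h') 3 = (ar h' 3)(n * p + q := G p q)"
      using ix base0D(4)[OF b'] by (simp add: G_def)
  qed (use base0D[OF b] that in simp_all)
  have b1: "base0 ?h1" by (rule base0_agr[OF b agr_run]) auto
  have s: "ar ?h2 12 0 = (\<Sum>i<n. yv i)"
    using base0D[OF b1] y by (subst run_HSum) simp_all
  have b2: "base0 ?h2" by (rule base0_agr[OF b1 agr_run]) auto
  have g2: "ar ?h2 3 (n * p + q) = G p q" if "p < d" "q < d" for p q using 1[OF that] by simp
  have D: "d = min n (iv ?h2 1)" using base0D[OF b2] by simp
  have dn: "p < n" if "p < d" for p using that sz by simp
  have inj: "inj_on (\<lambda>i. n * i + i) {..<d}"
  proof (rule inj_onI)
    fix a b assume ab: "a \<in> {..<d}" "b \<in> {..<d}" and eq: "n * a + a = n * b + b"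
    have "a < n" "b < n" using ab dn by auto
    from cell2_inj[OF this, of a b] show "a = b" using eq by simp
  qed
  have st: "ar (run n ?c2 h') 3 = (ar h' 3)(n * i + i := M i i)"
    if "i < d" "agr (amods ?c2) (insert 10 (mods ?c2)) ?h2 h'" "iv h' 10 = i"
      "\<And>e. (\<forall>i'<i. e \<noteq> n * i' + i') \<Longrightarrow> ar h' 3 e = ar ?h2 3 e" for i h'
  proof -
    have "ar h' 3 (n * i + i) = ar ?h2 3 (n * i + i)"
    proof (rule that(4), intro allI impI)
      fix i' assume "i' < i"
      then show "n * i + i \<noteq> n * i' + i'" using inj_onD[OF inj, of i i'] that(1) by auto
    qed
    moreover have "ar h' 12 0 = (\<Sum>i<n. yv i)" using agr_ar[OF that(2), of 12] s by simp
    moreover have "iv h' 3 = n" using agr_iv[OF that(2), of 3] base0D[OF b2] by simp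
    ultimately show ?thesis using that(1,3) g2 by (simp add: M_def G_def)
  qed
  note f = fill[where idx = "\<lambda>i. n * i + i" and r = 3 and val = "\<lambda>i. M i i" and c = ?c2 and x = 10, OF D inj st]
  have e: "run n PM h = run n (HFor 10 1 ?c2) ?h2" by (simp add: PM_def)
  show ?thesis
  proof (cases "p = q")
    case True
    have "ar (run n (HFor 10 1 ?c2) ?h2) 3 (n * p + p) = M p p" by (rule f(1)) (use pq in simp_all)
    then show ?thesis using True e by simp
  next
    case False
    have "ar (run n (HFor 10 1 ?c2) ?h2) 3 (n * p + q) = ar ?h2 3 (n * p + q)"
    proof (rule f(2))
      show "\<forall>a<d. n * p + q \<noteq> n * a + a"
      proof (intro allI impI)
        fix a assume "a < d"
        then have "a < n" using dn by simp
        from cell2_inj[OF dn[OF pq(2)] this, of p a] show "n * p + q \<noteq> n * a + a" using False by simp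
      qed
    qed simp_all
    then show ?thesis using False e g2[OF pq] by (simp add: M_def G_def)
  qed
qed

lemma run_PF:
  assumes b: "base0 h" and M: "\<And>p q. p < d \<Longrightarrow> q < d \<Longrightarrow> ar h 3 (n * p + q) = M p q"
  shows "ar (run n PF h) 11 0 = F"
proof -
  let ?c = "HSeq (HSum 10 17 1 (KT (cell 3 10 17) (cell 3 10 17))) (HSt 11 (HC 0) (KA (sca 11) (sca 10)))"
  let ?h = "run n (HSt 11 (HC 0) (KC 0)) h"
  have b1: "base0 ?h" by (rule base0_agr[OF b agr_run]) auto
  define I where "I i A \<longleftrightarrow> A 11 0 = (\<Sum>p<i. \<Sum>q<d. M p q * M p q)" for i and A :: "nat \<Rightarrow> nat \<Rightarrow> real"
  have "I d (ar (run n (HFor 10 1 ?c) ?h))"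
  proof (rule For_ar)
    show "I 0 (ar ?h)" by (simp add: I_def)
    show "d = min n (iv ?h 1)" using base0D[OF b1] by simp
    fix i h' assume i: "i < d" and I: "I i (ar h')"
      and ag: "agr (amods ?c) (insert 10 (mods ?c)) ?h h'" and ix: "iv h' 10 = i"
    have b': "base0 h'" by (rule base0_agr[OF b1 ag]) auto
    have M': "ar h' 3 (n * i + q) = M i q" if "q < d" for q using agr_ar[OF ag, of 3] M[OF i that] by simp
    have "ar (run n (HSum 10 17 1 (KT (cell 3 10 17) (cell 3 10 17))) h') 10 0 = (\<Sum>q<d. M i q * M i q)"
      using base0D[OF b'] M' ix by (subst run_HSum) simp_all
    then show "I (Suc i) (ar (run n ?c h'))" using I by (simp add: I_def)
  qed
  then show ?thesis by (simp add: PF_def F_def I_def)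
qed

lemma run_gen1:
  assumes b: "base h" and ix: "iv h 13 = t" "iv h 11 = p0" and t: "t < d" "p0 < d" and l: "ar h 12 0 = lam li" and j: "j < d"
  shows "ar (run n gen1 h) 5 j = rowsE li p0 t j"
proof -
  let ?A = "HFor 16 1 (HSt 5 (HV 16) (cell 3 13 16))"
  let ?B = "HSt 5 (HV 13) (KM (vec1 5 13) (sca 12))"
  let ?C = "HFor 16 1 (HSt 5 (HV 16) (KC 0))"
  let ?h1 = "run n ?A h"
  let ?h2 = "run n ?B ?h1"
  have D: "d = min n (iv h 1)" using base0D[OF baseD(1)[OF b]] by simp
  have 1: "ar ?h1 5 j = M t j" if "j < d" for j
  proof (rule vfill(1)[OF D])
    fix i h' assume i: "i < d" and ag: "agr (amods (HSt 5 (HV 16) (cell 3 13 16))) (insert 16 (mods (HSt 5 (HV 16) (cell 3 13 16)))) h h'"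
      and "iv h' 16 = i"
    then show "ar (run n (HSt 5 (HV 16) (cell 3 13 16)) h') 5 = (ar h' 5)(i := M t i)"
      using agr_ar[OF ag, of 3] agr_iv[OF ag, of 13] baseD(2)[OF b t(1) i] ix by simp
  qed fact
  have 2: "ar ?h2 5 j = M t j - (if t = j then lam li else 0)" if "j < d" for j
    using 1[OF that] 1[OF t(1)] ix l by simp
  have iv2: "iv ?h2 13 = t" "iv ?h2 11 = p0" "iv ?h2 1 = d" using ix base0D[OF baseD(1)[OF b]] by simp_all
  have run: "run n gen1 h = (if t \<le> p0 then (if p0 \<le> t then run n ?C ?h2 else ?h2) else ?h2)"
    unfolding gen1_def run.simps(5) run.simps(6) vb.simps vi.simps iv2 by simp
  show ?thesis
  proof (cases "t = p0")
    case True
    have "ar (run n ?C ?h2) 5 j = 0"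
      by (rule vfill(1)[where b = d and val = "\<lambda>_. 0"]) (use iv2 j in simp_all)
    then show ?thesis using run True by (simp add: rowsE_def)
  next
    case False
    then have "run n gen1 h = ?h2" using run by auto
    then show ?thesis using 2[OF j] False by (simp add: rowsE_def)
  qed
qed

lemma run_Pcand:
  assumes b: "base h" and ix: "iv h 10 = li" "iv h 11 = p0" and p0: "p0 < d"
  defines "h' \<equiv> run n Pcand h"
  shows "ar h' 12 0 = lam li" "\<And>q. q < d \<Longrightarrow> ar h' 7 q = xc li p0 q" "ar h' 13 0 = tt li p0"
    "ar h' 14 0 = dotp d (xc li p0) (xc li p0)"
proof -
  let ?A = "HSt 12 (HC 0) (KT (sca 11) (KM (KD (KT (KC 4) (KN (HV 10))) (KN (HV 3))) (KC 2)))"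
  let ?C = "HFor 16 1 (HSt 7 (HV 16) (cell 4 16 11))"
  let ?D = "HSum 13 16 1 (KT (cell 3 11 16) (vec1 7 16))"
  let ?E = "HSt 13 (HC 0) (KM (sca 13) (KT (sca 12) (vec1 7 11)))"
  let ?G = "HSum 14 16 1 (KT (vec1 7 16) (vec1 7 16))"
  note b0 = base0D[OF baseD(1)[OF b]]
  let ?h1 = "run n ?A h"
  have l1: "ar ?h1 12 0 = lam li" using baseD(3)[OF b] b0 ix by (simp add: lam_def)
  have b1: "base ?h1" by (rule base_agr[OF b agr_run]) auto
  let ?h2 = "run n (HNPJ 1 1 gen1) ?h1"
  have P2: "ar ?h2 4 (n * i + j) = npj d (rowsE li p0) d i j" if "i < d" "j < d" for i j
  proof (rule run_HNPJ)
    show "d = min n (iv ?h1 1)" "d = min n (iv ?h1 1)" using b0 by simp_all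
    fix t h' j assume t: "t < d" and ag: "agr ({4, 6, 10, 17} \<union> amods gen1) ({13, 14, 15} \<union> mods gen1) ?h1 h'"
      and it: "iv h' 13 = t" and j: "j < d"
    have b': "base h'" by (rule base_agr[OF b1 ag]) auto
    have i11: "iv h' 11 = p0" using agr_iv[OF ag, of 11] ix by simp
    have l': "ar h' 12 0 = lam li" using agr_ar[OF ag, of 12] l1 by simp
    show "ar (run n gen1 h') 5 j = rowsE li p0 t j" by (rule run_gen1[OF b' it i11 t p0 l' j])
  qed (use that in simp_all)
  have b2: "base ?h2" by (rule base_agr[OF b1 agr_run]) auto
  let ?h3 = "run n ?C ?h2"
  have D2: "d = min n (iv ?h2 1)" using base0D[OF baseD(1)[OF b2]] by simp
  have x3: "ar ?h3 7 q = xc li p0 q" if "q < d" for q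
  proof (rule vfill(1)[OF D2])
    fix i h' assume i: "i < d" and ag: "agr (amods (HSt 7 (HV 16) (cell 4 16 11))) (insert 16 (mods (HSt 7 (HV 16) (cell 4 16 11)))) ?h2 h'"
      and "iv h' 16 = i"
    then show "ar (run n (HSt 7 (HV 16) (cell 4 16 11)) h') 7 = (ar h' 7)(i := xc li p0 i)"
      using agr_ar[OF ag, of 4] agr_iv[OF ag, of 11] P2[OF i p0] ix by (simp add: xc_def)
  qed fact
  have b3: "base ?h3" by (rule base_agr[OF b2 agr_run]) auto
  let ?h4 = "run n ?D ?h3"
  have t4: "ar ?h4 13 0 = dotp d (M p0) (xc li p0)"
    using base0D[OF baseD(1)[OF b3]] baseD(2)[OF b3 p0] x3 ix by (subst run_HSum) (simp_all add: dotp_def)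
  let ?h5 = "run n ?E ?h4"
  have l4: "ar ?h4 12 0 = lam li" using l1 by simp
  have x4: "ar ?h4 7 q = xc li p0 q" if "q < d" for q using x3[OF that] by simp
  have t5: "ar ?h5 13 0 = tt li p0" using t4 l4 x4[OF p0] ix by (simp add: tt_def)
  let ?h6 = "run n ?G ?h5"
  have e: "h' = ?h6" by (simp add: h'_def Pcand_def)
  have x5: "ar ?h5 7 q = xc li p0 q" if "q < d" for q using x4[OF that] by simp
  have "min n (iv ?h5 1) = d" using b0 by simp
  then show "ar h' 14 0 = dotp d (xc li p0) (xc li p0)"
    unfolding e using x5 by (subst run_HSum) (simp_all add: dotp_def)
  show "ar h' 12 0 = lam li" using l4 unfolding e by simp
  show "ar h' 7 q = xc li p0 q" if "q < d" for q using x5[OF that] unfolding e by simp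
  show "ar h' 13 0 = tt li p0" using t5 unfolding e by simp
qed

lemma run_gen2:
  assumes b: "base h" and ix: "iv h 13 = i" and i: "i < N" and w: "\<And>q. q < d \<Longrightarrow> ar h 7 q = w q" and j: "j < m + d"
  shows "ar (run n gen2 h) 5 j = rowsR w i j"
proof -
  let ?A = "HSum 18 16 1 (KT (vec1 7 16) (Xc 16 13))"
  let ?B = "HFor 16 0 (HSt 5 (HV 16) (cell 0 16 13))"
  let ?C0 = "HSt 5 (HA (HV 0) (HV 16)) (KC 0)"
  let ?C1 = "HSt 5 (HA (HV 0) (HV 16)) (Xc 16 13)"
  have i': "i < n" using i sz by simp
  note b0 = base0D[OF baseD(1)[OF b]]
  let ?h1 = "run n ?A h"
  have s1: "ar ?h1 18 0 = dotp d w (x i)"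
    using b0 w ix i' by (subst run_HSum) (simp_all add: dotp_def)
  have b1: "base ?h1" by (rule base_agr[OF b agr_run]) auto
  let ?h2 = "run n ?B ?h1"
  have D1: "m = min n (iv ?h1 0)" using b0 by simp
  have a2: "ar ?h2 5 r = A r i" if "r < m" for r
  proof (rule vfill(1)[OF D1])
    fix r h' assume r: "r < m" and ag: "agr (amods (HSt 5 (HV 16) (cell 0 16 13))) (insert 16 (mods (HSt 5 (HV 16) (cell 0 16 13)))) ?h1 h'"
      and "iv h' 16 = r"
    then show "ar (run n (HSt 5 (HV 16) (cell 0 16 13)) h') 5 = (ar h' 5)(r := A r i)"
      using agr_ar[OF ag, of 0] agr_iv[OF ag, of 13] b0(7)[OF r i'] ix by simp
  qed fact
  have b2: "base ?h2" by (rule base_agr[OF b1 agr_run]) auto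
  have s2: "ar ?h2 18 0 = dotp d w (x i)" using s1 by simp
  have i2: "iv ?h2 13 = i" "iv ?h2 0 = m" using ix b0 by simp_all
  have D2: "d = min n (iv ?h2 1)" using b0 by simp
  define val where "val q = (if dotp d w (x i) \<le> 0 then 0 else x i q)" for q
  let ?C = "if dotp d w (x i) \<le> 0 then ?C0 else ?C1"
  have run: "run n gen2 h = run n (HFor 16 1 ?C) ?h2" using s2 by (simp add: gen2_def)
  have st: "ar (run n ?C h') 5 = (ar h' 5)(m + q := val q)"
    if "q < d" "agr (amods ?C) (insert 16 (mods ?C)) ?h2 h'" "iv h' 16 = q" for q h'
  proof -
    have ag: "agr {5} {16} ?h2 h'" by (rule agr_mono[OF that(2)]) auto
    have "iv h' 0 = m" "iv h' 13 = i" using agr_iv[OF ag, of 0] agr_iv[OF ag, of 13] i2 by simp_all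
    moreover have "ar h' 0 (n * m + n * q + i) = x i q"
      using agr_ar[OF ag, of 0] base0D(8)[OF baseD(1)[OF b2] that(1) i'] by simp
    ultimately show ?thesis using that(3) by (simp add: val_def)
  qed
  have inj: "inj_on (\<lambda>q. m + q) {..<d}" by (simp add: inj_on_def)
  note f = fill[where idx = "\<lambda>q. m + q" and r = 5 and val = val and c = ?C and x = 16, OF D2 inj]
  show ?thesis
  proof (cases "j < m")
    case True
    have "ar (run n (HFor 16 1 ?C) ?h2) 5 j = ar ?h2 5 j" by (rule f(2)) (use True st in auto)
    then show ?thesis using True a2 run by (simp add: rowsR_def)
  next
    case False
    define q where "q = j - m"
    have q: "q < d" "j = m + q" using False j by (simp_all add: q_def)
    have "ar (run n (HFor 16 1 ?C) ?h2) 5 (m + q) = val q" by (rule f(1)) (use q st in auto)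
    then show ?thesis using False run q by (simp add: rowsR_def val_def)
  qed
qed

lemma run_Prefine:
  assumes b: "base h" and w: "\<And>q. q < d \<Longrightarrow> ar h 7 q = w q"
  defines "h' \<equiv> run n Prefine h"
  shows "\<And>p. p < d \<Longrightarrow> ar h' 20 p = vv w p" "ar h' 16 0 = dotp d (vv w) (vv w)"
proof -
  let ?c = "HSeq (HSum 10 17 1 (KT (KL 4 (HA (HA (HS 0) (HS 16)) (HA (HV 0) (HV 17)))) (vec1 7 17))) (HSt 20 (HV 16) (sca 10))"
  let ?h1 = "run n (HNPJ 2 5 gen2) h"
  note b0 = base0D[OF baseD(1)[OF b]]
  have P: "ar ?h1 4 (n * i + j) = npj (m + d) (rowsR w) N i j" if "i < m + d" "j < m + d" for i j
  proof (rule run_HNPJ)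
    show "m + d = min n (iv h 2)" "N = min n (iv h 5)" using b0 by simp_all
    fix t h' j assume t: "t < N" and ag: "agr ({4, 6, 10, 17} \<union> amods gen2) ({13, 14, 15} \<union> mods gen2) h h'"
      and it: "iv h' 13 = t" and j: "j < m + d"
    have b': "base h'" by (rule base_agr[OF b ag]) auto
    have w': "ar h' 7 q = w q" if "q < d" for q using agr_ar[OF ag, of 7] w[OF that] by simp
    show "ar (run n gen2 h') 5 j = rowsR w t j" by (rule run_gen2[OF b' it t w' j])
  qed (use that in simp_all)
  have b1: "base ?h1" by (rule base_agr[OF b agr_run]) auto
  have w1: "ar ?h1 7 q = w q" if "q < d" for q using w[OF that] by simp
  have D1: "d = min n (iv ?h1 1)" using b0 by simp
  let ?h2 = "run n (HFor 16 1 ?c) ?h1"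
  have v: "ar ?h2 20 p = vv w p" if "p < d" for p
  proof (rule vfill(1)[OF D1])
    fix p h' assume p: "p < d" and ag: "agr (amods ?c) (insert 16 (mods ?c)) ?h1 h'" and ix: "iv h' 16 = p"
    have b': "base h'" by (rule base_agr[OF b1 ag]) auto
    have w': "ar h' 7 q = w q" if "q < d" for q using agr_ar[OF ag, of 7] w1[OF that] by simp
    have P': "ar h' 4 (n * m + n * p + (m + q)) = npj (m + d) (rowsR w) N (m + p) (m + q)" if "q < d" for q
      using agr_ar[OF ag, of 4] P[of "m + p" "m + q"] p that by (simp add: distrib_left)
    have "ar (run n (HSum 10 17 1 (KT (KL 4 (HA (HA (HS 0) (HS 16)) (HA (HV 0) (HV 17)))) (vec1 7 17))) h') 10 0 = vv w p"
      using base0D[OF baseD(1)[OF b']] w' P' ix by (subst run_HSum) (simp_all add: vv_def)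
    then show "ar (run n ?c h') 20 = (ar h' 20)(p := vv w p)" using ix by simp
  qed fact
  have e: "h' = run n (HSum 16 17 1 (KT (vec1 20 17) (vec1 20 17))) ?h2" by (simp add: h'_def Prefine_def)
  show "ar h' 20 p = vv w p" if "p < d" for p using v[OF that] unfolding e by simp
  have "min n (iv ?h2 1) = d" using b0 by simp
  then show "ar h' 16 0 = dotp d (vv w) (vv w)"
    unfolding e using v by (subst run_HSum) (simp_all add: dotp_def)
qed

lemma run_Ptot:
  assumes b: "base h" and c: "iv h 6 = c" "c \<le> n" and V: "\<And>l q. l < c \<Longrightarrow> q < d \<Longrightarrow> ar h 8 (n * l + q) = V l q"
    and v: "\<And>q. q < d \<Longrightarrow> ar h 20 q = f q" and s: "ar h 16 0 = s"
  defines "h' \<equiv> run n Ptot h"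
  shows "\<And>q. q < d \<Longrightarrow> ar h' 22 q = f q / sqrt s" "ar h' 15 0 = (\<Sum>l<c. dotp d (V l) (\<lambda>q. f q / sqrt s))"
proof -
  let ?A = "HFor 16 1 (HSt 22 (HV 16) (KD (vec1 20 16) (KQ (sca 16))))"
  let ?B = "HSt 15 (HC 0) (KC 0)"
  let ?c = "HSeq (HSum 10 17 1 (KT (cell 8 18 17) (vec1 22 17))) (HSt 15 (HC 0) (KA (sca 15) (sca 10)))"
  note b0 = base0D[OF baseD(1)[OF b]]
  have D: "d = min n (iv h 1)" using b0 by simp
  let ?h1 = "run n ?A h"
  have 1: "ar ?h1 22 q = f q / sqrt s" if "q < d" for q
  proof (rule vfill(1)[OF D])
    fix i h' assume i: "i < d" and ag: "agr (amods (HSt 22 (HV 16) (KD (vec1 20 16) (KQ (sca 16)))))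
       (insert 16 (mods (HSt 22 (HV 16) (KD (vec1 20 16) (KQ (sca 16)))))) h h'" and "iv h' 16 = i"
    then show "ar (run n (HSt 22 (HV 16) (KD (vec1 20 16) (KQ (sca 16)))) h') 22 = (ar h' 22)(i := f i / sqrt s)"
      using agr_ar[OF ag, of 20] agr_ar[OF ag, of 16] v[OF i] s by simp
  qed fact
  let ?h2 = "run n ?B ?h1"
  have b2: "base ?h2"
  proof -
    have "base ?h1" by (rule base_agr[OF b agr_run]) auto
    then show ?thesis by (rule base_agr[OF _ agr_run]) auto
  qed
  have "(\<lambda>i A. A 15 0 = (\<Sum>l<i. dotp d (V l) (\<lambda>q. f q / sqrt s))) c (ar (run n (HFor 18 6 ?c) ?h2))"
  proof (rule For_ar)
    show "c = min n (iv ?h2 6)" using c by simp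
    fix i h' assume i: "i < c" and I: "ar h' 15 0 = (\<Sum>l<i. dotp d (V l) (\<lambda>q. f q / sqrt s))"
      and ag: "agr (amods ?c) (insert 18 (mods ?c)) ?h2 h'" and ix: "iv h' 18 = i"
    have b': "base h'" by (rule base_agr[OF b2 ag]) auto
    have V': "ar h' 8 (n * i + q) = V i q" if "q < d" for q using agr_ar[OF ag, of 8] V[OF i that] by simp
    have w': "ar h' 22 q = f q / sqrt s" if "q < d" for q using agr_ar[OF ag, of 22] 1[OF that] by simp
    have "ar (run n (HSum 10 17 1 (KT (cell 8 18 17) (vec1 22 17))) h') 10 0 = dotp d (V i) (\<lambda>q. f q / sqrt s)"
      using base0D[OF baseD(1)[OF b']] V' w' ix by (subst run_HSum) (simp_all add: dotp_def)
    then show "ar (run n ?c h') 15 0 = (\<Sum>l<Suc i. dotp d (V l) (\<lambda>q. f q / sqrt s))" using I by simp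
  qed simp
  then show "ar h' 15 0 = (\<Sum>l<c. dotp d (V l) (\<lambda>q. f q / sqrt s))" by (simp add: h'_def Ptot_def)
  show "ar h' 22 q = f q / sqrt s" if "q < d" for q using 1[OF that] by (simp add: h'_def Ptot_def)
qed

lemma run_Pappend:
  assumes b: "base h" and c: "iv h 6 = c" and q: "q < d"
  shows "ar (run n Pappend h) 8 (n * c + q) = ar h 22 q"
    "l \<noteq> c \<Longrightarrow> ar (run n Pappend h) 8 (n * l + q) = ar h 8 (n * l + q)" "iv (run n Pappend h) 6 = Suc c"
proof -
  let ?c = "HSt 8 (HA (HS 6) (HV 16)) (vec1 22 16)"
  note b0 = base0D[OF baseD(1)[OF b]]
  have D: "d = min n (iv h 1)" using b0 by simp
  have dn: "q < n" if "q < d" for q using that sz by simp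
  have st: "ar (run n ?c h') 8 = (ar h' 8)(n * c + q := ar h 22 q)"
    if "q < d" "agr (amods ?c) (insert 16 (mods ?c)) h h'" "iv h' 16 = q" for q h'
    using agr_ar[OF that(2), of 22] agr_iv[OF that(2), of 6] c that by simp
  have inj: "inj_on (\<lambda>q. n * c + q) {..<d}" by (simp add: inj_on_def)
  note f = fill[where idx = "\<lambda>q. n * c + q" and r = 8 and val = "ar h 22" and c = ?c and x = 16, OF D inj]
  have "ar (run n (HFor 16 1 ?c) h) 8 (n * c + q) = ar h 22 q" by (rule f(1)) (use q st in auto)
  then show "ar (run n Pappend h) 8 (n * c + q) = ar h 22 q" by (simp add: Pappend_def)
  have "ar (run n (HFor 16 1 ?c) h) 8 (n * l + q) = ar h 8 (n * l + q)" if l: "l \<noteq> c"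
    by (rule f(2)) (use l st cell2_inj[OF dn[OF q] dn] in auto)
  then show "l \<noteq> c \<Longrightarrow> ar (run n Pappend h) 8 (n * l + q) = ar h 8 (n * l + q)" by (simp add: Pappend_def)
  show "iv (run n Pappend h) 6 = Suc c" using c by (simp add: Pappend_def)
qed

end

text \<open>Split off because the semantics of the remaining program is stated for a fixed
  \<open>N\<close>, which is known only after \<open>PN\<close> has run.\<close>

definition Prest :: hcom where
  "Prest = HSeq Py (HSeq PM (HSeq PF (HSeq Pmain
    (HSeq (HSeq (HFor 10 6 (HInc 8)) (HInc 8)) (HSeq Pb (HSeq PU PV))))))"

lemma Prog_Prest: "Prog P = HSeq (PN P) Prest"
  by (simp add: Prog_def Prest_def)

text \<open>The interface between program and analysis; \<open>assoc j w\<close> is to mean that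
  \<open>w\<close> has the signs of unit \<open>j\<close> on the sample. \<open>S1\<close> and
  \<open>C1\<close> make the accepted candidates sound and complete, \<open>S2\<close> and
  \<open>S2'\<close> describe the refinement for the right and the wrong sign, \<open>S3\<close> the
  second layer.\<close>

locale good_run = run_data m d n N A x + orthonormal d k v for m d n N k A x v +
  fixes u :: "nat \<Rightarrow> nat \<Rightarrow> real" and assoc :: "nat \<Rightarrow> (nat \<Rightarrow> real) \<Rightarrow> bool"
  assumes kn: "k + 1 \<le> n"
    and S1: "\<And>li p0. li < n \<Longrightarrow> p0 < d \<Longrightarrow> check li p0 \<Longrightarrow> \<exists>j<k. assoc j (xc li p0) \<or> assoc j (\<lambda>q. - xc li p0 q)"
    and C1: "\<And>j. j < k \<Longrightarrow> \<exists>li<n. \<exists>p0<d. check li p0 \<and> (assoc j (xc li p0) \<or> assoc j (\<lambda>q. - xc li p0 q))"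
    and S2: "\<And>j w. j < k \<Longrightarrow> assoc j w \<Longrightarrow> \<exists>\<gamma>>0. \<forall>p<d. vv w p = \<gamma> * v j p"
    and S2': "\<And>j w p. j < k \<Longrightarrow> assoc j w \<Longrightarrow> p < d \<Longrightarrow> vv (\<lambda>q. - w q) p = 0"
    and S3: "\<And>\<sigma> r l. bij_betw \<sigma> {..<k} {..<k} \<Longrightarrow> r < m \<Longrightarrow> l < k \<Longrightarrow>
      - npj (k + 1) (\<lambda>i j. if j < k then relu (dotp d (v (\<sigma> j)) (x i)) else A r i) N l k /
        npj (k + 1) (\<lambda>i j. if j < k then relu (dotp d (v (\<sigma> j)) (x i)) else A r i) N k k = u (\<sigma> l) r"
begin

lemma vdot: "l < k \<Longrightarrow> l' < k \<Longrightarrow> dotp d (v l) (v l') = (if l = l' then 1 else 0)"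
  using orth by (simp add: orthn_def dotp_def)

text \<open>The refined vector betrays the unit: it is a positive multiple of \<open>v j\<close>,
  which is neither zero nor a multiple of another \<open>v j'\<close>.\<close>

lemma assoc_unique:
  assumes j: "j < k" "assoc j w" and j': "j' < k" "assoc j' w \<or> assoc j' (\<lambda>q. - w q)"
  shows "j = j'"
proof -
  obtain \<gamma> where g: "\<gamma> > 0" "\<And>p. p < d \<Longrightarrow> vv w p = \<gamma> * v j p" using S2[OF j] by blast
  from j'(2) show ?thesis
  proof
    assume "assoc j' w"
    then obtain \<gamma>' where g': "\<gamma>' > 0" "\<And>p. p < d \<Longrightarrow> vv w p = \<gamma>' * v j' p" using S2[OF j'(1)] by blast
    have "dotp d (v j) (\<lambda>p. \<gamma> * v j p) = dotp d (v j) (\<lambda>p. \<gamma>' * v j' p)"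
      using g(2) g'(2) by (intro dotp_cong) auto
    then show ?thesis using j j' g by (simp add: dotp_scale vdot split: if_splits)
  next
    assume "assoc j' (\<lambda>q. - w q)"
    then have "vv w p = 0" if "p < d" for p using S2'[OF j'(1) _ that, of "\<lambda>q. - w q"] by simp
    then have "dotp d (v j) (\<lambda>p. \<gamma> * v j p) = dotp d (v j) (\<lambda>p. 0)"
      using g(2) by (intro dotp_cong) auto
    moreover have "dotp d (v j) (\<lambda>p. 0) = 0" by (simp add: dotp_def)
    ultimately show ?thesis using j g by (simp add: dotp_scale vdot)
  qed
qed

text \<open>\<open>S\<close> is the set of units recovered so far and \<open>\<sigma>\<close> the
  order of their discovery, which becomes the permutation in the output.\<close>

definition found :: "hst \<Rightarrow> nat set \<Rightarrow> bool" where
  "found h S \<longleftrightarrow> S \<subseteq> {..<k} \<and> iv h 6 = card S \<and>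
    (\<exists>\<sigma>. bij_betw \<sigma> {..<card S} S \<and> (\<forall>l<card S. \<forall>q<d. ar h 8 (n * l + q) = v (\<sigma> l) q))"

lemma found_card: "found h S \<Longrightarrow> card S \<le> k"
  using card_mono[of "{..<k}" S] by (simp add: found_def)

lemma found_agr: "found h S \<Longrightarrow> agr X W h h' \<Longrightarrow> 8 \<notin> X \<Longrightarrow> 6 \<notin> W \<Longrightarrow> found h' S"
  by (simp add: found_def agr_def)

lemma run_Ptry:
  assumes b: "base h" and f: "found h S" and w: "\<And>q. q < d \<Longrightarrow> ar h 7 q = - w q" and j: "j < k"
    and as: "assoc j w \<or> assoc j (\<lambda>q. - w q)"
  defines "h' \<equiv> run n Ptry h"
  shows "base h'" "found h' (if assoc j w then insert j S else S)" "\<And>q. q < d \<Longrightarrow> ar h' 7 q = w q"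
proof -
  show "base h'" unfolding h'_def by (rule base_agr[OF b agr_run]) auto
  let ?A = "HFor 16 1 (HSt 7 (HV 16) (KM (KC 0) (vec1 7 16)))"
  let ?h1 = "run n ?A h"
  have D: "d = min n (iv h 1)" using base0D[OF baseD(1)[OF b]] by simp
  have w1: "ar ?h1 7 q = w q" if "q < d" for q
  proof (rule vfill(1)[OF D])
    fix i and h' :: hst assume i: "i < d" and ix: "iv h' 16 = i" and o: "\<And>e. i \<le> e \<Longrightarrow> ar h' 7 e = ar h 7 e"
    have "ar h' 7 i = - w i" using o[of i] w[OF i] by simp
    then show "ar (run n (HSt 7 (HV 16) (KM (KC 0) (vec1 7 16))) h') 7 = (ar h' 7)(i := w i)"
      using ix by simp
  qed fact
  have b1: "base ?h1" by (rule base_agr[OF b agr_run]) auto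
  have f1: "found ?h1 S" by (rule found_agr[OF f agr_run]) auto
  let ?h2 = "run n Prefine ?h1"
  have r: "\<And>p. p < d \<Longrightarrow> ar ?h2 20 p = vv w p" "ar ?h2 16 0 = dotp d (vv w) (vv w)"
    using run_Prefine[OF b1 w1] by simp_all
  have b2: "base ?h2" by (rule base_agr[OF b1 agr_run]) auto
  have f2: "found ?h2 S" by (rule found_agr[OF f1 agr_run]) auto
  let ?T = "HSeq Ptot (HIf (BR (sca 15) (KC (1 / 2))) Pappend HSkip)"
  have e: "h' = (if dotp d (vv w) (vv w) \<le> 0 then ?h2 else run n ?T ?h2)"
    using r(2) by (simp add: h'_def Ptry_def)
  have "ar (run n ?T ?h2) 7 q = ar ?h2 7 q" for q by (simp)
  then show "ar h' 7 q = w q" if "q < d" for q using w1[OF that] e by simp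
  show "found h' (if assoc j w then insert j S else S)"
  proof (cases "assoc j w")
    case False
    then have "assoc j (\<lambda>q. - w q)" using as by simp
    then have "vv w p = 0" if "p < d" for p using S2'[OF j _ that, of "\<lambda>q. - w q"] by simp
    then have "dotp d (vv w) (vv w) = 0" by (simp add: dotp_def)
    then show ?thesis using e f2 False by simp
  next
    case True
    obtain \<gamma> where g: "\<gamma> > 0" "\<And>p. p < d \<Longrightarrow> vv w p = \<gamma> * v j p" using S2[OF j True] by blast
    have "dotp d (vv w) (vv w) = dotp d (\<lambda>p. \<gamma> * v j p) (\<lambda>p. \<gamma> * v j p)" using g(2) by (intro dotp_cong) auto
    also have "\<dots> = \<gamma> * dotp d (v j) (\<lambda>p. \<gamma> * v j p)" by (simp add: dotp_def sum_distrib_left algebra_simps)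
    also have "\<dots> = \<gamma>\<^sup>2" using vdot[OF j j] by (simp add: dotp_scale power2_eq_square)
    finally have s: "dotp d (vv w) (vv w) = \<gamma>\<^sup>2" .
    have s': "ar ?h2 16 0 = \<gamma>\<^sup>2" using r(2) s by simp
    have sq: "vv w q / sqrt (\<gamma>\<^sup>2) = v j q" if "q < d" for q using g that by simp
    obtain \<sigma> where \<sigma>: "bij_betw \<sigma> {..<card S} S" "\<And>l q. l < card S \<Longrightarrow> q < d \<Longrightarrow> ar ?h2 8 (n * l + q) = v (\<sigma> l) q"
      and c: "iv ?h2 6 = card S" and Sk: "S \<subseteq> {..<k}"
      using f2 unfolding found_def by blast
    have cn: "card S \<le> n" using found_card[OF f] kn by simp
    let ?h3 = "run n Ptot ?h2"
    have t: "\<And>q. q < d \<Longrightarrow> ar ?h3 22 q = vv w q / sqrt (\<gamma>\<^sup>2)"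
      "ar ?h3 15 0 = (\<Sum>l<card S. dotp d (v (\<sigma> l)) (\<lambda>q. vv w q / sqrt (\<gamma>\<^sup>2)))"
      by (rule run_Ptot[where V = "\<lambda>l. v (\<sigma> l)" and f = "vv w", OF b2 c cn \<sigma>(2) r(1) s'], assumption+)
        (rule run_Ptot(2)[where V = "\<lambda>l. v (\<sigma> l)" and f = "vv w", OF b2 c cn \<sigma>(2) r(1) s'], assumption+)
    have fin: "finite S" using Sk finite_subset by blast
    have "ar ?h3 15 0 = (\<Sum>l<card S. dotp d (v (\<sigma> l)) (v j))"
      unfolding t(2) using sq by (intro sum.cong refl dotp_cong) auto
    also have "\<dots> = (\<Sum>i\<in>S. dotp d (v i) (v j))" by (rule sum.reindex_bij_betw[OF \<sigma>(1)])
    also have "\<dots> = (\<Sum>i\<in>S. if i = j then 1 else 0)" using Sk j vdot by (intro sum.cong) auto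
    also have "\<dots> = (if j \<in> S then 1 else 0)" using fin by simp
    finally have tot: "ar ?h3 15 0 = (if j \<in> S then 1 else 0)" .
    have b3: "base ?h3" by (rule base_agr[OF b2 agr_run]) auto
    have f3: "found ?h3 S" by (rule found_agr[OF f2 agr_run]) auto
    have half: "vr n (KC (1 / 2)) ?h3 = 1 / 2" by (simp add: of_rat_divide)
    have run: "run n ?T ?h2 = (if ar ?h3 15 0 \<le> 1 / 2 then run n Pappend ?h3 else ?h3)"
      using half by simp
    have ng: "\<not> dotp d (vv w) (vv w) \<le> 0" using s g by simp
    show ?thesis
    proof (cases "j \<in> S")
      case True2: True
      then have "h' = ?h3" using e run ng tot by simp
      then show ?thesis using f3 True True2 by (simp add: insert_absorb)
    next
      case False
      then have h': "h' = run n Pappend ?h3" using e run ng tot by simp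
      have c3: "iv ?h3 6 = card S" using c by simp
      define \<tau> where "\<tau> l = (if l = card S then j else \<sigma> l)" for l
      have cI: "card (insert j S) = Suc (card S)" using fin False by simp
      have "bij_betw \<tau> {..<Suc (card S)} (insert j S)"
      proof -
        have "bij_betw \<tau> {..<card S} S" using \<sigma>(1) by (rule bij_betw_cong[THEN iffD1, rotated]) (simp add: \<tau>_def)
        moreover have "bij_betw \<tau> {card S} {j}" by (simp add: bij_betw_def \<tau>_def)
        ultimately have "bij_betw \<tau> ({..<card S} \<union> {card S}) (S \<union> {j})" using False by (intro bij_betw_combine) auto
        then show ?thesis by (simp add: lessThan_Suc)
      qed
      moreover have "ar h' 8 (n * l + q) = v (\<tau> l) q" if l: "l < Suc (card S)" and q: "q < d" for l q
      proof (cases "l = card S")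
        case True
        then show ?thesis using run_Pappend(1)[OF b3 c3 q] t(1)[OF q] sq[OF q] h' by (simp add: \<tau>_def)
      next
        case False
        then have "l < card S" using l by simp
        then show ?thesis using run_Pappend(2)[OF b3 c3 q False] \<sigma>(2)[OF _ q, of l] h' False by (simp add: \<tau>_def)
      qed
      moreover have "iv h' 6 = card (insert j S)" using run_Pappend(3)[OF b3 c3 d0] h' cI by simp
      moreover have "insert j S \<subseteq> {..<k}" using Sk j by simp
      ultimately have "found h' (insert j S)" unfolding found_def cI by (intro conjI exI[of _ \<tau>]) blast+
      then show ?thesis using True by simp
    qed
  qed
qed

lemma run_Pbody:
  assumes b: "base h" and f: "found h S" and ix: "iv h 10 = li" "iv h 11 = p0" and li: "li < n" "p0 < d"
  shows "base (run n Pbody h)" "\<exists>S'. S \<subseteq> S' \<and> found (run n Pbody h) S' \<and>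
    (\<forall>j<k. check li p0 \<longrightarrow> (assoc j (xc li p0) \<or> assoc j (\<lambda>q. - xc li p0 q)) \<longrightarrow> j \<in> S')"
proof -
  show "base (run n Pbody h)" by (rule base_agr[OF b agr_run]) auto
  let ?h1 = "run n Pcand h"
  note c = run_Pcand[OF b ix li(2)]
  have b1: "base ?h1" by (rule base_agr[OF b agr_run]) auto
  have f1: "found ?h1 S" by (rule found_agr[OF f agr_run]) auto
  have F1: "ar ?h1 11 0 = F" by (rule baseD(3)[OF b1])
  have N1: "iv ?h1 5 = N" using base0D(6)[OF baseD(1)[OF b1]] .
  let ?T = "run n (HFor 12 4 Ptry) ?h1"
  have e: "run n Pbody h = (if check li p0 then ?T else ?h1)"
    unfolding Pbody_def run.simps(5) run.simps(6) run.simps(1) vb.simps vr.simps pw_simps(1) vi.simps F1 N1 c(1,3,4) check_def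
    by (auto simp: not_le)
  show "\<exists>S'. S \<subseteq> S' \<and> found (run n Pbody h) S' \<and>
    (\<forall>j<k. check li p0 \<longrightarrow> (assoc j (xc li p0) \<or> assoc j (\<lambda>q. - xc li p0 q)) \<longrightarrow> j \<in> S')"
  proof (cases "check li p0")
    case False
    then show ?thesis using e f1 by auto
  next
    case True
    let ?w = "xc li p0"
    obtain j where j: "j < k" "assoc j ?w \<or> assoc j (\<lambda>q. - ?w q)" using S1[OF li True] by blast
    have u: "j' = j" if "j' < k" "assoc j' ?w \<or> assoc j' (\<lambda>q. - ?w q)" for j'
      using j(2)
    proof
      assume "assoc j ?w"
      then show ?thesis using assoc_unique[OF j(1) _ that] by simp
    next
      assume a: "assoc j (\<lambda>q. - ?w q)"
      show ?thesis using assoc_unique[OF j(1) a that(1)] that(2) by auto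
    qed
    \<comment> \<open>Variable 4 holds the constant 2: one pass for each sign.\<close>
    have i4: "min n (iv ?h1 4) = 2" using base0D(5)[OF baseD(1)[OF b1]] by simp
    let ?h2 = "run n Ptry (setv ?h1 12 0)"
    let ?h3 = "run n Ptry (setv ?h2 12 (Suc 0))"
    have T: "?T = setv ?h3 12 2" unfolding run_HFor i4 by (simp add: numeral_2_eq_2)
    have b1': "base (setv ?h1 12 0)" by (rule base_setv[OF b1]) simp
    have f1': "found (setv ?h1 12 0) S" by (rule found_agr[OF f1 agr_setv[of 12 "{12}"]]) auto
    note t1 = run_Ptry[where w = "\<lambda>q. - ?w q", OF b1' f1' _ j(1)]
    have A1: "base ?h2" "found ?h2 (if assoc j (\<lambda>q. - ?w q) then insert j S else S)" "\<And>q. q < d \<Longrightarrow> ar ?h2 7 q = - ?w q"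
      by (rule t1; use c(2) j(2) in auto)+
    have b2': "base (setv ?h2 12 (Suc 0))" by (rule base_setv[OF A1(1)]) simp
    have f2': "found (setv ?h2 12 (Suc 0)) (if assoc j (\<lambda>q. - ?w q) then insert j S else S)"
      by (rule found_agr[OF A1(2) agr_setv[of 12 "{12}"]]) auto
    note t2 = run_Ptry[where w = ?w, OF b2' f2' _ j(1)]
    have A2: "found ?h3 (if assoc j ?w then insert j (if assoc j (\<lambda>q. - ?w q) then insert j S else S)
        else (if assoc j (\<lambda>q. - ?w q) then insert j S else S))"
      by (rule t2(2); use A1(3) j(2) in auto)
    then have "found ?h3 (insert j S)" using j(2) by (auto split: if_splits)
    then have "found ?T (insert j S)" unfolding T by (rule found_agr[OF _ agr_setv[of 12 "{12}"]]) auto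
    then show ?thesis using True e u by (intro exI[of _ "insert j S"]) auto
  qed
qed

lemma run_Pmain:
  assumes b: "base h" and f: "found h {}"
  shows "base (run n Pmain h)" "found (run n Pmain h) {..<k}"
proof -
  show "base (run n Pmain h)" by (rule base_agr[OF b agr_run]) (auto simp: Pmain_def)
  have "\<forall>j. \<exists>li p0. j < k \<longrightarrow> li < n \<and> p0 < d \<and> check li p0 \<and> (assoc j (xc li p0) \<or> assoc j (\<lambda>q. - xc li p0 q))"
  proof
    fix j show "\<exists>li p0. j < k \<longrightarrow> li < n \<and> p0 < d \<and> check li p0 \<and> (assoc j (xc li p0) \<or> assoc j (\<lambda>q. - xc li p0 q))"
      using C1[of j] by (cases "j < k") auto
  qed
  then obtain fl fp where fl: "\<And>j. j < k \<Longrightarrow> fl j < n" "\<And>j. j < k \<Longrightarrow> fp j < d" "\<And>j. j < k \<Longrightarrow> check (fl j) (fp j)"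
    "\<And>j. j < k \<Longrightarrow> assoc j (xc (fl j) (fp j)) \<or> assoc j (\<lambda>q. - xc (fl j) (fp j) q)" by metis
  \<comment> \<open>The units whose designated grid point precedes \<open>(i, p)\<close> in the
    order of the two loops.\<close>
  define T where "T i p = {j. j < k \<and> (fl j < i \<or> fl j = i \<and> fp j < p)}" for i p :: nat
  define I where "I i p h' \<longleftrightarrow> base h' \<and> (\<exists>S. T i p \<subseteq> S \<and> found h' S)" for i p and h' :: hst
  have Iset: "I i p (setv h' z y)" if "I i p h'" "z \<in> {10, 11}" for i p h' z y
  proof -
    have "base (setv h' z y)" using that by (intro base_setv) (auto simp: I_def)
    moreover have "found (setv h' z y) S" if "found h' S" for S
      by (rule found_agr[OF that agr_setv[of z "{z}"]]) (use \<open>z \<in> {10, 11}\<close> in auto)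
    ultimately show ?thesis using that(1) unfolding I_def by blast
  qed
  have "I n 0 (run n (HFor 10 3 (HFor 11 1 Pbody)) h)"
  proof (rule For_inv[where I = "\<lambda>i. I i 0"])
    show "n = min n (iv h 3)" using base0D(4)[OF baseD(1)[OF b]] by simp
    show "I 0 0 h" using b f by (auto simp: I_def T_def)
    show "I i 0 (setv h' 10 z)" if "I i 0 h'" for i h' z by (rule Iset[OF that]) simp
    fix i h' assume i: "i < n" and I: "I i 0 h'" and ix: "iv h' 10 = i"
    have "I i d (run n (HFor 11 1 Pbody) h')"
    proof (rule For_inv[where I = "I i"])
      show "d = min n (iv h' 1)" using I base0D(2)[OF baseD(1)] by (simp add: I_def)
      show "I i 0 h'" by fact
      show "I i p (setv h'' 11 z)" if "I i p h''" for p h'' z by (rule Iset[OF that]) simp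
      fix p h'' assume p: "p < d" and I: "I i p h''" and ag: "agr (amods Pbody) (insert 11 (mods Pbody)) h' h''" and ip: "iv h'' 11 = p"
      have i10: "iv h'' 10 = i" using agr_iv[OF ag, of 10] ix by simp
      obtain S where S: "base h''" "T i p \<subseteq> S" "found h'' S" using I unfolding I_def by blast
      obtain S' where S': "S \<subseteq> S'" "found (run n Pbody h'') S'"
        "\<forall>j<k. check i p \<longrightarrow> (assoc j (xc i p) \<or> assoc j (\<lambda>q. - xc i p q)) \<longrightarrow> j \<in> S'"
        using run_Pbody(2)[OF S(1,3) i10 ip i p] by blast
      have "T i (Suc p) \<subseteq> S'"
      proof
        fix j assume "j \<in> T i (Suc p)"
        then have "j \<in> T i p \<or> (j < k \<and> fl j = i \<and> fp j = p)" by (auto simp: T_def less_Suc_eq)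
        then show "j \<in> S'" using S(2) S' fl(3,4) by blast
      qed
      then show "I i (Suc p) (run n Pbody h'')" using run_Pbody(1)[OF S(1,3) i10 ip i p] S'(2) unfolding I_def by blast
    qed
    moreover have "T (Suc i) 0 \<subseteq> T i d" using fl(2) by (auto simp: T_def less_Suc_eq)
    ultimately show "I (Suc i) 0 (run n (HFor 11 1 Pbody) h')" unfolding I_def by blast
  qed
  then obtain S where S: "T n 0 \<subseteq> S" "found (run n Pmain h) S" unfolding I_def Pmain_def by blast
  have "S = {..<k}"
  proof
    show "S \<subseteq> {..<k}" using S(2) by (simp add: found_def)
    show "{..<k} \<subseteq> S" using S(1) fl(1) by (auto simp: T_def)
  qed
  then show "found (run n Pmain h) {..<k}" using S(2) by simp
qed

text \<open>One rule for all output loops: the position in variable 7 advances by \<open>w\<close>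
  in each pass, so pass \<open>i\<close> fills the block at \<open>p + i * w\<close>. It is used
  with width 1 inside a row and with width \<open>k\<close> or \<open>d\<close> from row to
  row.\<close>

lemma run_out_loop:
  assumes y: "iv h yb = b" "b \<le> n" "x' \<noteq> 7" "yb \<noteq> x'"
    and step: "\<And>i h'. i < b \<Longrightarrow> agr (amods c) (insert x' (mods c)) h h' \<Longrightarrow> iv h' x' = i \<Longrightarrow> iv h' 7 = p + i * w \<Longrightarrow>
      iv (run n c h') 7 = p + Suc i * w \<and> (\<forall>e<p + i * w. ar (run n c h') 1 e = ar h' 1 e) \<and>
      (\<forall>l<w. ar (run n c h') 1 (p + i * w + l) = val i l)"
    and p: "iv h 7 = p"
  shows "iv (run n (HFor x' yb c) h) 7 = p + b * w" "\<forall>e<p. ar (run n (HFor x' yb c) h) 1 e = ar h 1 e"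
    "\<forall>i<b. \<forall>l<w. ar (run n (HFor x' yb c) h) 1 (p + i * w + l) = val i l"
proof -
  define I where "I i h' \<longleftrightarrow> iv h' 7 = p + i * w \<and> (\<forall>e<p. ar h' 1 e = ar h 1 e) \<and>
     (\<forall>i'<i. \<forall>l<w. ar h' 1 (p + i' * w + l) = val i' l)" for i and h' :: hst
  have "I b (run n (HFor x' yb c) h)"
  proof (rule For_inv)
    show "b = min n (iv h yb)" using y by simp
    show "I 0 h" using p by (simp add: I_def)
    show "I i (setv h' x' z)" if "I i h'" for i h' z using that y by (simp add: I_def)
    fix i h' assume i: "i < b" and I: "I i h'" and ag: "agr (amods c) (insert x' (mods c)) h h'" and ix: "iv h' x' = i"
    have s: "iv (run n c h') 7 = p + Suc i * w" "\<And>e. e < p + i * w \<Longrightarrow> ar (run n c h') 1 e = ar h' 1 e"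
      "\<And>l. l < w \<Longrightarrow> ar (run n c h') 1 (p + i * w + l) = val i l"
      using step[OF i ag ix] I by (simp_all add: I_def)
    show "I (Suc i) (run n c h')"
      unfolding I_def
    proof (intro conjI allI impI)
      show "iv (run n c h') 7 = p + Suc i * w" by (rule s)
      show "ar (run n c h') 1 e = ar h 1 e" if "e < p" for e using s(2)[of e] I that by (simp add: I_def)
      show "ar (run n c h') 1 (p + i' * w + l) = val i' l" if "i' < Suc i" "l < w" for i' l
      proof (cases "i' = i")
        case True
        then show ?thesis using s(3) that by simp
      next
        case False
        then have "i' < i" using that by simp
        then have "i' * w + l < i * w"
        proof -
          have "i' * w + l < Suc i' * w" using that by simp
          also have "\<dots> \<le> i * w" using \<open>i' < i\<close> by (intro mult_le_mono1) simp
          finally show ?thesis .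
        qed
        then show ?thesis using s(2)[of "p + i' * w + l"] I \<open>i' < i\<close> that by (simp add: I_def)
      qed
    qed
  qed
  then show "iv (run n (HFor x' yb c) h) 7 = p + b * w" "\<forall>e<p. ar (run n (HFor x' yb c) h) 1 e = ar h 1 e"
    "\<forall>i<b. \<forall>l<w. ar (run n (HFor x' yb c) h) 1 (p + i * w + l) = val i l" by (simp_all add: I_def)
qed

lemma run_Prest:
  assumes b: "base0 h" and z: "iv h 6 = 0" "iv h 7 = 0" "iv h 8 = 0"
  shows "\<exists>\<sigma>. bij_betw \<sigma> {..<k} {..<k} \<and> iv (run n Prest h) 6 = k \<and>
    (\<forall>r<m. \<forall>l<k. ar (run n Prest h) 1 (r * k + l) = u (\<sigma> l) r) \<and>
    (\<forall>l<k. \<forall>q<d. ar (run n Prest h) 1 (m * k + l * d + q) = v (\<sigma> l) q)"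
proof -
  let ?h1 = "run n Py h"
  have y1: "\<And>i. i < n \<Longrightarrow> ar ?h1 2 i = yv i" by (rule run_Py[OF b])
  have b1: "base0 ?h1" by (rule base0_agr[OF b agr_run]) auto
  let ?h2 = "run n PM ?h1"
  have M2: "\<And>p q. p < d \<Longrightarrow> q < d \<Longrightarrow> ar ?h2 3 (n * p + q) = M p q" by (rule run_PM[OF b1 y1])
  have b2: "base0 ?h2" by (rule base0_agr[OF b1 agr_run]) auto
  let ?h3 = "run n PF ?h2"
  have F3: "ar ?h3 11 0 = F" by (rule run_PF[OF b2 M2])
  have b3: "base ?h3"
  proof -
    have "base0 ?h3" by (rule base0_agr[OF b2 agr_run]) auto
    then show ?thesis using M2 F3 by (simp add: base_def)
  qed
  have f3: "found ?h3 {}"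
  proof -
    have "bij_betw id {..<card ({}::nat set)} ({}::nat set)" by simp
    moreover have "iv ?h3 6 = 0" using z by simp
    ultimately show ?thesis unfolding found_def by (intro conjI exI[of _ id]) auto
  qed
  let ?h4 = "run n Pmain ?h3"
  have b4: "base ?h4" and f4: "found ?h4 {..<k}" by (rule run_Pmain[OF b3 f3])+
  obtain \<sigma> where \<sigma>: "bij_betw \<sigma> {..<k} {..<k}" "\<And>l q. l < k \<Longrightarrow> q < d \<Longrightarrow> ar ?h4 8 (n * l + q) = v (\<sigma> l) q"
    and c4: "iv ?h4 6 = k"
    using f4 unfolding found_def card_lessThan by blast
  have z4: "iv ?h4 7 = 0" "iv ?h4 8 = 0" using z by (simp_all add: Pmain_def)
  let ?K = "HSeq (HFor 10 6 (HInc 8)) (HInc 8)"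
  let ?h5 = "run n ?K ?h4"
  have kn': "min n k = k" "k \<le> n" using kn by simp_all
  have "(\<lambda>i h. iv h 8 = i) k (run n (HFor 10 6 (HInc 8)) ?h4)"
    by (rule For_inv[where I = "\<lambda>i h. iv h 8 = i"]) (use c4 z4 kn' in simp_all)
  then have k5: "iv ?h5 8 = k + 1" by simp
  have b5: "base ?h5" by (rule base_agr[OF b4 agr_run]) auto
  have V5: "ar ?h5 8 (n * l + q) = v (\<sigma> l) q" if "l < k" "q < d" for l q using \<sigma>(2)[OF that] by simp
  have c5: "iv ?h5 6 = k" "iv ?h5 7 = 0" using c4 z4 by simp_all
  let ?cb = "HSeq (HSum 10 17 1 (KT (cell 8 10 17) (Xc 17 11)))
    (HIf (BR (sca 10) (KC 0)) (HSt 9 (HA (HS 10) (HV 11)) (KC 0)) (HSt 9 (HA (HS 10) (HV 11)) (sca 10)))"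
  let ?h6 = "run n Pb ?h5"
  have B6: "ar ?h6 9 (n * l + i) = relu (dotp d (v (\<sigma> l)) (x i))" if "l < k" "i < N" for l i
    unfolding Pb_def
  proof (rule matfill[where bi = k and bj = N])
    show "k = min n (iv ?h5 6)" using c5 kn' by simp
    show "N = min n (iv ?h5 5)" using base0D(6)[OF baseD(1)[OF b5]] by simp
    fix l i h' assume l: "l < k" and i: "i < N" and ag: "agr (amods ?cb) (insert 10 (insert 11 (mods ?cb))) ?h5 h'"
      and ix: "iv h' 10 = l" "iv h' 11 = i"
    have b': "base h'" by (rule base_agr[OF b5 ag]) auto
    note b0 = base0D[OF baseD(1)[OF b']]
    have V': "ar h' 8 (n * l + q) = v (\<sigma> l) q" if "q < d" for q using agr_ar[OF ag, of 8] V5[OF l that] by simp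
    have i': "i < n" using i sz by simp
    have "ar (run n (HSum 10 17 1 (KT (cell 8 10 17) (Xc 17 11))) h') 10 0 = dotp d (v (\<sigma> l)) (x i)"
      using b0 V' ix i' by (subst run_HSum) (simp_all add: dotp_def)
    then show "ar (run n ?cb h') 9 = (ar h' 9)(n * l + i := relu (dotp d (v (\<sigma> l)) (x i)))"
      using ix by (simp add: relu_def)
  qed (use that in simp_all)
  have b6: "base ?h6" by (rule base_agr[OF b5 agr_run]) auto
  have c6: "iv ?h6 6 = k" "iv ?h6 7 = 0" "iv ?h6 8 = k + 1" using c5 k5 by simp_all
  have V6: "ar ?h6 8 (n * l + q) = v (\<sigma> l) q" if "l < k" "q < d" for l q using V5[OF that] by simp
  let ?ce = "HSeq (HSt 1 (HV 7) (KD (KM (KC 0) (cell 4 11 6)) (KL 4 (HA (HS 6) (HV 6))))) (HInc 7)"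
  let ?cu = "HSeq (HNPJ 8 5 gen3) (HFor 11 6 ?ce)"
  let ?h7 = "run n PU ?h6"
  have U: "iv ?h7 7 = 0 + m * k" "\<forall>r<m. \<forall>l<k. ar ?h7 1 (0 + r * k + l) = u (\<sigma> l) r"
  proof -
    have step: "iv (run n ?cu h') 7 = 0 + Suc r * k \<and> (\<forall>e<0 + r * k. ar (run n ?cu h') 1 e = ar h' 1 e) \<and>
      (\<forall>l<k. ar (run n ?cu h') 1 (0 + r * k + l) = u (\<sigma> l) r)"
      if r: "r < m" and ag: "agr (amods ?cu) (insert 10 (mods ?cu)) ?h6 h'" and ix: "iv h' 10 = r" and p: "iv h' 7 = 0 + r * k" for r h'
    proof -
      define rw where "rw i j = (if j < k then relu (dotp d (v (\<sigma> j)) (x i)) else A r i)" for i j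
      define P where "P = npj (k + 1) rw N"
      have b': "base h'" by (rule base_agr[OF b6 ag]) auto
      have k': "iv h' 6 = k" "iv h' 8 = k + 1" using agr_iv[OF ag, of 6] agr_iv[OF ag, of 8] c6 by simp_all
      have B': "ar h' 9 (n * l + i) = relu (dotp d (v (\<sigma> l)) (x i))" if "l < k" "i < N" for l i
        using agr_ar[OF ag, of 9] B6[OF that] by simp
      let ?g = "run n (HNPJ 8 5 gen3) h'"
      have Pg: "ar ?g 4 (n * i + j) = P i j" if "i < k + 1" "j < k + 1" for i j
        unfolding P_def
      proof (rule run_HNPJ)
        show "k + 1 = min n (iv h' 8)" using k' kn by simp
        show "N = min n (iv h' 5)" using base0D(6)[OF baseD(1)[OF b']] by simp
        fix t h'' j assume t: "t < N" and ag2: "agr ({4, 6, 10, 17} \<union> amods gen3) ({13, 14, 15} \<union> mods gen3) h' h''"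
          and it: "iv h'' 13 = t" and j: "j < k + 1"
        have b'': "base h''" by (rule base_agr[OF b' ag2]) auto
        have k'': "iv h'' 6 = k" "iv h'' 10 = r" using agr_iv[OF ag2, of 6] agr_iv[OF ag2, of 10] k' ix by simp_all
        have B'': "ar h'' 9 (n * l + t) = relu (dotp d (v (\<sigma> l)) (x t))" if "l < k" for l
          using agr_ar[OF ag2, of 9] B'[OF that t] by simp
        have t': "t < n" using t sz by simp
        let ?f = "HFor 16 6 (HSt 5 (HV 16) (cell 9 16 13))"
        have D: "k = min n (iv h'' 6)" using k'' kn' by simp
        have f: "ar (run n ?f h'') 5 l = rw t l" if "l < k" for l
        proof (rule vfill(1)[OF D])
          fix i g assume i: "i < k" and ag3: "agr (amods (HSt 5 (HV 16) (cell 9 16 13))) (insert 16 (mods (HSt 5 (HV 16) (cell 9 16 13)))) h'' g"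
            and "iv g 16 = i"
          then show "ar (run n (HSt 5 (HV 16) (cell 9 16 13)) g) 5 = (ar g 5)(i := rw t i)"
            using agr_ar[OF ag3, of 9] agr_iv[OF ag3, of 13] B''[OF i] it by (simp add: rw_def)
        qed fact
        have "ar (run n ?f h'') 0 (n * r + t) = A r t" using base0D(7)[OF baseD(1)[OF b''] r t'] by simp
        then show "ar (run n gen3 h'') 5 j = rw t j"
          using f[of j] j k'' it by (cases "j = k") (auto simp: gen3_def rw_def)
      qed (use that in auto)
      have kg: "iv ?g 6 = k" "iv ?g 7 = r * k" using k' p by simp_all
      have st: "iv (run n ?ce g) 7 = r * k + Suc l * 1 \<and> (\<forall>e<r * k + l * 1. ar (run n ?ce g) 1 e = ar g 1 e) \<and>
         (\<forall>a<1. ar (run n ?ce g) 1 (r * k + l * 1 + a) = u (\<sigma> l) r)"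
        if l: "l < k" and ag3: "agr (amods ?ce) (insert 11 (mods ?ce)) ?g g" and il: "iv g 11 = l" and ip: "iv g 7 = r * k + l * 1" for l g
      proof -
        have "iv g 6 = k" using agr_iv[OF ag3, of 6] kg by simp
        moreover have "ar g 4 (n * l + k) = P l k" "ar g 4 (n * k + k) = P k k"
          using agr_ar[OF ag3, of 4] Pg[of l k] Pg[of k k] l by simp_all
        moreover have "- P l k / P k k = u (\<sigma> l) r"
          using S3[OF \<sigma>(1) r l] unfolding P_def rw_def[abs_def] .
        ultimately show ?thesis using il ip by simp
      qed
      note o = run_out_loop[where val = "\<lambda>l _. u (\<sigma> l) r" and w = 1, OF kg(1) kn'(2) _ _ st kg(2)]
      have "iv (run n (HFor 11 6 ?ce) ?g) 7 = r * k + k * 1" by (rule o(1)) simp_all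
      moreover have "\<forall>e<r * k. ar (run n (HFor 11 6 ?ce) ?g) 1 e = ar ?g 1 e" by (rule o(2)) simp_all
      moreover have "\<forall>l<k. \<forall>a<1. ar (run n (HFor 11 6 ?ce) ?g) 1 (r * k + l * 1 + a) = u (\<sigma> l) r" by (rule o(3)) simp_all
      ultimately show ?thesis by simp
    qed
    have i0: "iv ?h6 0 = m" "m \<le> n" using base0D(1)[OF baseD(1)[OF b6]] sz by simp_all
    note o = run_out_loop[where val = "\<lambda>r l. u (\<sigma> l) r" and w = k, OF i0 _ _ step c6(2)]
    show "iv ?h7 7 = 0 + m * k" unfolding PU_def by (rule o(1)) simp_all
    show "\<forall>r<m. \<forall>l<k. ar ?h7 1 (0 + r * k + l) = u (\<sigma> l) r" unfolding PU_def by (rule o(3)) simp_all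
  qed
  have b7: "base ?h7" by (rule base_agr[OF b6 agr_run]) (auto simp: PU_def)
  have c7: "iv ?h7 6 = k" using c6 by (simp add: PU_def)
  have V7: "ar ?h7 8 (n * l + q) = v (\<sigma> l) q" if "l < k" "q < d" for l q using V6[OF that] by (simp add: PU_def)
  let ?cq = "HSeq (HSt 1 (HV 7) (cell 8 10 11)) (HInc 7)"
  let ?cv = "HFor 11 1 ?cq"
  let ?h8 = "run n PV ?h7"
  have p7: "iv ?h7 7 = m * k" using U(1) by simp
  have stepV: "iv (run n ?cv h') 7 = m * k + Suc l * d \<and> (\<forall>e<m * k + l * d. ar (run n ?cv h') 1 e = ar h' 1 e) \<and>
      (\<forall>q<d. ar (run n ?cv h') 1 (m * k + l * d + q) = v (\<sigma> l) q)"
    if l: "l < k" and ag: "agr (amods ?cv) (insert 10 (mods ?cv)) ?h7 h'" and ix: "iv h' 10 = l" and p: "iv h' 7 = m * k + l * d" for l h'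
  proof -
    have b': "base h'" by (rule base_agr[OF b7 ag]) auto
    have V': "ar h' 8 (n * l + q) = v (\<sigma> l) q" if "q < d" for q using agr_ar[OF ag, of 8] V7[OF l that] by simp
    have i1: "iv h' 1 = d" "d \<le> n" using base0D(2)[OF baseD(1)[OF b']] sz by simp_all
    have st: "iv (run n ?cq g) 7 = (m * k + l * d) + Suc q * 1 \<and> (\<forall>e<(m * k + l * d) + q * 1. ar (run n ?cq g) 1 e = ar g 1 e) \<and>
       (\<forall>a<1. ar (run n ?cq g) 1 ((m * k + l * d) + q * 1 + a) = v (\<sigma> l) q)"
      if q: "q < d" and ag3: "agr (amods ?cq) (insert 11 (mods ?cq)) h' g" and il: "iv g 11 = q" and ip: "iv g 7 = (m * k + l * d) + q * 1" for q g
      using agr_iv[OF ag3, of 10] agr_ar[OF ag3, of 8] V'[OF q] ix il ip by simp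
    note o = run_out_loop[where val = "\<lambda>q _. v (\<sigma> l) q" and w = 1, OF i1 _ _ st p]
    have "iv (run n ?cv h') 7 = (m * k + l * d) + d * 1" by (rule o(1)) simp_all
    moreover have "\<forall>e<m * k + l * d. ar (run n ?cv h') 1 e = ar h' 1 e" by (rule o(2)) simp_all
    moreover have "\<forall>q<d. \<forall>a<1. ar (run n ?cv h') 1 ((m * k + l * d) + q * 1 + a) = v (\<sigma> l) q" by (rule o(3)) simp_all
    ultimately show ?thesis by simp
  qed
  note o = run_out_loop[where val = "\<lambda>l q. v (\<sigma> l) q" and w = d, OF c7 kn'(2) _ _ stepV p7]
  have o2: "\<forall>e<m * k. ar ?h8 1 e = ar ?h7 1 e" unfolding PV_def by (rule o(2)) simp_all
  have o3: "\<forall>l<k. \<forall>q<d. ar ?h8 1 (m * k + l * d + q) = v (\<sigma> l) q" unfolding PV_def by (rule o(3)) simp_all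
  have e: "run n Prest h = ?h8" by (simp add: Prest_def)
  have "ar ?h8 1 (r * k + l) = u (\<sigma> l) r" if "r < m" "l < k" for r l
  proof -
    have "r * k + l < Suc r * k" using that by simp
    also have "\<dots> \<le> m * k" using that by (intro mult_le_mono1) simp
    finally show ?thesis using o2 U(2) that by simp
  qed
  moreover have "iv ?h8 6 = k" using c7 by (simp add: PV_def)
  ultimately show ?thesis unfolding e using \<sigma>(1) o3 by blast
qed

end

section \<open>Approximate eigenvectors have the right sign pattern\<close>

text \<open>The bookkeeping device of the error analysis: one spare factor \<open>\<delta>\<close>
  absorbs any constant up to 100.\<close>

lemma small_pow: "0 \<le> (\<delta>::real) \<Longrightarrow> \<delta> \<le> 1 / 100 \<Longrightarrow> b < a \<Longrightarrow> c \<le> 100 \<Longrightarrow> c * \<delta> ^ a \<le> \<delta> ^ b"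
proof -
  assume *: "0 \<le> \<delta>" "\<delta> \<le> 1 / 100" "b < a" "c \<le> 100"
  have "\<delta> ^ a \<le> \<delta> ^ Suc b" using * by (intro power_decreasing) auto
  then have "100 * \<delta> ^ a \<le> 100 * \<delta> ^ Suc b" by simp
  also have "\<dots> = (100 * \<delta>) * \<delta> ^ b" by simp
  also have "\<dots> \<le> 1 * \<delta> ^ b" using * by (intro mult_right_mono) auto
  finally have "100 * \<delta> ^ a \<le> \<delta> ^ b" by simp
  moreover have "c * \<delta> ^ a \<le> 100 * \<delta> ^ a" using * by (intro mult_right_mono) auto
  ultimately show ?thesis by linarith
qed

lemma dotp_add_self: "dotp d (\<lambda>p. a p + b p) (\<lambda>p. a p + b p) \<le> 2 * dotp d a a + 2 * dotp d b b"
proof -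
  have "dotp d (\<lambda>p. a p + b p) (\<lambda>p. a p + b p) + dotp d (\<lambda>p. a p - b p) (\<lambda>p. a p - b p) = 2 * dotp d a a + 2 * dotp d b b"
    unfolding dotp_def sum.distrib[symmetric] sum_distrib_left
    by (intro sum.cong refl) (simp add: algebra_simps)
  then show ?thesis using dotp_self_nonneg[of d "\<lambda>p. a p - b p"] by linarith
qed

text \<open>A square matrix with a zero row is singular. Hence the null space from which candidates
  are taken is never trivial.\<close>

lemma kernel_vector:
  fixes a :: "nat \<Rightarrow> nat \<Rightarrow> real"
  assumes p0: "p0 < d" and z: "\<And>q. a p0 q = 0"
  shows "\<exists>x. dotp d x x > 0 \<and> (\<forall>t<d. dotp d (a t) x = 0)"
proof -
  define B where "B = mat\<^sub>r d d (\<lambda>t. if t = p0 then 0\<^sub>v d else vec d (a t))"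
  have B: "B \<in> carrier_mat d d" by (simp add: B_def)
  have "det B = 0" unfolding B_def by (rule det_row_0[OF p0]) auto
  then obtain w where w: "w \<in> carrier_vec d" "w \<noteq> 0\<^sub>v d" "B *\<^sub>v w = 0\<^sub>v d"
    using det_0_iff_vec_prod_zero_field[OF B] by blast
  have "\<exists>i<d. w $ i \<noteq> 0" using w(1,2) by (metis carrier_vecD eq_vecI index_zero_vec)
  then have "dotp d (\<lambda>i. w $ i) (\<lambda>i. w $ i) > 0" using dotp_self_pos by blast
  moreover have "dotp d (a t) (\<lambda>i. w $ i) = 0" if t: "t < d" for t
  proof (cases "t = p0")
    case True
    then show ?thesis using z by (simp add: dotp_def)
  next
    case False
    have "(B *\<^sub>v w) $ t = dotp d (a t) (\<lambda>i. w $ i)"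
      using t w(1) False by (simp add: B_def scalar_prod_def dotp_def atLeast0LessThan)
    then show ?thesis using w(3) t by simp
  qed
  ultimately show ?thesis by blast
qed

section \<open>The averaged matrix as a combination of empirical tensors\<close>

locale sample = run_data m d n N A x + orthonormal d k v for m d n N k A x v +
  fixes u :: "nat \<Rightarrow> nat \<Rightarrow> real" and S :: real
  assumes k1: "0 < k"
    and Au: "\<And>r i. r < m \<Longrightarrow> i < n \<Longrightarrow> A r i = (\<Sum>l<k. u l r * relu (dotp d (v l) (x i)))"
begin

definition s :: "nat \<Rightarrow> real" where "s l = (\<Sum>r<m. x r 0 * u l r)"

sublocale spectral d k v "\<lambda>l. c0 * s l"
  by unfold_locales

abbreviation Q :: "(nat \<Rightarrow> real) \<Rightarrow> real" where "Q y \<equiv> dotp d y y"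

definition \<delta> :: real where "\<delta> = 1 / real N"

text \<open>Nonvanishing inner products ensure that reversing \<open>w\<close> reverses the pattern
  exactly; the positive inner product with \<open>v j\<close> makes the refined vector a positive
  multiple of \<open>v j\<close>.\<close>

definition assoc :: "nat \<Rightarrow> (nat \<Rightarrow> real) \<Rightarrow> bool" where
  "assoc j w \<longleftrightarrow> 0 < dotp d w (v j) \<and>
    (\<forall>i<N. dotp d w (x i) \<noteq> 0 \<and> (0 < dotp d w (x i) \<longleftrightarrow> 0 < dotp d (v j) (x i)))"

definition Tn :: "nat \<Rightarrow> nat \<Rightarrow> nat \<Rightarrow> real" where
  "Tn l p q = (\<Sum>i<n. relu (dotp d (v l) (x i)) * (x i p * x i q - (if p = q then 1 else 0))) / n"

lemma yv_eq: "i < n \<Longrightarrow> yv i = (\<Sum>l<k. s l * relu (dotp d (v l) (x i)))"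
  unfolding yv_def s_def sum_distrib_right
  by (subst sum.swap) (simp add: Au sum_distrib_left algebra_simps)

text \<open>By linearity the direction \<open>g\<close> enters only through the coefficients
  \<open>s l\<close>. Concentration is then required of the averages \<open>Tn l\<close> alone, and
  it does not matter that \<open>g\<close> shares entries with the columns.\<close>

lemma M_eq: "M p q = (\<Sum>l<k. s l * Tn l p q)"
proof -
  have "M p q = (\<Sum>i<n. yv i * (x i p * x i q - (if p = q then 1 else 0))) / n"
    unfolding M_def by (simp add: right_diff_distrib sum_subtractf diff_divide_distrib sum_distrib_right if_distrib[of "\<lambda>c. _ * c"] cong: if_cong)
  also have "(\<Sum>i<n. yv i * (x i p * x i q - (if p = q then 1 else 0))) =
      (\<Sum>i<n. \<Sum>l<k. s l * (relu (dotp d (v l) (x i)) * (x i p * x i q - (if p = q then 1 else 0))))"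
    by (intro sum.cong refl) (simp only: yv_eq lessThan_iff sum_distrib_right mult.assoc)
  also have "\<dots> / n = (\<Sum>l<k. s l * Tn l p q)"
    by (subst sum.swap) (simp add: Tn_def sum_divide_distrib sum_distrib_left)
  finally show ?thesis .
qed

lemma M_sym: "M p q = M q p"
  by (simp add: M_def mult.commute)

end

text \<open>\<open>S\<close> stands for the least singular value of \<open>U\<close>. The margins
  are powers of \<open>N\<close> chosen so that each is violated with probability at most
  \<open>1 / N\<close> times a polynomial in the dimensions; the tensors, being averages over all
  \<open>n\<close> columns, can be much more accurate than the other bounds.\<close>

locale spectral_sample = sample +
  assumes N100: "100 \<le> N" and d2: "(real d)\<^sup>2 \<le> N" and n42: "real N ^ 42 \<le> n"
    and S0: "0 < S"
    and s_sum: "(\<Sum>l<k. \<bar>s l\<bar>) \<le> real N ^ 3 * S"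
    and s_gap: "\<And>i j. i < k \<Longrightarrow> j < k \<Longrightarrow> i \<noteq> j \<Longrightarrow> S / N \<le> \<bar>s i - s j\<bar>"
    and s_big: "\<And>j. j < k \<Longrightarrow> S / N \<le> \<bar>s j\<bar>"
    and xb: "\<And>i p. i < N \<Longrightarrow> p < d \<Longrightarrow> \<bar>x i p\<bar> \<le> (real N)\<^sup>2"
    and vx: "\<And>j i. j < k \<Longrightarrow> i < N \<Longrightarrow> 1 / real N ^ 3 \<le> \<bar>dotp d (v j) (x i)\<bar>"
    and tens: "\<And>l p q. l < k \<Longrightarrow> p < d \<Longrightarrow> q < d \<Longrightarrow> \<bar>Tn l p q - c0 * v l p * v l q\<bar> \<le> 1 / real N ^ 20"
begin

lemma \<delta>: "0 < \<delta>" "\<delta> \<le> 1 / 100" "0 \<le> \<delta>"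
  using N100 by (auto simp: \<delta>_def field_simps)

lemma \<delta>N: "real N * \<delta> = 1" "real N ^ a * \<delta> ^ a = 1" "1 / real N ^ a = \<delta> ^ a"
  using N100 by (auto simp: \<delta>_def field_simps power_divide)

lemma sp: "b < a \<Longrightarrow> c \<le> 100 \<Longrightarrow> c * \<delta> ^ a \<le> \<delta> ^ b"
  using \<delta> by (intro small_pow) auto

lemma d\<delta>: "real d * real d * \<delta> \<le> 1" "real d * \<delta> \<le> 1" "1 \<le> real d"
proof -
  have "real d * real d * \<delta> \<le> real N * \<delta>" using d2 \<delta> by (intro mult_right_mono) (auto simp: power2_eq_square)
  then show 1: "real d * real d * \<delta> \<le> 1" using \<delta>N(1) by simp
  show d: "1 \<le> real d" using d0 by simp
  have "1 * (real d * \<delta>) \<le> real d * (real d * \<delta>)" using d \<delta> by (intro mult_right_mono) auto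
  then show "real d * \<delta> \<le> 1" using 1 by simp
qed

lemma vle1: "l < k \<Longrightarrow> p < d \<Longrightarrow> (v l p)\<^sup>2 \<le> 1"
  using v_dot[of l l] member_le_sum[of p "{..<d}" "\<lambda>p. v l p * v l p"] by (simp add: dotp_def power2_eq_square)

text \<open>Of the 20 powers of \<open>\<delta>\<close> in the accuracy of the tensors, three are
  spent on the sum of the \<open>\<bar>s l\<bar>\<close>.\<close>

lemma M_err: "p < d \<Longrightarrow> q < d \<Longrightarrow> \<bar>M p q - (\<Sum>l<k. c0 * s l * v l p * v l q)\<bar> \<le> \<delta> ^ 17 * S"
proof -
  assume pq: "p < d" "q < d"
  have "\<bar>M p q - (\<Sum>l<k. c0 * s l * v l p * v l q)\<bar> = \<bar>\<Sum>l<k. s l * (Tn l p q - c0 * v l p * v l q)\<bar>"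
    by (simp add: M_eq sum_subtractf[symmetric] algebra_simps)
  also have "\<dots> \<le> (\<Sum>l<k. \<bar>s l\<bar> * \<delta> ^ 20)"
    using tens pq by (intro order_trans[OF sum_abs] sum_mono) (auto simp: abs_mult \<delta>N(3) intro!: mult_left_mono)
  also have "\<dots> \<le> (real N ^ 3 * S) * \<delta> ^ 20" unfolding sum_distrib_right[symmetric] using s_sum \<delta> by (intro mult_right_mono) auto
  also have "\<dots> = \<delta> ^ 17 * S * (real N ^ 3 * \<delta> ^ 3)" by (simp add: power_add[symmetric])
  finally show ?thesis by (simp add: \<delta>N(2))
qed

definition er :: "(nat \<Rightarrow> real) \<Rightarrow> nat \<Rightarrow> real" where "er y p = dotp d (M p) y - Mx y p"

text \<open>Squaring gives \<open>\<delta> ^ 34\<close>. The \<open>d * d\<close> entries cost one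
  power, as \<open>d * d * \<delta> \<le> 1\<close>, and one more is given away to make the exponent
  even, so that a root can be taken.\<close>

lemma er_bound: "Q (er y) \<le> \<delta> ^ 32 * S\<^sup>2 * Q y"
proof -
  have 1: "(er y p)\<^sup>2 \<le> real d * (\<delta> ^ 34 * S\<^sup>2) * Q y" if p: "p < d" for p
  proof -
    let ?e = "\<lambda>q. M p q - (\<Sum>l<k. c0 * s l * v l p * v l q)"
    have "Mx y p = (\<Sum>l<k. \<Sum>q<d. c0 * s l * v l p * v l q * y q)"
      unfolding Mx_def dotp_def by (intro sum.cong refl) (simp add: sum_distrib_left sum_distrib_right algebra_simps)
    also have "\<dots> = (\<Sum>q<d. \<Sum>l<k. c0 * s l * v l p * v l q * y q)" by (rule sum.swap)
    finally have "er y p = dotp d ?e y"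
      unfolding er_def by (simp add: dotp_def left_diff_distrib sum_subtractf sum_distrib_right)
    then have "(er y p)\<^sup>2 \<le> dotp d ?e ?e * Q y" by (simp add: dotp_CS)
    moreover have "dotp d ?e ?e \<le> (\<Sum>q<d. \<delta> ^ 34 * S\<^sup>2)"
      unfolding dotp_def
    proof (rule sum_mono)
      fix q assume "q \<in> {..<d}"
      then have "(?e q)\<^sup>2 \<le> (\<delta> ^ 17 * S)\<^sup>2" using M_err[OF p] S0 \<delta> by (intro power2_le_iff_abs_le[THEN iffD2]) auto
      then show "?e q * ?e q \<le> \<delta> ^ 34 * S\<^sup>2" by (simp add: power2_eq_square power_mult_distrib power_add[symmetric] algebra_simps)
    qed
    ultimately show ?thesis using mult_right_mono[OF _ dotp_self_nonneg[of d y]] by fastforce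
  qed
  have "Q (er y) \<le> (\<Sum>p<d. real d * (\<delta> ^ 34 * S\<^sup>2) * Q y)"
    unfolding dotp_def[of d "er y"] using 1 by (intro sum_mono) (auto simp: power2_eq_square)
  also have "\<dots> = (real d * real d * \<delta>) * (\<delta> ^ 33 * S\<^sup>2 * Q y)" by (simp add: numeral_eq_Suc)
  also have "\<dots> \<le> 1 * (\<delta> ^ 33 * S\<^sup>2 * Q y)" using d\<delta> \<delta> dotp_self_nonneg by (intro mult_right_mono) auto
  also have "\<dots> \<le> \<delta> ^ 32 * S\<^sup>2 * Q y"
    using sp[of 32 33 1] dotp_self_nonneg[of d y] by (simp add: mult_right_mono)
  finally show ?thesis .
qed

lemma F0: "0 \<le> F" and F2: "F\<^sup>2 = (\<Sum>p<d. Q (M p))"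
  unfolding F_def dotp_def by (simp_all add: sum_nonneg)

lemma MQ: "Q (\<lambda>p. dotp d (M p) y) \<le> F\<^sup>2 * Q y"
  unfolding F2 sum_distrib_right dotp_def[of d "\<lambda>p. dotp d (M p) y"]
  using dotp_CS by (intro sum_mono) (simp add: power2_eq_square)

lemma F_ge: "j < k \<Longrightarrow> \<bar>c0 * s j\<bar> \<le> F + \<delta> ^ 16 * S"
proof -
  assume j: "j < k"
  have "(dotp d (v j) (\<lambda>p. dotp d (M p) (v j)))\<^sup>2 \<le> 1 * (F\<^sup>2 * 1)"
    using dotp_CS[of d "v j" "\<lambda>p. dotp d (M p) (v j)"] MQ[of "v j"] v_dot[OF j j] by simp
  then have 1: "\<bar>dotp d (v j) (\<lambda>p. dotp d (M p) (v j))\<bar> \<le> F" using F0 by (simp add: power2_le_iff_abs_le)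
  have "(dotp d (v j) (er (v j)))\<^sup>2 \<le> \<delta> ^ 32 * S\<^sup>2"
    using dotp_CS[of d "v j" "er (v j)"] er_bound[of "v j"] v_dot[OF j j] by simp
  also have "\<dots> = (\<delta> ^ 16 * S)\<^sup>2" by (simp add: power_mult_distrib flip: power_mult)
  finally have 2: "\<bar>dotp d (v j) (er (v j))\<bar> \<le> \<delta> ^ 16 * S" using \<delta> S0 by (simp add: power2_le_iff_abs_le)
  have "dotp d (v j) (Mx (v j)) = c0 * s j"
    using v_dot[OF j j] dotp_scale[of d "v j" "c0 * s j" "v j"] by (simp add: Mx_eigen[OF j] cong: dotp_cong)
  then have "dotp d (v j) (er (v j)) = dotp d (v j) (\<lambda>p. dotp d (M p) (v j)) - c0 * s j"
    unfolding er_def[abs_def] dotp_diff by simp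
  then show ?thesis using 1 2 by linarith
qed

lemma \<mu>_big: "j < k \<Longrightarrow> \<delta> * S / 3 \<le> \<bar>c0 * s j\<bar>"
  using mult_mono[OF c0_bounds(1) s_big[of j]] S0 c0_bounds by (simp add: abs_mult \<delta>_def)

lemma \<mu>_gap: "i < k \<Longrightarrow> j < k \<Longrightarrow> i \<noteq> j \<Longrightarrow> \<delta> * S / 3 \<le> \<bar>c0 * s i - c0 * s j\<bar>"
  using mult_mono[OF c0_bounds(1) s_gap[of i j]] S0 c0_bounds by (simp add: abs_mult \<delta>_def flip: right_diff_distrib)

lemma sS: "b < a \<Longrightarrow> c \<le> 100 \<Longrightarrow> c * (\<delta> ^ a * S) \<le> \<delta> ^ b * S"
  using mult_right_mono[OF sp[of b a c], of S] S0 by (simp add: mult.assoc)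

text \<open>The Frobenius norm dominates the values of the form of \<open>M\<close> at the unit
  vectors \<open>v j\<close>, which are nearly \<open>c0 * s j\<close>. So \<open>F\<close> is not
  small compared with \<open>S\<close>, and every eigenvalue sought lies between
  \<open>- 2 * F\<close> and \<open>2 * F\<close>, the range of the grid.\<close>

lemma F_low: "\<delta> * S / 4 \<le> F" and \<mu>_F: "j < k \<Longrightarrow> \<bar>c0 * s j\<bar> < 2 * F"
proof -
  have 16: "100 * (\<delta> ^ 16 * S) \<le> \<delta> * S" using sS[of 1 16 100] by simp
  have 0: "0 < \<delta> * S" using \<delta> S0 by simp
  show low: "\<delta> * S / 4 \<le> F" using \<mu>_big[of 0] F_ge[of 0] k1 16 0 by simp
  show "j < k \<Longrightarrow> \<bar>c0 * s j\<bar> < 2 * F" using F_ge[of j] low 16 0 by simp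
qed

text \<open>The entries of \<open>M\<close> are at most \<open>N ^ 3 * S\<close>, and there are
  \<open>d * d\<close>, hence at most \<open>N\<close>, of them; squaring makes seven powers of
  \<open>N\<close>.\<close>

lemma F_up: "F\<^sup>2 * \<delta> ^ 7 \<le> S\<^sup>2"
proof -
  have "\<bar>M p q\<bar> \<le> real N ^ 3 * S" if pq: "p < d" "q < d" for p q
  proof -
    have "\<bar>Tn l p q\<bar> \<le> 1" if l: "l < k" for l
    proof -
      have "(v l p * v l q)\<^sup>2 \<le> 1" unfolding power_mult_distrib using vle1[OF l pq(1)] vle1[OF l pq(2)] by (simp add: mult_le_one)
      then have "\<bar>v l p * v l q\<bar> \<le> 1" using abs_le_square_iff[of "v l p * v l q" 1] by simp
      then have "c0 * \<bar>v l p * v l q\<bar> \<le> c0 * 1" using c0_bounds by (intro mult_left_mono) auto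
      moreover have "\<bar>c0 * v l p * v l q\<bar> = c0 * \<bar>v l p * v l q\<bar>" using c0_bounds by (simp add: abs_mult mult.assoc)
      ultimately have "\<bar>c0 * v l p * v l q\<bar> \<le> 1 / 2" using c0_bounds by linarith
      moreover have "\<bar>Tn l p q - c0 * v l p * v l q\<bar> \<le> 1 / 100" using tens[OF l pq] \<delta>N(3)[of 20] sp[of 0 20 100] by simp
      ultimately show ?thesis by linarith
    qed
    then have "\<bar>M p q\<bar> \<le> (\<Sum>l<k. \<bar>s l\<bar> * 1)"
      unfolding M_eq by (intro order_trans[OF sum_abs] sum_mono) (simp add: abs_mult mult_left_le)
    then show ?thesis using s_sum by simp
  qed
  then have "(M p q)\<^sup>2 \<le> (real N ^ 3 * S)\<^sup>2" if "p < d" "q < d" for p q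
    using that S0 by (intro power2_le_iff_abs_le[THEN iffD2]) auto
  then have "F\<^sup>2 \<le> (\<Sum>p<d. \<Sum>q<d. (real N ^ 3 * S)\<^sup>2)"
    unfolding F2 dotp_def by (intro sum_mono) (auto simp: power2_eq_square)
  then have "F\<^sup>2 * \<delta> ^ 7 \<le> (real d * real d * (real N ^ 3 * S)\<^sup>2) * \<delta> ^ 7" using \<delta> by (intro mult_right_mono) auto
  also have "\<dots> = (real d * real d * \<delta>) * S\<^sup>2 * (real N ^ 6 * \<delta> ^ 6)" by (simp add: power_mult_distrib numeral_eq_Suc)
  also have "\<dots> \<le> 1 * S\<^sup>2 * (real N ^ 6 * \<delta> ^ 6)" using d\<delta> by (intro mult_right_mono) auto
  finally show ?thesis by (simp add: \<delta>N(2))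
qed

lemma residual:
  assumes L: "Q (\<lambda>p. dotp d (M p) y - L * y p) \<le> \<delta> ^ 17 * S\<^sup>2 * Q y"
  shows "Q (\<lambda>p. Mx y p - L * y p) \<le> (2 * \<delta> ^ 8 * S)\<^sup>2 * Q y"
proof -
  have "Q (\<lambda>p. (dotp d (M p) y - L * y p) + (- er y p)) \<le> 2 * (\<delta> ^ 17 * S\<^sup>2 * Q y) + 2 * Q (\<lambda>p. - er y p)"
    using dotp_add_self[of d "\<lambda>p. dotp d (M p) y - L * y p" "\<lambda>p. - er y p"] L by linarith
  also have "Q (\<lambda>p. - er y p) = Q (er y)" by (simp add: dotp_def)
  also have "2 * (\<delta> ^ 17 * S\<^sup>2 * Q y) + 2 * Q (er y) \<le> (2 * \<delta> ^ 17 + 2 * \<delta> ^ 32) * (S\<^sup>2 * Q y)"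
    using er_bound[of y] by (simp add: algebra_simps)
  also have "\<dots> \<le> (4 * \<delta> ^ 16) * (S\<^sup>2 * Q y)"
  proof (rule mult_right_mono)
    have "0 < \<delta> ^ 16" using \<delta> by simp
    then show "2 * \<delta> ^ 17 + 2 * \<delta> ^ 32 \<le> 4 * \<delta> ^ 16" using sp[of 16 17 2] sp[of 16 32 2] by linarith
  qed (simp add: dotp_self_nonneg)
  finally show ?thesis by (simp add: er_def power_mult_distrib algebra_simps flip: power_mult)
qed

text \<open>All other eigenvalues, zero included, have distance at least
  \<open>\<delta> * S / 4\<close> from \<open>L\<close>. Against a residual of
  \<open>2 * \<delta> ^ 8 * S\<close> this leaves a relative squared deviation of
  \<open>64 * \<delta> ^ 14\<close> from the line of \<open>v j\<close>.\<close>

lemma dominated: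
  assumes j: "j < k" and y: "Q y > 0" and L: "\<bar>c0 * s j - L\<bar> \<le> 2 * \<delta> ^ 8 * S"
    and res: "Q (\<lambda>p. dotp d (M p) y - L * y p) \<le> \<delta> ^ 17 * S\<^sup>2 * Q y"
  defines "r \<equiv> \<lambda>p. y p - dotp d (v j) y * v j p"
  shows "Q r \<le> \<delta> ^ 12 * Q y" "Q y \<le> 2 * (dotp d (v j) y)\<^sup>2"
proof -
  let ?g = "\<delta> * S / 4"
  have 0: "0 < \<delta> * S" using \<delta> S0 by simp
  have small: "100 * (\<delta> ^ 8 * S) \<le> \<delta> * S" using sS[of 1 8 100] by simp
  have far: "?g \<le> \<bar>c0 * s l - L\<bar>" if "l < k" "l \<noteq> j" for l
    using \<mu>_gap[OF that(1) j that(2)] L small 0 by linarith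
  have "?g \<le> \<bar>L\<bar>" using \<mu>_big[OF j] L small 0 by linarith
  from off_component[OF j far this, of y] 0
  have "?g\<^sup>2 * (Q y - (dotp d (v j) y)\<^sup>2) \<le> (2 * \<delta> ^ 8 * S)\<^sup>2 * Q y"
    using residual[OF res] by (meson less_imp_le order_trans divide_nonneg_pos zero_less_numeral)
  then have "(\<delta> * S)\<^sup>2 * (Q y - (dotp d (v j) y)\<^sup>2) \<le> (\<delta> * S)\<^sup>2 * (64 * \<delta> ^ 14 * Q y)"
  proof -
    assume a: "?g\<^sup>2 * (Q y - (dotp d (v j) y)\<^sup>2) \<le> (2 * \<delta> ^ 8 * S)\<^sup>2 * Q y"
    have "?g\<^sup>2 = (\<delta> * S)\<^sup>2 / 16" by (simp add: power_divide)
    moreover have "(2 * \<delta> ^ 8 * S)\<^sup>2 = (\<delta> * S)\<^sup>2 * (4 * \<delta> ^ 14)"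
      by (simp add: power_mult_distrib flip: power_mult power_add)
    ultimately show ?thesis using a by (simp only:)
  qed
  then have "Q y - (dotp d (v j) y)\<^sup>2 \<le> 64 * \<delta> ^ 14 * Q y"
    by (rule mult_left_le_imp_le) (use \<delta> S0 in simp)
  also have "\<dots> \<le> \<delta> ^ 12 * Q y" using sp[of 12 14 64] y by (intro mult_right_mono) auto
  finally have 1: "Q y - (dotp d (v j) y)\<^sup>2 \<le> \<delta> ^ 12 * Q y" .
  then show "Q r \<le> \<delta> ^ 12 * Q y" unfolding r_def component_diff[OF j] .
  have "\<delta> ^ 12 * Q y \<le> (1 / 2) * Q y" using sp[of 0 12 2] y by (intro mult_right_mono) auto
  then show "Q y \<le> 2 * (dotp d (v j) y)\<^sup>2" using 1 by linarith
qed

text \<open>Relative to \<open>Q y\<close>, the deviation from \<open>\<beta> * v j\<close>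
  contributes to a squared inner product with a column at most
  \<open>\<delta> ^ 12 * d * N ^ 4\<close>, hence at most \<open>\<delta> ^ 7\<close>, while the
  main term contributes at least \<open>\<delta> ^ 6 / 2\<close>. So the main term decides the sign;
  \<open>\<beta>\<close> itself may be negative.\<close>

lemma same_signs:
  assumes j: "j < k" and y: "Q y > 0" and L: "\<bar>c0 * s j - L\<bar> \<le> 2 * \<delta> ^ 8 * S"
    and res: "Q (\<lambda>p. dotp d (M p) y - L * y p) \<le> \<delta> ^ 17 * S\<^sup>2 * Q y"
  shows "assoc j y \<or> assoc j (\<lambda>q. - y q)"
proof -
  define \<beta> where "\<beta> = dotp d (v j) y"
  define r where "r p = y p - \<beta> * v j p" for p
  have D: "Q r \<le> \<delta> ^ 12 * Q y" "Q y \<le> 2 * \<beta>\<^sup>2"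
    using dominated[OF assms] unfolding r_def[abs_def] \<beta>_def by blast+
  have r: "\<bar>dotp d r (x i)\<bar> < \<bar>\<beta> * dotp d (v j) (x i)\<bar>" if i: "i < N" for i
  proof -
    have "(x i p)\<^sup>2 \<le> real N ^ 4" if "p < d" for p
      using power_mono[OF xb[OF i that], of 2] by (simp flip: power_mult)
    then have "Q (x i) \<le> (\<Sum>p<d. real N ^ 4)" unfolding dotp_def by (intro sum_mono) (auto simp: power2_eq_square)
    then have "(dotp d r (x i))\<^sup>2 \<le> (\<delta> ^ 12 * Q y) * (real d * real N ^ 4)"
      using D(1) y \<delta> dotp_self_nonneg[of d "x i"] by (intro order_trans[OF dotp_CS] mult_mono) auto
    also have "\<dots> = \<delta> ^ 7 * Q y * (real d * \<delta>) * (real N ^ 4 * \<delta> ^ 4)" by (simp add: numeral_eq_Suc)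
    also have "\<dots> \<le> \<delta> ^ 7 * Q y * 1 * (real N ^ 4 * \<delta> ^ 4)"
      using d\<delta> \<delta> y by (intro mult_right_mono mult_left_mono) auto
    also have "\<dots> = \<delta> ^ 7 * Q y" by (simp add: \<delta>N(2))
    finally have 1: "(dotp d r (x i))\<^sup>2 \<le> \<delta> ^ 7 * Q y" .
    have "\<delta> ^ 6 * Q y \<le> \<delta> ^ 6 * (2 * \<beta>\<^sup>2)" using D(2) \<delta> by (intro mult_left_mono) auto
    also have "\<dots> = (\<delta> ^ 3)\<^sup>2 * (2 * \<beta>\<^sup>2)" by (simp flip: power_mult)
    also have "\<dots> \<le> (dotp d (v j) (x i))\<^sup>2 * (2 * \<beta>\<^sup>2)"
    proof (rule mult_right_mono)
      have "(\<delta> ^ 3)\<^sup>2 \<le> \<bar>dotp d (v j) (x i)\<bar>\<^sup>2" using vx[OF j i] \<delta> unfolding \<delta>N(3) by (intro power_mono) auto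
      then show "(\<delta> ^ 3)\<^sup>2 \<le> (dotp d (v j) (x i))\<^sup>2" by simp
    qed simp
    finally have 2: "\<delta> ^ 6 * Q y \<le> 2 * (\<beta> * dotp d (v j) (x i))\<^sup>2" by (simp add: power_mult_distrib algebra_simps)
    have "3 * \<delta> ^ 7 * Q y \<le> \<delta> ^ 6 * Q y" using sp[of 6 7 3] y by (intro mult_right_mono) auto
    moreover have "0 < \<delta> ^ 7 * Q y" using \<delta> y by simp
    ultimately have "(dotp d r (x i))\<^sup>2 < (\<beta> * dotp d (v j) (x i))\<^sup>2" using 1 2 by linarith
    then show ?thesis using abs_le_square_iff not_le by blast
  qed
  have yx: "dotp d y (x i) = \<beta> * dotp d (v j) (x i) + dotp d r (x i)" for i
    unfolding r_def[abs_def] by (simp add: dotp_def sum_distrib_left sum.distrib[symmetric] algebra_simps)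
  have \<beta>0: "\<beta> \<noteq> 0" using D(2) y by auto
  show ?thesis
  proof (cases "\<beta> > 0")
    case True
    have "assoc j y" unfolding assoc_def
    proof (intro conjI allI impI)
      show "0 < dotp d y (v j)" using True by (simp add: \<beta>_def dotp_commute)
      fix i assume i: "i < N"
      have a: "\<bar>dotp d r (x i)\<bar> < \<beta> * \<bar>dotp d (v j) (x i)\<bar>" using r[OF i] True by (simp add: abs_mult)
      have b: "0 < \<beta> * t \<longleftrightarrow> 0 < t" for t using True by (simp add: zero_less_mult_iff)
      show "dotp d y (x i) \<noteq> 0" "0 < dotp d y (x i) \<longleftrightarrow> 0 < dotp d (v j) (x i)"
        using a b[of "dotp d (v j) (x i)"] b[of "- dotp d (v j) (x i)"] unfolding yx by (auto simp: abs_if split: if_splits)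
    qed
    then show ?thesis by simp
  next
    case False
    then have neg: "\<beta> < 0" using \<beta>0 by simp
    have mi: "dotp d (\<lambda>q. - y q) z = - dotp d y z" for z by (simp add: dotp_def sum_negf)
    have "assoc j (\<lambda>q. - y q)" unfolding assoc_def mi
    proof (intro conjI allI impI)
      show "0 < - dotp d y (v j)" using neg by (simp add: \<beta>_def dotp_commute)
      fix i assume i: "i < N"
      have a: "\<bar>dotp d r (x i)\<bar> < - \<beta> * \<bar>dotp d (v j) (x i)\<bar>" using r[OF i] neg by (simp add: abs_mult)
      have b: "\<beta> * t < 0 \<longleftrightarrow> 0 < t" for t using neg by (simp add: mult_less_0_iff)
      show "- dotp d y (x i) \<noteq> 0" "0 < - dotp d y (x i) \<longleftrightarrow> 0 < dotp d (v j) (x i)"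
        using a b[of "dotp d (v j) (x i)"] b[of "- dotp d (v j) (x i)"] unfolding yx by (auto simp: abs_if split: if_splits)
    qed
    then show ?thesis by simp
  qed
qed

lemma rowsE_dot: "t < d \<Longrightarrow> dotp d (rowsE li p0 t) y = (if t = p0 then 0 else dotp d (M t) y - lam li * y t)"
  using dotp_unit[of t d y]
  by (simp add: rowsE_def[abs_def] dotp_def left_diff_distrib sum_subtractf if_distrib[of "\<lambda>c. c * _"] cong: if_cong)

lemma xc_null: "p0 < d \<Longrightarrow> t < d \<Longrightarrow> dotp d (rowsE li p0 t) (xc li p0) = 0"
proof -
  assume p: "p0 < d" "t < d"
  have "dotp d (npj d (rowsE li p0) d p0) (rowsE li p0 t) = dotp d (xc li p0) (rowsE li p0 t)"
    unfolding xc_def by (intro dotp_cong npj_sym p) auto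
  then show ?thesis using npj_kill[OF p(2,1), of "rowsE li p0"] by (simp add: dotp_commute)
qed

lemma shifted:
  assumes y: "\<And>t. t < d \<Longrightarrow> dotp d (rowsE li p0 t) y = 0" and p: "p < d" "p \<noteq> p0"
  shows "dotp d (M p) y = lam li * y p"
  using y[OF p(1)] rowsE_dot[OF p(1), of li p0 y] p(2) by simp

text \<open>Every row other than \<open>p0\<close> is satisfied exactly, so the residual is a
  multiple of a coordinate vector.\<close>

lemma shifted_Q:
  assumes p0: "p0 < d" and y: "\<And>t. t < d \<Longrightarrow> dotp d (rowsE li p0 t) y = 0"
  shows "Q (\<lambda>p. dotp d (M p) y - lam li * y p) = (dotp d (M p0) y - lam li * y p0)\<^sup>2"
proof -
  let ?t = "dotp d (M p0) y - lam li * y p0"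
  have "Q (\<lambda>p. dotp d (M p) y - lam li * y p) = Q (\<lambda>p. ?t * (if p = p0 then 1 else 0))"
    by (intro dotp_cong) (simp_all add: shifted[OF y])
  also have "\<dots> = ?t\<^sup>2" unfolding dotp_scale dotp_unit[OF p0] by (simp add: power2_eq_square)
  finally show ?thesis .
qed

text \<open>Both tests are relative to \<open>F\<close> and are translated to \<open>S\<close>. The
  first bounds the squared residual by \<open>\<delta> ^ 24 * F^2\<close>, which is at most
  \<open>\<delta> ^ 17 * S^2\<close>, relative to the candidate; the second keeps
  \<open>lam li\<close> above \<open>2 * \<delta> ^ 8 * S\<close> in absolute value, so the
  candidate cannot come from the kernel.\<close>

lemma sound:
  assumes p0: "p0 < d" and c: "check li p0"
  shows "\<exists>j<k. assoc j (xc li p0) \<or> assoc j (\<lambda>q. - xc li p0 q)"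
proof -
  let ?y = "xc li p0"
  have c1: "real N ^ 24 * (tt li p0)\<^sup>2 < F\<^sup>2 * Q ?y" and c2: "F\<^sup>2 < real N ^ 10 * (lam li)\<^sup>2"
    using c by (simp_all add: check_def power2_eq_square)
  have y: "Q ?y > 0"
  proof (rule ccontr)
    assume "\<not> Q ?y > 0"
    then have "Q ?y = 0" using dotp_self_nonneg[of d ?y] by linarith
    then have "real N ^ 24 * (tt li p0)\<^sup>2 < 0" using c1 by simp
    then show False by (simp add: mult_less_0_iff)
  qed
  have "\<delta> ^ 24 * (real N ^ 24 * (tt li p0)\<^sup>2) \<le> \<delta> ^ 24 * (F\<^sup>2 * Q ?y)" using c1 \<delta> by (intro mult_left_mono) auto
  then have "(real N ^ 24 * \<delta> ^ 24) * (tt li p0)\<^sup>2 \<le> \<delta> ^ 17 * (F\<^sup>2 * \<delta> ^ 7) * Q ?y" by (simp add: mult.commute mult.left_commute flip: power_add)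
  also have "\<dots> \<le> \<delta> ^ 17 * S\<^sup>2 * Q ?y" using F_up \<delta> y by (intro mult_right_mono mult_left_mono) auto
  finally have "(tt li p0)\<^sup>2 \<le> \<delta> ^ 17 * S\<^sup>2 * Q ?y" unfolding \<delta>N(2) by simp
  then have res: "Q (\<lambda>p. dotp d (M p) ?y - lam li * ?y p) \<le> \<delta> ^ 17 * S\<^sup>2 * Q ?y"
    using shifted_Q[OF p0, of li ?y] xc_null[OF p0, of _ li] by (simp add: tt_def)
  let ?\<rho> = "2 * \<delta> ^ 8 * S"
  have "?\<rho> < \<bar>lam li\<bar>"
  proof -
    have "\<delta> ^ 10 * F\<^sup>2 < \<delta> ^ 10 * (real N ^ 10 * (lam li)\<^sup>2)" using c2 \<delta> by (intro mult_strict_left_mono) auto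
    also have "\<dots> = (lam li)\<^sup>2" using \<delta>N(2)[of 10] by (simp add: mult.commute mult.left_commute flip: mult.assoc)
    finally have "(\<delta> ^ 5 * F)\<^sup>2 < (lam li)\<^sup>2" by (simp add: power_mult_distrib flip: power_mult)
    then have "\<delta> ^ 5 * F < \<bar>lam li\<bar>" using F0 \<delta> abs_le_square_iff[of "lam li" "\<delta> ^ 5 * F"] by (simp add: not_le[symmetric])
    moreover have "\<delta> ^ 5 * (\<delta> * S / 4) \<le> \<delta> ^ 5 * F" using F_low \<delta> by (intro mult_left_mono) auto
    moreover have "\<delta> ^ 5 * (\<delta> * S / 4) = \<delta> ^ 6 * S / 4" by (simp add: numeral_eq_Suc)
    moreover have "8 * (\<delta> ^ 8 * S) \<le> \<delta> ^ 6 * S" by (rule sS) auto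
    ultimately show ?thesis by linarith
  qed
  moreover have "0 \<le> ?\<rho>" using \<delta> S0 by simp
  ultimately obtain j where "j < k" "\<bar>c0 * s j - lam li\<bar> \<le> ?\<rho>"
    using near_eigenvalue[OF residual[OF res] y] by blast
  then show ?thesis using same_signs[OF _ y _ res] by blast
qed

text \<open>The spacing is \<open>4 * F / n\<close>, where \<open>F\<close> is at most
  \<open>N ^ 4 * S\<close> and \<open>n\<close> at least \<open>N ^ 42\<close>: far finer than
  required.\<close>

lemma grid_near:
  assumes j: "j < k"
  shows "\<exists>li<n. \<bar>c0 * s j - lam li\<bar> \<le> \<delta> ^ 16 * S"
proof -
  have 0: "0 < \<delta> * S" using \<delta> S0 by simp
  have Fp: "0 < F" using F_low 0 by simp
  have n0: "0 < real n" using sz by simp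
  \<comment> \<open>The real-valued index of the eigenvalue on the grid. The strict bounds by
    \<open>2 * F\<close> put it between 0 and \<open>n\<close>, so its integer part is an admissible
    index.\<close>
  define a where "a = (c0 * s j / F + 2) / 4 * n"
  have "c0 * s j < 2 * F" "- 2 * F < c0 * s j" using \<mu>_F[OF j] by linarith+
  then have cs: "c0 * s j / F < 2" "- 2 < c0 * s j / F" using Fp by (simp_all add: divide_less_eq less_divide_eq)
  have a: "0 \<le> a" unfolding a_def using cs by (intro mult_nonneg_nonneg) auto
  have "(c0 * s j / F + 2) / 4 * n < 1 * real n" using cs n0 by (intro mult_strict_right_mono) auto
  then have an: "a < n" by (simp add: a_def)
  define li where "li = nat \<lfloor>a\<rfloor>"
  have li: "real li \<le> a" "a < real li + 1" unfolding li_def using a by linarith+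
  have lin: "li < n" using li an by linarith
  have e: "c0 * s j = F * (4 * a / n - 2)" using Fp n0 by (simp add: a_def field_simps)
  have diff: "c0 * s j - lam li = 4 * F * (a - real li) / n"
    by (subst e) (simp add: lam_def algebra_simps diff_divide_distrib)
  have "\<bar>c0 * s j - lam li\<bar> \<le> 4 * F / n"
    unfolding diff using li Fp n0 by (simp add: abs_mult divide_right_mono mult_left_le)
  moreover have "4 * F / n \<le> \<delta> ^ 16 * S"
  proof -
    have "(F * \<delta> ^ 4)\<^sup>2 = F\<^sup>2 * \<delta> ^ 8" by (simp add: power_mult_distrib flip: power_mult)
    also have "\<dots> \<le> F\<^sup>2 * \<delta> ^ 7" using sp[of 7 8 1] by (intro mult_left_mono) auto
    finally have "F * \<delta> ^ 4 \<le> S" using F_up S0 power2_le_imp_le[of "F * \<delta> ^ 4" S] by simp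
    have "1 / n \<le> 1 / real N ^ 42" using n42 n0 N100 by (intro divide_left_mono) auto
    then have "4 * F * (1 / n) \<le> 4 * F * \<delta> ^ 42" unfolding \<delta>N(3) using Fp by (intro mult_left_mono) auto
    also have "\<dots> = 4 * \<delta> ^ 38 * (F * \<delta> ^ 4)" by (simp flip: power_add)
    also have "\<dots> \<le> 4 * \<delta> ^ 38 * S" using \<open>F * \<delta> ^ 4 \<le> S\<close> \<delta> by (intro mult_left_mono) auto
    also have "\<dots> \<le> \<delta> ^ 16 * S" using sS[of 16 38 4] by simp
    finally show ?thesis by simp
  qed
  ultimately have "\<bar>c0 * s j - lam li\<bar> \<le> \<delta> ^ 16 * S" by linarith
  then show ?thesis using lin by blast
qed

lemma big_entry:
  assumes j: "j < k"
  shows "\<exists>p0<d. 1 \<le> real d * (v j p0)\<^sup>2"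
proof (rule ccontr)
  assume "\<not> ?thesis"
  then have "real d * (v j p)\<^sup>2 < 1" if "p < d" for p using that not_le by blast
  then have "(\<Sum>p<d. real d * (v j p)\<^sup>2) < (\<Sum>p<d. 1)" using d0 by (intro sum_strict_mono) auto
  moreover have "(\<Sum>p<d. real d * (v j p)\<^sup>2) = real d"
    using v_dot[OF j j] by (simp add: dotp_def power2_eq_square flip: sum_distrib_left)
  ultimately show False by simp
qed

text \<open>The residual is a number \<open>t\<close> at the coordinate \<open>p0\<close>. Its inner
  product with \<open>v j\<close> is \<open>t * v j p0\<close>, and by symmetry of \<open>M\<close>
  also that of \<open>y\<close> with the residual of \<open>v j\<close>, which is small. The
  division by \<open>v j p0\<close> is the reason why all coordinates are tried: one of them has a
  square of at least \<open>1 / d\<close>.\<close>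

lemma null_residual:
  assumes j: "j < k" and near: "\<bar>c0 * s j - lam li\<bar> \<le> \<delta> ^ 16 * S"
    and p0: "p0 < d" "1 \<le> real d * (v j p0)\<^sup>2"
    and y: "\<And>t. t < d \<Longrightarrow> dotp d (rowsE li p0 t) y = 0"
  shows "(dotp d (M p0) y - lam li * y p0)\<^sup>2 \<le> \<delta> ^ 30 * S\<^sup>2 * Q y"
    "Q (\<lambda>p. dotp d (M p) y - lam li * y p) \<le> \<delta> ^ 17 * S\<^sup>2 * Q y"
proof -
  let ?t = "dotp d (M p0) y - lam li * y p0"
  let ?e = "\<lambda>p. dotp d (M p) (v j) - lam li * v j p"
  have "Q ?e = Q (\<lambda>p. (c0 * s j - lam li) * v j p + er (v j) p)"
    by (intro dotp_cong) (simp_all add: er_def Mx_eigen[OF j] algebra_simps)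
  also have "\<dots> \<le> 2 * Q (\<lambda>p. (c0 * s j - lam li) * v j p) + 2 * Q (er (v j))" by (rule dotp_add_self)
  also have "Q (\<lambda>p. (c0 * s j - lam li) * v j p) = (c0 * s j - lam li)\<^sup>2 * Q (v j)"
    by (simp add: dotp_scale dotp_commute[of d "\<lambda>p. (c0 * s j - lam li) * v j p" "v j"] power2_eq_square)
  also have "\<dots> = (c0 * s j - lam li)\<^sup>2" using v_dot[OF j j] by simp
  finally have "Q ?e \<le> 2 * (c0 * s j - lam li)\<^sup>2 + 2 * (\<delta> ^ 32 * S\<^sup>2)"
    using er_bound[of "v j"] v_dot[OF j j] by simp
  moreover have "(c0 * s j - lam li)\<^sup>2 \<le> (\<delta> ^ 16 * S)\<^sup>2" using near S0 \<delta> by (simp add: power2_le_iff_abs_le)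
  moreover have "(\<delta> ^ 16 * S)\<^sup>2 = \<delta> ^ 32 * S\<^sup>2" by (simp add: power_mult_distrib flip: power_mult)
  ultimately have Qe: "Q ?e \<le> 4 * \<delta> ^ 32 * S\<^sup>2" by linarith
  have "dotp d (v j) (\<lambda>p. dotp d (M p) y) = dotp d (\<lambda>p. dotp d (M p) (v j)) y"
  proof -
    have "dotp d (v j) (\<lambda>p. dotp d (M p) y) = (\<Sum>p<d. \<Sum>q<d. v j p * M p q * y q)"
      by (simp add: dotp_def sum_distrib_left mult.assoc)
    also have "\<dots> = (\<Sum>q<d. \<Sum>p<d. v j p * M p q * y q)" by (rule sum.swap)
    also have "\<dots> = dotp d (\<lambda>p. dotp d (M p) (v j)) y"
      by (simp add: dotp_def sum_distrib_left M_sym mult.commute mult.left_commute)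
    finally show ?thesis .
  qed
  then have "dotp d (v j) (\<lambda>p. dotp d (M p) y - lam li * y p) = dotp d ?e y"
    by (simp add: dotp_diff dotp_scale dotp_commute[of d _ y])
  moreover have "dotp d (v j) (\<lambda>p. dotp d (M p) y - lam li * y p) = dotp d (v j) (\<lambda>p. ?t * (if p = p0 then 1 else 0))"
    by (intro dotp_cong) (simp_all add: shifted[OF y])
  ultimately have "?t * v j p0 = dotp d ?e y" unfolding dotp_scale dotp_unit[OF p0(1)] by simp
  then have tv: "?t\<^sup>2 * (v j p0)\<^sup>2 \<le> 4 * \<delta> ^ 32 * S\<^sup>2 * Q y"
    using dotp_CS[of d ?e y] mult_right_mono[OF Qe dotp_self_nonneg[of d y]] by (simp flip: power_mult_distrib)
  have "?t\<^sup>2 * 1 \<le> ?t\<^sup>2 * (real d * (v j p0)\<^sup>2)" using p0(2) by (intro mult_left_mono) auto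
  also have "\<dots> = real d * (?t\<^sup>2 * (v j p0)\<^sup>2)" by simp
  also have "\<dots> \<le> real d * (4 * \<delta> ^ 32 * S\<^sup>2 * Q y)" using tv by (intro mult_left_mono) auto
  also have "\<dots> = (real d * \<delta>) * (4 * \<delta> ^ 31 * (S\<^sup>2 * Q y))" by (simp add: numeral_eq_Suc)
  also have "\<dots> \<le> 1 * (4 * \<delta> ^ 31 * (S\<^sup>2 * Q y))" using d\<delta> \<delta> dotp_self_nonneg[of d y] by (intro mult_right_mono) auto
  also have "\<dots> \<le> \<delta> ^ 30 * (S\<^sup>2 * Q y)" using sp[of 30 31 4] dotp_self_nonneg[of d y]
    by (simp only: mult_1) (intro mult_right_mono; simp)
  finally show small: "?t\<^sup>2 \<le> \<delta> ^ 30 * S\<^sup>2 * Q y" by (simp only: mult.assoc mult_1_right)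
  have "\<delta> ^ 30 * S\<^sup>2 * Q y \<le> \<delta> ^ 17 * S\<^sup>2 * Q y"
    using sp[of 17 30 1] dotp_self_nonneg[of d y] by (intro mult_right_mono) auto
  moreover have "Q (\<lambda>p. dotp d (M p) y - lam li * y p) = ?t\<^sup>2" by (rule shifted_Q[OF p0(1)]) (rule y)
  ultimately show "Q (\<lambda>p. dotp d (M p) y - lam li * y p) \<le> \<delta> ^ 17 * S\<^sup>2 * Q y" using small by linarith
qed

lemma complete:
  assumes j: "j < k"
  shows "\<exists>li<n. \<exists>p0<d. check li p0 \<and> (assoc j (xc li p0) \<or> assoc j (\<lambda>q. - xc li p0 q))"
proof -
  have 0: "0 < \<delta> * S" using \<delta> S0 by simp
  have Fp: "0 < F" using F_low 0 by simp
  obtain li where lin: "li < n" and near: "\<bar>c0 * s j - lam li\<bar> \<le> \<delta> ^ 16 * S" using grid_near[OF j] by blast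
  obtain p0 where p0: "p0 < d" "1 \<le> real d * (v j p0)\<^sup>2" using big_entry[OF j] by blast
  have near8: "\<bar>c0 * s j - lam li\<bar> \<le> 2 * \<delta> ^ 8 * S"
  proof -
    have "0 < \<delta> ^ 8 * S" using \<delta> S0 by simp
    then show ?thesis using near sS[of 8 16 1] by linarith
  qed
  let ?y = "xc li p0"
  have smy: "(dotp d (M p0) ?y - lam li * ?y p0)\<^sup>2 \<le> \<delta> ^ 30 * S\<^sup>2 * Q ?y" by (rule null_residual(1)[OF j near p0]) (rule xc_null[OF p0(1)])
  have resy: "Q (\<lambda>p. dotp d (M p) ?y - lam li * ?y p) \<le> \<delta> ^ 17 * S\<^sup>2 * Q ?y" by (rule null_residual(2)[OF j near p0]) (rule xc_null[OF p0(1)])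
  have y: "Q ?y > 0"
  proof (rule ccontr)
    assume "\<not> Q ?y > 0"
    then have "Q ?y = 0" using dotp_self_nonneg[of d ?y] by linarith
    then have z0: "?y q = 0" if "q < d" for q using dotp_self_zero that by blast
    \<comment> \<open>If the coordinate vector projected to zero, all null vectors would vanish at
      \<open>p0\<close>. But a nonzero null vector exists and is close to a multiple of
      \<open>v j\<close>, whose entry at \<open>p0\<close> is not small.\<close>
    obtain z where z: "Q z > 0" "\<And>t. t < d \<Longrightarrow> dotp d (rowsE li p0 t) z = 0"
      using kernel_vector[OF p0(1), of "rowsE li p0"] by (auto simp: rowsE_def)
    have "z p0 = dotp d (npj d (rowsE li p0) d p0) z" using npj_fix[OF z(2) p0(1)] by simp
    also have "\<dots> = dotp d ?y z" unfolding xc_def by (intro dotp_cong npj_sym p0) auto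
    also have "\<dots> = 0" using z0 by (simp add: dotp_def)
    finally have zp: "z p0 = 0" .
    have "Q (\<lambda>p. dotp d (M p) z - lam li * z p) \<le> \<delta> ^ 17 * S\<^sup>2 * Q z" by (rule null_residual(2)[OF j near p0]) (rule z(2))
    note D = dominated[OF j z(1) near8 this]
    let ?b = "dotp d (v j) z"
    have "(z p0 - ?b * v j p0) * (z p0 - ?b * v j p0) \<le> dotp d (\<lambda>p. z p - ?b * v j p) (\<lambda>p. z p - ?b * v j p)"
      unfolding dotp_def[of d "\<lambda>p. z p - ?b * v j p"]
      by (rule member_le_sum[of p0 "{..<d}" "\<lambda>p. (z p - ?b * v j p) * (z p - ?b * v j p)"]) (use p0 in auto)
    then have 1: "?b\<^sup>2 * (v j p0)\<^sup>2 \<le> \<delta> ^ 12 * Q z" using D(1) zp by (simp add: power2_eq_square algebra_simps)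
    have "Q z * 1 \<le> 2 * ?b\<^sup>2 * (real d * (v j p0)\<^sup>2)" using D(2) p0(2) z(1) by (intro mult_mono) auto
    also have "\<dots> = 2 * real d * (?b\<^sup>2 * (v j p0)\<^sup>2)" by simp
    also have "\<dots> \<le> 2 * real d * (\<delta> ^ 12 * Q z)" using 1 by (intro mult_left_mono) auto
    also have "\<dots> = (real d * \<delta>) * (2 * \<delta> ^ 11 * Q z)" by (simp add: numeral_eq_Suc)
    also have "\<dots> \<le> 1 * (2 * \<delta> ^ 11 * Q z)" using d\<delta> \<delta> z(1) by (intro mult_right_mono) auto
    finally have "Q z \<le> 2 * \<delta> ^ 11 * Q z" by simp
    moreover have "4 * \<delta> ^ 11 * Q z \<le> 1 * Q z" using sp[of 0 11 4] z(1) by (intro mult_right_mono) auto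
    ultimately show False using z(1) by linarith
  qed
  \<comment> \<open>As \<open>F\<close> is at least \<open>\<delta> * S / 4\<close>, the squared
    residual \<open>\<delta> ^ 30 * S^2\<close> is far below \<open>\<delta> ^ 24 * F^2\<close>. The
    shift is close to an eigenvalue of size at least \<open>\<delta> * S / 3\<close>, which exceeds
    \<open>\<delta> ^ 5 * F\<close> by the upper bound for \<open>F\<close>.\<close>
  have "check li p0" unfolding check_def
  proof
    have "\<delta> ^ 24 * (real N ^ 24 * (tt li p0 * tt li p0)) = (tt li p0)\<^sup>2 * (real N ^ 24 * \<delta> ^ 24)"
      by (simp add: power2_eq_square)
    also have "\<dots> = (tt li p0)\<^sup>2" unfolding \<delta>N(2) by simp
    also have "\<dots> \<le> \<delta> ^ 30 * S\<^sup>2 * Q ?y" using smy by (simp add: tt_def)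
    also have "\<dots> < \<delta> ^ 24 * (F * F * Q ?y)"
    proof -
      have "(\<delta> * S / 4)\<^sup>2 \<le> F\<^sup>2" using F_low 0 by (intro power_mono) auto
      then have "\<delta>\<^sup>2 * S\<^sup>2 / 16 \<le> F\<^sup>2" by (simp add: power_mult_distrib power_divide)
      then have "\<delta> ^ 24 * (\<delta>\<^sup>2 * S\<^sup>2 / 16) \<le> \<delta> ^ 24 * F\<^sup>2" using \<delta> by (intro mult_left_mono) auto
      moreover have "\<delta> ^ 24 * (\<delta>\<^sup>2 * S\<^sup>2 / 16) = \<delta> ^ 26 * S\<^sup>2 / 16"
        using power_add[of \<delta> 24 2] by simp
      ultimately have "\<delta> ^ 26 * S\<^sup>2 / 16 \<le> \<delta> ^ 24 * F\<^sup>2" by linarith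
      moreover have "17 * \<delta> ^ 30 * S\<^sup>2 \<le> \<delta> ^ 26 * S\<^sup>2" using sp[of 26 30 17] by (intro mult_right_mono) auto
      moreover have "0 < \<delta> ^ 30 * S\<^sup>2" using \<delta> S0 by simp
      ultimately have "\<delta> ^ 30 * S\<^sup>2 < \<delta> ^ 24 * F\<^sup>2" by linarith
      then have "\<delta> ^ 30 * S\<^sup>2 * Q ?y < \<delta> ^ 24 * F\<^sup>2 * Q ?y" using y by (rule mult_strict_right_mono)
      then show ?thesis by (simp add: power2_eq_square)
    qed
    finally show "real N ^ 24 * (tt li p0 * tt li p0) < F * F * Q ?y" by (rule mult_less_cancel_left_pos[THEN iffD1, rotated]) (use \<delta> in simp)
    have "\<bar>lam li\<bar> \<ge> \<delta> * S / 4"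
    proof -
      have "100 * (\<delta> ^ 16 * S) \<le> \<delta> * S" using sS[of 1 16 100] by simp
      then show ?thesis using \<mu>_big[OF j] near 0 by linarith
    qed
    moreover have "0 \<le> \<delta> * S / 4" using 0 by simp
    ultimately have "(\<delta> * S / 4)\<^sup>2 \<le> \<bar>lam li\<bar>\<^sup>2" by (rule power_mono)
    moreover have "(\<delta> * S / 4)\<^sup>2 = \<delta>\<^sup>2 * S\<^sup>2 / 16" by (simp add: power_mult_distrib power_divide)
    moreover have "\<bar>lam li\<bar>\<^sup>2 = (lam li)\<^sup>2" by (rule power2_abs)
    ultimately have l: "\<delta>\<^sup>2 * S\<^sup>2 \<le> 16 * (lam li)\<^sup>2" by linarith
    have "17 * \<delta> ^ 10 * F\<^sup>2 = 17 * \<delta> ^ 3 * (F\<^sup>2 * \<delta> ^ 7)" by (simp flip: power_add)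
    also have "\<dots> \<le> \<delta>\<^sup>2 * S\<^sup>2" using sp[of 2 3 17] F_up \<delta> by (intro mult_mono) auto
    finally have "17 * (\<delta> ^ 10 * F\<^sup>2) \<le> 16 * (lam li)\<^sup>2" using l by linarith
    moreover have "0 < \<delta> ^ 10 * F\<^sup>2" using \<delta> Fp by simp
    ultimately have "\<delta> ^ 10 * F\<^sup>2 < (lam li)\<^sup>2 * 1" by linarith
    also have "\<dots> = (lam li)\<^sup>2 * (real N ^ 10 * \<delta> ^ 10)" by (simp only: \<delta>N(2))
    also have "\<dots> = \<delta> ^ 10 * (real N ^ 10 * (lam li)\<^sup>2)" by (simp add: mult.commute mult.left_commute)
    finally show "F * F < real N ^ 10 * (lam li * lam li)" using \<delta> by (simp add: power2_eq_square)
  qed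
  moreover have "assoc j ?y \<or> assoc j (\<lambda>q. - ?y q)"
    using same_signs[OF j y near8 resy] by simp
  ultimately show ?thesis using lin p0(1) by blast
qed

end

section \<open>Genericity of the sample\<close>

text \<open>Evaluate the relation at an index with the largest coefficient: the diagonal term is at
  least a quarter of it, whereas all deviations together amount to less than a quarter.\<close>

lemma diagonally_dominant:
  fixes T :: "nat \<Rightarrow> nat \<Rightarrow> real"
  assumes S: "finite S" and z: "\<And>r. r \<in> S \<Longrightarrow> (\<Sum>l\<in>S. c l * T l r) = 0"
    and T: "\<And>l r. l \<in> S \<Longrightarrow> r \<in> S \<Longrightarrow> \<bar>T l r - (if l = r then \<tau> r else 0)\<bar> \<le> \<eta>"
    and \<tau>: "\<And>r. r \<in> S \<Longrightarrow> 1 / 4 \<le> \<tau> r" and \<eta>: "real (card S) * \<eta> < 1 / 4" and l: "l \<in> S"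
  shows "c l = 0"
proof -
  define m where "m = Max ((\<lambda>l. \<bar>c l\<bar>) ` S)"
  have m: "\<bar>c l\<bar> \<le> m" if "l \<in> S" for l unfolding m_def using S that by simp
  have "m \<in> (\<lambda>l. \<bar>c l\<bar>) ` S" unfolding m_def using S l by (intro Max_in) auto
  then obtain r where r: "r \<in> S" "m = \<bar>c r\<bar>" by blast
  have "(\<Sum>l\<in>S. c l * (T l r - (if l = r then \<tau> r else 0))) = (\<Sum>l\<in>S. c l * T l r) - (\<Sum>l\<in>S. if l = r then c l * \<tau> r else 0)"
    by (simp add: right_diff_distrib sum_subtractf if_distrib[of "\<lambda>t. _ * t"] cong: if_cong)
  also have "\<dots> = - (c r * \<tau> r)" using z[OF r(1)] r(1) S by simp
  finally have "\<bar>c r * \<tau> r\<bar> = \<bar>\<Sum>l\<in>S. c l * (T l r - (if l = r then \<tau> r else 0))\<bar>" by simp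
  also have "\<dots> \<le> (\<Sum>l\<in>S. \<bar>c l\<bar> * \<bar>T l r - (if l = r then \<tau> r else 0)\<bar>)"
    unfolding abs_mult[symmetric] by (rule sum_abs)
  also have "\<dots> \<le> (\<Sum>l\<in>S. m * \<eta>)"
    using m T r(1) by (intro sum_mono mult_mono) (auto simp: r(2))
  finally have 1: "\<bar>c r\<bar> * \<bar>\<tau> r\<bar> \<le> m * (real (card S) * \<eta>)" by (simp add: abs_mult algebra_simps)
  have "m * (1 / 4) \<le> \<bar>c r\<bar> * \<bar>\<tau> r\<bar>" using \<tau>[OF r(1)] unfolding r(2) by (intro mult_left_mono) auto
  then have "m * (1 / 4 - real (card S) * \<eta>) \<le> 0" using 1 by (simp add: algebra_simps)
  then have "m \<le> 0" using \<eta> by (simp add: mult_le_0_iff)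
  then show ?thesis using m[OF l] by simp
qed

lemma sum_lessThan_split:
  fixes m d :: nat
  shows "(\<Sum>j<m + d. f j) = (\<Sum>j<m. f j) + (\<Sum>q<d. f (m + q) :: real)"
  by (induction d) (simp_all add: algebra_simps)

section \<open>Linear independence certified by averages\<close>

locale generic_sample = sample +
  fixes \<eta> :: real
  assumes N0: "0 < N" and \<eta>: "real (d + k) * \<eta> < 1 / 4" "0 \<le> \<eta>"
    and u_inj: "\<And>c l. \<forall>r<m. (\<Sum>l<k. c l * u l r) = 0 \<Longrightarrow> l < k \<Longrightarrow> c l = 0"
    and T1: "\<And>j l r. j < k \<Longrightarrow> l < k \<Longrightarrow> r < k \<Longrightarrow> l \<noteq> j \<Longrightarrow> r \<noteq> j \<Longrightarrow>
      \<bar>(\<Sum>i<N. neg (dotp d (v j) (x i)) * relu (dotp d (v l) (x i)) * dotp d (v r) (x i)) / N - (if l = r then 1 / 4 else 0)\<bar> \<le> \<eta>"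
    and T2: "\<And>j l r. j < k \<Longrightarrow> l < k \<Longrightarrow> r < k \<Longrightarrow> r \<noteq> j \<Longrightarrow>
      \<bar>(\<Sum>i<N. pos (dotp d (v j) (x i)) * relu (dotp d (v l) (x i)) * dotp d (v r) (x i)) / N - (if l = r then 1 / 4 else 0)\<bar> \<le> \<eta>"
    and T3: "\<And>j l. j < k \<Longrightarrow> l < k \<Longrightarrow>
      \<bar>(\<Sum>i<N. pos (dotp d (v j) (x i)) * relu (dotp d (v l) (x i)) * ((dotp d (v j) (x i))\<^sup>2 - 1)) / N - (if l = j then c0 else 0)\<bar> \<le> \<eta>"
    and T4: "\<And>w j p q. w = pos \<or> w = neg \<Longrightarrow> j < k \<Longrightarrow> p < d \<Longrightarrow> q < d \<Longrightarrow>
      \<bar>(\<Sum>i<N. w (dotp d (v j) (x i)) * x i p * x i q) / N - (if p = q then 1 / 2 else 0)\<bar> \<le> \<eta>"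
begin

abbreviation b :: "nat \<Rightarrow> nat \<Rightarrow> real" where "b l i \<equiv> relu (dotp d (v l) (x i))"

lemma kd': "k \<le> d"
  using kd[of "k - 1"] k1 by simp

lemma \<eta>_card: "real c * \<eta> < 1 / 4" if "c \<le> d + k"
proof -
  have "real c * \<eta> \<le> real (d + k) * \<eta>" using that \<eta> by (intro mult_right_mono) simp_all
  then show ?thesis using \<eta> by linarith
qed

text \<open>A linear relation valid on the columns selected by the weight \<open>w\<close> is
  multiplied by a test function \<open>g\<close> and averaged. It becomes a relation among the test
  averages, to which diagonal dominance applies.\<close>

lemma avg_comb:
  assumes "\<And>i. i < N \<Longrightarrow> w i * (\<Sum>l\<in>J. c l * f l i) = 0"
  shows "(\<Sum>l\<in>J. c l * ((\<Sum>i<N. w i * f l i * g i) / N)) = (0::real)"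
proof -
  have "(\<Sum>l\<in>J. c l * ((\<Sum>i<N. w i * f l i * g i) / N)) = (\<Sum>l\<in>J. \<Sum>i<N. w i * (c l * f l i) * g i) / N"
    by (simp add: sum_distrib_left sum_divide_distrib algebra_simps)
  also have "(\<Sum>l\<in>J. \<Sum>i<N. w i * (c l * f l i) * g i) = (\<Sum>i<N. w i * (\<Sum>l\<in>J. c l * f l i) * g i)"
    by (subst sum.swap) (simp add: sum_distrib_left sum_distrib_right)
  also have "\<dots> = 0"
  proof (rule sum.neutral, rule ballI)
    fix i assume "i \<in> {..<N}"
    then have "w i * (\<Sum>l\<in>J. c l * f l i) = 0" using assms by blast
    then show "w i * (\<Sum>l\<in>J. c l * f l i) * g i = 0" by (simp only: mult_zero_left)
  qed
  finally show ?thesis by simp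
qed

text \<open>On the columns where unit \<open>j\<close> is off, the linear test in direction
  \<open>v r\<close> correlates, among the remaining units, with unit \<open>r\<close> only.\<close>

lemma inactive_independent:
  assumes j: "j < k" and z: "\<And>i. i < N \<Longrightarrow> dotp d (v j) (x i) < 0 \<Longrightarrow> (\<Sum>l\<in>{..<k} - {j}. c l * b l i) = 0"
    and l: "l < k" "l \<noteq> j"
  shows "c l = 0"
proof (rule diagonally_dominant[where S = "{..<k} - {j}" and \<tau> = "\<lambda>_. 1 / 4"
      and T = "\<lambda>l r. (\<Sum>i<N. neg (dotp d (v j) (x i)) * b l i * dotp d (v r) (x i)) / N"])
  show "(\<Sum>l\<in>{..<k} - {j}. c l * ((\<Sum>i<N. neg (dotp d (v j) (x i)) * b l i * dotp d (v r) (x i)) / N)) = 0" for r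
    by (rule avg_comb) (simp add: neg_def z)
  show "real (card ({..<k} - {j})) * \<eta> < 1 / 4" using j by (intro \<eta>_card) simp
qed (use T1[OF j] l in auto)

text \<open>Where unit \<open>j\<close> is on, the linear tests single out the units other than
  \<open>j\<close>, and the quadratic Hermite test singles out \<open>j\<close>.\<close>

lemma active_independent:
  assumes j: "j < k" and z: "\<And>i. i < N \<Longrightarrow> 0 < dotp d (v j) (x i) \<Longrightarrow> (\<Sum>l<k. c l * b l i) = 0"
    and l: "l < k"
  shows "c l = 0"
proof (rule diagonally_dominant[where S = "{..<k}" and \<tau> = "\<lambda>r. if r = j then c0 else 1 / 4"
      and T = "\<lambda>l r. (\<Sum>i<N. pos (dotp d (v j) (x i)) * b l i * (if r = j then (dotp d (v j) (x i))\<^sup>2 - 1 else dotp d (v r) (x i))) / N"])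
  show "(\<Sum>l<k. c l * ((\<Sum>i<N. pos (dotp d (v j) (x i)) * b l i * (if r = j then (dotp d (v j) (x i))\<^sup>2 - 1 else dotp d (v r) (x i))) / N)) = 0" for r
    by (rule avg_comb) (simp add: pos_def z)
  show "real (card {..<k}) * \<eta> < 1 / 4" by (intro \<eta>_card) simp
  show "\<bar>(\<Sum>i<N. pos (dotp d (v j) (x i)) * b l i * (if r = j then (dotp d (v j) (x i))\<^sup>2 - 1 else dotp d (v r) (x i))) / N -
      (if l = r then if r = j then c0 else 1 / 4 else 0)\<bar> \<le> \<eta>" if "l \<in> {..<k}" "r \<in> {..<k}" for l r
  proof (cases "r = j")
    case True
    then show ?thesis using that T3[OF j, of l] by (simp only: refl if_True lessThan_iff)
  next
    case False
    then show ?thesis using that T2[OF j, of l r] by (simp only: False if_False lessThan_iff not_False_eq_True)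
  qed
  show "1 / 4 \<le> (if r = j then c0 else 1 / 4)" for r using c0_bounds by simp
qed (use l in auto)

text \<open>The columns on one side of the hyperplane have empirical second moments close to half
  the identity, so no nonzero linear form vanishes on all of them.\<close>

lemma half_space_spans:
  assumes w: "w = pos \<or> w = neg" and j: "j < k" and z: "\<And>i. i < N \<Longrightarrow> w (dotp d (v j) (x i)) \<noteq> 0 \<Longrightarrow> dotp d \<beta> (x i) = 0"
    and p: "p < d"
  shows "\<beta> p = 0"
proof (rule diagonally_dominant[where S = "{..<d}" and \<tau> = "\<lambda>_. 1 / 2"
      and T = "\<lambda>p q. (\<Sum>i<N. w (dotp d (v j) (x i)) * x i p * x i q) / N"])
  show "(\<Sum>p<d. \<beta> p * ((\<Sum>i<N. w (dotp d (v j) (x i)) * x i p * x i q) / N)) = 0" for q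
  proof (rule avg_comb)
    fix i assume "i < N"
    then show "w (dotp d (v j) (x i)) * (\<Sum>p<d. \<beta> p * x i p) = 0"
      using z[of i] by (cases "w (dotp d (v j) (x i)) = 0") (simp_all add: dotp_def)
  qed
  show "real (card {..<d}) * \<eta> < 1 / 4" by (intro \<eta>_card) simp
qed (use T4[OF w j] p in auto)

section \<open>Exact refinement of a hidden direction, and the second layer\<close>

definition lift :: "(nat \<Rightarrow> real) \<Rightarrow> nat \<Rightarrow> real" where "lift w j = (if j < m then 0 else w (j - m))"

definition pr :: "(nat \<Rightarrow> real) \<Rightarrow> nat \<Rightarrow> real" where
  "pr w i = dotp (m + d) (npj (m + d) (rowsR w) N i) (lift w)"

lemma vv_pr: "vv w p = pr w (m + p)"
  unfolding vv_def pr_def dotp_def sum_lessThan_split by (simp add: lift_def)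

lemma rowsR_dot: "i < N \<Longrightarrow> dotp (m + d) (rowsR w i) y =
  (\<Sum>l<k. (\<Sum>r<m. u l r * y r) * b l i) + (if dotp d w (x i) \<le> 0 then 0 else dotp d (\<lambda>q. y (m + q)) (x i))"
proof -
  assume "i < N"
  then have i: "i < n" using sz by simp
  have "(\<Sum>r<m. A r i * y r) = (\<Sum>r<m. \<Sum>l<k. u l r * y r * b l i)"
    by (intro sum.cong refl) (simp add: Au i sum_distrib_left sum_distrib_right algebra_simps)
  also have "\<dots> = (\<Sum>l<k. (\<Sum>r<m. u l r * y r) * b l i)"
    by (subst sum.swap) (simp add: sum_distrib_right)
  finally have 1: "(\<Sum>r<m. A r i * y r) = (\<Sum>l<k. (\<Sum>r<m. u l r * y r) * b l i)" .
  have "dotp (m + d) (rowsR w i) y = (\<Sum>r<m. A r i * y r) + (\<Sum>q<d. (if dotp d w (x i) \<le> 0 then 0 else x i q) * y (m + q))"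
    by (simp add: dotp_def[of "m + d"] sum_lessThan_split rowsR_def cong: if_cong)
  also have "(\<Sum>q<d. (if dotp d w (x i) \<le> 0 then 0 else x i q) * y (m + q)) =
      (if dotp d w (x i) \<le> 0 then 0 else dotp d (\<lambda>q. y (m + q)) (x i))"
    by (simp add: dotp_def[of d "\<lambda>q. y (m + q)"] mult.commute)
  finally show ?thesis unfolding 1 .
qed

lemma pr_null: "i < N \<Longrightarrow> dotp (m + d) (rowsR w i) (pr w) = 0"
  using npj_null[of i N "m + d" "rowsR w" "lift w"] by (simp add: pr_def[abs_def])

text \<open>Where unit \<open>j\<close> is off, the equations involve only the other units, whose
  coefficients must vanish. Where it is on, what remains is that \<open>c j * v j + \<beta>\<close>
  is orthogonal to the column, so \<open>\<beta> = - c j * v j\<close>. The projection is thus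
  confined to a line; that it is nonzero and points the right way is shown by an explicit
  solution.\<close>

lemma refine:
  assumes j: "j < k" and as: "assoc j w"
  shows "\<exists>\<gamma>>0. \<forall>p<d. vv w p = \<gamma> * v j p"
proof -
  have sg: "dotp d w (x i) \<le> 0 \<longleftrightarrow> dotp d (v j) (x i) \<le> 0" if "i < N" for i
    using as that unfolding assoc_def by (auto simp: not_less[symmetric])
  define c where "c l = (\<Sum>r<m. u l r * pr w r)" for l
  define \<beta> where "\<beta> q = pr w (m + q)" for q
  have null: "(\<Sum>l<k. c l * b l i) + (if dotp d (v j) (x i) \<le> 0 then 0 else dotp d \<beta> (x i)) = 0" if "i < N" for i
    using pr_null[OF that, of w] rowsR_dot[OF that, of w "pr w"] sg[OF that] unfolding c_def \<beta>_def[abs_def] by simp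
  have off: "c l = 0" if l: "l < k" "l \<noteq> j" for l
  proof (rule inactive_independent[OF j _ l])
    fix i assume i: "i < N" "dotp d (v j) (x i) < 0"
    then have "(\<Sum>l<k. c l * b l i) = 0" using null by force
    moreover have "b j i = 0" using i by (simp add: relu_def)
    ultimately show "(\<Sum>l\<in>{..<k} - {j}. c l * b l i) = 0" using j by (simp add: sum.remove[of "{..<k}" j])
  qed
  have "\<beta> p + c j * v j p = 0" if p: "p < d" for p
  proof (rule half_space_spans[OF _ j _ p, of pos "\<lambda>p. \<beta> p + c j * v j p"])
    fix i assume i: "i < N" "pos (dotp d (v j) (x i)) \<noteq> 0"
    then have pz: "dotp d (v j) (x i) > 0" by (simp add: pos_def split: if_splits)
    have "(\<Sum>l<k. c l * b l i) = c j * b j i" using off j by (subst sum.remove[of _ j]) auto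
    then have "c j * dotp d (v j) (x i) + dotp d \<beta> (x i) = 0" using null[OF i(1)] pz by (simp add: relu_def)
    then show "dotp d (\<lambda>p. \<beta> p + c j * v j p) (x i) = 0"
      unfolding dotp_commute[of d _ "x i"] dotp_add dotp_scale by simp
  qed simp
  then have \<beta>: "\<beta> p = - c j * v j p" if "p < d" for p using that by force
  have vv: "vv w p = - c j * v j p" if "p < d" for p using \<beta>[OF that] by (simp add: vv_pr \<beta>_def)
  have "\<exists>a. \<forall>l<k. dotp m a (u l) = (if l = j then 1 else 0)"
    by (rule dual_vector[OF _ j]) (rule u_inj, simp_all)
  then obtain a where a: "\<And>l. l < k \<Longrightarrow> dotp m a (u l) = (if l = j then 1 else 0)" by blast
  \<comment> \<open>An exact solution: its first part is dual to \<open>u j\<close> and extracts the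
    output of unit \<open>j\<close>, its second part is \<open>- v j\<close>. Its inner product with
    the vector being projected is minus that of \<open>w\<close> and \<open>v j\<close>, hence
    nonzero.\<close>
  define z where "z i = (if i < m then a i else - v j (i - m))" for i
  have zn: "dotp (m + d) (rowsR w i) z = 0" if i: "i < N" for i
  proof -
    have "(\<Sum>r<m. u l r * z r) = dotp m a (u l)" for l unfolding dotp_def by (simp add: z_def mult.commute)
    then have "(\<Sum>l<k. (\<Sum>r<m. u l r * z r) * b l i) = (\<Sum>l<k. if l = j then b l i else 0)"
      using a by (intro sum.cong) auto
    also have "\<dots> = b j i" using j by simp
    finally show ?thesis using sg[OF i] unfolding rowsR_dot[OF i]
      by (simp add: z_def relu_def dotp_def sum_negf)
  qed
  have "dotp (m + d) (pr w) z = dotp (m + d) (lift w) z" unfolding pr_def[abs_def] by (rule npj_pair) (rule zn)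
  also have "\<dots> = - dotp d w (v j)" unfolding dotp_def sum_lessThan_split by (simp add: lift_def z_def sum_negf)
  finally have "dotp (m + d) (pr w) z \<noteq> 0" using as by (simp add: assoc_def)
  then have "dotp (m + d) (pr w) (pr w) \<noteq> 0" using dotp_CS[of "m + d" "pr w" z] by auto
  then have "0 < dotp (m + d) (pr w) (pr w)" using dotp_self_nonneg[of "m + d" "pr w"] by linarith
  \<comment> \<open>The squared norm of an orthogonal projection is its inner product with the
    original vector; this fixes the sign of \<open>c j\<close>.\<close>
  also have "\<dots> = dotp (m + d) (lift w) (pr w)"
    unfolding pr_def[abs_def] by (rule npj_pair_self[symmetric])
  also have "\<dots> = dotp d w (\<lambda>p. - c j * v j p)"
    unfolding dotp_def sum_lessThan_split using \<beta> by (simp add: lift_def \<beta>_def)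
  also have "\<dots> = - c j * dotp d w (v j)" by (rule dotp_scale)
  finally have "0 < - c j" using as by (simp add: assoc_def zero_less_mult_iff mult_less_0_iff)
  then show ?thesis using vv by blast
qed

text \<open>With the gate reversed, the columns where unit \<open>j\<close> is on lack the term with
  \<open>\<beta>\<close> and force every \<open>c l\<close> to vanish; on the columns where it is
  off \<open>\<beta>\<close> alone remains, and it vanishes too. The wrong sign is therefore
  recognised exactly.\<close>

lemma refine_opposite:
  assumes j: "j < k" and as: "assoc j w" and p: "p < d"
  shows "vv (\<lambda>q. - w q) p = 0"
proof -
  let ?w = "\<lambda>q. - w q"
  have mi: "dotp d ?w (x i) = - dotp d w (x i)" for i by (simp add: dotp_def sum_negf)
  have sg: "dotp d ?w (x i) \<le> 0 \<longleftrightarrow> 0 < dotp d (v j) (x i)" if "i < N" for i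
  proof -
    have "dotp d w (x i) \<noteq> 0" "0 < dotp d w (x i) \<longleftrightarrow> 0 < dotp d (v j) (x i)"
      using as that unfolding assoc_def by blast+
    then show ?thesis unfolding mi by auto
  qed
  define c where "c l = (\<Sum>r<m. u l r * pr ?w r)" for l
  define \<beta> where "\<beta> q = pr ?w (m + q)" for q
  have null: "(\<Sum>l<k. c l * b l i) + (if 0 < dotp d (v j) (x i) then 0 else dotp d \<beta> (x i)) = 0" if "i < N" for i
    using pr_null[OF that, of ?w] rowsR_dot[OF that, of ?w "pr ?w"] sg[OF that] unfolding c_def \<beta>_def[abs_def] by simp
  have c: "c l = 0" if "l < k" for l
  proof (rule active_independent[OF j _ that])
    fix i assume "i < N" "0 < dotp d (v j) (x i)"
    then show "(\<Sum>l<k. c l * b l i) = 0" using null[of i] by simp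
  qed
  have "\<beta> p = 0"
  proof (rule half_space_spans[OF _ j _ p, of neg])
    fix i assume i: "i < N" "neg (dotp d (v j) (x i)) \<noteq> 0"
    then show "dotp d \<beta> (x i) = 0" using null[OF i(1)] c by (simp add: neg_def split: if_splits)
  qed simp
  then show ?thesis by (simp add: vv_pr \<beta>_def)
qed

text \<open>Independence of the hidden outputs on the sample leaves only the line through
  \<open>(- u, 1)\<close> as null space. The last coordinate vector has inner product 1 with that
  solution, so its projection is a nonzero multiple of it and the ratio of entries is exact.\<close>

lemma solve_second_layer:
  assumes \<sigma>: "bij_betw \<sigma> {..<k} {..<k}" and r: "r < m" and l: "l < k"
  defines "a \<equiv> \<lambda>i j. if j < k then b (\<sigma> j) i else A r i"
  shows "- npj (k + 1) a N l k / npj (k + 1) a N k k = u (\<sigma> l) r"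
proof -
  define e where "e j = (if j = k then 1 else 0 :: real)" for j
  define y where "y i = dotp (k + 1) (npj (k + 1) a N i) e" for i
  have y: "y i = npj (k + 1) a N i k" for i unfolding y_def e_def[abs_def] by (rule dotp_unit) simp
  have dot: "dotp (k + 1) (a i) z = (\<Sum>l<k. (z l + z k * u (\<sigma> l) r) * b (\<sigma> l) i)" if i: "i < N" for i z
  proof -
    have "A r i = (\<Sum>l<k. u (\<sigma> l) r * b (\<sigma> l) i)"
      using sum.reindex_bij_betw[OF \<sigma>, of "\<lambda>l. u l r * b l i"] i sz r by (simp add: Au)
    then show ?thesis by (simp add: dotp_def[of "Suc k"] a_def sum.distrib sum_distrib_left algebra_simps)
  qed
  have k0: "0 < k" by (rule k1)
  have null: "y l = - y k * u (\<sigma> l) r" if l: "l < k" for l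
  proof -
    define \<sigma>' where "\<sigma>' = the_inv_into {..<k} \<sigma>"
    have \<sigma>': "\<sigma>' (\<sigma> l) = l" if "l < k" for l unfolding \<sigma>'_def using \<sigma> that by (simp add: bij_betw_def the_inv_into_f_f)
    define c where "c l = y (\<sigma>' l) + y k * u l r" for l
    have "c (\<sigma> l) = 0"
    \<comment> \<open>Independence on the columns where a single unit is active is already enough;
      unit 0 is an arbitrary choice.\<close>
    proof (rule active_independent[OF k0])
      show "\<sigma> l < k" using \<sigma> l by (auto simp: bij_betw_def)
      fix i assume i: "i < N"
      have "dotp (k + 1) (a i) y = 0" using npj_null[OF i, of "k + 1" a e] by (simp add: y_def[abs_def])
      then have "(\<Sum>l<k. c (\<sigma> l) * b (\<sigma> l) i) = 0" unfolding dot[OF i] by (simp add: c_def \<sigma>')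
      then show "(\<Sum>l<k. c l * b l i) = 0" using sum.reindex_bij_betw[OF \<sigma>, of "\<lambda>l. c l * b l i"] by simp
    qed
    then show ?thesis using \<sigma>'[OF l] by (simp add: c_def)
  qed
  define z where "z j = (if j < k then - u (\<sigma> j) r else 1)" for j
  have zn: "dotp (k + 1) (a i) z = 0" if "i < N" for i unfolding dot[OF that] by (simp add: z_def)
  have "dotp (k + 1) y z = dotp (k + 1) e z" unfolding y_def[abs_def] by (rule npj_pair) (rule zn)
  also have "\<dots> = dotp (k + 1) z e" by (rule dotp_commute)
  also have "\<dots> = 1" unfolding e_def[abs_def] by (subst dotp_unit) (simp_all add: z_def)
  finally have yz: "dotp (k + 1) y z = 1" .
  have "y k \<noteq> 0"
  proof
    assume "y k = 0"
    then have "y i = 0" if "i < k + 1" for i using null[of i] that by (cases "i = k") simp_all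
    then have "dotp (k + 1) y z = 0" by (simp add: dotp_def)
    then show False using yz by simp
  qed
  then show ?thesis using null[OF l] y by (simp add: field_simps)
qed

end

locale recovery_sample = spectral_sample + generic_sample
begin

text \<open>The two halves of the analysis meet: candidates with correct signs come from the
  spectral part, exact recovery from genericity.\<close>

sublocale good_run m d n N k A x v u assoc
proof
  show "k + 1 \<le> n" using kd' sz by simp
qed (use sound complete refine refine_opposite solve_second_layer in auto)

end

section \<open>Most samples are good\<close>

lemma recovery_sampleI:
  assumes sz: "m + d + 1 \<le> n" "2 \<le> n" "N \<le> n" "0 < d" and v: "orthn d k v" and k: "0 < k"
    and A: "\<And>r i. A r i = (\<Sum>l<k. u l r * relu (dotp d (v l) (x i)))"
    and N: "100 \<le> N" "(real d)\<^sup>2 \<le> N" "real N ^ 42 \<le> n" and S: "0 < S"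
    and s: "(\<Sum>l<k. \<bar>\<Sum>r<m. x r 0 * u l r\<bar>) \<le> real N ^ 3 * S"
      "\<And>i j. i < k \<Longrightarrow> j < k \<Longrightarrow> i \<noteq> j \<Longrightarrow> S / N \<le> \<bar>\<Sum>r<m. (u i r - u j r) * x r 0\<bar>"
      "\<And>j. j < k \<Longrightarrow> S / N \<le> \<bar>\<Sum>r<m. u j r * x r 0\<bar>"
    and xb: "\<And>i p. i < N \<Longrightarrow> p < d \<Longrightarrow> \<bar>x i p\<bar> \<le> (real N)\<^sup>2"
    and vx: "\<And>j i. j < k \<Longrightarrow> i < N \<Longrightarrow> 1 / real N ^ 3 \<le> \<bar>dotp d (v j) (x i)\<bar>"
    and t: "\<And>l p q. l < k \<Longrightarrow> p < d \<Longrightarrow> q < d \<Longrightarrow>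
      \<bar>(\<Sum>i<n. relu (dotp d (v l) (x i)) * (x i p * x i q - (if p = q then 1 else 0))) / n - c0 * v l p * v l q\<bar> \<le> 1 / real N ^ 20"
    and \<eta>: "real (d + k) * \<eta> < 1 / 4" "0 \<le> \<eta>"
    and lower: "\<And>c. S\<^sup>2 * (\<Sum>j<k. (c j)\<^sup>2) \<le> (\<Sum>r<m. (\<Sum>j<k. c j * u j r)\<^sup>2)"
    and T1: "\<And>j l r. j < k \<Longrightarrow> l < k \<Longrightarrow> r < k \<Longrightarrow> l \<noteq> j \<Longrightarrow> r \<noteq> j \<Longrightarrow>
      \<bar>(\<Sum>i<N. neg (dotp d (v j) (x i)) * relu (dotp d (v l) (x i)) * dotp d (v r) (x i)) / N - (if l = r then 1 / 4 else 0)\<bar> \<le> \<eta>"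
    and T2: "\<And>j l r. j < k \<Longrightarrow> l < k \<Longrightarrow> r < k \<Longrightarrow> r \<noteq> j \<Longrightarrow>
      \<bar>(\<Sum>i<N. pos (dotp d (v j) (x i)) * relu (dotp d (v l) (x i)) * dotp d (v r) (x i)) / N - (if l = r then 1 / 4 else 0)\<bar> \<le> \<eta>"
    and T3: "\<And>j l. j < k \<Longrightarrow> l < k \<Longrightarrow>
      \<bar>(\<Sum>i<N. pos (dotp d (v j) (x i)) * relu (dotp d (v l) (x i)) * ((dotp d (v j) (x i))\<^sup>2 - 1)) / N - (if l = j then c0 else 0)\<bar> \<le> \<eta>"
    and T4: "\<And>w j p q. w = pos \<or> w = neg \<Longrightarrow> j < k \<Longrightarrow> p < d \<Longrightarrow> q < d \<Longrightarrow>
      \<bar>(\<Sum>i<N. w (dotp d (v j) (x i)) * x i p * x i q) / N - (if p = q then 1 / 2 else 0)\<bar> \<le> \<eta>"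
  shows "recovery_sample m d n N k A x v u S \<eta>"
proof -
  interpret sm: sample m d n N k A x v u S
    using sz v k A by unfold_locales
  have inj: "c l = 0" if "\<forall>r<m. (\<Sum>l<k. c l * u l r) = 0" "l < k" for c l
  proof -
    have "S\<^sup>2 * (\<Sum>j<k. (c j)\<^sup>2) \<le> 0" using lower[of c] that(1) by simp
    then have "(\<Sum>j<k. (c j)\<^sup>2) \<le> 0" using S by (simp add: mult_le_0_iff)
    then have "(\<Sum>j<k. (c j)\<^sup>2) = 0" using sum_nonneg[of "{..<k}" "\<lambda>j. (c j)\<^sup>2"] by simp
    then show ?thesis using that(2) by (simp add: sum_nonneg_eq_0_iff)
  qed
  have gap: "S / N \<le> \<bar>sm.s i - sm.s j\<bar>" if "i < k" "j < k" "i \<noteq> j" for i j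
    using s(2)[OF that] by (simp add: sm.s_def algebra_simps sum_subtractf)
  have big: "S / N \<le> \<bar>sm.s j\<bar>" if "j < k" for j
    using s(3)[OF that] by (simp add: sm.s_def mult.commute)
  have spec: "spectral_sample m d n N k A x v u S"
    by unfold_locales (fact N S s(1)[folded sm.s_def] gap big xb vx t[folded sm.Tn_def])+
  have "generic_sample m d n N k A x v u \<eta>"
  proof unfold_locales
    show "0 < N" using N by simp
  qed (fact \<eta> inj T1 T2 T3 T4)+
  with spec show ?thesis by (rule recovery_sample.intro)
qed

text \<open>Averaging would give \<open>S / sqrt m\<close>; the weaker \<open>S / m\<close> avoids
  the root and costs only another factor polynomial in \<open>m\<close>.\<close>

lemma big_coordinate:
  fixes c :: "nat \<Rightarrow> real"
  assumes "S\<^sup>2 \<le> (\<Sum>r<m. (c r)\<^sup>2)" "0 < S"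
  shows "\<exists>r<m. c r \<noteq> 0 \<and> S / m \<le> \<bar>c r\<bar>"
proof (rule ccontr)
  assume "\<not> ?thesis"
  then have less: "c r = 0 \<or> \<bar>c r\<bar> < S / m" if "r < m" for r using that not_le by blast
  have m: "0 < m" using assms by (cases m) simp_all
  have "(\<Sum>r<m. (c r)\<^sup>2) < (\<Sum>r<m. (S / m)\<^sup>2)"
  proof (rule sum_strict_mono)
    fix r assume "r \<in> {..<m}"
    then have "\<bar>c r\<bar> < S / m" using less[of r] assms m by auto
    then have "\<bar>c r\<bar>\<^sup>2 < (S / m)\<^sup>2" by (intro power_strict_mono) auto
    then show "(c r)\<^sup>2 < (S / m)\<^sup>2" by simp
  qed (use m in auto)
  also have "\<dots> = S\<^sup>2 / m" using m by (simp add: power2_eq_square)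
  also have "\<dots> \<le> S\<^sup>2 / 1" using m by (intro divide_left_mono) auto
  finally show False using assms(1) by simp
qed

lemma union_bound:
  assumes "prob_space M" "finite J" "\<And>j. j \<in> J \<Longrightarrow> B j \<in> sets M" "\<And>j. j \<in> J \<Longrightarrow> measure M (B j) \<le> p"
    and "real (card J) * p \<le> q"
  shows "measure M (\<Union>j\<in>J. B j) \<le> q" "(\<Union>j\<in>J. B j) \<in> sets M"
proof -
  interpret prob_space M by fact
  show "(\<Union>j\<in>J. B j) \<in> sets M" using assms(2,3) by (intro sets.finite_UN) auto
  have "measure M (\<Union>j\<in>J. B j) \<le> (\<Sum>j\<in>J. measure M (B j))"
    using assms(2,3) by (intro finite_measure_subadditive_finite) auto
  also have "\<dots> \<le> (\<Sum>j\<in>J. p)" using assms(4) by (intro sum_mono) auto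
  finally show "measure M (\<Union>j\<in>J. B j) \<le> q" using assms(5) by simp
qed

section \<open>The finite families of test functions and their growth\<close>

context orthonormal
begin

lemma lin_le: "l < k \<Longrightarrow> \<bar>dotp d (v l) x\<bar> \<le> 1 + dotp d x x"
proof -
  assume l: "l < k"
  have "(dotp d (v l) x)\<^sup>2 \<le> dotp d (v l) (v l) * dotp d x x" by (rule dotp_CS)
  also have "dotp d (v l) (v l) = 1" using orth l by (simp add: orthn_def dotp_def)
  finally have "\<bar>dotp d (v l) x\<bar>\<^sup>2 \<le> dotp d x x" by simp
  moreover have "2 * \<bar>dotp d (v l) x\<bar> \<le> 1 + \<bar>dotp d (v l) x\<bar>\<^sup>2"
    using zero_le_power2[of "1 - \<bar>dotp d (v l) x\<bar>"] by (simp add: power2_diff)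
  ultimately show ?thesis by linarith
qed

lemma sq_le: "l < k \<Longrightarrow> \<bar>(dotp d (v l) x)\<^sup>2 - 1\<bar> \<le> 1 + dotp d x x"
proof -
  assume l: "l < k"
  have "(dotp d (v l) x)\<^sup>2 \<le> dotp d (v l) (v l) * dotp d x x" by (rule dotp_CS)
  also have "dotp d (v l) (v l) = 1" using orth l by (simp add: orthn_def dotp_def)
  finally have "(dotp d (v l) x)\<^sup>2 \<le> dotp d x x" by simp
  then show ?thesis using zero_le_power2[of "dotp d (v l) x"] by linarith
qed

lemma entry_le: "p < d \<Longrightarrow> \<bar>x p\<bar> \<le> 1 + dotp d x x" and
  entries_le: "p < d \<Longrightarrow> q < d \<Longrightarrow> \<bar>x p * x q - (if p = q then 1 else 0)\<bar> \<le> 1 + dotp d x x" for x :: "nat \<Rightarrow> real"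
proof -
  have sq: "(x p)\<^sup>2 \<le> dotp d x x" if "p < d" for p
    using member_le_sum[of p "{..<d}" "\<lambda>p. x p * x p"] that by (simp add: dotp_def power2_eq_square)
  show "p < d \<Longrightarrow> \<bar>x p\<bar> \<le> 1 + dotp d x x"
    using sq[of p] zero_le_power2[of "1 - \<bar>x p\<bar>"] by (simp add: power2_diff)
  assume pq: "p < d" "q < d"
  have "2 * \<bar>x p * x q\<bar> \<le> (x p)\<^sup>2 + (x q)\<^sup>2"
    using zero_le_power2[of "\<bar>x p\<bar> - \<bar>x q\<bar>"] by (simp add: power2_diff abs_mult)
  then have "\<bar>x p * x q\<bar> \<le> dotp d x x" using sq[OF pq(1)] sq[OF pq(2)] by linarith
  then show "\<bar>x p * x q - (if p = q then 1 else 0)\<bar> \<le> 1 + dotp d x x"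
    using dotp_self_nonneg[of d x] by (auto simp: abs_le_iff split: if_split)
qed

lemma grow_prod:
  assumes "\<bar>a\<bar> \<le> 1 + dotp d x x" "\<bar>b\<bar> \<le> 1 + dotp d x x"
  shows "\<bar>a * b\<bar> \<le> grow d x"
proof -
  have "\<bar>a\<bar> * \<bar>b\<bar> \<le> (1 + dotp d x x) * (1 + dotp d x x)" using assms by (intro mult_mono) auto
  then show ?thesis by (simp add: abs_mult grow_def dotp_def power2_eq_square)
qed

lemma gate_le: "w = pos \<or> w = neg \<Longrightarrow> \<bar>a\<bar> \<le> c \<Longrightarrow> \<bar>w t * a\<bar> \<le> c" "\<bar>a\<bar> \<le> c \<Longrightarrow> \<bar>relu a\<bar> \<le> c"
  by (auto simp: pos_def neg_def relu_def)

lemma coordinate_measurable: "p < d \<Longrightarrow> (\<lambda>x. x p) \<in> borel_measurable (gam d)"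
  by measurable

text \<open>Averages of these functions over the first columns certify the genericity of the sample.\<close>

definition tests :: "((nat \<Rightarrow> real) \<Rightarrow> real) set" where
  "tests = (\<lambda>(j, l, r) x. neg (dotp d (v j) x) * relu (dotp d (v l) x) * dotp d (v r) x) ` ({..<k} \<times> {..<k} \<times> {..<k})
    \<union> (\<lambda>(j, l, r) x. pos (dotp d (v j) x) * relu (dotp d (v l) x) * dotp d (v r) x) ` ({..<k} \<times> {..<k} \<times> {..<k})
    \<union> (\<lambda>(j, l) x. pos (dotp d (v j) x) * relu (dotp d (v l) x) * ((dotp d (v j) x)\<^sup>2 - 1)) ` ({..<k} \<times> {..<k})
    \<union> (\<lambda>(w, j, p, q) x. w (dotp d (v j) x) * x p * x q) ` ({pos, neg} \<times> {..<k} \<times> {..<d} \<times> {..<d})"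

definition tensors :: "((nat \<Rightarrow> real) \<Rightarrow> real) set" where
  "tensors = (\<lambda>(l, p, q) x. relu (dotp d (v l) x) * (x p * x q - (if p = q then 1 else 0))) ` ({..<k} \<times> {..<d} \<times> {..<d})"

lemma testsI:
  "j < k \<Longrightarrow> l < k \<Longrightarrow> r < k \<Longrightarrow> (\<lambda>x. neg (dotp d (v j) x) * relu (dotp d (v l) x) * dotp d (v r) x) \<in> tests"
  "j < k \<Longrightarrow> l < k \<Longrightarrow> r < k \<Longrightarrow> (\<lambda>x. pos (dotp d (v j) x) * relu (dotp d (v l) x) * dotp d (v r) x) \<in> tests"
  "j < k \<Longrightarrow> l < k \<Longrightarrow> (\<lambda>x. pos (dotp d (v j) x) * relu (dotp d (v l) x) * ((dotp d (v j) x)\<^sup>2 - 1)) \<in> tests"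
  "w = pos \<or> w = neg \<Longrightarrow> j < k \<Longrightarrow> p < d \<Longrightarrow> q < d \<Longrightarrow> (\<lambda>x. w (dotp d (v j) x) * x p * x q) \<in> tests"
proof -
  show "j < k \<Longrightarrow> l < k \<Longrightarrow> r < k \<Longrightarrow> (\<lambda>x. neg (dotp d (v j) x) * relu (dotp d (v l) x) * dotp d (v r) x) \<in> tests" unfolding tests_def
    by (rule UnI1, rule UnI1, rule UnI1, rule image_eqI[of _ _ "(j, l, r)"]) simp_all
  show "j < k \<Longrightarrow> l < k \<Longrightarrow> r < k \<Longrightarrow> (\<lambda>x. pos (dotp d (v j) x) * relu (dotp d (v l) x) * dotp d (v r) x) \<in> tests" unfolding tests_def
    by (rule UnI1, rule UnI1, rule UnI2, rule image_eqI[of _ _ "(j, l, r)"]) simp_all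
  show "j < k \<Longrightarrow> l < k \<Longrightarrow> (\<lambda>x. pos (dotp d (v j) x) * relu (dotp d (v l) x) * ((dotp d (v j) x)\<^sup>2 - 1)) \<in> tests" unfolding tests_def
    by (rule UnI1, rule UnI2, rule image_eqI[of _ _ "(j, l)"]) simp_all
  show "w = pos \<or> w = neg \<Longrightarrow> j < k \<Longrightarrow> p < d \<Longrightarrow> q < d \<Longrightarrow> (\<lambda>x. w (dotp d (v j) x) * x p * x q) \<in> tests" unfolding tests_def
    by (rule UnI2, rule image_eqI[of _ _ "(w, j, p, q)"]) auto
qed

lemma tensorsI:
  "l < k \<Longrightarrow> p < d \<Longrightarrow> q < d \<Longrightarrow> (\<lambda>x. relu (dotp d (v l) x) * (x p * x q - (if p = q then 1 else 0))) \<in> tensors"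
  unfolding tensors_def by (rule image_eqI[of _ _ "(l, p, q)"]) simp_all

lemma tests_ok: "h \<in> tests \<Longrightarrow> h \<in> borel_measurable (gam d) \<and> (\<forall>x. \<bar>h x\<bar> \<le> grow d x)"
proof -
  have 1: "(\<lambda>x. w (dotp d (v j) x) * relu (dotp d (v l) x) * dotp d (v r) x) \<in> borel_measurable (gam d) \<and>
      (\<forall>x. \<bar>w (dotp d (v j) x) * relu (dotp d (v l) x) * dotp d (v r) x\<bar> \<le> grow d x)"
    if w: "w = pos \<or> w = neg" and j: "j < k" "l < k" "r < k" for w j l r
  proof
    have [measurable]: "w \<in> borel_measurable borel" using w pos_neg_measurable by auto
    show "(\<lambda>x. w (dotp d (v j) x) * relu (dotp d (v l) x) * dotp d (v r) x) \<in> borel_measurable (gam d)"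
      by measurable
    show "\<forall>x. \<bar>w (dotp d (v j) x) * relu (dotp d (v l) x) * dotp d (v r) x\<bar> \<le> grow d x"
      using w j by (intro allI grow_prod gate_le lin_le)
  qed
  have 2: "(\<lambda>x. pos (dotp d (v j) x) * relu (dotp d (v l) x) * ((dotp d (v j) x)\<^sup>2 - 1)) \<in> borel_measurable (gam d) \<and>
      (\<forall>x. \<bar>pos (dotp d (v j) x) * relu (dotp d (v l) x) * ((dotp d (v j) x)\<^sup>2 - 1)\<bar> \<le> grow d x)"
    if j: "j < k" "l < k" for j l
  proof
    show "(\<lambda>x. pos (dotp d (v j) x) * relu (dotp d (v l) x) * ((dotp d (v j) x)\<^sup>2 - 1)) \<in> borel_measurable (gam d)" by measurable
    show "\<forall>x. \<bar>pos (dotp d (v j) x) * relu (dotp d (v l) x) * ((dotp d (v j) x)\<^sup>2 - 1)\<bar> \<le> grow d x"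
      using j by (intro allI grow_prod gate_le lin_le sq_le) simp_all
  qed
  have 3: "(\<lambda>x. w (dotp d (v j) x) * x p * x q) \<in> borel_measurable (gam d) \<and> (\<forall>x. \<bar>w (dotp d (v j) x) * x p * x q\<bar> \<le> grow d x)"
    if w: "w = pos \<or> w = neg" and j: "j < k" "p < d" "q < d" for w j p q
  proof
    have [measurable]: "w \<in> borel_measurable borel" using w pos_neg_measurable by auto
    note [measurable] = coordinate_measurable[OF j(2)] coordinate_measurable[OF j(3)]
    show "(\<lambda>x. w (dotp d (v j) x) * x p * x q) \<in> borel_measurable (gam d)"
      by measurable
    show "\<forall>x. \<bar>w (dotp d (v j) x) * x p * x q\<bar> \<le> grow d x"
      using w j by (intro allI grow_prod gate_le entry_le)
  qed
  assume "h \<in> tests"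
  then show ?thesis unfolding tests_def
    by (elim UnE imageE SigmaE) (simp_all only: prod.case lessThan_iff insert_iff empty_iff simp_thms 1 2 3)
qed

lemma tensors_ok: "h \<in> tensors \<Longrightarrow> h \<in> borel_measurable (gam d) \<and> (\<forall>x. \<bar>h x\<bar> \<le> grow d x)"
proof -
  assume "h \<in> tensors"
  then obtain l p q where h: "h = (\<lambda>x. relu (dotp d (v l) x) * (x p * x q - (if p = q then 1 else 0)))" and j: "l < k" "p < d" "q < d"
    unfolding tensors_def by auto
  note [measurable] = coordinate_measurable[OF j(2)] coordinate_measurable[OF j(3)]
  have "h \<in> borel_measurable (gam d)" unfolding h by measurable
  moreover have "\<bar>h x\<bar> \<le> grow d x" for x
    unfolding h by (intro grow_prod gate_le lin_le entries_le j)
  ultimately show ?thesis by blast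
qed

lemma card_tests: "finite tests" "card tests \<le> 2 * k ^ 3 + k\<^sup>2 + 2 * k * d\<^sup>2"
proof -
  show "finite tests" by (simp add: tests_def)
  have "card tests \<le> k ^ 3 + k ^ 3 + k\<^sup>2 + 2 * k * d\<^sup>2"
    unfolding tests_def
    by (intro order_trans[OF card_Un_le] add_mono order_trans[OF card_image_le])
      (auto simp: card_cartesian_product numeral_eq_Suc card_insert_if)
  then show "card tests \<le> 2 * k ^ 3 + k\<^sup>2 + 2 * k * d\<^sup>2" by simp
qed

lemma card_tensors: "finite tensors" "card tensors \<le> k * d\<^sup>2"
  unfolding tensors_def by (auto intro!: order_trans[OF card_image_le] simp: card_cartesian_product power2_eq_square)

end

lemma linear_small_ball:
  assumes I: "\<And>\<xi>. L \<xi> = (\<Sum>e\<in>{..<d} \<times> {..<n}. c e * \<xi> e)" and e: "e \<in> {..<d} \<times> {..<n}" "c e \<noteq> 0" "b \<le> \<bar>c e\<bar>" and b: "0 < b" and t: "0 \<le> t"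
  shows "measure (SG d n) {\<xi> \<in> space (SG d n). \<bar>L \<xi>\<bar> \<le> t} \<le> t / b" "{\<xi> \<in> space (SG d n). \<bar>L \<xi>\<bar> \<le> t} \<in> sets (SG d n)"
proof -
  have "measure (SG d n) {\<xi> \<in> space (SG d n). \<bar>L \<xi>\<bar> \<le> t} \<le> t / \<bar>c e\<bar>"
    unfolding I by (rule small_ball) (use e t in auto)
  also have "\<dots> \<le> t / b" using e b t by (intro divide_left_mono) auto
  finally show "measure (SG d n) {\<xi> \<in> space (SG d n). \<bar>L \<xi>\<bar> \<le> t} \<le> t / b" .
  have [measurable]: "(\<lambda>\<xi>. \<Sum>e\<in>{..<d} \<times> {..<n}. c e * \<xi> e) \<in> borel_measurable (SG d n)"
    by measurable
  show "{\<xi> \<in> space (SG d n). \<bar>L \<xi>\<bar> \<le> t} \<in> sets (SG d n)" unfolding I by measurable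
qed

lemma column_form:
  assumes "i < n"
  shows "dotp d w (col d i \<xi>) = (\<Sum>e\<in>{..<d} \<times> {..<n}. (if snd e = i then w (fst e) else 0) * \<xi> e)"
proof -
  have "(\<Sum>e\<in>{..<d} \<times> {..<n}. (if snd e = i then w (fst e) else 0) * \<xi> e) = (\<Sum>p<d. \<Sum>i'<n. if i' = i then w p * \<xi> (p, i') else 0)"
    unfolding sum.cartesian_product by (intro sum.cong) auto
  also have "\<dots> = (\<Sum>p<d. w p * \<xi> (p, i))" using assms by simp
  finally show ?thesis by (simp add: dotp_def col_def)
qed

lemma row_form:
  assumes "m \<le> n" "0 < d"
  shows "(\<Sum>r<m. w r * col d r \<xi> 0) = (\<Sum>e\<in>{..<d} \<times> {..<n}. (if fst e = 0 \<and> snd e < m then w (snd e) else 0) * \<xi> e)"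
proof -
  have "(\<Sum>e\<in>{..<d} \<times> {..<n}. (if fst e = 0 \<and> snd e < m then w (snd e) else 0) * \<xi> e) =
      (\<Sum>p<d. \<Sum>r<n. if p = 0 then (if r < m then w r * \<xi> (0, r) else 0) else 0)"
    unfolding sum.cartesian_product by (intro sum.cong) auto
  also have "\<dots> = (\<Sum>p<d. if p = 0 then (\<Sum>r<n. if r < m then w r * \<xi> (0, r) else 0) else 0)"
    by (intro sum.cong) auto
  also have "\<dots> = (\<Sum>r<n. if r < m then w r * \<xi> (0, r) else 0)" using assms by simp
  also have "\<dots> = (\<Sum>r\<in>{r \<in> {..<n}. r < m}. w r * \<xi> (0, r))" by (rule sum.inter_filter[symmetric]) simp
  also have "{r \<in> {..<n}. r < m} = {..<m}" using assms by auto
  finally show ?thesis using assms by (simp add: col_def)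
qed

text \<open>A union bound over six families of bad events, whose constants add up to less than
  34000. The ninth power comes from the genericity tests: there are of order \<open>R ^ 3\<close> of
  them, the second moment of \<open>grow\<close> contributes \<open>R ^ 4\<close>, and the inverse
  square of the tolerance another \<open>R ^ 2\<close>.\<close>

theorem (in orthonormal) good_event:
  fixes u :: "nat \<Rightarrow> nat \<Rightarrow> real" and S \<kappa> :: real
  assumes k: "0 < k" and m: "0 < m" and N: "100 \<le> N" "N \<le> n" "real N ^ 42 \<le> n" and D: "(real (d + k + m))\<^sup>2 \<le> N"
    and S: "0 < S" and \<kappa>: "0 \<le> \<kappa>" "real k * real m * \<kappa> \<le> N"
    and lower: "\<And>c. S\<^sup>2 * (\<Sum>j<k. (c j)\<^sup>2) \<le> (\<Sum>r<m. (\<Sum>j<k. c j * u j r)\<^sup>2)"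
    and upper: "\<And>c. (\<Sum>r<m. (\<Sum>j<k. c j * u j r)\<^sup>2) \<le> (\<kappa> * S)\<^sup>2 * (\<Sum>j<k. (c j)\<^sup>2)"
  shows "\<exists>G\<in>sets (SG d n). 1 - 34000 * real (d + k + m) ^ 9 / N \<le> measure (SG d n) G \<and>
    (\<forall>\<xi>\<in>G. recovery_sample m d n N k (\<lambda>r i. \<Sum>l<k. u l r * relu (dotp d (v l) (col d i \<xi>)))
       (\<lambda>i. col d i \<xi>) v u S (1 / (8 * real (d + k + m))))"
proof -
  define R where "R = real (d + k + m)"
  \<comment> \<open>With fewer than \<open>R\<close> unknowns, the total deviation stays below
    \<open>1 / 8\<close>, within the quarter allowed by diagonal dominance.\<close>
  define \<eta> where "\<eta> = 1 / (8 * R)"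
  define \<epsilon> where "\<epsilon> = 1 / real N ^ 20"
  have kd': "k \<le> d" using kd[of "k - 1"] k by simp
  have d: "0 < d" using kd' k by simp
  have R: "real d + 1 \<le> R" "real k \<le> R" "real m \<le> R" "1 \<le> R" "real d \<le> R" using k by (simp_all add: R_def)
  have \<eta>: "0 < \<eta>" using R by (simp add: \<eta>_def)
  have N0: "0 < real N" "0 < N" "0 < n" using N by simp_all
  have \<epsilon>: "0 < \<epsilon>" using N0 by (simp add: \<epsilon>_def)
  have RN: "R * R \<le> real N" using D by (simp add: R_def power2_eq_square)
  have "R * 2 \<le> R * R" using R k d m by (intro mult_left_mono) (simp_all add: R_def)
  then have szN: "m + d + 1 \<le> N" using RN k by (simp add: R_def)
  have Rp: "R ^ a \<le> R ^ b" if "a \<le> b" for a b using R that by (simp add: power_increasing)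
  interpret P: prob_space "SG d n" by (rule prob_space_SG)
  define C where "C N' e h = {\<xi> \<in> space (SG d n). e \<le> \<bar>(\<Sum>i<N'. h (col d i \<xi>)) / N' - (\<integral>x. h x \<partial>gam d)\<bar>}"
    for N' :: nat and e :: real and h :: "(nat \<Rightarrow> real) \<Rightarrow> real"
  have C: "C N' e h \<in> sets (SG d n)" "measure (SG d n) (C N' e h) \<le> 105 * (real d + 1) ^ 4 / (N' * e\<^sup>2)"
    if h: "h \<in> borel_measurable (gam d) \<and> (\<forall>x. \<bar>h x\<bar> \<le> grow d x)" and N': "0 < N'" "N' \<le> n" "0 < e" for N' e h
  proof -
    have [measurable]: "(\<lambda>\<xi>. h (col d i \<xi>)) \<in> borel_measurable (SG d n)" if "i < n" for i
      using measurable_compose[OF col_measurable[OF that]] h by blast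
    have "(\<lambda>\<xi>. \<Sum>i<N'. h (col d i \<xi>)) \<in> borel_measurable (SG d n)"
      by (intro borel_measurable_sum) (use N' in auto)
    then show "C N' e h \<in> sets (SG d n)" unfolding C_def by measurable
    show "measure (SG d n) (C N' e h) \<le> 105 * (real d + 1) ^ 4 / (N' * e\<^sup>2)"
      unfolding C_def using h N' d by (intro concentration) auto
  qed
  \<comment> \<open>The families, in order: a test average over \<open>N\<close> columns is off, a
    tensor average over all \<open>n\<close> columns is off, a column is close to a hidden
    hyperplane, two coefficients \<open>s\<close> nearly coincide, one is nearly zero, an entry is
    large.\<close>
  define B1 where "B1 = (\<Union>h\<in>tests. C N \<eta> h)"
  define B2 where "B2 = (\<Union>h\<in>tensors. C n \<epsilon> h)"
  define B3 where "B3 = (\<Union>(j, i)\<in>{..<k} \<times> {..<N}. {\<xi> \<in> space (SG d n). \<bar>dotp d (v j) (col d i \<xi>)\<bar> \<le> 1 / real N ^ 3})"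
  define B4 where "B4 = (\<Union>(i, j)\<in>{(i, j). i < k \<and> j < k \<and> i \<noteq> j}. {\<xi> \<in> space (SG d n). \<bar>\<Sum>r<m. (u i r - u j r) * col d r \<xi> 0\<bar> \<le> S / N})"
  define B5 where "B5 = (\<Union>j\<in>{..<k}. {\<xi> \<in> space (SG d n). \<bar>\<Sum>r<m. u j r * col d r \<xi> 0\<bar> \<le> S / N})"
  define B6 where "B6 = (\<Union>(p, i)\<in>{..<d} \<times> {..<N}. {\<xi> \<in> space (SG d n). (real N)\<^sup>2 \<le> \<bar>\<xi> (p, i)\<bar>})"
  have d4: "(real d + 1) ^ 4 \<le> R ^ 4" using R by (intro power_mono) auto
  have b1: "measure (SG d n) B1 \<le> 33600 * R ^ 9 / N" "B1 \<in> sets (SG d n)"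
  proof -
    have k3: "real k ^ 3 \<le> R ^ 3" "(real k)\<^sup>2 \<le> R\<^sup>2" using R by (auto intro!: power_mono)
    have kdd: "real k * (real d)\<^sup>2 \<le> R * R\<^sup>2" using R by (intro mult_mono power_mono) auto
    have "real (card tests) \<le> real (2 * k ^ 3 + k\<^sup>2 + 2 * k * d\<^sup>2)" by (rule of_nat_mono[OF card_tests(2)])
    also have "\<dots> \<le> 2 * R ^ 3 + R ^ 3 + 2 * R ^ 3"
      using k3 kdd Rp[of 2 3] by (simp add: numeral_3_eq_3 power2_eq_square)
    finally have c: "real (card tests) \<le> 5 * R ^ 3" by simp
    have "105 * (real d + 1) ^ 4 / (N * \<eta>\<^sup>2) = 6720 * R\<^sup>2 * (real d + 1) ^ 4 / N"
      using R by (simp add: \<eta>_def power2_eq_square)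
    also have "\<dots> \<le> 6720 * R\<^sup>2 * R ^ 4 / N" using d4 by (intro divide_right_mono mult_left_mono) auto
    finally have "real (card tests) * (105 * (real d + 1) ^ 4 / (N * \<eta>\<^sup>2)) \<le> 5 * R ^ 3 * (6720 * R\<^sup>2 * R ^ 4 / N)"
      using c R by (intro mult_mono) auto
    also have "\<dots> = 33600 * R ^ 9 / N" by (simp flip: power_add)
    finally have u: "real (card tests) * (105 * (real d + 1) ^ 4 / (N * \<eta>\<^sup>2)) \<le> 33600 * R ^ 9 / N" .
    show "measure (SG d n) B1 \<le> 33600 * R ^ 9 / N" "B1 \<in> sets (SG d n)" unfolding B1_def
      by (rule union_bound[OF P.prob_space_axioms card_tests(1) _ _ u];
          rule C(1)[OF tests_ok N0(2) N(2) \<eta>] C(2)[OF tests_ok N0(2) N(2) \<eta>], assumption)+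
  qed
  have b2: "measure (SG d n) B2 \<le> 105 * R ^ 9 / N" "B2 \<in> sets (SG d n)"
  proof -
    have "real (card tensors) \<le> real (k * d\<^sup>2)" by (rule of_nat_mono[OF card_tensors(2)])
    also have "\<dots> \<le> R * R\<^sup>2" using R by (simp, intro mult_mono power_mono) auto
    finally have c: "real (card tensors) \<le> R ^ 3" by (simp add: numeral_3_eq_3 power2_eq_square)
    \<comment> \<open>Here the 42nd power is used: \<open>n * \<epsilon>^2\<close> is at least
      \<open>N ^ 42 / N ^ 40\<close>.\<close>
    have "real N * 1 \<le> real N * real N" using N by (intro mult_left_mono) auto
    also have "\<dots> = real N ^ 42 * \<epsilon>\<^sup>2" using N0 by (simp add: \<epsilon>_def power_divide flip: power_mult) (simp add: field_simps flip: power_add power_Suc)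
    also have "\<dots> \<le> n * \<epsilon>\<^sup>2" using N by (intro mult_right_mono) auto
    finally have "105 * (real d + 1) ^ 4 / (n * \<epsilon>\<^sup>2) \<le> 105 * R ^ 4 / N"
      using d4 N0 R by (intro frac_le) auto
    then have "real (card tensors) * (105 * (real d + 1) ^ 4 / (n * \<epsilon>\<^sup>2)) \<le> R ^ 3 * (105 * R ^ 4 / N)"
      using c R by (intro mult_mono) auto
    also have "\<dots> = 105 * R ^ 7 / N" by (simp flip: power_add)
    also have "\<dots> \<le> 105 * R ^ 9 / N" using Rp[of 7 9] by (intro divide_right_mono mult_left_mono) auto
    finally have u: "real (card tensors) * (105 * (real d + 1) ^ 4 / (n * \<epsilon>\<^sup>2)) \<le> 105 * R ^ 9 / N" .
    show "measure (SG d n) B2 \<le> 105 * R ^ 9 / N" "B2 \<in> sets (SG d n)" unfolding B2_def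
      by (rule union_bound[OF P.prob_space_axioms card_tensors(1) _ _ u];
          rule C(1)[OF tensors_ok N0(3) order_refl \<epsilon>] C(2)[OF tensors_ok N0(3) order_refl \<epsilon>], assumption)+
  qed
  have b3: "measure (SG d n) B3 \<le> R ^ 9 / N" "B3 \<in> sets (SG d n)"
  proof -
    have sb: "measure (SG d n) {\<xi> \<in> space (SG d n). \<bar>dotp d (v j) (col d i \<xi>)\<bar> \<le> 1 / real N ^ 3} \<le> (1 / real N ^ 3) / (1 / d)"
      "{\<xi> \<in> space (SG d n). \<bar>dotp d (v j) (col d i \<xi>)\<bar> \<le> 1 / real N ^ 3} \<in> sets (SG d n)" if ji: "j < k" "i < N" for j i
    proof -
      have "(\<Sum>p<d. (v j p)\<^sup>2) = 1" using orth ji by (simp add: orthn_def power2_eq_square)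
      then obtain p where p: "p < d" "v j p \<noteq> 0" "1 / d \<le> \<bar>v j p\<bar>"
        using big_coordinate[of 1 "v j" d] by auto
      have i: "i < n" using ji N by simp
      note b = linear_small_ball[where e = "(p, i)" and b = "1 / d" and t = "1 / real N ^ 3", OF column_form[OF i]]
      show "measure (SG d n) {\<xi> \<in> space (SG d n). \<bar>dotp d (v j) (col d i \<xi>)\<bar> \<le> 1 / real N ^ 3} \<le> (1 / real N ^ 3) / (1 / d)"
        by (rule b(1)) (use p i d in auto)
      show "{\<xi> \<in> space (SG d n). \<bar>dotp d (v j) (col d i \<xi>)\<bar> \<le> 1 / real N ^ 3} \<in> sets (SG d n)"
        by (rule b(2)) (use p i d in auto)
    qed
    have "real (card ({..<k} \<times> {..<N})) * ((1 / real N ^ 3) / (1 / d)) = real k * real d / N / N"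
      using N0 by (simp add: card_cartesian_product numeral_3_eq_3)
    also have "\<dots> \<le> R * R / N / 1" using R N by (intro frac_le divide_right_mono mult_mono) auto
    also have "\<dots> \<le> R ^ 9 / N" using Rp[of 2 9] by (simp add: power2_eq_square divide_right_mono)
    finally have u: "real (card ({..<k} \<times> {..<N})) * ((1 / real N ^ 3) / (1 / d)) \<le> R ^ 9 / N" .
    show "measure (SG d n) B3 \<le> R ^ 9 / N" "B3 \<in> sets (SG d n)" unfolding B3_def
      by (rule union_bound[OF P.prob_space_axioms _ _ _ u]; use sb in auto)+
  qed
  have row: "measure (SG d n) {\<xi> \<in> space (SG d n). \<bar>\<Sum>r<m. w r * col d r \<xi> 0\<bar> \<le> S / N} \<le> R / N"
    "{\<xi> \<in> space (SG d n). \<bar>\<Sum>r<m. w r * col d r \<xi> 0\<bar> \<le> S / N} \<in> sets (SG d n)" if w: "S\<^sup>2 \<le> (\<Sum>r<m. (w r)\<^sup>2)" for w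
  proof -
    obtain r where r: "r < m" "w r \<noteq> 0" "S / m \<le> \<bar>w r\<bar>" using big_coordinate[OF w S] by blast
    have mn: "m \<le> n" "r < n" using szN N r by simp_all
    note b = linear_small_ball[where e = "(0, r)" and b = "S / m" and t = "S / N", OF row_form[OF mn(1) d]]
    have "measure (SG d n) {\<xi> \<in> space (SG d n). \<bar>\<Sum>r<m. w r * col d r \<xi> 0\<bar> \<le> S / N} \<le> S / N / (S / m)"
      by (rule b(1)) (use r mn d S m N0 in auto)
    also have "\<dots> = m / N" using S m by simp
    also have "\<dots> \<le> R / N" using R by (intro divide_right_mono) auto
    finally show "measure (SG d n) {\<xi> \<in> space (SG d n). \<bar>\<Sum>r<m. w r * col d r \<xi> 0\<bar> \<le> S / N} \<le> R / N" .
    show "{\<xi> \<in> space (SG d n). \<bar>\<Sum>r<m. w r * col d r \<xi> 0\<bar> \<le> S / N} \<in> sets (SG d n)"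
      by (rule b(2)) (use r mn d S m N0 in auto)
  qed
  have u1: "S\<^sup>2 \<le> (\<Sum>r<m. (u j r)\<^sup>2)" "(\<Sum>r<m. (u j r)\<^sup>2) \<le> (\<kappa> * S)\<^sup>2" if j: "j < k" for j
  proof -
    have e: "(\<Sum>l<k. (if l = j then 1 else 0 :: real)\<^sup>2) = 1" "(\<Sum>l<k. (if l = j then 1 else 0) * u l r) = u j r" for r
      using j by (simp_all add: if_distrib[of "\<lambda>t. t\<^sup>2"] if_distrib[of "\<lambda>t. t * _"] cong: if_cong)
    show "S\<^sup>2 \<le> (\<Sum>r<m. (u j r)\<^sup>2)" "(\<Sum>r<m. (u j r)\<^sup>2) \<le> (\<kappa> * S)\<^sup>2"
      using lower[of "\<lambda>l. if l = j then 1 else 0"] upper[of "\<lambda>l. if l = j then 1 else 0"] unfolding e by simp_all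
  qed
  \<comment> \<open>A difference of two columns is the image under \<open>U\<close> of a vector with
    entries 1 and -1, so the least singular value bounds it from below; this separates the
    coefficients \<open>s\<close>.\<close>
  have u2: "S\<^sup>2 \<le> (\<Sum>r<m. (u i r - u j r)\<^sup>2)" if ij: "i < k" "j < k" "i \<noteq> j" for i j
  proof -
    let ?c = "\<lambda>l. (if l = i then 1 else 0) - (if l = j then 1 else 0 :: real)"
    have "(\<Sum>l<k. ?c l * u l r) = u i r - u j r" for r
      using ij by (simp add: left_diff_distrib sum_subtractf if_distrib[of "\<lambda>t. t * _"] cong: if_cong)
    moreover have "(?c i)\<^sup>2 \<le> (\<Sum>l<k. (?c l)\<^sup>2)" using ij by (intro member_le_sum) auto
    then have "S\<^sup>2 * 1 \<le> S\<^sup>2 * (\<Sum>l<k. (?c l)\<^sup>2)" using ij by (intro mult_left_mono) auto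
    ultimately show ?thesis using lower[of ?c] by simp
  qed
  have b4: "measure (SG d n) B4 \<le> R ^ 9 / N" "B4 \<in> sets (SG d n)"
  proof -
    let ?J = "{(i, j). i < k \<and> j < k \<and> i \<noteq> j}"
    have sub: "?J \<subseteq> {..<k} \<times> {..<k}" by auto
    have fin: "finite ?J" by (rule finite_subset[OF sub]) simp
    have "card ?J \<le> k * k" using card_mono[OF _ sub] by (simp add: card_cartesian_product)
    then have "real (card ?J) \<le> real k * real k" by (simp flip: of_nat_mult)
    also have "\<dots> \<le> R * R" using R by (intro mult_mono) auto
    finally have "real (card ?J) * (R / N) \<le> R * R * (R / N)" using R by (intro mult_right_mono) auto
    also have "\<dots> = R ^ 3 / N" by (simp add: numeral_3_eq_3)
    also have "\<dots> \<le> R ^ 9 / N" using Rp[of 3 9] by (intro divide_right_mono) auto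
    finally have u: "real (card ?J) * (R / N) \<le> R ^ 9 / N" .
    show "measure (SG d n) B4 \<le> R ^ 9 / N" "B4 \<in> sets (SG d n)" unfolding B4_def
      by (rule union_bound[OF P.prob_space_axioms fin _ _ u]; use row u2 in auto)+
  qed
  have b5: "measure (SG d n) B5 \<le> R ^ 9 / N" "B5 \<in> sets (SG d n)"
  proof -
    have "real (card {..<k}) * (R / N) \<le> R * (R / N)" using R by (intro mult_right_mono) auto
    also have "\<dots> = R\<^sup>2 / N" by (simp add: power2_eq_square)
    also have "\<dots> \<le> R ^ 9 / N" using Rp[of 2 9] by (intro divide_right_mono) auto
    finally have u: "real (card {..<k}) * (R / N) \<le> R ^ 9 / N" .
    show "measure (SG d n) B5 \<le> R ^ 9 / N" "B5 \<in> sets (SG d n)" unfolding B5_def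
      by (rule union_bound[OF P.prob_space_axioms _ _ _ u]; use row u1 in auto)+
  qed
  have b6: "measure (SG d n) B6 \<le> R ^ 9 / N" "B6 \<in> sets (SG d n)"
  proof -
    have tail: "measure (SG d n) {\<xi> \<in> space (SG d n). (real N)\<^sup>2 \<le> \<bar>\<xi> (p, i)\<bar>} \<le> 1 / ((real N)\<^sup>2)\<^sup>2"
      "{\<xi> \<in> space (SG d n). (real N)\<^sup>2 \<le> \<bar>\<xi> (p, i)\<bar>} \<in> sets (SG d n)" if "p < d" "i < N" for p i
    proof -
      have pi: "(p, i) \<in> {..<d} \<times> {..<n}" using that N by auto
      show "measure (SG d n) {\<xi> \<in> space (SG d n). (real N)\<^sup>2 \<le> \<bar>\<xi> (p, i)\<bar>} \<le> 1 / ((real N)\<^sup>2)\<^sup>2"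
        by (rule gaussian_tail[OF pi]) (use N0 in simp)
      have [measurable]: "(\<lambda>\<xi>. \<xi> (p, i)) \<in> borel_measurable (SG d n)" using pi by measurable
      show "{\<xi> \<in> space (SG d n). (real N)\<^sup>2 \<le> \<bar>\<xi> (p, i)\<bar>} \<in> sets (SG d n)" by measurable
    qed
    have "real (card ({..<d} \<times> {..<N})) * (1 / ((real N)\<^sup>2)\<^sup>2) = real d / N / (real N)\<^sup>2"
      using N0 by (simp add: card_cartesian_product power2_eq_square)
    also have "\<dots> \<le> R / N / 1" using R N by (intro frac_le divide_right_mono) auto
    also have "\<dots> \<le> R ^ 9 / N" using Rp[of 1 9] by (simp add: divide_right_mono)
    finally have u: "real (card ({..<d} \<times> {..<N})) * (1 / ((real N)\<^sup>2)\<^sup>2) \<le> R ^ 9 / N" .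
    show "measure (SG d n) B6 \<le> R ^ 9 / N" "B6 \<in> sets (SG d n)" unfolding B6_def
      by (rule union_bound[OF P.prob_space_axioms _ _ _ u]; use tail in auto)+
  qed
  define B where "B = B1 \<union> B2 \<union> B3 \<union> B4 \<union> B5 \<union> B6"
  have Bs: "B \<in> sets (SG d n)" unfolding B_def using b1 b2 b3 b4 b5 b6 by blast
  have "measure (SG d n) B \<le> measure (SG d n) B1 + measure (SG d n) B2 + measure (SG d n) B3 + measure (SG d n) B4
      + measure (SG d n) B5 + measure (SG d n) B6"
    unfolding B_def using b1 b2 b3 b4 b5 b6
    by (intro order_trans[OF measure_Un_le] add_mono sets.Un order_refl)
  also have "\<dots> \<le> 34000 * R ^ 9 / N"
  proof -
    have "0 \<le> R ^ 9 / N" using R by simp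
    then show ?thesis using b1(1) b2(1) b3(1) b4(1) b5(1) b6(1) by simp
  qed
  finally have Bm: "measure (SG d n) B \<le> 34000 * R ^ 9 / N" .
  show ?thesis
  proof (intro bexI[of _ "space (SG d n) - B"] conjI ballI)
    show "space (SG d n) - B \<in> sets (SG d n)" using Bs by blast
    show "1 - 34000 * real (d + k + m) ^ 9 / N \<le> measure (SG d n) (space (SG d n) - B)"
      using P.prob_compl[OF Bs] Bm unfolding R_def by linarith
    fix \<xi> assume x: "\<xi> \<in> space (SG d n) - B"
    define xs where "xs i = col d i \<xi>" for i
    have sp: "\<xi> \<in> space (SG d n)" using x by simp
    have t1: "\<bar>(\<Sum>i<N. h (xs i)) / N - (\<integral>y. h y \<partial>gam d)\<bar> \<le> \<eta>" if "h \<in> tests" for h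
      using x that unfolding B_def B1_def C_def xs_def by (auto simp: not_le less_imp_le)
    have t2: "\<bar>(\<Sum>i<n. h (xs i)) / n - (\<integral>y. h y \<partial>gam d)\<bar> \<le> \<epsilon>" if "h \<in> tensors" for h
      using x that unfolding B_def B2_def C_def xs_def by (auto simp: not_le less_imp_le)
    have xb: "\<bar>xs i p\<bar> \<le> (real N)\<^sup>2" if "i < N" "p < d" for i p
      using x that unfolding B_def B6_def xs_def by (auto simp: col_def not_le less_imp_le)
    have "recovery_sample m d n N k (\<lambda>r i. \<Sum>l<k. u l r * relu (dotp d (v l) (xs i))) xs v u S \<eta>"
    proof (rule recovery_sampleI)
      show "m + d + 1 \<le> n" "2 \<le> n" "N \<le> n" "100 \<le> N" using szN N by simp_all
      show "(real d)\<^sup>2 \<le> N" using RN mult_mono[OF R(5) R(5)] R by (simp add: power2_eq_square)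
      \<comment> \<open>Each entry of \<open>U\<close> is at most \<open>\<kappa> * S\<close> and
        each entry of \<open>g\<close> at most \<open>N^2\<close>; the number \<open>k * m\<close>
        of terms and \<open>\<kappa>\<close> together cost one more factor \<open>N\<close>.\<close>
      show "(\<Sum>l<k. \<bar>\<Sum>r<m. xs r 0 * u l r\<bar>) \<le> real N ^ 3 * S"
      proof -
        have "\<bar>u l r\<bar> \<le> \<kappa> * S" if "l < k" "r < m" for l r
        proof -
          have "(u l r)\<^sup>2 \<le> (\<Sum>r<m. (u l r)\<^sup>2)" using that by (intro member_le_sum) auto
          then have "(u l r)\<^sup>2 \<le> (\<kappa> * S)\<^sup>2" using u1(2)[OF that(1)] by linarith
          then show ?thesis using \<kappa> S by (simp add: power2_le_iff_abs_le)
        qed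
        then have "(\<Sum>l<k. \<bar>\<Sum>r<m. xs r 0 * u l r\<bar>) \<le> (\<Sum>l<k. \<Sum>r<m. (real N)\<^sup>2 * (\<kappa> * S))"
          using xb szN d by (intro sum_mono order_trans[OF sum_abs]) (auto simp: abs_mult intro!: mult_mono)
        also have "\<dots> = (real k * real m * \<kappa>) * ((real N)\<^sup>2 * S)" by simp
        also have "\<dots> \<le> N * ((real N)\<^sup>2 * S)" using \<kappa> S by (intro mult_right_mono) auto
        also have "\<dots> = real N ^ 3 * S" by (simp add: numeral_3_eq_3 power2_eq_square)
        finally show ?thesis .
      qed
      show "S / N \<le> \<bar>\<Sum>r<m. (u i r - u j r) * xs r 0\<bar>" if ij: "i < k" "j < k" "i \<noteq> j" for i j
      proof (rule ccontr)
        assume "\<not> ?thesis"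
        then have "\<xi> \<in> B4" unfolding B4_def xs_def by (intro UN_I[of "(i, j)"]) (use ij sp in simp_all)
        then show False using x by (simp add: B_def)
      qed
      show "S / N \<le> \<bar>\<Sum>r<m. u j r * xs r 0\<bar>" if "j < k" for j
        using x that unfolding B_def B5_def xs_def by (auto simp: not_le less_imp_le)
      show "1 / real N ^ 3 \<le> \<bar>dotp d (v j) (xs i)\<bar>" if "j < k" "i < N" for j i
        using x that unfolding B_def B3_def xs_def by (auto simp: not_le less_imp_le)
      show "\<bar>(\<Sum>i<n. relu (dotp d (v l) (xs i)) * (xs i p * xs i q - (if p = q then 1 else 0))) / n - c0 * v l p * v l q\<bar> \<le> 1 / real N ^ 20"
        if "l < k" "p < d" "q < d" for l p q
        using t2[OF tensorsI[OF that]] unfolding E5[OF that] \<epsilon>_def .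
      show "real (d + k) * \<eta> < 1 / 4" using R by (simp add: \<eta>_def R_def divide_less_eq)
      show "0 \<le> \<eta>" using \<eta> by simp
      show "\<bar>(\<Sum>i<N. neg (dotp d (v j) (xs i)) * relu (dotp d (v l) (xs i)) * dotp d (v r) (xs i)) / N - (if l = r then 1 / 4 else 0)\<bar> \<le> \<eta>"
        if "j < k" "l < k" "r < k" "l \<noteq> j" "r \<noteq> j" for j l r
        using t1[OF testsI(1)[OF that(1-3)]] unfolding E1[OF that] .
      show "\<bar>(\<Sum>i<N. pos (dotp d (v j) (xs i)) * relu (dotp d (v l) (xs i)) * dotp d (v r) (xs i)) / N - (if l = r then 1 / 4 else 0)\<bar> \<le> \<eta>"
        if "j < k" "l < k" "r < k" "r \<noteq> j" for j l r
        using t1[OF testsI(2)[OF that(1-3)]] unfolding E2[OF that] .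
      show "\<bar>(\<Sum>i<N. pos (dotp d (v j) (xs i)) * relu (dotp d (v l) (xs i)) * ((dotp d (v j) (xs i))\<^sup>2 - 1)) / N - (if l = j then c0 else 0)\<bar> \<le> \<eta>"
        if "j < k" "l < k" for j l
        using t1[OF testsI(3)[OF that]] unfolding E3[OF that] .
      show "\<bar>(\<Sum>i<N. w (dotp d (v j) (xs i)) * xs i p * xs i q) / N - (if p = q then 1 / 2 else 0)\<bar> \<le> \<eta>"
        if "w = pos \<or> w = neg" "j < k" "p < d" "q < d" for w j p q
        using t1[OF testsI(4)[OF that]] unfolding E4[OF that(2-4,1)] .
    qed (fact d orth k refl N(3) S xb lower)+
    then show "recovery_sample m d n N k (\<lambda>r i. \<Sum>l<k. u l r * relu (dotp d (v l) (col d i \<xi>)))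
       (\<lambda>i. col d i \<xi>) v u S (1 / (8 * real (d + k + m)))"
      unfolding xs_def[abs_def] \<eta>_def R_def .
  qed
qed

text \<open>The integer \<open>N\<close> of the analysis is the one computed by \<open>PN\<close>,
  as both are the integer part of the 42nd root of \<open>n\<close>.\<close>

lemma recover_run:
  assumes rs: "recovery_sample m d n N k A x v u S \<eta>" and N: "real N ^ 42 \<le> n" "real n < (real N + 1) ^ 42"
    and rm: "\<And>r i. r < m \<Longrightarrow> i < n \<Longrightarrow> rm (n * r + i) = A r i" "\<And>p i. p < d \<Longrightarrow> i < n \<Longrightarrow> rm (n * m + n * p + i) = x i p"
  shows "\<exists>\<sigma>. bij_betw \<sigma> {..<k} {..<k} \<and> iv (run n (Prog 42) (hinit m d n rm)) 6 = k \<and>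
    (\<forall>r<m. \<forall>l<k. ar (run n (Prog 42) (hinit m d n rm)) 1 (r * k + l) = u (\<sigma> l) r) \<and>
    (\<forall>l<k. \<forall>q<d. ar (run n (Prog 42) (hinit m d n rm)) 1 (m * k + l * d + q) = v (\<sigma> l) q)"
proof -
  interpret recovery_sample m d n N k A x v u S \<eta> by (rule rs)
  let ?h = "hinit m d n rm" and ?g = "run n (PN 42) (hinit m d n rm)"
  obtain N' where N': "iv ?g 5 = N'" "real N' ^ 42 \<le> n" "real n < (real N' + 1) ^ 42"
    using run_PN[of 42 ?h n] sz by (auto simp: hinit_def)
  have le: "a \<le> b" if "real a ^ 42 \<le> n" "real n < (real b + 1) ^ 42" for a b :: nat
  proof (rule ccontr)
    assume "\<not> a \<le> b"
    then have "real b + 1 \<le> real a" by simp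
    then have "(real b + 1) ^ 42 \<le> real a ^ 42" by (intro power_mono) auto
    then show False using that by linarith
  qed
  have "N' = N" by (rule antisym[OF le[OF N'(2) N(2)] le[OF N(1) N'(3)]])
  then have b: "base0 ?g" using N'(1) rm by (simp add: base0_def hinit_def)
  have z: "iv ?g 6 = 0" "iv ?g 7 = 0" "iv ?g 8 = 0" by (simp_all add: hinit_def)
  show ?thesis using run_Prest[OF b z] unfolding Prog_Prest run.simps .
qed

section \<open>The theorem\<close>

lemma rmem_input:
  assumes "A \<in> carrier_mat m n" "X \<in> carrier_mat d n"
  shows "rmem (input_state A X \<omega>) a = (if a < m * n then A $$ (a div n, a mod n)
    else if a < m * n + d * n then X $$ ((a - m * n) div n, (a - m * n) mod n) else 0)"
  using assms by (simp add: input_state_def Let_def)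

lemma outputs_iff:
  assumes "U \<in> carrier_mat m k" "V \<in> carrier_mat k d"
  shows "outputs s (mat (dim_row U) (dim_col U) (\<lambda>(i, j). U $$ (i, \<pi> j))) (mat (dim_row V) (dim_col V) (\<lambda>(i, j). V $$ (\<pi> i, j))) \<longleftrightarrow>
    imem s 0 = k \<and> (\<forall>r<m. \<forall>l<k. rmem s (r * k + l) = U $$ (r, \<pi> l)) \<and> (\<forall>l<k. \<forall>q<d. rmem s (m * k + l * d + q) = V $$ (\<pi> l, q))"
proof -
  have eq: "mat a b f = mat a b g \<longleftrightarrow> (\<forall>i<a. \<forall>j<b. f (i, j) = (g (i, j) :: real))" for a b f g
    by (metis (no_types, lifting) cong_mat index_mat(1))
  show ?thesis using assms by (auto simp: outputs_def eq)
qed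

section \<open>The success event and its measurability\<close>

locale instance_data =
  fixes m k d n :: nat and U V :: "real mat"
  assumes U: "U \<in> carrier_mat m k" and V: "V \<in> carrier_mat k d" and sz: "k \<le> n" "m \<le> n" "d \<le> n"
begin

definition X :: "(nat \<times> nat \<Rightarrow> real) \<Rightarrow> real mat" where "X \<xi> = mat d n \<xi>"

definition A :: "(nat \<times> nat \<Rightarrow> real) \<Rightarrow> real mat" where "A \<xi> = U * map_mat relu (V * X \<xi>)"

text \<open>Compiled programs contain no \<open>RSample\<close>, so the final state is a function of
  the data matrix, and one fixed source of coins represents all of them.\<close>

definition H :: "(nat \<times> nat \<Rightarrow> real) \<Rightarrow> hst" where
  "H \<xi> = run n (Prog 42) (hinit m d n (rmem (input_state (A \<xi>) (X \<xi>) (\<lambda>_. 0))))"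

text \<open>All quantifiers range over finite sets, the permutations included, so that measurability
  reduces to that of single memory cells.\<close>

definition good_output :: "hst \<Rightarrow> bool" where
  "good_output h \<longleftrightarrow> iv h 6 = k \<and> (\<exists>\<pi>\<in>{\<pi>. \<pi> permutes {..<k}}.
    (\<forall>r\<in>{..<m}. \<forall>l\<in>{..<k}. ar h 1 (r * k + l) = U $$ (r, \<pi> l)) \<and>
    (\<forall>l\<in>{..<k}. \<forall>q\<in>{..<d}. ar h 1 (m * k + l * d + q) = V $$ (\<pi> l, q)))"

lemma carriers: "X \<xi> \<in> carrier_mat d n" "A \<xi> \<in> carrier_mat m n"
  using U V by (simp_all add: X_def A_def)

lemma A_entry:
  assumes "r < m" "i < n"
  shows "A \<xi> $$ (r, i) = (\<Sum>l<k. U $$ (r, l) * relu (dotp d (\<lambda>p. V $$ (l, p)) (col d i \<xi>)))"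
proof -
  have "(V * X \<xi>) $$ (l, i) = dotp d (\<lambda>p. V $$ (l, p)) (col d i \<xi>)" if "l < k" for l
    using V that assms by (simp add: X_def scalar_prod_def dotp_def col_def atLeast0LessThan)
  then show ?thesis using U V assms by (simp add: A_def X_def scalar_prod_def atLeast0LessThan)
qed

text \<open>Determinism makes the constructed run the only one, and \<open>k \<le> n\<close> ensures
  that the whole output lies in the stretch of memory copied at the end.\<close>

lemma recovers_iff: "recovers (calg (Prog 42)) (A \<xi>) (X \<xi>) \<omega> U V \<longleftrightarrow> good_output (H \<xi>)"
proof -
  obtain t s where e: "exec (calg (Prog 42)) (input_state (A \<xi>) (X \<xi>) \<omega>) t s"
    and s0: "imem s 0 = iv (run n (Prog 42) (hinit m d n (rmem (input_state (A \<xi>) (X \<xi>) \<omega>)))) 6"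
    and s1: "\<And>e. e < (m + d) * n \<Longrightarrow> rmem s e = ar (run n (Prog 42) (hinit m d n (rmem (input_state (A \<xi>) (X \<xi>) \<omega>)))) 1 e"
    using exec_calg[OF wf_Prog[of 42]] carriers[of \<xi>] sz by meson
  have rm: "rmem (input_state (A \<xi>) (X \<xi>) \<omega>) = rmem (input_state (A \<xi>) (X \<xi>) (\<lambda>_. 0))"
    by (simp add: input_state_def Let_def)
  have i0: "imem s 0 = iv (H \<xi>) 6" using s0 by (simp add: H_def rm)
  have r0: "rmem s e = ar (H \<xi>) 1 e" if "e < (m + d) * n" for e using s1[OF that] by (simp add: H_def rm)
  have mk: "m * k \<le> m * n" "k * d \<le> n * d" by (fact mult_le_mono2[OF sz(1)] mult_le_mono1[OF sz(1)])+
  have rU: "rmem s (r * k + l) = ar (H \<xi>) 1 (r * k + l)" if "r < m" "l < k" for r l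
  proof (rule r0)
    have "r * k + l < Suc r * k" using that by simp
    also have "\<dots> \<le> m * k" using that by (intro mult_le_mono1) simp
    also have "\<dots> \<le> m * n" by (rule mk)
    also have "\<dots> \<le> (m + d) * n" by simp
    finally show "r * k + l < (m + d) * n" .
  qed
  have rV: "rmem s (m * k + l * d + q) = ar (H \<xi>) 1 (m * k + l * d + q)" if "l < k" "q < d" for l q
  proof (rule r0)
    have "l * d + q < Suc l * d" using that by simp
    also have "\<dots> \<le> k * d" using that by (intro mult_le_mono1) simp
    also have "\<dots> \<le> n * d" by (rule mk)
    finally have "m * k + (l * d + q) < m * n + n * d" using mk(1) by (rule add_le_less_mono[rotated])
    then show "m * k + l * d + q < (m + d) * n" by (simp add: algebra_simps)
  qed
  have "recovers (calg (Prog 42)) (A \<xi>) (X \<xi>) \<omega> U V \<longleftrightarrow> (\<exists>\<pi>. \<pi> permutes {..<k} \<and>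
      outputs s (mat (dim_row U) (dim_col U) (\<lambda>(i, j). U $$ (i, \<pi> j))) (mat (dim_row V) (dim_col V) (\<lambda>(i, j). V $$ (\<pi> i, j))))"
    unfolding recovers_def using e exec_det[OF e] U by (metis carrier_matD(2))
  also have "\<dots> \<longleftrightarrow> good_output (H \<xi>)"
  proof -
    have "(\<forall>r<m. \<forall>l<k. rmem s (r * k + l) = U $$ (r, \<pi> l)) \<longleftrightarrow> (\<forall>r\<in>{..<m}. \<forall>l\<in>{..<k}. ar (H \<xi>) 1 (r * k + l) = U $$ (r, \<pi> l))"
      "(\<forall>l<k. \<forall>q<d. rmem s (m * k + l * d + q) = V $$ (\<pi> l, q)) \<longleftrightarrow> (\<forall>l\<in>{..<k}. \<forall>q\<in>{..<d}. ar (H \<xi>) 1 (m * k + l * d + q) = V $$ (\<pi> l, q))"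
      for \<pi> using rU rV by (simp_all add: Ball_def)
    then show ?thesis unfolding outputs_iff[OF U V] good_output_def i0 by simp blast
  qed
  finally show ?thesis .
qed

lemma H_measurable: "mh (SG d n) H"
proof -
  have col: "(\<lambda>\<xi>. dotp d w (col d i \<xi>)) \<in> borel_measurable (SG d n)" if "i < n" for w i
    using measurable_compose[OF col_measurable[OF that] dotp_measurable] .
  have A: "(\<lambda>\<xi>. A \<xi> $$ (r, i)) \<in> borel_measurable (SG d n)" if "r < m" "i < n" for r i
  proof -
    note [measurable] = col[OF that(2)]
    show ?thesis unfolding A_entry[OF that] by measurable
  qed
  have X: "(\<lambda>\<xi>. X \<xi> $$ (p, i)) \<in> borel_measurable (SG d n)" if "p < d" "i < n" for p i
  proof -
    have pi: "(p, i) \<in> {..<d} \<times> {..<n}" using that by simp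
    have "(\<lambda>\<xi>. \<xi> (p, i)) \<in> borel_measurable (SG d n)" using pi by measurable
    then show ?thesis using that by (simp add: X_def)
  qed
  have rm: "(\<lambda>\<xi>. rmem (input_state (A \<xi>) (X \<xi>) (\<lambda>_. 0)) a) \<in> borel_measurable (SG d n)" for a
  proof (cases "n = 0")
    case True
    then show ?thesis unfolding rmem_input[OF carriers(2,1)] by simp
  next
    case False
    then have n: "a mod n < n" "(a - m * n) mod n < n" by simp_all
    have 1: "a div n < m" if "a < m * n" using that by (simp add: less_mult_imp_div_less)
    have 2: "(a - m * n) div n < d" if "a < m * n + d * n" "\<not> a < m * n"
      using that by (intro less_mult_imp_div_less) simp
    consider "a < m * n" | "\<not> a < m * n" "a < m * n + d * n" | "\<not> a < m * n + d * n" "\<not> a < m * n" by linarith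
    then show ?thesis
      unfolding rmem_input[OF carriers(2,1)] by cases (use A[OF 1 n(1)] X[OF 2 n(2)] in simp_all)
  qed
  have "mh (SG d n) (\<lambda>\<xi>. hinit m d n (rmem (input_state (A \<xi>) (X \<xi>) (\<lambda>_. 0))))"
    unfolding mh_def
  proof (intro conjI allI)
    show "(\<lambda>\<xi>. iv (hinit m d n (rmem (input_state (A \<xi>) (X \<xi>) (\<lambda>_. 0)))) z) \<in> measurable (SG d n) (count_space UNIV)" for z
      by (simp add: hinit_def)
    show "(\<lambda>\<xi>. ar (hinit m d n (rmem (input_state (A \<xi>) (X \<xi>) (\<lambda>_. 0)))) r e) \<in> borel_measurable (SG d n)" for r e
      using rm[of e] by (cases "r = 0") (simp_all add: hinit_def)
  qed
  then show ?thesis unfolding H_def[abs_def] by (rule mh_run)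
qed

lemma good_output_measurable: "Measurable.pred (SG d n) (\<lambda>\<xi>. good_output (H \<xi>))"
proof -
  have iv: "Measurable.pred (SG d n) (\<lambda>\<xi>. iv (H \<xi>) 6 = k)"
    using measurable_compose[of "\<lambda>\<xi>. iv (H \<xi>) 6" "SG d n" "count_space UNIV" "\<lambda>i. i = k"] H_measurable
    by (simp add: mh_def)
  have ar: "Measurable.pred (SG d n) (\<lambda>\<xi>. ar (H \<xi>) 1 e = c)" for e c
  proof -
    have [measurable]: "(\<lambda>\<xi>. ar (H \<xi>) 1 e) \<in> borel_measurable (SG d n)" using H_measurable by (simp add: mh_def)
    show ?thesis by measurable
  qed
  show ?thesis unfolding good_output_def
    by (intro pred_intros_logic pred_intros_finite iv ar finite_permutations finite_lessThan)
qed

text \<open>Success is the same for all coins, so the event is a cylinder and its probability is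
  that of a set of data matrices.\<close>

lemma event_measurable:
  "{(\<xi>, \<omega>) \<in> space (sample_space d n). let X = mat d n \<xi>; A = U * map_mat relu (V * X)
     in recovers (calg (Prog 42)) A X \<omega> U V} = {\<xi> \<in> space (SG d n). good_output (H \<xi>)} \<times> space (\<Pi>\<^sub>M _\<in>UNIV. uniform_measure lborel {0..1})"
  using recovers_iff by (auto simp: sample_space_def space_pair_measure X_def A_def Let_def)

end

lemma prob_space_coins: "prob_space (\<Pi>\<^sub>M _\<in>(UNIV :: nat set). uniform_measure lborel {0..1 :: real})"
  by (intro prob_space_PiM prob_space_uniform_measure) auto

text \<open>Taking 42nd roots gives \<open>\<tau> ^ (c + 26) < N + 1\<close>; one factor
  \<open>\<tau>\<close>, which is at least 2, absorbs the 1 and leaves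
  \<open>\<tau> ^ (c + 25) \<le> N\<close>. The number 25 is 9 from the failure bound plus 16, as
  34000 is at most \<open>2 ^ 16\<close>.\<close>

lemma size_bounds:
  fixes \<tau> \<kappa> :: real and d k m N n c :: nat
  assumes \<tau>: "real (d + k + m) \<le> \<tau>" "real k \<le> \<tau>" "real m \<le> \<tau>" "\<kappa> \<le> \<tau>" "0 \<le> \<kappa>" and D: "2 \<le> d + k + m"
    and n: "\<tau> ^ (42 * (c + 26)) \<le> n" and N: "real n < (real N + 1) ^ 42"
  shows "100 \<le> N" "(real (d + k + m))\<^sup>2 \<le> N" "real k * real m * \<kappa> \<le> N"
    "34000 * real (d + k + m) ^ 9 / N \<le> 1 / real (d + m + k) ^ c"
proof -
  define R where "R = real (d + k + m)"
  have R: "2 \<le> R" "R \<le> \<tau>" using D \<tau> by (simp_all add: R_def)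
  have \<tau>2: "2 \<le> \<tau>" using R by simp
  have "\<tau> ^ (c + 26) < real N + 1"
  proof (rule ccontr)
    assume "\<not> ?thesis"
    then have "(real N + 1) ^ 42 \<le> (\<tau> ^ (c + 26)) ^ 42" by (intro power_mono) auto
    also have "\<dots> = \<tau> ^ (42 * (c + 26))" by (simp add: mult.commute flip: power_mult)
    finally show False using n N by linarith
  qed
  moreover have "2 * \<tau> ^ (c + 25) \<le> \<tau> * \<tau> ^ (c + 25)" using \<tau>2 by (intro mult_right_mono) auto
  moreover have "\<tau> * \<tau> ^ (c + 25) = \<tau> ^ (c + 26)" using power_add[of \<tau> 1 "c + 25"] by (simp add: add.commute)
  moreover have "1 \<le> \<tau> ^ (c + 25)" using \<tau>2 by (intro one_le_power) simp
  ultimately have Nb: "\<tau> ^ (c + 25) \<le> N" by linarith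
  have pow: "\<tau> ^ a \<le> N" if "a \<le> 25" for a
  proof -
    have "\<tau> ^ a \<le> \<tau> ^ (c + 25)" by (rule power_increasing) (use that \<tau>2 in simp_all)
    then show ?thesis using Nb by linarith
  qed
  have "(2::real) ^ 7 \<le> \<tau> ^ 7" using \<tau>2 by (intro power_mono) auto
  then show "100 \<le> N" using pow[of 7] by simp
  have "R\<^sup>2 \<le> \<tau>\<^sup>2" using R by (intro power_mono) auto
  then show "(real (d + k + m))\<^sup>2 \<le> N" using pow[of 2] by (simp add: R_def)
  have "real k * real m * \<kappa> \<le> \<tau> * \<tau> * \<tau>" using \<tau> \<tau>2 by (intro mult_mono) auto
  then show "real k * real m * \<kappa> \<le> N" using pow[of 3] by (simp add: numeral_3_eq_3)
  have N0: "0 < real N" using pow[of 0] by simp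
  have "34000 * R ^ 9 * R ^ c \<le> R ^ 16 * R ^ 9 * R ^ c"
  proof -
    have "(2::real) ^ 16 \<le> R ^ 16" using R by (intro power_mono) auto
    then show ?thesis using R by (intro mult_right_mono) auto
  qed
  also have "\<dots> = R ^ (c + 25)" by (simp add: add.commute flip: power_add)
  also have "\<dots> \<le> \<tau> ^ (c + 25)" using R by (intro power_mono) auto
  also have "\<dots> \<le> N" by (rule Nb)
  finally have "34000 * R ^ 9 * R ^ c \<le> N" .
  then have "34000 * R ^ 9 / N \<le> 1 / R ^ c" using N0 R by (simp add: field_simps)
  moreover have "R = real (d + m + k)" by (simp add: R_def)
  ultimately show "34000 * real (d + k + m) ^ 9 / N \<le> 1 / real (d + m + k) ^ c" by (simp only: R_def)
qed

(* Powers of d + k + m + ..., a quantity bounded away from 1, dominate every polynomial in the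
   parameters: "n = poly(...)" asks for some exponent q, and the failure probability 1/poly can
   be made smaller than any prescribed inverse power. *)
theorem mainTheorem14:
  shows "\<forall>c :: nat. \<exists>(q :: nat) (alg :: com).
    poly_time alg \<and>
    (\<forall>(m :: nat) (k :: nat) (d :: nat) (n :: nat) (U :: real mat) (V :: real mat).
       1 \<le> k \<longrightarrow>
       U \<in> carrier_mat m k \<longrightarrow> mat_rank U = k \<longrightarrow>
       V \<in> carrier_mat k d \<longrightarrow> mat_rank V = k \<longrightarrow>
       orthonormal_rows V \<longrightarrow>
       (real d + real k + real m + cond_number U + cond_number V) ^ q \<le> real n \<longrightarrow>
       measure (sample_space d n)
         {(\<xi>, \<omega>) \<in> space (sample_space d n).
            let X = mat d n \<xi>; A = U * map_mat relu (V * X)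
            in recovers alg A X \<omega> U V}
       \<ge> 1 - 1 / real (d + m + k) ^ c)"
proof (intro allI exI conjI impI)
  fix c :: nat
  show "poly_time (calg (Prog 42))" by (rule poly_time_calg[OF wf_Prog])
  fix m k d n :: nat and U V :: "real mat"
  assume k: "1 \<le> k" and U: "U \<in> carrier_mat m k" "mat_rank U = k" and V: "V \<in> carrier_mat k d"
    and o: "orthonormal_rows V" and n: "(real d + real k + real m + cond_number U + cond_number V) ^ (42 * (c + 26)) \<le> real n"
  define v where "v l p = V $$ (l, p)" for l p
  define u where "u l r = U $$ (r, l)" for l r
  define \<kappa> where "\<kappa> = cond_number U"
  define \<tau> where "\<tau> = real d + real k + real m + cond_number U + cond_number V"
  obtain S where S: "0 < S" "0 \<le> \<kappa>"
    and lower: "\<And>c. S\<^sup>2 * (\<Sum>j<k. (c j)\<^sup>2) \<le> (\<Sum>r<m. (\<Sum>j<k. c j * u j r)\<^sup>2)"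
    and upper: "\<And>c. (\<Sum>r<m. (\<Sum>j<k. c j * u j r)\<^sup>2) \<le> (\<kappa> * S)\<^sup>2 * (\<Sum>j<k. (c j)\<^sup>2)"
    using singular_value_bounds[OF U k] unfolding u_def \<kappa>_def by blast
  have \<kappa>V: "0 \<le> cond_number V" by (rule cond_number_orthonormal_nonneg[OF V k o])
  have "orthn d k v"
    using o V by (auto simp: orthn_def orthonormal_rows_def v_def scalar_prod_def atLeast0LessThan)
  then interpret orthonormal d k v by unfold_locales
  have kd': "k \<le> d" using kd[of "k - 1"] k by simp
  \<comment> \<open>For \<open>m = 0\<close> the Gram form would vanish identically, against its
    positive lower bound.\<close>
  have m: "0 < m"
  proof (rule ccontr)
    assume "\<not> 0 < m"
    moreover have "0 < S\<^sup>2 * real k" using S k by simp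
    ultimately show False using lower[of "\<lambda>_. 1"] by simp
  qed
  have \<tau>: "real (d + k + m) \<le> \<tau>" "real k \<le> \<tau>" "real m \<le> \<tau>" "\<kappa> \<le> \<tau>"
    using S \<kappa>V by (simp_all add: \<tau>_def \<kappa>_def)
  have "1 \<le> \<tau>" using \<tau>(2) k by simp
  then have "1 \<le> \<tau> ^ (42 * (c + 26))" by (rule one_le_power)
  then have n1: "1 \<le> n" using n unfolding \<tau>_def[symmetric] by linarith
  \<comment> \<open>Only the existence of the integer root is taken from this run, hence the empty
    dummy input.\<close>
  obtain N where N: "N \<le> n" "real N ^ 42 \<le> n" "real n < (real N + 1) ^ 42"
    using run_PN[of 42 "hinit 0 0 n (\<lambda>_. 0)" n] n1 by (auto simp: hinit_def)
  have "2 \<le> d + k + m" using k kd' by simp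
  note sb = size_bounds[OF \<tau> S(2) this n[folded \<tau>_def] N(3)]
  obtain G where G: "G \<in> sets (SG d n)" "1 - 34000 * real (d + k + m) ^ 9 / N \<le> measure (SG d n) G"
    and rs: "\<And>\<xi>. \<xi> \<in> G \<Longrightarrow> recovery_sample m d n N k (\<lambda>r i. \<Sum>l<k. u l r * relu (dotp d (v l) (col d i \<xi>)))
       (\<lambda>i. col d i \<xi>) v u S (1 / (8 * real (d + k + m)))"
    using good_event[OF _ m sb(1) N(1,2) sb(2) S sb(3) lower upper] k by auto
  have "real (d + k + m) * 1 \<le> real (d + k + m) * real (d + k + m)" using k by (intro mult_left_mono) simp_all
  then have "d + k + m \<le> N" using sb(2) by (simp add: power2_eq_square)
  then interpret I: instance_data m k d n U V using U V N by unfold_locales simp_all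
  interpret P: prob_space "SG d n" by (rule prob_space_SG)
  interpret C: prob_space "\<Pi>\<^sub>M _\<in>(UNIV :: nat set). uniform_measure lborel {0..1 :: real}" by (rule prob_space_coins)
  let ?E = "{\<xi> \<in> space (SG d n). I.good_output (I.H \<xi>)}"
  have E: "?E \<in> sets (SG d n)" using I.good_output_measurable by simp
  have "G \<subseteq> ?E"
  proof
    fix \<xi> assume x: "\<xi> \<in> G"
    let ?rm = "rmem (input_state (I.A \<xi>) (I.X \<xi>) (\<lambda>_. 0))"
    have rm1: "?rm (n * r + i) = (\<Sum>l<k. u l r * relu (dotp d (v l) (col d i \<xi>)))" if "r < m" "i < n" for r i
    proof -
      have "n * r + i < n * Suc r" using that by simp
      also have "\<dots> \<le> n * m" using that by (intro mult_le_mono2) simp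
      finally have "n * r + i < m * n" by (simp add: mult.commute)
      moreover have "(n * r + i) div n = r" "(n * r + i) mod n = i" using that by simp_all
      ultimately show ?thesis
        unfolding rmem_input[OF I.carriers(2,1)] using I.A_entry[OF that, of \<xi>] by (simp add: u_def v_def[abs_def])
    qed
    have rm2: "?rm (n * m + n * p + i) = col d i \<xi> p" if "p < d" "i < n" for p i
    proof -
      have "n * p + i < n * Suc p" using that by simp
      also have "\<dots> \<le> n * d" using that by (intro mult_le_mono2) simp
      finally have "n * m + n * p + i < m * n + d * n" by (simp add: mult.commute)
      moreover have "n * m + n * p + i - m * n = n * p + i" by (simp add: mult.commute)
      moreover have "(n * p + i) div n = p" "(n * p + i) mod n = i" using that by simp_all
      moreover have "\<not> n * m + n * p + i < m * n" by (simp add: mult.commute)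
      ultimately show ?thesis
        unfolding rmem_input[OF I.carriers(2,1)] using that by (simp add: I.X_def col_def)
    qed
    obtain \<sigma> where \<sigma>: "bij_betw \<sigma> {..<k} {..<k}" "iv (I.H \<xi>) 6 = k"
      "\<And>r l. r < m \<Longrightarrow> l < k \<Longrightarrow> ar (I.H \<xi>) 1 (r * k + l) = u (\<sigma> l) r"
      "\<And>l q. l < k \<Longrightarrow> q < d \<Longrightarrow> ar (I.H \<xi>) 1 (m * k + l * d + q) = v (\<sigma> l) q"
      using recover_run[where rm = ?rm, OF rs[OF x] N(2,3) rm1 rm2] unfolding I.H_def by blast
    define \<pi> where "\<pi> l = (if l < k then \<sigma> l else l)" for l
    have "bij_betw \<pi> {..<k} {..<k}" using \<sigma>(1) by (rule bij_betw_cong[THEN iffD1, rotated]) (simp add: \<pi>_def)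
    then have "\<pi> permutes {..<k}" by (rule bij_imp_permutes) (simp add: \<pi>_def)
    then have "I.good_output (I.H \<xi>)"
      unfolding I.good_output_def using \<sigma> by (intro conjI bexI[of _ \<pi>]) (auto simp: \<pi>_def u_def v_def)
    then show "\<xi> \<in> ?E" using x sets.sets_into_space[OF G(1)] by auto
  qed
  then have "measure (SG d n) G \<le> measure (SG d n) ?E" using E by (intro P.finite_measure_mono)
  moreover have "measure (sample_space d n) (?E \<times> space (\<Pi>\<^sub>M _\<in>UNIV. uniform_measure lborel {0..1})) = measure (SG d n) ?E"
    unfolding sample_space_def measure_def C.emeasure_pair_measure_Times[OF E sets.top] C.emeasure_space_1 by simp
  ultimately show "1 - 1 / real (d + m + k) ^ c \<le> measure (sample_space d n)
         {(\<xi>, \<omega>) \<in> space (sample_space d n).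
            let X = mat d n \<xi>; A = U * map_mat relu (V * X)
            in recovers (calg (Prog 42)) A X \<omega> U V}"
    unfolding I.event_measurable using G(2) sb(4) by linarith
qed

end
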